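(* Let $\varepsilon,\lambda>0$. The couple $(u,v)\in H^1(M)\times H^1(M)$ is a weak solution of the system $$-\Delta u=\varepsilon^{-1}\lambda\bigl(v-f(e^{\sigma+u})\bigr)+A,\qquad -\Delta v=\varepsilon^{-1}\left[\lambda f'(e^{\sigma+u})e^{\sigma+u}(s-v)-\varepsilon^{-1}\bigl(v-f(e^{\sigma+u})\bigr)\right]\quad\text{on }M$$ if and only if $u\in H^2(M)$ is a weak solution of the fourth order equation $$\varepsilon^2\Delta^2u-\Delta u=-\varepsilon\lambda\left[f''(e^{\sigma+u})e^{\sigma+u}+f'(e^{\sigma+u})\right]e^{\sigma+u}|\nabla(\sigma+u)|^2+2\varepsilon\lambda\,\Delta f(e^{\sigma+u})+\lambda^2f'(e^{\sigma+u})e^{\sigma+u}\bigl(s-f(e^{\sigma+u})\bigr)+A\quad\text{on }M$$ and $v$ is defined by $$v=-\varepsilon\lambda^{-1}\Delta u-\varepsilon\lambda^{-1}A+f(e^{\sigma+u}).$$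
   Context: $M=\mathbb{R}^2/\mathbb{Z}^2$ is the flat 2-torus ($|M|=1$); $m>n$; $p_1,\dots,p_m,q_1,\dots,q_n\in M$ are fixed points; $A=4\pi(m-n)>0$; $\sigma$ is the unique distributional solution of $-\Delta\sigma=4\pi\sum_{j=1}^m\delta_{p_j}-4\pi\sum_{k=1}^n\delta_{q_k}-A$, $\int_M\sigma=0$. The function $f:[0,+\infty)\to\mathbb{R}$ and the constant $s\in\mathbb{R}$ satisfy: (f0) $f$ smooth and $f'(t)>0$ for all $t>0$; (f1) $f(0)<s<\sup_{t>0}f(t)<+\infty$; (f2) $\sup_{t>0}t^4|f'''(t)|<+\infty$. A weak solution $u\in H^2(M)$ of the fourth order equation is a function satisfying, for all $\phi\in H^2(M)$, the identity obtained by multiplying by $\phi$ and integrating over $M$, with $\int\Delta u\,\Delta\phi$, $\int\nabla u\cdot\nabla\phi$ and $-\int f'(e^{\sigma+u})e^{\sigma+u}\nabla(\sigma+u)\cdot\nabla\phi$ replacing $\int\phi\,\Delta^2u$, $-\int\phi\,\Delta u$ and $\int\phi\,\Delta f(e^{\sigma+u})$, respectively. *)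

theory Defs
  imports "HOL-Analysis.Analysis"
begin

(* Functions on the flat torus R^2/Z^2 are Z^2-periodic functions on R^2; integrals and
   almost-everywhere statements refer to Lebesgue measure on the fundamental domain [0,1]^2. *)

definition periodic :: "(real^2 \<Rightarrow> real) \<Rightarrow> bool" where
  "periodic u \<longleftrightarrow> (\<forall>x i. u (x + axis i 1) = u x)"

abbreviation torus :: "(real^2) measure" where
  "torus \<equiv> lebesgue_on (cbox 0 1)"

definition L1 :: "(real^2 \<Rightarrow> real) \<Rightarrow> bool" where
  "L1 u \<longleftrightarrow> periodic u \<and> integrable torus u"

definition L2 :: "(real^2 \<Rightarrow> real) \<Rightarrow> bool" where
  "L2 u \<longleftrightarrow> periodic u \<and> u \<in> borel_measurable torus \<and> integrable torus (\<lambda>x. (u x)\<^sup>2)"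

definition partial_deriv :: "2 \<Rightarrow> (real^2 \<Rightarrow> real) \<Rightarrow> real^2 \<Rightarrow> real" where
  "partial_deriv i \<phi> x = frechet_derivative \<phi> (at x) (axis i 1)"

definition laplacian :: "(real^2 \<Rightarrow> real) \<Rightarrow> real^2 \<Rightarrow> real" where
  "laplacian \<phi> x = (\<Sum>i\<in>UNIV. partial_deriv i (partial_deriv i \<phi>) x)"

primrec C_k :: "nat \<Rightarrow> (real^2 \<Rightarrow> real) \<Rightarrow> bool" where
  "C_k 0 \<phi> \<longleftrightarrow> continuous_on UNIV \<phi>"
| "C_k (Suc k) \<phi> \<longleftrightarrow> (\<forall>x. \<phi> differentiable (at x)) \<and> (\<forall>i. C_k k (partial_deriv i \<phi>))"

definition test_function :: "(real^2 \<Rightarrow> real) \<Rightarrow> bool" where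
  "test_function \<phi> \<longleftrightarrow> periodic \<phi> \<and> (\<forall>k. C_k k \<phi>)"

definition has_weak_partial :: "2 \<Rightarrow> (real^2 \<Rightarrow> real) \<Rightarrow> (real^2 \<Rightarrow> real) \<Rightarrow> bool" where
  "has_weak_partial i u g \<longleftrightarrow> L1 u \<and> L1 g \<and>
     (\<forall>\<phi>. test_function \<phi> \<longrightarrow>
        (LINT x|torus. u x * partial_deriv i \<phi> x) = - (LINT x|torus. g x * \<phi> x))"

(* Weak derivatives are unique up to null sets; this picks a representative, and it is an
   unspecified function if u has no weak derivative in L^1. *)
definition weak_partial :: "2 \<Rightarrow> (real^2 \<Rightarrow> real) \<Rightarrow> real^2 \<Rightarrow> real" where
  "weak_partial i u = (SOME g. has_weak_partial i u g)"

definition weak_grad :: "(real^2 \<Rightarrow> real) \<Rightarrow> real^2 \<Rightarrow> real^2" where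
  "weak_grad u x = (\<chi> i. weak_partial i u x)"

definition weak_laplacian :: "(real^2 \<Rightarrow> real) \<Rightarrow> real^2 \<Rightarrow> real" where
  "weak_laplacian u x = (\<Sum>i\<in>UNIV. weak_partial i (weak_partial i u) x)"

definition H1 :: "(real^2 \<Rightarrow> real) \<Rightarrow> bool" where
  "H1 u \<longleftrightarrow> L2 u \<and> (\<forall>i. \<exists>g. L2 g \<and> has_weak_partial i u g)"

definition H2 :: "(real^2 \<Rightarrow> real) \<Rightarrow> bool" where
  "H2 u \<longleftrightarrow> H1 u \<and> (\<forall>i. H1 (weak_partial i u))"

(* Points of the torus are given by representatives in R^2. As a distribution, the solution
   is an L^1 function, determined up to null sets. *)
definition is_sigma ::
  "nat \<Rightarrow> nat \<Rightarrow> (nat \<Rightarrow> real^2) \<Rightarrow> (nat \<Rightarrow> real^2) \<Rightarrow> real \<Rightarrow> (real^2 \<Rightarrow> real) \<Rightarrow> bool" where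
  "is_sigma m n p q A \<sigma> \<longleftrightarrow> L1 \<sigma> \<and> (LINT x|torus. \<sigma> x) = 0 \<and>
     (\<forall>\<phi>. test_function \<phi> \<longrightarrow>
        - (LINT x|torus. \<sigma> x * laplacian \<phi> x) =
          4 * pi * (\<Sum>j=1..m. \<phi> (p j)) - 4 * pi * (\<Sum>k=1..n. \<phi> (q k))
            - A * (LINT x|torus. \<phi> x))"

(* Smoothness up to the endpoint 0, with one-sided derivatives there. *)
definition smooth_on_nonneg :: "(real \<Rightarrow> real) \<Rightarrow> bool" where
  "smooth_on_nonneg f \<longleftrightarrow> (\<exists>D :: nat \<Rightarrow> real \<Rightarrow> real.
     (\<forall>t\<ge>0. D 0 t = f t) \<and>
     (\<forall>k. \<forall>t\<ge>0. (D k has_real_derivative D (Suc k) t) (at t within {0..})))"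

definition weak_solution_system ::
  "(real \<Rightarrow> real) \<Rightarrow> real \<Rightarrow> (real^2 \<Rightarrow> real) \<Rightarrow> real \<Rightarrow> real \<Rightarrow> real \<Rightarrow>
   (real^2 \<Rightarrow> real) \<Rightarrow> (real^2 \<Rightarrow> real) \<Rightarrow> bool" where
  "weak_solution_system f s \<sigma> A \<epsilon> lam u v \<longleftrightarrow> H1 u \<and> H1 v \<and>
     (\<forall>\<phi>. H1 \<phi> \<longrightarrow>
        (LINT x|torus. weak_grad u x \<bullet> weak_grad \<phi> x) =
        (LINT x|torus. (inverse \<epsilon> * lam * (v x - f (exp (\<sigma> x + u x))) + A) * \<phi> x)) \<and>
     (\<forall>\<phi>. H1 \<phi> \<longrightarrow>
        (LINT x|torus. weak_grad v x \<bullet> weak_grad \<phi> x) =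
        (LINT x|torus. inverse \<epsilon> *
           (lam * deriv f (exp (\<sigma> x + u x)) * exp (\<sigma> x + u x) * (s - v x)
             - inverse \<epsilon> * (v x - f (exp (\<sigma> x + u x)))) * \<phi> x))"

definition weak_solution_fourth_order ::
  "(real \<Rightarrow> real) \<Rightarrow> real \<Rightarrow> (real^2 \<Rightarrow> real) \<Rightarrow> real \<Rightarrow> real \<Rightarrow> real \<Rightarrow>
   (real^2 \<Rightarrow> real) \<Rightarrow> bool" where
  "weak_solution_fourth_order f s \<sigma> A \<epsilon> lam u \<longleftrightarrow> H2 u \<and>
     (\<forall>\<phi>. H2 \<phi> \<longrightarrow>
        \<epsilon>\<^sup>2 * (LINT x|torus. weak_laplacian u x * weak_laplacian \<phi> x)
          + (LINT x|torus. weak_grad u x \<bullet> weak_grad \<phi> x) =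
        - \<epsilon> * lam * (LINT x|torus.
             (deriv (deriv f) (exp (\<sigma> x + u x)) * exp (\<sigma> x + u x) + deriv f (exp (\<sigma> x + u x)))
               * exp (\<sigma> x + u x) * (norm (weak_grad (\<lambda>y. \<sigma> y + u y) x))\<^sup>2 * \<phi> x)
          + 2 * \<epsilon> * lam * (- (LINT x|torus.
             deriv f (exp (\<sigma> x + u x)) * exp (\<sigma> x + u x)
               * (weak_grad (\<lambda>y. \<sigma> y + u y) x \<bullet> weak_grad \<phi> x)))
          + lam\<^sup>2 * (LINT x|torus.
             deriv f (exp (\<sigma> x + u x)) * exp (\<sigma> x + u x) * (s - f (exp (\<sigma> x + u x))) * \<phi> x)
          + A * (LINT x|torus. \<phi> x))"

end

theory Submission
  imports Defs "HOL-Real_Asymp.Real_Asymp"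
begin

text \<open>
  On the torus a real orthonormal basis of trigonometric products characterises weak derivatives by
  their Fourier coefficients. Hence a function in \<open>L\<^sup>1\<close> whose distributional Laplacian lies in \<open>L\<^sup>2\<close>
  is in \<open>H\<^sup>2\<close>, and functions in \<open>H\<^sup>2\<close> are bounded. Consequently each weak equation
  \<open>- \<Delta> u = g\<close> with \<open>g\<close> in \<open>L\<^sup>2\<close> holds almost everywhere and may be tested with \<open>H\<^sup>2\<close> functions only.

  The singular function is \<open>\<sigma> = \<Lambda> + \<tau>\<close> with \<open>\<tau>\<close> in \<open>H\<^sup>2\<close>, where \<open>\<Lambda>\<close> is an integer combination of
  translates of the explicit function \<open>ln (sin\<^sup>2 \<pi>x\<^sub>1 + sin\<^sup>2 \<pi>x\<^sub>2)\<close>: its Laplacian is \<open>4\<pi>\<close> times a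
  Dirac mass plus a bounded function. Put \<open>F t = f (e\<^sup>t)\<close>, \<open>h = F'\<close> and \<open>W = \<sigma> + u\<close>. The
  hypotheses on \<open>f\<close> give that \<open>h t\<close> and \<open>h' t\<close> are \<open>O(exp (- |t|))\<close>, and
  \<open>exp (- |W|) |\<nabla>\<Lambda>|\<^sup>2\<close> is bounded, so \<open>F(W)\<close> and \<open>h(W) \<phi>\<close>
  lie in \<open>H\<^sup>1\<close> and the Dirac masses are invisible:
  \<open>\<integral> F(W) \<Delta>\<phi> = - \<integral> h(W) \<nabla>W \<bullet> \<nabla>\<phi>\<close> and
  \<open>\<integral> h(W) (\<Delta>u + A) \<phi> = - \<integral> h'(W) |\<nabla>W|\<^sup>2 \<phi> - \<integral> h(W) \<nabla>W \<bullet> \<nabla>\<phi>\<close>.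
  With these two identities the fourth order equation for \<open>u\<close> is the second equation of the system,
  tested with \<open>H\<^sup>2\<close> functions, after the first one has been solved for \<open>v\<close>.
\<close>

section \<open>Square integrable functions\<close>

text \<open>The obstacle is that W lies outside H1: a pole contributes a gradient of size 1/r, not
  square integrable in the plane, so neither Green's formula nor a chain rule applies to W itself.
  What helps is a match of exponents: at a pole of net multiplicity N, exp (- |\<Lambda>|) behaves
  like r^(2|N|), so one factor h(W) or h'(W) absorbs |\<nabla>\<Lambda>|^2 once |N| is at least 1.
  At the points p, W tends to +\<infinity> and the decay of h comes from f' = O(t^-2), f'' =
  O(t^-3); at the points q, W tends to -\<infinity> and it comes from smoothness of f at 0. Singular
  identities are proved classically with \<open>ln (d + sinsq x)\<close>, d > 0, and passed to the
  limit d -> 0. This kernel is periodic and has a Laplacian rational in sin^2, so that the mass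
  4\<pi> is an explicit double integral. A second obstacle: v is an expression in \<Delta>u, hence a
  priori only in L2. Its equation is therefore read with both derivatives on an H2 test function,
  and Fourier coefficients restore the regularity.\<close>

definition square_integrable :: "'a measure \<Rightarrow> ('a \<Rightarrow> real) \<Rightarrow> bool" where
  "square_integrable M f \<longleftrightarrow> f \<in> borel_measurable M \<and> integrable M (\<lambda>x. (f x)\<^sup>2)"

lemma square_integrable_measurable [measurable_dest]:
  "square_integrable M f \<Longrightarrow> f \<in> borel_measurable M"
  by (simp add: square_integrable_def)

lemma square_integrable_power2: "square_integrable M f \<Longrightarrow> integrable M (\<lambda>x. (f x)\<^sup>2)"
  by (simp add: square_integrable_def)

lemma integrable_mult_square_integrable:
  assumes "square_integrable M f" "square_integrable M g"
  shows "integrable M (\<lambda>x. f x * g x)"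
proof (rule Bochner_Integration.integrable_bound)
  show "integrable M (\<lambda>x. (f x)\<^sup>2 + (g x)\<^sup>2)"
    using assms by (simp add: square_integrable_def)
  show "(\<lambda>x. f x * g x) \<in> borel_measurable M"
    using assms by (auto simp: square_integrable_def)
  have "\<bar>a * b\<bar> \<le> a\<^sup>2 + b\<^sup>2" for a b :: real
    using sum_squares_bound[of "\<bar>a\<bar>" "\<bar>b\<bar>"] mult_nonneg_nonneg[OF abs_ge_zero[of a] abs_ge_zero[of b]]
    unfolding abs_mult power2_abs by linarith
  then show "AE x in M. norm (f x * g x) \<le> norm ((f x)\<^sup>2 + (g x)\<^sup>2)" by simp
qed

lemma square_integrable_add:
  assumes "square_integrable M f" "square_integrable M g"
  shows "square_integrable M (\<lambda>x. f x + g x)"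
  using assms integrable_mult_square_integrable[OF assms]
  unfolding square_integrable_def power2_sum mult.assoc
  by (intro conjI borel_measurable_add Bochner_Integration.integrable_add integrable_mult_right) auto

lemma square_integrable_cmult:
  assumes "square_integrable M f"
  shows "square_integrable M (\<lambda>x. c * f x)"
  using assms unfolding square_integrable_def power_mult_distrib
  by (intro conjI borel_measurable_times integrable_mult_right) auto

lemma square_integrable_diff:
  assumes "square_integrable M f" "square_integrable M g"
  shows "square_integrable M (\<lambda>x. f x - g x)"
  using square_integrable_add[OF assms(1) square_integrable_cmult[OF assms(2), of "-1"]] by simp

lemma square_integrable_cong_AE:
  assumes "square_integrable M f" "g \<in> borel_measurable M" "AE x in M. g x = f x"
  shows "square_integrable M g"
  unfolding square_integrable_def
proof
  have f: "f \<in> borel_measurable M" "integrable M (\<lambda>x. (f x)\<^sup>2)"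
    using assms(1) by (auto simp: square_integrable_def)
  show "integrable M (\<lambda>x. (g x)\<^sup>2)"
    by (rule Bochner_Integration.integrable_cong_AE_imp[OF f(2)]) (use assms(2,3) f in auto)
qed fact

lemma square_integrable_bounded_mult:
  assumes f: "square_integrable M f" and b: "b \<in> borel_measurable M" "AE x in M. \<bar>b x\<bar> \<le> B"
  shows "square_integrable M (\<lambda>x. b x * f x)"
  unfolding square_integrable_def
proof
  have [measurable]: "f \<in> borel_measurable M" using f by (simp add: square_integrable_def)
  note b(1)[measurable]
  show "(\<lambda>x. b x * f x) \<in> borel_measurable M" by measurable
  show "integrable M (\<lambda>x. (b x * f x)\<^sup>2)"
  proof (rule Bochner_Integration.integrable_bound)
    show "integrable M (\<lambda>x. B\<^sup>2 * (f x)\<^sup>2)" using f by (simp add: square_integrable_def)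
    show "AE x in M. norm ((b x * f x)\<^sup>2) \<le> norm (B\<^sup>2 * (f x)\<^sup>2)"
      using b(2)
    proof eventually_elim
      case (elim x)
      have "(b x)\<^sup>2 \<le> B\<^sup>2" using power_mono[OF elim, of 2] by simp
      then show ?case by (simp add: power_mult_distrib mult_right_mono)
    qed
  qed measurable
qed

lemma square_integrable_bounded:
  assumes "finite_measure M" and b: "b \<in> borel_measurable M" "AE x in M. \<bar>b x\<bar> \<le> B"
  shows "square_integrable M b"
  using square_integrable_bounded_mult[of M "\<lambda>x. 1" b B] assms
  by (simp add: square_integrable_def finite_measure.integrable_const)

lemma square_integrable_imp_integrable:
  assumes "finite_measure M" "square_integrable M f"
  shows "integrable M f"
  using integrable_mult_square_integrable[of M f "\<lambda>x. 1"] assms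
  by (simp add: square_integrable_def finite_measure.integrable_const)

text \<open>The integral of (f - t g)^2 is a nonnegative quadratic in t, and its value at the
  minimiser b/c is the inequality. For c = 0 it is affine in t, and t = (a + 1)/(2b) would give the
  value -1.\<close>

lemma Cauchy_Schwarz_integral:
  assumes "square_integrable M f" "square_integrable M g"
  shows "(\<integral>x. f x * g x \<partial>M)\<^sup>2 \<le> (\<integral>x. (f x)\<^sup>2 \<partial>M) * (\<integral>x. (g x)\<^sup>2 \<partial>M)"
proof -
  define a b c where "a = (\<integral>x. (f x)\<^sup>2 \<partial>M)" and "b = (\<integral>x. f x * g x \<partial>M)" and "c = (\<integral>x. (g x)\<^sup>2 \<partial>M)"
  have i: "integrable M (\<lambda>x. (f x)\<^sup>2)" "integrable M (\<lambda>x. (g x)\<^sup>2)" "integrable M (\<lambda>x. f x * g x)"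
    using assms integrable_mult_square_integrable[OF assms] by (auto simp: square_integrable_def)
  have q: "0 \<le> a - 2 * t * b + t\<^sup>2 * c" for t
  proof -
    have "0 \<le> (\<integral>x. (f x - t * g x)\<^sup>2 \<partial>M)" by simp
    also have "\<dots> = (\<integral>x. (f x)\<^sup>2 - (2 * t) * (f x * g x) + t\<^sup>2 * (g x)\<^sup>2 \<partial>M)"
      by (intro Bochner_Integration.integral_cong) (auto simp: power2_eq_square algebra_simps)
    also have "\<dots> = a - 2 * t * b + t\<^sup>2 * c" using i by (simp add: a_def b_def c_def)
    finally show ?thesis .
  qed
  have "c \<ge> 0" unfolding c_def by simp
  have "b\<^sup>2 \<le> a * c"
  proof (cases "c = 0")
    case True
    have "b = 0"
    proof (rule ccontr)
      assume "b \<noteq> 0"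
      then show False using q[of "(a + 1) / (2 * b)"] True by simp
    qed
    then show ?thesis using True by simp
  next
    case False
    then have "c > 0" using \<open>c \<ge> 0\<close> by simp
    then have "0 \<le> c * (a - 2 * (b/c) * b + (b/c)\<^sup>2 * c)" using q[of "b/c"] by simp
    also have "\<dots> = a * c - b\<^sup>2" using False by (simp add: field_simps power2_eq_square)
    finally show ?thesis by simp
  qed
  then show ?thesis by (simp add: a_def b_def c_def)
qed


text \<open>Cauchy-Schwarz against the constant 1 on a space of mass at most 1. It turns L2
  convergence into L1 convergence, both in the completeness theorem and for derivatives of Fourier
  sums.\<close>

lemma integral_abs_le_sqrt:
  assumes M: "finite_measure M" "measure M (space M) \<le> 1" and f: "square_integrable M f"
  shows "(\<integral>x. \<bar>f x\<bar> \<partial>M) \<le> sqrt (\<integral>x. (f x)\<^sup>2 \<partial>M)"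
proof (rule real_le_rsqrt)
  have "square_integrable M (\<lambda>x. \<bar>f x\<bar>)" "square_integrable M (\<lambda>x. 1)"
    using f M by (auto simp: square_integrable_def finite_measure.integrable_const)
  from Cauchy_Schwarz_integral[OF this]
  have "(\<integral>x. \<bar>f x\<bar> \<partial>M)\<^sup>2 \<le> (\<integral>x. (f x)\<^sup>2 \<partial>M) * measure M (space M)" by simp
  also have "\<dots> \<le> (\<integral>x. (f x)\<^sup>2 \<partial>M) * 1" by (intro mult_left_mono M) simp
  finally show "(\<integral>x. \<bar>f x\<bar> \<partial>M)\<^sup>2 \<le> (\<integral>x. (f x)\<^sup>2 \<partial>M)" by simp
qed

text \<open>By monotone convergence the series of absolute increments has finite integral, hence is
  finite almost everywhere, and an absolutely summable series of increments telescopes.\<close>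

lemma AE_convergent_of_summable:
  fixes f :: "nat \<Rightarrow> 'a \<Rightarrow> real"
  assumes i: "\<And>n. integrable M (\<lambda>x. f (Suc n) x - f n x)"
    and s: "summable (\<lambda>n. \<integral>x. \<bar>f (Suc n) x - f n x\<bar> \<partial>M)"
  shows "AE x in M. convergent (\<lambda>n. f n x)"
proof -
  define d where "d n x = \<bar>f (Suc n) x - f n x\<bar>" for n x
  have [measurable]: "d n \<in> borel_measurable M" for n using borel_measurable_integrable[OF i[of n]] unfolding d_def by measurable
  have "(\<integral>\<^sup>+x. (\<Sum>n. ennreal (d n x)) \<partial>M) = (\<Sum>n. \<integral>\<^sup>+x. ennreal (d n x) \<partial>M)"
    by (rule nn_integral_suminf) measurable
  also have "\<dots> = (\<Sum>n. ennreal (\<integral>x. d n x \<partial>M))"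
    using i by (intro suminf_cong nn_integral_eq_integral) (auto simp: d_def)
  also have "\<dots> = ennreal (\<Sum>n. \<integral>x. d n x \<partial>M)"
    using s by (intro suminf_ennreal2) (auto simp: d_def)
  finally have "(\<integral>\<^sup>+x. (\<Sum>n. ennreal (d n x)) \<partial>M) \<noteq> \<infinity>" by simp
  then have "AE x in M. (\<Sum>n. ennreal (d n x)) \<noteq> \<infinity>"
    by (intro nn_integral_PInf_AE) auto
  then show ?thesis
  proof eventually_elim
    case (elim x)
    then have "summable (\<lambda>n. d n x)"
      by (intro summable_suminf_not_top) (auto simp: d_def)
    then have "summable (\<lambda>n. f (Suc n) x - f n x)" unfolding d_def by (rule summable_rabs_cancel)
    then have "convergent (\<lambda>n. \<Sum>k<n. f (Suc k) x - f k x)" by (rule summable_iff_convergent[THEN iffD1])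
    then have "convergent (\<lambda>n. f n x - f 0 x)" by (simp add: sum_lessThan_telescope[of "\<lambda>k. f k x"])
    then have "convergent (\<lambda>n. (f n x - f 0 x) + f 0 x)" by (intro convergent_add convergent_const)
    then show ?case by simp
  qed
qed

text \<open>The limit is a pointwise \<open>lim\<close> along a subsequence rather than an abstract
  function: periodicity of the approximants then passes to it at every point, including points where
  the subsequence diverges.\<close>

lemma square_integrable_complete:
  fixes f :: "nat \<Rightarrow> 'a \<Rightarrow> real"
  assumes M: "finite_measure M" "measure M (space M) \<le> 1" and f: "\<And>n. square_integrable M (f n)"
    and cauchy: "\<And>e. e > 0 \<Longrightarrow> \<exists>N. \<forall>m\<ge>N. \<forall>n\<ge>N. (\<integral>x. (f m x - f n x)\<^sup>2 \<partial>M) < e"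
  obtains r :: "nat \<Rightarrow> nat" where "strict_mono r" "AE x in M. convergent (\<lambda>n. f (r n) x)"
    "square_integrable M (\<lambda>x. lim (\<lambda>n. f (r n) x))"
    "(\<lambda>n. \<integral>x. (f n x - lim (\<lambda>k. f (r k) x))\<^sup>2 \<partial>M) \<longlonglongrightarrow> 0"
proof -
  have fm[measurable]: "f n \<in> borel_measurable M" for n using f by (simp add: square_integrable_def)
  \<comment> \<open>The rate 1/4 is chosen so that, after the square root in
    \<open>integral_abs_le_sqrt\<close>, increments along \<open>r\<close> are bounded by the
    summable (1/2)^k.\<close>
  have ex: "\<exists>N. \<forall>m\<ge>N. \<forall>n\<ge>N. (\<integral>x. (f m x - f n x)\<^sup>2 \<partial>M) < (1/4) ^ k" for k :: nat
    by (rule cauchy) simp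
  then obtain N where N: "\<And>k m n. m \<ge> N k \<Longrightarrow> n \<ge> N k \<Longrightarrow> (\<integral>x. (f m x - f n x)\<^sup>2 \<partial>M) < (1/4) ^ k"
    by metis
  define r where "r = rec_nat (N 0) (\<lambda>k p. max (Suc p) (N (Suc k)))"
  have r_Suc: "r (Suc k) = max (Suc (r k)) (N (Suc k))" for k by (simp add: r_def)
  have rN: "r k \<ge> N k" for k by (cases k) (auto simp: r_def)
  have mono: "strict_mono r" by (rule strict_monoI_Suc) (simp add: r_Suc)
  have sd: "square_integrable M (\<lambda>x. f m x - f n x)" for m n by (intro square_integrable_diff f)
  have "AE x in M. convergent (\<lambda>n. f (r n) x)"
  proof (rule AE_convergent_of_summable)
    show "integrable M (\<lambda>x. f (r (Suc n)) x - f (r n) x)" for n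
      by (rule square_integrable_imp_integrable[OF M(1) sd])
    show "summable (\<lambda>n. \<integral>x. \<bar>f (r (Suc n)) x - f (r n) x\<bar> \<partial>M)"
    proof (rule summable_comparison_test')
      show "summable (\<lambda>n. (1/2::real) ^ n)" by (simp add: summable_geometric)
      fix n :: nat assume "n \<ge> 0"
      have "(\<integral>x. \<bar>f (r (Suc n)) x - f (r n) x\<bar> \<partial>M) \<le> sqrt (\<integral>x. (f (r (Suc n)) x - f (r n) x)\<^sup>2 \<partial>M)"
        by (rule integral_abs_le_sqrt[OF M sd])
      also have "\<dots> \<le> sqrt ((1/4) ^ n)"
        using N[of n "r (Suc n)" "r n"] rN[of n] strict_mono_less_eq[OF mono, of n "Suc n"]
        by (intro real_sqrt_le_mono less_imp_le) auto
      also have "\<dots> = (1/2) ^ n" by (simp add: real_sqrt_power real_sqrt_divide)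
      finally show "norm (\<integral>x. \<bar>f (r (Suc n)) x - f (r n) x\<bar> \<partial>M) \<le> (1/2) ^ n" by simp
    qed
  qed
  note conv = this
  define g where "g x = lim (\<lambda>n. f (r n) x)" for x
  have [measurable]: "g \<in> borel_measurable M" unfolding g_def by measurable
  \<comment> \<open>Fatou in k with n fixed delivers integrability and the bound at once, so nothing
    needs to be known about g beforehand.\<close>
  have fatou: "integrable M (\<lambda>x. (f n x - g x)\<^sup>2) \<and> (\<integral>x. (f n x - g x)\<^sup>2 \<partial>M) \<le> e"
    if "e \<ge> 0" "eventually (\<lambda>k. (\<integral>x. (f n x - f (r k) x)\<^sup>2 \<partial>M) \<le> e) sequentially" for n e
  proof -
    have "(\<integral>\<^sup>+x. ennreal ((f n x - g x)\<^sup>2) \<partial>M) = (\<integral>\<^sup>+x. liminf (\<lambda>k. ennreal ((f n x - f (r k) x)\<^sup>2)) \<partial>M)"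
    proof (rule nn_integral_cong_AE)
      show "AE x in M. ennreal ((f n x - g x)\<^sup>2) = liminf (\<lambda>k. ennreal ((f n x - f (r k) x)\<^sup>2))"
        using conv
      proof eventually_elim
        case (elim x)
        then have "(\<lambda>k. f (r k) x) \<longlonglongrightarrow> g x" unfolding g_def by (rule convergent_LIMSEQ_iff[THEN iffD1])
        then have "(\<lambda>k. ennreal ((f n x - f (r k) x)\<^sup>2)) \<longlonglongrightarrow> ennreal ((f n x - g x)\<^sup>2)"
          by (intro tendsto_intros)
        then show ?case by (rule lim_imp_Liminf[OF trivial_limit_sequentially, symmetric])
      qed
    qed
    also have "\<dots> \<le> liminf (\<lambda>k. \<integral>\<^sup>+x. ennreal ((f n x - f (r k) x)\<^sup>2) \<partial>M)"
      by (rule nn_integral_liminf) measurable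
    also have "\<dots> = liminf (\<lambda>k. ennreal (\<integral>x. (f n x - f (r k) x)\<^sup>2 \<partial>M))"
      using sd by (intro arg_cong[of _ _ liminf] ext nn_integral_eq_integral) (auto simp: square_integrable_def)
    also have "\<dots> \<le> liminf (\<lambda>k. ennreal e)"
      by (rule Liminf_mono, rule eventually_mono[OF that(2)]) (simp add: ennreal_leI)
    also have "\<dots> = ennreal e" by (simp add: Liminf_const)
    finally have le: "(\<integral>\<^sup>+x. ennreal ((f n x - g x)\<^sup>2) \<partial>M) \<le> ennreal e" .
    have int: "integrable M (\<lambda>x. (f n x - g x)\<^sup>2)"
    proof (rule integrableI_bounded)
      show "(\<integral>\<^sup>+ x. ennreal (norm ((f n x - g x)\<^sup>2)) \<partial>M) < \<infinity>"
        using order.strict_trans1[OF le, of top] by simp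
    qed measurable
    moreover have "ennreal (\<integral>x. (f n x - g x)\<^sup>2 \<partial>M) \<le> ennreal e"
      using le nn_integral_eq_integral[OF int] by simp
    ultimately show ?thesis using that(1) by (simp add: ennreal_le_iff)
  qed
  have ev: "eventually (\<lambda>k. (\<integral>x. (f n x - f (r k) x)\<^sup>2 \<partial>M) \<le> e) sequentially"
    if "\<forall>m\<ge>K. \<forall>n\<ge>K. (\<integral>x. (f m x - f n x)\<^sup>2 \<partial>M) < e" "n \<ge> K" for n K e
  proof (rule eventually_sequentiallyI[of K])
    fix k assume "K \<le> k"
    also have "k \<le> r k" by (rule seq_suble[OF mono])
    finally show "(\<integral>x. (f n x - f (r k) x)\<^sup>2 \<partial>M) \<le> e" using that by (intro less_imp_le) auto
  qed
  have lim: "(\<lambda>n. \<integral>x. (f n x - g x)\<^sup>2 \<partial>M) \<longlonglongrightarrow> 0"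
  proof (rule LIMSEQ_I)
    fix e :: real assume "e > 0"
    then obtain K where K: "\<forall>m\<ge>K. \<forall>n\<ge>K. (\<integral>x. (f m x - f n x)\<^sup>2 \<partial>M) < e / 2" using cauchy[of "e/2"] by auto
    have "norm ((\<integral>x. (f n x - g x)\<^sup>2 \<partial>M) - 0) < e" if "n \<ge> K" for n
      using fatou[OF _ ev[OF K that]] \<open>e > 0\<close> by auto
    then show "\<exists>K. \<forall>n\<ge>K. norm ((\<integral>x. (f n x - g x)\<^sup>2 \<partial>M) - 0) < e" by blast
  qed
  obtain K where K: "\<forall>m\<ge>K. \<forall>n\<ge>K. (\<integral>x. (f m x - f n x)\<^sup>2 \<partial>M) < 1" using cauchy[of 1] by auto
  have "square_integrable M (\<lambda>x. f K x - g x)"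
    using fatou[OF _ ev[OF K order_refl]] by (auto simp: square_integrable_def)
  from square_integrable_diff[OF f[of K] this] have "square_integrable M g" by simp
  with that[OF mono conv] lim show ?thesis unfolding g_def by simp
qed

section \<open>Integration on the torus\<close>

lemma axis_zero [simp]: "axis i (0::real) = 0"
  by (simp add: axis_eq_0_iff)

lemma Basis_vec_2: "Basis = {axis 1 1, axis 2 1 :: real^2}"
proof -
  have "{axis i (1::real) |i. True} = {axis 1 1, axis 2 1 :: real^2}"
    using exhaust_2 by (auto, metis)
  then show ?thesis by (auto simp: Basis_vec_def)
qed

lemma space_torus [simp]: "space torus = cbox 0 1"
  by (simp add: space_restrict_space)

lemma emeasure_torus: "emeasure torus (cbox 0 1) = 1"
  by (simp add: emeasure_restrict_space emeasure_lborel_cbox_eq Basis_vec_2 inner_axis axis_eq_axis)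

lemma finite_measure_torus: "finite_measure torus"
  by (rule finite_measureI) (simp add: emeasure_torus)

lemma measure_torus: "measure torus (cbox 0 1) = 1"
  using emeasure_torus by (simp add: measure_def)

lemma measurable_torus_borel: "f \<in> borel_measurable borel \<Longrightarrow> f \<in> borel_measurable torus"
  by (simp add: measurable_completion measurable_restrict_space1)

lemma integrable_torus_continuous:
  fixes f :: "real^2 \<Rightarrow> real"
  assumes "continuous_on UNIV f"
  shows "integrable torus f"
  by (rule continuous_imp_integrable) (rule continuous_on_subset[OF assms], simp)

lemma square_integrable_torus_continuous:
  fixes f :: "real^2 \<Rightarrow> real"
  assumes "continuous_on UNIV f"
  shows "square_integrable torus f"
  unfolding square_integrable_def
  by (intro conjI measurable_torus_borel borel_measurable_continuous_onI integrable_torus_continuous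
      continuous_intros assms)

section \<open>Fubini, integration by parts and translation for continuous periodic
  functions\<close>

definition pair_vec :: "real \<times> real \<Rightarrow> real^2" where
  "pair_vec p = (\<chi> i. if i = 1 then fst p else snd p)"

lemma pair_vec_nth [simp]: "pair_vec p $ 1 = fst p" "pair_vec p $ 2 = snd p"
  by (simp_all add: pair_vec_def)

lemma continuous_on_pair_vec [continuous_intros]:
  "continuous_on S f \<Longrightarrow> continuous_on S (\<lambda>x. pair_vec (f x))"
proof -
  assume "continuous_on S f"
  then have "continuous_on S (\<lambda>x. if i = 1 then fst (f x) else snd (f x))" for i :: 2
    by (cases "i = 1") (auto intro: continuous_intros)
  then show ?thesis unfolding pair_vec_def by (rule continuous_on_vec_lambda)
qed

text \<open>Lebesgue measure is determined by its values on boxes, and the preimage of a box is a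
  box of the same area.\<close>

lemma distr_pair_vec: "distr (lborel \<Otimes>\<^sub>M lborel) borel pair_vec = lborel"
proof (rule lborel_eqI[symmetric])
  have [measurable]: "pair_vec \<in> borel_measurable borel"
    by (intro borel_measurable_continuous_onI continuous_intros)
  fix l u :: "real^2" assume le: "\<And>b. b \<in> Basis \<Longrightarrow> l \<bullet> b \<le> u \<bullet> b"
  then have le': "l $ i \<le> u $ i" for i
    by (metis axis_in_Basis_iff cart_eq_inner_axis Basis_real_def singletonI)
  have "pair_vec -` box l u = box (l$1, l$2) (u$1, u$2)"
    by (simp add: set_eq_iff mem_box_cart forall_2 mem_box Basis_prod_def conj_ac ball_Un)
  then have "emeasure (distr (lborel \<Otimes>\<^sub>M lborel) borel pair_vec) (box l u) = emeasure lborel (box (l$1, l$2) (u$1, u$2))"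
    by (subst emeasure_distr) (simp_all add: lborel_prod)
  also have "\<dots> = ennreal ((u$1 - l$1) * (u$2 - l$2))"
    using le' by (subst emeasure_lborel_box) (auto simp: Basis_prod_def prod.union_disjoint)
  also have "(u$1 - l$1) * (u$2 - l$2) = (\<Prod>b\<in>Basis. (u - l) \<bullet> b)"
    unfolding Basis_vec_2 by (simp add: inner_axis axis_eq_axis)
  finally show "emeasure (distr (lborel \<Otimes>\<^sub>M lborel) borel pair_vec) (box l u) = ennreal (\<Prod>b\<in>Basis. (u - l) \<bullet> b)" .
qed simp

text \<open>Both orders are given so that the inner integral can run along either axis. The iterated
  integrals are gauge integrals over \<open>{0..1}\<close>, the form to which the fundamental
  theorem of calculus applies.\<close>

lemma torus_Fubini:
  assumes g: "continuous_on UNIV (g :: real^2 \<Rightarrow> real)"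
  shows "(LINT x|torus. g x) = integral {0..1} (\<lambda>x. integral {0..1} (\<lambda>y. g (pair_vec (x, y))))" (is ?A)
    and "(LINT x|torus. g x) = integral {0..1} (\<lambda>y. integral {0..1} (\<lambda>x. g (pair_vec (x, y))))" (is ?B)
proof -
  have [measurable]: "pair_vec \<in> borel_measurable borel" "g \<in> borel_measurable borel"
    by (intro borel_measurable_continuous_onI continuous_intros g)+
  define G where "G x y = indicator {0..1} x * (indicator {0..1} y * g (pair_vec (x, y)))" for x y :: real
  have ind: "indicator (cbox 0 1) (pair_vec (x, y)) * g (pair_vec (x, y)) = G x y" for x y
    by (auto simp: G_def indicator_def mem_box_cart forall_2)
  have int0: "integrable lborel (\<lambda>x. indicator (cbox 0 1) x * g x)"
    using borel_integrable_compact[OF compact_cbox continuous_on_subset[OF g subset_UNIV], of 0 1] by simp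
  have meas: "pair_vec \<in> lborel \<Otimes>\<^sub>M lborel \<rightarrow>\<^sub>M borel" by (simp add: lborel_prod)
  have int1: "integrable (lborel \<Otimes>\<^sub>M lborel) (\<lambda>(x, y). G x y)"
    using integrable_distr[OF meas, of "\<lambda>x. indicator (cbox 0 1) x * g x"] int0
    unfolding distr_pair_vec by (simp add: ind[symmetric] case_prod_unfold)
  have "(LINT x|torus. g x) = (LINT x|lebesgue. indicator (cbox 0 1) x * g x)"
    by (subst integral_restrict_space) auto
  also have "\<dots> = (LINT x|lborel. indicator (cbox 0 1) x * g x)"
    by (rule integral_completion) simp
  also have "\<dots> = integral\<^sup>L (lborel \<Otimes>\<^sub>M lborel) (\<lambda>(x, y). G x y)"
    by (subst distr_pair_vec[symmetric], subst integral_distr[OF meas])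
       (auto simp: ind[symmetric] case_prod_unfold)
  finally have eq: "(LINT x|torus. g x) = integral\<^sup>L (lborel \<Otimes>\<^sub>M lborel) (\<lambda>(x, y). G x y)" .
  have gc: "continuous_on S (\<lambda>y. g (pair_vec (x, y)))" "continuous_on S (\<lambda>y. g (pair_vec (y, x)))" for x S
    by (rule continuous_on_compose2[OF g]; (intro continuous_intros)?; simp)+
  have H: "(LINT x|lborel. indicator {0..1} x * h x) = integral {0..1} h"
    if "set_integrable lborel {0..1} h" for h :: "real \<Rightarrow> real"
    using set_borel_integral_eq_integral(2)[OF that] by (simp add: set_lebesgue_integral_def)
  have G1: "(LINT y|lborel. G x y) = indicator {0..1} x * integral {0..1} (\<lambda>y. g (pair_vec (x, y)))" for x
    unfolding G_def using H[OF borel_integrable_atLeastAtMost'[OF gc(1)[of _ x]]] by simp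
  have "G x y = indicator {0..1} y * (indicator {0..1} x * g (pair_vec (x, y)))" for x y
    by (simp add: G_def)
  then have G2: "(LINT x|lborel. G x y) = indicator {0..1} y * integral {0..1} (\<lambda>x. g (pair_vec (x, y)))" for y
    using H[OF borel_integrable_atLeastAtMost'[OF gc(2)[of _ y]]] by simp
  have "set_integrable lborel {0..1} (\<lambda>x. integral {0..1} (\<lambda>y. g (pair_vec (x, y))))"
    using lborel_pair.integrable_fst'[OF int1] by (simp add: G1 set_integrable_def)
  from H[OF this] show ?A
    using lborel_pair.integral_fst'[OF int1] eq by (simp add: G1)
  have "set_integrable lborel {0..1} (\<lambda>y. integral {0..1} (\<lambda>x. g (pair_vec (x, y))))"
    using lborel_pair.integrable_snd[OF int1] by (simp add: G2 set_integrable_def)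
  from H[OF this] show ?B
    using lborel_pair.integral_snd[OF int1] eq by (simp add: G2)
qed

text \<open>Differentiability along coordinate lines is all that integration by parts uses; for
  composite functions it reduces every derivative to the one-variable chain rule, without Frechet
  derivatives.\<close>

definition has_partial :: "2 \<Rightarrow> (real^2 \<Rightarrow> real) \<Rightarrow> (real^2 \<Rightarrow> real) \<Rightarrow> bool" where
  "has_partial i G g \<longleftrightarrow> (\<forall>x. ((\<lambda>t. G (x + axis i t)) has_real_derivative g x) (at 0))"

lemma periodicD: "periodic u \<Longrightarrow> u (x + axis i 1) = u x"
  by (simp add: periodic_def)

text \<open>Along each line in direction i the integral of g over one period is a difference of G at
  congruent points. Fubini is taken in the order that integrates first in that direction.\<close>

lemma torus_integral_partial:
  assumes G: "periodic G" "has_partial i G g" and g: "continuous_on UNIV g"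
  shows "(LINT x|torus. g x) = 0"
proof -
  have i: "i = 1 \<or> i = 2" using exhaust_2 by blast
  have D: "((\<lambda>t. G (x + axis i t)) has_real_derivative g (x + axis i t)) (at t within S)" for x t S
  proof -
    have e: "x + axis i t + axis i s = x + axis i (s + t)" for s
      by (simp add: vec_eq_iff axis_def)
    have "((\<lambda>s. G (x + axis i (s + t))) has_real_derivative g (x + axis i t)) (at 0)"
      using G(2)[unfolded has_partial_def, rule_format, of "x + axis i t"] by (simp only: e)
    then have "((\<lambda>s. G (x + axis i s)) has_real_derivative g (x + axis i t)) (at (0 + t))"
      by (subst DERIV_shift)
    then have "((\<lambda>s. G (x + axis i s)) has_real_derivative g (x + axis i t)) (at t)"
      by (simp only: add_0_left)
    then show ?thesis by (rule has_field_derivative_at_within)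
  qed
  have I: "integral {0..1} (\<lambda>t. g (x + axis i t)) = 0" for x
  proof -
    have "((\<lambda>t. g (x + axis i t)) has_integral (G (x + axis i 1) - G (x + axis i 0))) {0..1}"
      by (rule fundamental_theorem_of_calculus) (use D in \<open>auto simp: has_real_derivative_iff_has_vector_derivative[symmetric]\<close>)
    moreover have "axis i (0::real) = 0" by simp
    ultimately show ?thesis using periodicD[OF G(1), of x i] by (auto dest: integral_unique)
  qed
  from i show ?thesis
  proof
    assume "i = 1"
    then have "pair_vec (0, y) + axis i x = pair_vec (x, y)" for x y
      by (simp add: vec_eq_iff forall_2 axis_def)
    then have "integral {0..1} (\<lambda>x. g (pair_vec (x, y))) = 0" for y
      using I[of "pair_vec (0, y)"] by simp
    then show ?thesis unfolding torus_Fubini(2)[OF g] by simp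
  next
    assume "i = 2"
    then have "pair_vec (x, 0) + axis i y = pair_vec (x, y)" for x y
      by (simp add: vec_eq_iff forall_2 axis_def)
    then have "integral {0..1} (\<lambda>y. g (pair_vec (x, y))) = 0" for x
      using I[of "pair_vec (x, 0)"] by simp
    then show ?thesis unfolding torus_Fubini(1)[OF g] by simp
  qed
qed

lemma has_partial_mult:
  assumes "has_partial i F f" "has_partial i G g"
  shows "has_partial i (\<lambda>x. F x * G x) (\<lambda>x. f x * G x + F x * g x)"
  unfolding has_partial_def
proof
  fix x
  have "((\<lambda>t. F (x + axis i t) * G (x + axis i t)) has_real_derivative f x * G (x + axis i 0) + g x * F (x + axis i 0)) (at 0)"
    using assms unfolding has_partial_def by (intro DERIV_mult) auto
  then show "((\<lambda>t. F (x + axis i t) * G (x + axis i t)) has_real_derivative f x * G x + F x * g x) (at 0)"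
    by (simp add: mult.commute)
qed

lemma has_partial_add:
  assumes "has_partial i F f" "has_partial i G g"
  shows "has_partial i (\<lambda>x. F x + G x) (\<lambda>x. f x + g x)"
  using assms unfolding has_partial_def by (auto intro: DERIV_add)

lemma has_partial_cmult:
  assumes "has_partial i F f"
  shows "has_partial i (\<lambda>x. c * F x) (\<lambda>x. c * f x)"
  using assms unfolding has_partial_def by (auto intro: DERIV_cmult)

lemma has_partial_sum:
  assumes "\<And>k. k \<in> A \<Longrightarrow> has_partial i (F k) (f k)"
  shows "has_partial i (\<lambda>x. \<Sum>k\<in>A. F k x) (\<lambda>x. \<Sum>k\<in>A. f k x)"
  using assms unfolding has_partial_def by (auto intro: DERIV_sum)

lemma has_partial_chain:
  assumes F: "has_partial i F f" and h: "\<And>x. (h has_real_derivative h' (F x)) (at (F x))"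
  shows "has_partial i (\<lambda>x. h (F x)) (\<lambda>x. h' (F x) * f x)"
  unfolding has_partial_def
proof
  fix x
  have "(h has_real_derivative h' (F x)) (at (F (x + axis i 0)))" using h by simp
  then show "((\<lambda>t. h (F (x + axis i t))) has_real_derivative h' (F x) * f x) (at 0)"
    by (rule DERIV_chain2) (use F in \<open>simp add: has_partial_def\<close>)
qed

lemma has_partial_shift:
  assumes "has_partial i F f"
  shows "has_partial i (\<lambda>x. F (x - a)) (\<lambda>x. f (x - a))"
proof -
  have "x + axis i t - a = (x - a) + axis i t" for x and t :: real by simp
  then show ?thesis using assms unfolding has_partial_def by (simp only:) blast
qed

lemma periodic_shift: "periodic u \<Longrightarrow> periodic (\<lambda>x. u (x - a))"
  unfolding periodic_def
proof (intro allI)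
  fix x i assume *: "\<forall>x i. u (x + axis i 1) = u x"
  have "x + axis i 1 - a = (x - a) + axis i 1" by simp
  then show "u (x + axis i 1 - a) = u (x - a)" using * by (simp only:)
qed

lemma integration_by_parts_torus:
  assumes F: "periodic F" "has_partial i F f" "continuous_on UNIV F" "continuous_on UNIV f"
    and G: "periodic G" "has_partial i G g" "continuous_on UNIV G" "continuous_on UNIV g"
  shows "(LINT x|torus. F x * g x) = - (LINT x|torus. f x * G x)"
proof -
  have "(LINT x|torus. f x * G x + F x * g x) = 0"
    by (rule torus_integral_partial[OF _ has_partial_mult[OF F(2) G(2)]])
       (use F G in \<open>auto simp: periodic_def intro!: continuous_intros\<close>)
  moreover have "integrable torus (\<lambda>x. f x * G x)" "integrable torus (\<lambda>x. F x * g x)"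
    by (intro integrable_torus_continuous continuous_intros F G)+
  ultimately show ?thesis by simp
qed

lemma has_derivative_imp_has_partial:
  assumes "\<And>x. (\<phi> has_derivative D x) (at x)"
  shows "has_partial i \<phi> (\<lambda>x. D x (axis i 1))"
  unfolding has_partial_def
proof
  fix x
  have ax: "axis i t = t *\<^sub>R (axis i 1 :: real^2)" for t :: real by (simp add: vec_eq_iff axis_def)
  have "((\<lambda>t. x + t *\<^sub>R axis i 1 :: real^2) has_derivative (\<lambda>t. t *\<^sub>R axis i 1 :: real^2)) (at 0)"
    by (auto intro!: derivative_eq_intros)
  then have "((\<lambda>t. \<phi> (x + t *\<^sub>R axis i 1)) has_derivative (\<lambda>t. D x (t *\<^sub>R axis i 1))) (at 0)"
    by (rule has_derivative_compose) (simp add: assms)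
  moreover have "(\<lambda>t. D x (t *\<^sub>R axis i 1)) = (*) (D x (axis i 1))"
    using linear_scale[OF has_derivative_linear[OF assms[of x]]] by (simp add: fun_eq_iff)
  moreover have "(\<lambda>t. \<phi> (x + t *\<^sub>R axis i 1)) = (\<lambda>t. \<phi> (x + axis i t))"
    by (simp only: ax[symmetric])
  ultimately show "((\<lambda>t. \<phi> (x + axis i t)) has_real_derivative D x (axis i 1)) (at 0)"
    unfolding has_field_derivative_def by (simp only:)
qed

lemma test_function_C_k:
  assumes "test_function \<phi>"
  shows "periodic \<phi>" "C_k k \<phi>"
  using assms by (auto simp: test_function_def)

lemma test_function_continuous: "test_function \<phi> \<Longrightarrow> continuous_on UNIV \<phi>"
  using test_function_C_k(2)[of \<phi> 0] by simp

lemma test_function_differentiable: "test_function \<phi> \<Longrightarrow> \<phi> differentiable (at x)"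
  using test_function_C_k(2)[of \<phi> 1] by simp

lemma test_function_partial_continuous: "test_function \<phi> \<Longrightarrow> continuous_on UNIV (partial_deriv i \<phi>)"
  using test_function_C_k(2)[of \<phi> 1] by simp

lemma test_function_has_partial: "test_function \<phi> \<Longrightarrow> has_partial i \<phi> (partial_deriv i \<phi>)"
  unfolding partial_deriv_def
  by (rule has_derivative_imp_has_partial) (simp add: frechet_derivative_works[symmetric] test_function_differentiable)

lemma partial_deriv_eqI:
  assumes "\<And>x. (\<phi> has_derivative D x) (at x)"
  shows "partial_deriv i \<phi> = (\<lambda>x. D x (axis i 1))"
  unfolding partial_deriv_def using frechet_derivative_at[OF assms] by (auto simp: fun_eq_iff)

text \<open>Translating along one axis at a time, with the shifted variable innermost in Fubini,
  reduces the claim to periodic functions of one variable.\<close>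

lemma torus_integral_shift:
  assumes g: "continuous_on UNIV (g :: real^2 \<Rightarrow> real)" "periodic g"
  shows "(LINT x|torus. g (x + a)) = (LINT x|torus. g x)"
proof -
  have shift1: "integral {0..1} (\<lambda>y. h (y + t)) = integral {0..1} h"
    if h: "continuous_on UNIV h" "\<And>y. h (y + 1) = h y" for h :: "real \<Rightarrow> real" and t
  proof -
    \<comment> \<open>The interval \<open>{0..1+t}\<close> is split at t and at 1; the pieces
      \<open>{0..t}\<close> and \<open>{1..1+t}\<close> carry the same integral by
      periodicity.\<close>
    have nonneg: "integral {0..1} (\<lambda>y. h (y + t)) = integral {0..1} h"
      if h: "continuous_on UNIV h" "\<And>y. h (y + 1) = h y" and t: "t \<ge> 0" for h :: "real \<Rightarrow> real" and t
    proof -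
      have i: "h integrable_on {a..b}" for a b
        by (rule integrable_continuous_real[OF continuous_on_subset[OF h(1)]]) simp
      have "integral {0..1} (\<lambda>y. h (y + t)) = integral {t..1+t} h"
        using integral_shift_Icc_real[of 0 1 h t] by (simp add: o_def add.commute)
      moreover have "integral {0..t} h + integral {t..1+t} h = integral {0..1+t} h"
        by (rule Henstock_Kurzweil_Integration.integral_combine) (use t i in auto)
      moreover have "integral {0..1} h + integral {1..1+t} h = integral {0..1+t} h"
        by (rule Henstock_Kurzweil_Integration.integral_combine) (use t i in auto)
      moreover have "integral {1..1+t} h = integral {0..t} h"
        using integral_shift_Icc_real[of 0 t h 1] h(2) by (simp add: o_def add.commute)
      ultimately show ?thesis by simp
    qed
    show ?thesis
    proof (cases "t \<ge> 0")
      case False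
      \<comment> \<open>For negative t, the shift by -t is applied to the already shifted
        function.\<close>
      have "integral {0..1} (\<lambda>y. h ((y + -t) + t)) = integral {0..1} (\<lambda>y. h (y + t))"
        by (rule nonneg[of "\<lambda>y. h (y + t)" "-t"])
           (use False h(2)[of "_ + t"] in \<open>auto simp: add_ac intro!: continuous_on_compose2[OF h(1)] continuous_intros\<close>)
      then show ?thesis by simp
    qed (use nonneg h in blast)
  qed
  have shift: "(LINT x|torus. g (x + axis i t)) = (LINT x|torus. g x)"
    if g: "continuous_on UNIV g" "periodic g" for g :: "real^2 \<Rightarrow> real" and i t
  proof -
    have i: "i = 1 \<or> i = 2" using exhaust_2 by blast
    have gt: "continuous_on UNIV (\<lambda>x. g (x + axis i t))"
      by (rule continuous_on_compose2[OF g(1)]) (auto intro!: continuous_intros)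
    have gc: "continuous_on UNIV (\<lambda>y. g (pair_vec (x, y)))" "continuous_on UNIV (\<lambda>y. g (pair_vec (y, x)))" for x
      by (rule continuous_on_compose2[OF g(1)]; (intro continuous_intros)?; simp)+
    have e: "pair_vec (x, y) + axis 1 s = pair_vec (x + s, y)" "pair_vec (x, y) + axis 2 s = pair_vec (x, y + s)" for x y s
      by (simp_all add: vec_eq_iff forall_2 axis_def)
    have p: "g (pair_vec (x + 1, y)) = g (pair_vec (x, y))" "g (pair_vec (x, y + 1)) = g (pair_vec (x, y))" for x y
      by (simp_all flip: e add: periodicD[OF g(2)])
    from i show ?thesis
    proof
      assume "i = 1"
      then show ?thesis unfolding torus_Fubini(2)[OF gt] torus_Fubini(2)[OF g(1)]
        using shift1[OF gc(2) p(1)] by (simp add: e)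
    next
      assume "i = 2"
      then show ?thesis unfolding torus_Fubini(1)[OF gt] torus_Fubini(1)[OF g(1)]
        using shift1[OF gc(1) p(2)] by (simp add: e)
    qed
  qed
  have a: "a = axis 1 (a$1) + axis 2 (a$2)" by (simp add: vec_eq_iff forall_2 axis_def)
  have "(LINT x|torus. g (x + axis 1 (a$1) + axis 2 (a$2))) = (LINT x|torus. g (x + axis 1 (a$1)))"
    by (subst shift[of "\<lambda>x. g (x + axis 1 (a$1))" 2 "a$2", symmetric])
       (use periodic_shift[OF g(2), of "- axis 1 (a$1)"] in
         \<open>auto simp: add_ac intro!: continuous_on_compose2[OF g(1)] continuous_intros\<close>)
  also have "\<dots> = (LINT x|torus. g x)" by (rule shift[OF g])
  finally show ?thesis using a by (simp add: add.assoc)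
qed

section \<open>The real trigonometric basis\<close>

text \<open>Positive frequencies are cosines and negative ones sines, so that differentiation maps
  \<open>trig j\<close> to a multiple of \<open>trig (- j)\<close>.\<close>

definition trig :: "int \<Rightarrow> real \<Rightarrow> real" where
  "trig j t = (if j = 0 then 1 else if j > 0 then sqrt 2 * cos (2 * pi * j * t) else sqrt 2 * sin (2 * pi * j * t))"

lemma trig_0 [simp]: "trig 0 t = 1" by (simp add: trig_def)

lemma DERIV_trig: "(trig j has_real_derivative (2 * pi * j * trig (- j) t)) (at t)"
proof -
  consider "j = 0" | "j > 0" | "j < 0" by linarith
  then show ?thesis
  proof cases
    case 1
    have "trig j = (\<lambda>t. 1)" using 1 by auto
    then show ?thesis using 1 by simp
  next
    case 2
    have "trig j = (\<lambda>t. sqrt 2 * cos (2 * pi * j * t))" using 2 by (auto simp: trig_def)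
    moreover have "((\<lambda>t. sqrt 2 * cos (2 * pi * j * t)) has_real_derivative (2 * pi * j * trig (- j) t)) (at t)"
      using 2 by (auto intro!: derivative_eq_intros simp: trig_def)
    ultimately show ?thesis by simp
  next
    case 3
    have "trig j = (\<lambda>t. sqrt 2 * sin (2 * pi * j * t))" using 3 by (auto simp: trig_def)
    moreover have "((\<lambda>t. sqrt 2 * sin (2 * pi * j * t)) has_real_derivative (2 * pi * j * trig (- j) t)) (at t)"
      using 3 by (auto intro!: derivative_eq_intros simp: trig_def)
    ultimately show ?thesis by simp
  qed
qed

lemma continuous_on_trig [continuous_intros]:
  assumes "continuous_on S f"
  shows "continuous_on S (\<lambda>x. trig j (f x))"
proof -
  have "continuous_on UNIV (trig j)"
    by (rule DERIV_continuous_on[OF DERIV_trig])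
  then show ?thesis using assms by (rule continuous_on_compose2) simp
qed

lemma trig_periodic [simp]: "trig j (t + 1) = trig j t"
proof -
  have "cos (2 * pi * j * (t + 1)) = cos (2 * pi * j * t)" "sin (2 * pi * j * (t + 1)) = sin (2 * pi * j * t)"
    using cos_int_2pin[of j] sin_int_2pin[of j] by (simp_all add: distrib_left cos_add sin_add mult_ac)
  then show ?thesis by (simp add: trig_def)
qed

lemma abs_trig_le: "\<bar>trig j t\<bar> \<le> sqrt 2"
  by (auto simp: trig_def abs_mult intro!: mult_left_le)

lemma trig_sum_squares: "j \<noteq> 0 \<Longrightarrow> (trig j t)\<^sup>2 + (trig (- j) t)\<^sup>2 = 2"
proof -
  assume j: "j \<noteq> 0"
  have "(cos (2 * pi * j * t))\<^sup>2 + (sin (2 * pi * j * t))\<^sup>2 = 1" by (rule sin_cos_squared_add2)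
  then have "2 * (cos (2 * pi * j * t))\<^sup>2 + 2 * (sin (2 * pi * j * t))\<^sup>2 = 2" by linarith
  then show ?thesis using j by (auto simp: trig_def power_mult_distrib)
qed

text \<open>The product-to-sum formulas, with unspecified coefficients. Through them trigonometric
  polynomials form an algebra, as Stone-Weierstrass requires.\<close>

lemma trig_mult:
  "\<exists>a b l m. \<forall>t. trig j t * trig k t = a * trig l t + b * trig m t"
proof -
  \<comment> \<open>These cosines and sines admit every integer frequency, so the addition formulas
    need no case distinction on signs; each of them is a multiple of one
    \<open>trig\<close>.\<close>
  define C S where "C = (\<lambda>(l::int) t. cos (2 * pi * l * t))" and "S = (\<lambda>(l::int) t. sin (2 * pi * l * t))"
  have C: "\<exists>a l. \<forall>t. C m t = a * trig l t" for m
  proof (rule exI, rule exI, rule allI)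
    fix t
    show "C m t = (if m = 0 then 1 else 1 / sqrt 2) * trig \<bar>m\<bar> t"
      by (auto simp: C_def trig_def abs_if)
  qed
  have S: "\<exists>a l. \<forall>t. S m t = a * trig l t" for m
  proof (rule exI, rule exI, rule allI)
    fix t
    show "S m t = (if m = 0 then 0 else if m < 0 then 1 / sqrt 2 else - 1 / sqrt 2) * trig (- \<bar>m\<bar>) t"
      by (auto simp: S_def trig_def abs_if)
  qed
  have cases: "(\<exists>c. \<forall>t. trig j t = c * C j t) \<or> (\<exists>c. \<forall>t. trig j t = c * S j t)" for j
  proof -
    consider "j = 0" | "j > 0" | "j < 0" by linarith
    then show ?thesis
    proof cases
      case 1 then show ?thesis by (intro disjI1 exI[of _ 1]) (simp add: C_def)
    next
      case 2 then show ?thesis by (intro disjI1 exI[of _ "sqrt 2"]) (simp add: C_def trig_def)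
    next
      case 3 then show ?thesis by (intro disjI2 exI[of _ "sqrt 2"]) (simp add: S_def trig_def)
    qed
  qed
  have add: "C (j + k) t = C j t * C k t - S j t * S k t" "C (j - k) t = C j t * C k t + S j t * S k t"
    "S (j + k) t = S j t * C k t + C j t * S k t" "S (j - k) t = S j t * C k t - C j t * S k t" for j k t
    by (simp_all add: C_def S_def cos_add cos_diff sin_add sin_diff distrib_left distrib_right
        left_diff_distrib right_diff_distrib)
  have fin: ?thesis if XY: "\<And>t. trig j t * trig k t = c * X t + d * Y t"
    "\<exists>a l. \<forall>t. X t = a * trig l t" "\<exists>a l. \<forall>t. Y t = a * trig l t" for c d X Y
  proof -
    obtain a l b m where "\<And>t. X t = a * trig l t" "\<And>t. Y t = b * trig m t" using XY(2,3) by blast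
    then have "\<forall>t. trig j t * trig k t = (c * a) * trig l t + (d * b) * trig m t" using XY(1) by (simp add: mult.assoc)
    then show ?thesis by blast
  qed
  from cases[of j] cases[of k] show ?thesis
  proof (elim disjE exE)
    fix c d assume *: "\<forall>t. trig j t = c * C j t" "\<forall>t. trig k t = d * C k t"
    show ?thesis
      by (rule fin[of "c * d / 2" "C (j + k)" "c * d / 2" "C (j - k)", OF _ C C]) (use * in \<open>simp add: add algebra_simps\<close>)
  next
    fix c d assume *: "\<forall>t. trig j t = c * C j t" "\<forall>t. trig k t = d * S k t"
    show ?thesis
      by (rule fin[of "c * d / 2" "S (j + k)" "- c * d / 2" "S (j - k)", OF _ S S]) (use * in \<open>simp add: add algebra_simps\<close>)
  next
    fix c d assume *: "\<forall>t. trig j t = c * S j t" "\<forall>t. trig k t = d * C k t"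
    show ?thesis
      by (rule fin[of "c * d / 2" "S (j + k)" "c * d / 2" "S (j - k)", OF _ S S]) (use * in \<open>simp add: add algebra_simps\<close>)
  next
    fix c d assume *: "\<forall>t. trig j t = c * S j t" "\<forall>t. trig k t = d * S k t"
    show ?thesis
      by (rule fin[of "- c * d / 2" "C (j + k)" "c * d / 2" "C (j - k)", OF _ C C]) (use * in \<open>simp add: add algebra_simps\<close>)
  qed
qed

text \<open>Every value is read off from the derivative of a periodic function, whose integral over
  a period is zero.\<close>

lemma integral_trig_mult: "integral {0..1} (\<lambda>t. trig j t * trig k t) = (if j = k then 1 else 0)"
proof -
  have FTC: "integral {0..1} w = 0" if "\<And>t. (W has_real_derivative w t) (at t)" "W 1 = W 0" for W w :: "real \<Rightarrow> real"
  proof -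
    have "(w has_integral (W 1 - W 0)) {0..1}"
      by (rule fundamental_theorem_of_calculus)
         (use that(1) in \<open>auto simp: has_real_derivative_iff_has_vector_derivative[symmetric] intro: has_field_derivative_at_within\<close>)
    then show ?thesis using that(2) by (simp add: integral_unique)
  qed
  have int: "(\<lambda>t. trig j t * trig k t) integrable_on {0..1}" for j k
    by (intro integrable_continuous_real continuous_intros)
  have per: "trig j 1 = trig j 0" for j using trig_periodic[of j 0] by simp
  have W: "((\<lambda>t. trig j t * trig k t) has_real_derivative
      (2 * pi * j * trig (- j) t) * trig k t + (2 * pi * k * trig (- k) t) * trig j t) (at t)" for j k t
    by (rule DERIV_mult[OF DERIV_trig DERIV_trig])
  consider "j = 0 \<and> k = 0" | "j = k" "j \<noteq> 0" | "k = - j" "j \<noteq> 0" | "j\<^sup>2 \<noteq> k\<^sup>2"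
    by (metis power2_eq_iff neg_equal_0_iff_equal)
  then show ?thesis
  proof cases
    case 1 then show ?thesis by simp
  next
    case 2
    \<comment> \<open>The derivative of \<open>trig j\<close> times \<open>trig (- j)\<close> shows
      that both have the same norm; their squares add up to 2.\<close>
    have "integral {0..1} (\<lambda>t. (2 * pi * j * trig (- j) t) * trig (- j) t + (2 * pi * real_of_int (- j) * trig (- (- j)) t) * trig j t) = 0"
      by (rule FTC[OF W]) (simp add: per)
    then have "integral {0..1} (\<lambda>t. (2 * pi * j) * (trig (- j) t * trig (- j) t - trig j t * trig j t)) = 0"
      by (simp add: algebra_simps)
    then have "(2 * pi * j) * integral {0..1} (\<lambda>t. (trig (- j) t * trig (- j) t - trig j t * trig j t)) = 0"
      by (subst (asm) integral_mult_right)
    then have "integral {0..1} (\<lambda>t. (trig (- j) t * trig (- j) t - trig j t * trig j t)) = 0" using 2 by simp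
    then have "integral {0..1} (\<lambda>t. trig (- j) t * trig (- j) t) = integral {0..1} (\<lambda>t. trig j t * trig j t)"
      using int by (subst (asm) Henstock_Kurzweil_Integration.integral_diff) auto
    moreover have "integral {0..1} (\<lambda>t. trig j t * trig j t + trig (- j) t * trig (- j) t) = 2"
      using trig_sum_squares[OF 2(2)] by (simp add: power2_eq_square)
    then have "integral {0..1} (\<lambda>t. trig j t * trig j t) + integral {0..1} (\<lambda>t. trig (- j) t * trig (- j) t) = 2"
      using int by (subst (asm) Henstock_Kurzweil_Integration.integral_add) auto
    ultimately show ?thesis using 2 by simp
  next
    case 3
    \<comment> \<open>Here the antiderivative is the square of \<open>trig j\<close>.\<close>
    have "integral {0..1} (\<lambda>t. (2 * pi * j * trig (- j) t) * trig j t + (2 * pi * j * trig (- j) t) * trig j t) = 0"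
      by (rule FTC[OF W]) (simp add: per)
    then have "integral {0..1} (\<lambda>t. (4 * pi * j) * (trig j t * trig (- j) t)) = 0"
      by (simp add: algebra_simps)
    then have "(4 * pi * j) * integral {0..1} (\<lambda>t. trig j t * trig (- j) t) = 0"
      by (subst (asm) integral_mult_right)
    then show ?thesis using 3 by auto
  next
    case 4
    \<comment> \<open>The Wronskian of \<open>trig j\<close> and \<open>trig k\<close>: they solve
      y'' = -(2\<pi>j)^2 y and y'' = -(2\<pi>k)^2 y, so its derivative is a nonzero multiple of
      their product.\<close>
    have D: "((\<lambda>t. (2 * pi * j) * (trig (- j) t * trig k t) - (2 * pi * k) * (trig (- k) t * trig j t)) has_real_derivative
        (4 * pi\<^sup>2 * ((real_of_int k)\<^sup>2 - (real_of_int j)\<^sup>2)) * (trig j t * trig k t)) (at t)" for t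
      by (rule DERIV_cong[OF DERIV_diff[OF DERIV_cmult[OF W] DERIV_cmult[OF W]]])
         (simp add: algebra_simps power2_eq_square)
    have "integral {0..1} (\<lambda>t. (4 * pi\<^sup>2 * ((real_of_int k)\<^sup>2 - (real_of_int j)\<^sup>2)) * (trig j t * trig k t)) = 0"
      by (rule FTC[OF D]) (simp add: per)
    then have "(4 * pi\<^sup>2 * ((real_of_int k)\<^sup>2 - (real_of_int j)\<^sup>2)) * integral {0..1} (\<lambda>t. trig j t * trig k t) = 0"
      by (subst (asm) integral_mult_right)
    moreover have "(real_of_int k)\<^sup>2 \<noteq> (real_of_int j)\<^sup>2"
      using 4 by (metis of_int_eq_iff of_int_power)
    ultimately show ?thesis using 4 by auto
  qed
qed

section \<open>Products of trigonometric functions in two variables and their partial sums\<close>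

definition trig2 :: "int^2 \<Rightarrow> real^2 \<Rightarrow> real" where
  "trig2 k x = trig (k$1) (x$1) * trig (k$2) (x$2)"

text \<open>The partial derivative in direction i sends \<open>trig2 k\<close> to 2\<pi>k_i times
  \<open>trig2 (flip i k)\<close>; this involution takes the place of the imaginary unit in the
  complex Fourier basis.\<close>

definition flip :: "2 \<Rightarrow> int^2 \<Rightarrow> int^2" where
  "flip i k = (\<chi> j. if j = i then - (k$j) else k$j)"

lemma flip_flip [simp]: "flip i (flip i k) = k"
  by (simp add: flip_def vec_eq_iff)

lemma flip_nth_same [simp]: "flip i k $ i = - (k $ i)"
  by (simp add: flip_def)

lemma abs_flip_nth [simp]: "\<bar>flip i k $ j\<bar> = \<bar>k $ j\<bar>"
  by (simp add: flip_def)

lemma flip_nth_power2 [simp]: "(real_of_int (flip i k $ j))\<^sup>2 = (real_of_int (k $ j))\<^sup>2"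
  by (simp add: flip_def)

lemma trig2_has_derivative:
  "(trig2 k has_derivative (\<lambda>h. 2 * pi * (k$1) * trig2 (flip 1 k) x * h$1 + 2 * pi * (k$2) * trig2 (flip 2 k) x * h$2)) (at x)"
proof -
  have D: "((\<lambda>x::real^2. trig (k$i) (x$i)) has_derivative (\<lambda>h. h$i * (2 * pi * (k$i) * trig (- (k$i)) (x$i)))) (at x)" for i
    by (rule has_derivative_eq_rhs)
       (rule has_derivative_compose[OF bounded_linear_imp_has_derivative[OF bounded_linear_vec_nth]
         DERIV_trig[unfolded has_field_derivative_def]], simp add: mult_ac)
  have "((\<lambda>x. trig (k$1) (x$1) * trig (k$2) (x$2)) has_derivative
     (\<lambda>h. trig (k$1) (x$1) * (h$2 * (2 * pi * (k$2) * trig (- (k$2)) (x$2))) +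
        (h$1 * (2 * pi * (k$1) * trig (- (k$1)) (x$1))) * trig (k$2) (x$2))) (at x)"
    by (rule has_derivative_mult[OF D D])
  moreover have "trig2 k = (\<lambda>x. trig (k$1) (x$1) * trig (k$2) (x$2))" by (simp add: trig2_def fun_eq_iff)
  ultimately show ?thesis
    by (simp add: trig2_def flip_def algebra_simps)
qed

lemma partial_deriv_trig2: "partial_deriv i (trig2 k) = (\<lambda>x. 2 * pi * (k$i) * trig2 (flip i k) x)"
proof -
  have "i = 1 \<or> i = 2" using exhaust_2 by blast
  then show ?thesis
    by (subst partial_deriv_eqI[OF trig2_has_derivative]) (auto simp: axis_def)
qed

lemma partial_deriv_cmult:
  assumes "\<And>x. \<phi> differentiable (at x)"
  shows "partial_deriv i (\<lambda>x. c * \<phi> x) = (\<lambda>x. c * partial_deriv i \<phi> x)"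
proof -
  have "((\<lambda>x. c * \<phi> x) has_derivative (\<lambda>h. c * frechet_derivative \<phi> (at x) h)) (at x)" for x
    using assms[of x] by (intro has_derivative_mult_right) (simp add: frechet_derivative_works)
  from partial_deriv_eqI[OF this] show ?thesis by (simp add: partial_deriv_def)
qed

lemma differentiable_trig2: "trig2 k differentiable (at x)"
  using trig2_has_derivative differentiable_def by blast

lemma C_k_trig2: "C_k n (\<lambda>x. c * trig2 k x)"
proof (induction n arbitrary: c k)
  case 0
  show ?case by (auto simp: trig2_def intro!: continuous_intros)
next
  case (Suc n)
  have "(\<lambda>x. c * trig2 k x) differentiable (at x)" for x
    by (intro differentiable_mult differentiable_trig2) auto
  moreover have "C_k n (partial_deriv i (\<lambda>x. c * trig2 k x))" for i
    unfolding partial_deriv_cmult[OF differentiable_trig2] partial_deriv_trig2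
    using Suc.IH[of "c * (2 * pi * (k$i))" "flip i k"] by (simp add: mult.assoc)
  ultimately show ?case by simp
qed

lemma periodic_trig2: "periodic (trig2 k)"
  unfolding periodic_def trig2_def by (auto simp: axis_def)

lemma test_function_trig2: "test_function (trig2 k)"
  using C_k_trig2[of _ 1] by (simp add: test_function_def periodic_trig2)

lemma continuous_on_trig2: "continuous_on UNIV (trig2 k)"
  by (rule test_function_continuous[OF test_function_trig2])

lemma abs_trig2_le: "\<bar>trig2 k x\<bar> \<le> 2"
proof -
  have "\<bar>trig2 k x\<bar> \<le> sqrt 2 * sqrt 2"
    unfolding trig2_def abs_mult by (intro mult_mono abs_trig_le) auto
  then show ?thesis by simp
qed

lemma trig2_0 [simp]: "trig2 0 x = 1"
  by (simp add: trig2_def)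

lemma laplacian_trig2: "laplacian (trig2 k) x = - 4 * pi\<^sup>2 * ((k$1)\<^sup>2 + (k$2)\<^sup>2) * trig2 k x"
  unfolding laplacian_def sum_2 partial_deriv_trig2 partial_deriv_cmult[OF differentiable_trig2]
  by (simp add: algebra_simps power2_eq_square)

lemma integral_trig2_mult: "(LINT x|torus. trig2 k x * trig2 l x) = (if k = l then 1 else 0)"
proof -
  have "(LINT x|torus. trig2 k x * trig2 l x) = integral {0..1} (\<lambda>x. integral {0..1} (\<lambda>y.
    (trig (k$1) x * trig (l$1) x) * (trig (k$2) y * trig (l$2) y)))"
    by (subst torus_Fubini(1)) (auto intro!: continuous_intros continuous_on_trig2 simp: trig2_def mult_ac)
  also have "\<dots> = (if k$1 = l$1 then 1 else 0) * (if k$2 = l$2 then 1 else 0)"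
    by (subst integral_mult_right, subst integral_mult_left) (simp add: integral_trig_mult)
  finally show ?thesis by (simp add: vec_eq_iff forall_2)
qed

text \<open>Square partial sums: the boxes increase, exhaust all frequencies and are invariant under
  \<open>flip\<close>, so a derivative of a partial sum is again a partial sum over the same
  box.\<close>

definition freq_box :: "nat \<Rightarrow> (int^2) set" where
  "freq_box N = {k. \<forall>i. \<bar>k$i\<bar> \<le> int N}"

lemma freq_box_image: "freq_box N = (\<lambda>(a, b). \<chi> i. if i = 1 then a else b) ` ({-int N..int N} \<times> {-int N..int N})"
proof (intro set_eqI iffI)
  fix k :: "int^2" assume "k \<in> freq_box N"
  then show "k \<in> (\<lambda>(a, b). \<chi> i. if i = 1 then a else b) ` ({-int N..int N} \<times> {-int N..int N})"
    by (intro image_eqI[of _ _ "(k$1, k$2)"]) (auto simp: freq_box_def vec_eq_iff forall_2 abs_le_iff)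
qed (auto simp: freq_box_def abs_le_iff)

lemma finite_freq_box [simp]: "finite (freq_box N)"
  unfolding freq_box_image by simp

lemma freq_box_mono: "M \<le> N \<Longrightarrow> freq_box M \<subseteq> freq_box N"
  unfolding freq_box_def by (auto intro: order_trans)

lemma freq_box_exhaust: "\<exists>N. k \<in> freq_box N"
proof -
  have "k \<in> freq_box (nat (\<bar>k$1\<bar> + \<bar>k$2\<bar>))"
    by (simp add: freq_box_def forall_2)
  then show ?thesis ..
qed

lemma flip_in_freq_box [simp]: "flip i k \<in> freq_box N \<longleftrightarrow> k \<in> freq_box N"
  by (simp add: freq_box_def)

lemma sum_freq_box_flip: "(\<Sum>k\<in>freq_box N. f (flip i k)) = (\<Sum>k\<in>freq_box N. f k)"
  by (rule sum.reindex_bij_witness[of _ "flip i" "flip i"]) auto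

definition coef :: "(real^2 \<Rightarrow> real) \<Rightarrow> int^2 \<Rightarrow> real" where
  "coef u k = (LINT x|torus. u x * trig2 k x)"

definition trig_sum :: "(int^2 \<Rightarrow> real) \<Rightarrow> nat \<Rightarrow> real^2 \<Rightarrow> real" where
  "trig_sum c N x = (\<Sum>k\<in>freq_box N. c k * trig2 k x)"

lemma continuous_on_trig_sum: "continuous_on UNIV (trig_sum c N)"
  unfolding trig_sum_def[abs_def] by (intro continuous_intros continuous_on_trig2)

lemma periodic_trig_sum: "periodic (trig_sum c N)"
  using periodic_trig2 by (simp add: periodic_def trig_sum_def)

text \<open>After reindexing by \<open>flip\<close> the new coefficients are those of the weak
  derivative, see \<open>partial_coef\<close>. Hence the partial sums of a weak derivative of u are
  the classical derivatives of the partial sums of u.\<close>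

lemma has_partial_trig_sum:
  "has_partial i (trig_sum c N) (trig_sum (\<lambda>k. - 2 * pi * (k$i) * c (flip i k)) N)"
proof -
  have "has_partial i (trig_sum c N) (\<lambda>x. \<Sum>k\<in>freq_box N. c k * (2 * pi * (k$i) * trig2 (flip i k) x))"
    unfolding trig_sum_def[abs_def]
  proof (rule has_partial_sum)
    fix k
    show "has_partial i (\<lambda>x. c k * trig2 k x) (\<lambda>x. c k * (2 * pi * (k$i) * trig2 (flip i k) x))"
      using has_partial_cmult[OF test_function_has_partial[OF test_function_trig2], of i "c k" k]
      by (simp add: partial_deriv_trig2)
  qed
  also have "(\<lambda>x. \<Sum>k\<in>freq_box N. c k * (2 * pi * (k$i) * trig2 (flip i k) x)) =
    trig_sum (\<lambda>k. - 2 * pi * (k$i) * c (flip i k)) N"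
    unfolding trig_sum_def fun_eq_iff
    by (subst sum_freq_box_flip[of _ i, symmetric]) (simp add: mult_ac)
  finally show ?thesis .
qed

lemma square_integrable_trig2: "square_integrable torus (trig2 k)"
  by (rule square_integrable_torus_continuous[OF continuous_on_trig2])

lemma square_integrable_trig_sum: "square_integrable torus (trig_sum c N)"
  by (rule square_integrable_torus_continuous[OF continuous_on_trig_sum])

lemma integrable_mult_trig2:
  assumes "integrable torus u"
  shows "integrable torus (\<lambda>x. u x * trig2 k x)"
proof (rule Bochner_Integration.integrable_bound)
  show "integrable torus (\<lambda>x. 2 * u x)" using assms by simp
  show "(\<lambda>x. u x * trig2 k x) \<in> borel_measurable torus"
    using borel_measurable_integrable[OF assms] square_integrable_trig2[of k]
    by (intro borel_measurable_times) (auto simp: square_integrable_def)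
  show "AE x in torus. norm (u x * trig2 k x) \<le> norm (2 * u x)"
    by (rule AE_I2) (use mult_left_mono[OF abs_trig2_le[of k] abs_ge_zero] in \<open>simp add: abs_mult mult.commute\<close>)
qed

lemma integral_mult_trig_sum:
  assumes "integrable torus u"
  shows "(LINT x|torus. u x * trig_sum c N x) = (\<Sum>k\<in>freq_box N. c k * coef u k)"
proof -
  have "(LINT x|torus. u x * trig_sum c N x) = (LINT x|torus. (\<Sum>k\<in>freq_box N. c k * (u x * trig2 k x)))"
    by (simp add: trig_sum_def sum_distrib_left mult_ac)
  also have "\<dots> = (\<Sum>k\<in>freq_box N. c k * coef u k)"
    using integrable_mult_trig2[OF assms] by (simp add: coef_def)
  finally show ?thesis .
qed

lemma coef_trig_sum: "coef (trig_sum c N) k = (if k \<in> freq_box N then c k else 0)"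
proof -
  have "coef (trig_sum c N) k = (LINT x|torus. trig2 k x * trig_sum c N x)"
    by (simp add: coef_def mult.commute)
  also have "\<dots> = (\<Sum>l\<in>freq_box N. c l * (if k = l then 1 else 0))"
    by (subst integral_mult_trig_sum)
       (auto simp: coef_def integral_trig2_mult intro!: integrable_torus_continuous continuous_on_trig2)
  also have "\<dots> = (\<Sum>l\<in>freq_box N. if l = k then c l else 0)"
    by (intro sum.cong) auto
  also have "\<dots> = (if k \<in> freq_box N then c k else 0)" by (rule sum.delta) simp
  finally show ?thesis .
qed

lemma integral_trig_sum_mult:
  "(LINT x|torus. trig_sum c N x * trig_sum d N x) = (\<Sum>k\<in>freq_box N. c k * d k)"
  by (subst integral_mult_trig_sum)
     (auto simp: coef_trig_sum mult.commute intro!: integrable_torus_continuous continuous_on_trig_sum sum.cong)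

section \<open>Completeness of the trigonometric system\<close>

lemma AE_torus_iff: "(AE x in torus. P x) \<longleftrightarrow> (AE x in lebesgue. x \<in> cbox 0 1 \<longrightarrow> P x)"
  by (rule AE_restrict_space_iff) simp

lemma AE_torus_notin_negligible: "negligible N \<Longrightarrow> AE x in torus. x \<notin> N"
  unfolding AE_torus_iff using AE_not_in[of N lebesgue] by (auto simp: negligible_iff_null_sets)

text \<open>Given as a linear span, so that orthogonality to all modes passes to it by induction;
  closure under products is a separate lemma.\<close>

inductive trig_poly :: "(real^2 \<Rightarrow> real) \<Rightarrow> bool" where
  trig2: "trig_poly (trig2 k)"
| cmult: "trig_poly f \<Longrightarrow> trig_poly (\<lambda>x. c * f x)"
| add: "trig_poly f \<Longrightarrow> trig_poly g \<Longrightarrow> trig_poly (\<lambda>x. f x + g x)"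

lemma trig_poly_mult_trig2: "trig_poly (\<lambda>x. trig2 k x * trig2 l x)"
proof -
  obtain a1 b1 p1 q1 where 1: "\<And>t. trig (k$1) t * trig (l$1) t = a1 * trig p1 t + b1 * trig q1 t"
    using trig_mult by metis
  obtain a2 b2 p2 q2 where 2: "\<And>t. trig (k$2) t * trig (l$2) t = a2 * trig p2 t + b2 * trig q2 t"
    using trig_mult by metis
  define T where "T = (\<lambda>p q. trig2 (\<chi> i. if i = 1 then p else q))"
  have "trig2 k x * trig2 l x = (trig (k$1) (x$1) * trig (l$1) (x$1)) * (trig (k$2) (x$2) * trig (l$2) (x$2))" for x
    by (simp add: trig2_def mult_ac)
  then have "(\<lambda>x. trig2 k x * trig2 l x) = (\<lambda>x. ((a1 * a2) * T p1 p2 x + (a1 * b2) * T p1 q2 x) + ((b1 * a2) * T q1 p2 x + (b1 * b2) * T q1 q2 x))"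
    unfolding 1 2 by (simp add: T_def trig2_def fun_eq_iff algebra_simps)
  then show ?thesis by (simp only:) (intro trig_poly.intros; simp add: T_def trig_poly.trig2)
qed

lemma trig_poly_mult:
  assumes "trig_poly f" "trig_poly g"
  shows "trig_poly (\<lambda>x. f x * g x)"
  using assms(1)
proof (induction rule: trig_poly.induct)
  case (trig2 k)
  show ?case using assms(2)
  proof (induction rule: trig_poly.induct)
    case (trig2 l)
    show ?case by (rule trig_poly_mult_trig2)
  next
    case (cmult f c)
    then show ?case using trig_poly.cmult[OF cmult.IH, of c] by (simp add: mult_ac)
  next
    case (add f g)
    then show ?case using trig_poly.add[OF add.IH] by (simp add: distrib_left)
  qed
next
  case (cmult f c)
  then show ?case using trig_poly.cmult[OF cmult.IH, of c] by (simp add: mult_ac)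
next
  case (add f g)
  then show ?case using trig_poly.add[OF add.IH] by (simp add: distrib_right)
qed

lemma trig_poly_continuous: "trig_poly f \<Longrightarrow> continuous_on UNIV f"
  by (induction rule: trig_poly.induct) (auto intro!: continuous_intros continuous_on_trig2)

text \<open>Equal cosines and sines force coordinates to differ by integers, and inside the closed
  unit cube a nonzero integer difference occurs only between opposite faces.\<close>

lemma torus_cos_sin_inj:
  assumes "\<And>i. cos (2 * pi * x$i) = cos (2 * pi * y$i)" "\<And>i. sin (2 * pi * x$i) = sin (2 * pi * y$i)"
    and "x \<in> cbox 0 1" "y \<in> cbox 0 1" "x \<noteq> y"
  shows "x \<notin> box 0 1 \<and> y \<notin> box 0 (1 :: real^2)"
proof -
  obtain i where i: "x$i \<noteq> y$i" using \<open>x \<noteq> y\<close> by (auto simp: vec_eq_iff)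
  have b: "0 \<le> x$i" "x$i \<le> 1" "0 \<le> y$i" "y$i \<le> 1" using assms(3,4) by (auto simp: mem_box_cart)
  obtain n where n: "2 * pi * x$i = 2 * pi * y$i + 2 * pi * of_int n"
    using sin_cos_eq_iff[THEN iffD1, of "2 * pi * x$i" "2 * pi * y$i"] assms(1,2) by (auto simp: mult_ac)
  then have "2 * pi * (x$i - y$i - of_int n) = 0" by (simp add: algebra_simps)
  then have n: "x$i - y$i = of_int n" by simp
  moreover have "n \<noteq> 0" using i n by auto
  ultimately have "(x$i = 1 \<and> y$i = 0) \<or> (x$i = 0 \<and> y$i = 1)"
  proof (cases "n > 0")
    case True
    then have "real_of_int n \<ge> 1" by simp
    then show ?thesis using b n by linarith
  next
    case False
    then have "n \<le> -1" using \<open>n \<noteq> 0\<close> by simp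
    then have "real_of_int n \<le> -1" by linarith
    then show ?thesis using b n by linarith
  qed
  then show ?thesis by (auto simp: mem_box_cart intro: exI[of _ i])
qed

text \<open>A function vanishing on the boundary of the cube descends to the image of the torus in
  \<open>\<real>\<^sup>4\<close>, where the Stone-Weierstrass theorem applies.\<close>

lemma trig_poly_dense_continuous:
  fixes G :: "real^2 \<Rightarrow> real"
  assumes G: "continuous_on (cbox 0 1) G" and G0: "\<And>x. x \<in> cbox 0 1 - box 0 1 \<Longrightarrow> G x = 0" and "e > 0"
  obtains P where "trig_poly P" "\<And>x. x \<in> cbox 0 1 \<Longrightarrow> \<bar>G x - P x\<bar> < e"
proof -
  define \<Phi> :: "real^2 \<Rightarrow> (real^2) \<times> (real^2)"
    where "\<Phi> x = ((\<chi> i. cos (2 * pi * x$i)), (\<chi> i. sin (2 * pi * x$i)))" for x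
  define S where "S = \<Phi> ` cbox 0 1"
  have \<Phi>: "continuous_on A \<Phi>" for A
    unfolding \<Phi>_def by (intro continuous_intros)
  have "compact S" unfolding S_def by (intro compact_continuous_image \<Phi> compact_cbox)
  \<comment> \<open>A continuous map from a compact space onto a Hausdorff one is a quotient map, so
    G factors through the embedded torus as a continuous function on the image.\<close>
  have qm: "quotient_map (top_of_set (cbox 0 1)) (top_of_set S) \<Phi>"
  proof (rule continuous_imp_quotient_map)
    show "compact_space (top_of_set (cbox (0::real^2) 1))"
      by (simp add: compact_space_subtopology)
    show "Hausdorff_space (top_of_set S)"
      by (simp add: Hausdorff_space_subtopology)
  qed (use \<Phi> in \<open>auto simp: S_def\<close>)
  have cm: "continuous_map (top_of_set (cbox 0 1)) euclideanreal G" using G by simp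
  have eq: "G x = G y" if "x \<in> topspace (top_of_set (cbox 0 1))" "y \<in> topspace (top_of_set (cbox 0 1))" "\<Phi> x = \<Phi> y" for x y
  proof (cases "x = y")
    case False
    then have "x \<notin> box 0 1 \<and> y \<notin> box 0 1"
      using that by (intro torus_cos_sin_inj) (auto simp: \<Phi>_def vec_eq_iff)
    then show ?thesis using G0 that by simp
  qed simp
  have "\<exists>g. continuous_map (top_of_set S) euclideanreal g \<and> (\<forall>x\<in>cbox 0 1. g (\<Phi> x) = G x)"
    by (rule quotient_map_lift_exists[OF qm cm eq]) auto
  then obtain g where g: "continuous_map (top_of_set S) euclideanreal g"
    and gG: "\<And>x. x \<in> cbox 0 1 \<Longrightarrow> g (\<Phi> x) = G x"
    by blast
  \<comment> \<open>Stone-Weierstrass is applied to the continuous functions on the image whose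
    pullback is a trigonometric polynomial; the four coordinates of the ambient space belong to this
    class and separate points.\<close>
  have "\<exists>F. (continuous_on S F \<and> trig_poly (\<lambda>x. F (\<Phi> x))) \<and> (\<forall>z\<in>S. \<bar>g z - F z\<bar> < e)"
  proof (rule Stone_Weierstrass_HOL[OF \<open>compact S\<close>])
    show "continuous_on S (\<lambda>x. c) \<and> trig_poly (\<lambda>x. c)" for c
      using trig_poly.cmult[OF trig_poly.trig2[of 0], of c] by simp
    show "\<exists>F. (continuous_on S F \<and> trig_poly (\<lambda>x. F (\<Phi> x))) \<and> F z \<noteq> F w" if "z \<in> S \<and> w \<in> S \<and> z \<noteq> w" for z w
    proof -
      have c: "trig_poly (\<lambda>x. cos (2 * pi * x$i))" for i
      proof -
        have "i = 1 \<or> i = 2" using exhaust_2 by blast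
        then have "(\<lambda>x::real^2. cos (2 * pi * x$i)) = (\<lambda>x. (1 / sqrt 2) * trig2 (\<chi> j. if j = i then 1 else 0) x)"
          by (auto simp: trig2_def trig_def)
        then show ?thesis by (simp only:) (intro trig_poly.cmult trig_poly.trig2)
      qed
      have s: "trig_poly (\<lambda>x. sin (2 * pi * x$i))" for i
      proof -
        have "i = 1 \<or> i = 2" using exhaust_2 by blast
        then have "(\<lambda>x::real^2. sin (2 * pi * x$i)) = (\<lambda>x. (- 1 / sqrt 2) * trig2 (\<chi> j. if j = i then - 1 else 0) x)"
          by (auto simp: trig2_def trig_def)
        then show ?thesis by (simp only:) (intro trig_poly.cmult trig_poly.trig2)
      qed
      have "(\<exists>i. fst z $ i \<noteq> fst w $ i) \<or> (\<exists>i. snd z $ i \<noteq> snd w $ i)"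
        using that by (auto simp: prod_eq_iff vec_eq_iff)
      then show ?thesis
      proof (elim disjE exE)
        fix i assume "fst z $ i \<noteq> fst w $ i"
        then show ?thesis using c[of i]
          by (intro exI[of _ "\<lambda>z. fst z $ i"]) (auto simp: \<Phi>_def intro!: continuous_intros)
      next
        fix i assume "snd z $ i \<noteq> snd w $ i"
        then show ?thesis using s[of i]
          by (intro exI[of _ "\<lambda>z. snd z $ i"]) (auto simp: \<Phi>_def intro!: continuous_intros)
      qed
    qed
    show "continuous_on S g" using g by simp
  qed (auto intro!: continuous_intros trig_poly.add trig_poly_mult \<open>e > 0\<close>)
  then obtain F where F: "trig_poly (\<lambda>x. F (\<Phi> x))" "\<And>z. z \<in> S \<Longrightarrow> \<bar>g z - F z\<bar> < e" by blast
  show ?thesis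
  proof (rule that[OF F(1)])
    fix x :: "real^2" assume "x \<in> cbox 0 1"
    then show "\<bar>G x - F (\<Phi> x)\<bar> < e" using F(2)[of "\<Phi> x"] gG[of x] by (simp add: S_def)
  qed
qed

lemma integral_mult_trig_poly_eq_0:
  assumes g: "integrable torus g" "\<And>k. coef g k = 0" and P: "trig_poly P"
  shows "integrable torus (\<lambda>x. g x * P x) \<and> (LINT x|torus. g x * P x) = 0"
  using P
proof (induction rule: trig_poly.induct)
  case (trig2 k)
  then show ?case using g(2)[of k] integrable_mult_trig2[OF g(1)] by (simp add: coef_def)
next
  case (cmult f c)
  then have "integrable torus (\<lambda>x. c * (g x * f x)) \<and> (LINT x|torus. c * (g x * f x)) = 0" by simp
  then show ?case by (simp add: mult_ac)
next
  case (add f h)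
  then show ?case by (simp add: distrib_left)
qed

text \<open>Such a g is orthogonal to trigonometric polynomials, hence by density to continuous
  functions vanishing on the boundary of the cube. These approximate sgn g boundedly almost
  everywhere, and the limit of the tests is \<integral>|g| = 0. Working with integrable g makes
  uniqueness available for functions not yet known to be in L2.\<close>

theorem coef_eq_0_imp_AE_eq_0:
  assumes g: "integrable torus g" "\<And>k. coef g k = 0"
  shows "AE x in torus. g x = 0"
proof -
  have gm[measurable]: "g \<in> borel_measurable torus" using g(1) by (rule borel_measurable_integrable)
  have cont: "(LINT x|torus. g x * G x) = 0"
    if G: "continuous_on UNIV G" "\<And>x. x \<in> cbox 0 1 - box 0 1 \<Longrightarrow> G x = 0" for G :: "real^2 \<Rightarrow> real"
  proof (rule ccontr)
    assume ne: "(LINT x|torus. g x * G x) \<noteq> 0"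
    define I where "I = (LINT x|torus. \<bar>g x\<bar>)"
    \<comment> \<open>With this tolerance the approximation error is at most I * e, strictly below
      |\<integral> g G|; the summand 1 avoids division by zero.\<close>
    define e where "e = \<bar>LINT x|torus. g x * G x\<bar> / (I + 1)"
    have "I \<ge> 0" by (simp add: I_def)
    then have "e > 0" using ne by (simp add: e_def)
    obtain P where P: "trig_poly P" "\<And>x. x \<in> cbox 0 1 \<Longrightarrow> \<bar>G x - P x\<bar> < e"
      using trig_poly_dense_continuous[OF continuous_on_subset[OF G(1) subset_UNIV] G(2) \<open>e > 0\<close>] by blast
    have [measurable]: "P \<in> borel_measurable torus" "G \<in> borel_measurable torus"
      by (intro measurable_torus_borel borel_measurable_continuous_onI trig_poly_continuous P G)+
    have int: "integrable torus (\<lambda>x. g x * (G x - P x))"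
    proof (rule Bochner_Integration.integrable_bound)
      show "integrable torus (\<lambda>x. e * g x)" using g(1) by simp
      show "AE x in torus. norm (g x * (G x - P x)) \<le> norm (e * g x)"
      proof (rule AE_I2)
        fix x :: "real^2" assume "x \<in> space torus"
        then have "\<bar>g x\<bar> * \<bar>G x - P x\<bar> \<le> \<bar>g x\<bar> * e" using P(2)[of x] by (intro mult_left_mono) auto
        then show "norm (g x * (G x - P x)) \<le> norm (e * g x)" using \<open>e > 0\<close> by (simp add: abs_mult mult.commute)
      qed
    qed measurable
    have "(LINT x|torus. g x * G x) = (LINT x|torus. g x * (G x - P x) + g x * P x)"
      by (simp add: algebra_simps)
    also have "\<dots> = (LINT x|torus. g x * (G x - P x))"
      using int integral_mult_trig_poly_eq_0[OF g P(1)] by (subst Bochner_Integration.integral_add) auto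
    also have "\<bar>\<dots>\<bar> \<le> (LINT x|torus. \<bar>g x\<bar> * e)"
    proof (rule order_trans[OF integral_abs_bound])
      show "(LINT x|torus. \<bar>g x * (G x - P x)\<bar>) \<le> (LINT x|torus. \<bar>g x\<bar> * e)"
      proof (rule integral_mono)
        fix x :: "real^2" assume "x \<in> space torus"
        then show "\<bar>g x * (G x - P x)\<bar> \<le> \<bar>g x\<bar> * e"
          using P(2)[of x] unfolding abs_mult by (intro mult_left_mono) auto
      qed (use int g(1) in auto)
    qed
    also have "\<dots> = I * e" by (simp add: I_def)
    also have "\<dots> < (I + 1) * e" using \<open>e > 0\<close> by simp
    also have "\<dots> = \<bar>LINT x|torus. g x * G x\<bar>" using \<open>I \<ge> 0\<close> by (simp add: e_def)
    finally show False by simp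
  qed
  define h where "h x = sgn (g x)" for x
  have [measurable]: "h \<in> borel_measurable torus" unfolding h_def by measurable
  then have "h measurable_on (cbox 0 1)" by (simp add: measurable_on_iff_borel_measurable)
  then obtain N H where N: "negligible N" and H: "\<And>n. continuous_on UNIV (H n)"
    "\<And>x. x \<notin> N \<Longrightarrow> (\<lambda>n. H n x) \<longlonglongrightarrow> (if x \<in> cbox 0 1 then h x else 0)"
    unfolding measurable_on_def by blast
  \<comment> \<open>\<open>q\<close> is positive inside the square and zero on its boundary, so
    \<open>c n\<close> is a continuous cutoff tending to 1 in the interior.\<close>
  define q where "q x = x$1 * (1 - x$1) * (x$2 * (1 - x$2))" for x :: "real^2"
  define c where "c n x = max 0 (min 1 (real n * q x))" for n x
  \<comment> \<open>Clipping to [-1, 1] keeps the integrands dominated by |g| and does not disturb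
    the limit sgn g.\<close>
  define K where "K n x = c n x * max (-1) (min 1 (H n x))" for n x
  have Kc: "continuous_on UNIV (K n)" for n
    unfolding K_def c_def q_def by (intro continuous_intros H)
  have K0: "K n x = 0" if "x \<in> cbox 0 1 - box 0 1" for n x
  proof -
    have "\<exists>i. \<not> (0 < x$i \<and> x$i < 1)" using that by (simp add: mem_box_cart)
    then obtain i where "\<not> (0 < x$i \<and> x$i < 1)" by blast
    moreover have "0 \<le> x$i \<and> x$i \<le> 1" using that by (auto simp: mem_box_cart)
    ultimately have "x$i = 0 \<or> x$i = 1" by linarith
    then have "q x = 0" by (auto simp: q_def exhaust_2) (metis exhaust_2)+
    then show ?thesis by (simp add: K_def c_def)
  qed
  have Kb: "\<bar>K n x\<bar> \<le> 1" for n x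
  proof -
    have "\<bar>K n x\<bar> \<le> 1 * 1" unfolding K_def abs_mult c_def by (intro mult_mono) auto
    then show ?thesis by simp
  qed
  have lim: "AE x in torus. (\<lambda>n. g x * K n x) \<longlonglongrightarrow> g x * h x"
    using AE_torus_notin_negligible[OF N] AE_torus_notin_negligible[OF negligible_frontier_interval(1)[of 0 1]] AE_space
  proof eventually_elim
    case (elim x)
    then have x: "x \<in> cbox 0 1" "x \<in> box 0 1" by auto
    have "q x > 0" using x(2) by (auto simp: q_def mem_box_cart)
    obtain n0 where n0: "real n0 * q x > 1" using \<open>q x > 0\<close> ex_less_of_nat_mult by blast
    have "eventually (\<lambda>n. c n x = 1) sequentially"
    proof (rule eventually_sequentiallyI)
      fix n assume "n0 \<le> n"
      then have "real n * q x \<ge> real n0 * q x" using \<open>q x > 0\<close> by (simp add: mult_right_mono)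
      then show "c n x = 1" using n0 by (simp add: c_def)
    qed
    then have "(\<lambda>n. c n x) \<longlonglongrightarrow> 1" by (rule tendsto_eventually)
    moreover have Hx: "(\<lambda>n. H n x) \<longlonglongrightarrow> h x" using H(2)[OF elim(1)] x by simp
    have "(\<lambda>n. max (-1) (min 1 (H n x))) \<longlonglongrightarrow> max (-1) (min 1 (h x))"
      by (rule tendsto_max[OF tendsto_const tendsto_min[OF tendsto_const Hx]])
    ultimately have "(\<lambda>n. g x * K n x) \<longlonglongrightarrow> g x * (1 * max (-1) (min 1 (h x)))"
      unfolding K_def by (intro tendsto_mult[OF tendsto_const] tendsto_mult)
    moreover have "max (-1) (min 1 (h x)) = h x" by (auto simp: h_def sgn_if)
    ultimately show ?case by simp
  qed
  have "(\<lambda>n. LINT x|torus. g x * K n x) \<longlonglongrightarrow> (LINT x|torus. g x * h x)"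
  proof (rule integral_dominated_convergence[where w = "\<lambda>x. \<bar>g x\<bar>"])
    show "(\<lambda>x. g x * K n x) \<in> borel_measurable torus" for n
      using measurable_torus_borel[OF borel_measurable_continuous_onI[OF Kc]] by measurable
    show "AE x in torus. norm (g x * K n x) \<le> \<bar>g x\<bar>" for n
      using Kb by (auto simp: abs_mult intro!: AE_I2 mult_left_le)
  qed (use g(1) lim in auto)
  then have "(LINT x|torus. g x * h x) = 0"
    using cont[OF Kc K0] by (simp add: LIMSEQ_unique)
  then have "(LINT x|torus. \<bar>g x\<bar>) = 0" by (simp add: h_def linordered_idom_class.abs_sgn)
  then show ?thesis using g(1) by (subst (asm) integral_nonneg_eq_0_iff_AE) auto
qed

section \<open>Coefficients determine functions; convergence of Fourier series in L2\<close>

lemma coef_diff: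
  assumes "integrable torus u" "integrable torus v"
  shows "coef (\<lambda>x. u x - v x) k = coef u k - coef v k"
  using integrable_mult_trig2[OF assms(1), of k] integrable_mult_trig2[OF assms(2), of k]
  by (simp add: coef_def left_diff_distrib)

lemma coef_add:
  assumes "integrable torus u" "integrable torus v"
  shows "coef (\<lambda>x. u x + v x) k = coef u k + coef v k"
  using integrable_mult_trig2[OF assms(1), of k] integrable_mult_trig2[OF assms(2), of k]
  by (simp add: coef_def distrib_right)

lemma coef_cmult: "coef (\<lambda>x. c * u x) k = c * coef u k"
  by (simp add: coef_def mult.assoc)

lemma coef_eqI_AE:
  assumes "integrable torus u" "integrable torus v" "\<And>k. coef u k = coef v k"
  shows "AE x in torus. u x = v x"
  using coef_eq_0_imp_AE_eq_0[of "\<lambda>x. u x - v x"] assms by (simp add: coef_diff)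

lemma coef_cong_AE:
  assumes "u \<in> borel_measurable torus" "v \<in> borel_measurable torus" "AE x in torus. u x = v x"
  shows "coef u k = coef v k"
  unfolding coef_def
proof (rule integral_cong_AE)
  show "AE x in torus. u x * trig2 k x = v x * trig2 k x" using assms(3) by eventually_elim simp
qed (use assms square_integrable_trig2[of k] in \<open>auto simp: square_integrable_def intro!: borel_measurable_times\<close>)

text \<open>Orthonormality turns L2 distances of partial sums into differences of the increasing,
  bounded sequence of square sums. The subsequence is recorded because later approximations need
  convergence almost everywhere besides convergence in norm.\<close>

theorem Riesz_Fischer_torus:
  assumes bdd: "\<And>N. (\<Sum>k\<in>freq_box N. (c k)\<^sup>2) \<le> B"
  obtains g r where "L2 g" "strict_mono r" "AE x in torus. (\<lambda>n. trig_sum c (r n) x) \<longlonglongrightarrow> g x"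
    "(\<lambda>n. LINT x|torus. (trig_sum c n x - g x)\<^sup>2) \<longlonglongrightarrow> 0" "\<And>k. coef g k = c k"
proof -
  define s where "s N = (\<Sum>k\<in>freq_box N. (c k)\<^sup>2)" for N
  have "incseq s" unfolding s_def incseq_def by (intro allI impI sum_mono2 freq_box_mono) auto
  then have "Cauchy s"
  proof -
    obtain L where "s \<longlonglongrightarrow> L" using incseq_convergent[OF \<open>incseq s\<close>, of B] bdd s_def by metis
    then show ?thesis by (rule LIMSEQ_imp_Cauchy)
  qed
  have diff: "(LINT x|torus. (trig_sum c M x - trig_sum c N x)\<^sup>2) = \<bar>s M - s N\<bar>" for M N
  proof -
    have le: "(LINT x|torus. (trig_sum c M x - trig_sum c N x)\<^sup>2) = s M - s N" if "N \<le> M" for M N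
    proof -
      define d where "d = (\<lambda>k. if k \<in> freq_box N then 0 else c k)"
      have sub: "freq_box N \<subseteq> freq_box M" by (rule freq_box_mono[OF that])
      have "trig_sum c M x - trig_sum c N x = trig_sum d M x" for x
        unfolding trig_sum_def sum_diff[OF finite_freq_box sub, symmetric]
        by (rule sum.mono_neutral_cong_left) (auto simp: d_def)
      then have "(LINT x|torus. (trig_sum c M x - trig_sum c N x)\<^sup>2) = (\<Sum>k\<in>freq_box M. d k * d k)"
        by (simp add: power2_eq_square integral_trig_sum_mult)
      also have "\<dots> = (\<Sum>k\<in>freq_box M - freq_box N. (c k)\<^sup>2)"
        by (rule sum.mono_neutral_cong_right) (auto simp: d_def power2_eq_square)
      also have "\<dots> = s M - s N" unfolding s_def by (rule sum_diff[OF finite_freq_box sub])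
      finally show ?thesis .
    qed
    show ?thesis
    proof (cases "N \<le> M")
      case True
      then show ?thesis using le[OF True] incseqD[OF \<open>incseq s\<close> True] by simp
    next
      case False
      then have MN: "M \<le> N" by simp
      show ?thesis using le[OF MN] incseqD[OF \<open>incseq s\<close> MN] by (simp add: power2_commute)
    qed
  qed
  have cauchy: "\<exists>N. \<forall>m\<ge>N. \<forall>n\<ge>N. (LINT x|torus. (trig_sum c m x - trig_sum c n x)\<^sup>2) < e" if "e > 0" for e
    using CauchyD[OF \<open>Cauchy s\<close> that] by (simp add: diff)
  have "measure torus (space torus) \<le> 1" by (simp add: measure_torus)
  then obtain r where r: "strict_mono r" "AE x in torus. convergent (\<lambda>n. trig_sum c (r n) x)"
    "square_integrable torus (\<lambda>x. lim (\<lambda>n. trig_sum c (r n) x))"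
    "(\<lambda>n. LINT x|torus. (trig_sum c n x - lim (\<lambda>k. trig_sum c (r k) x))\<^sup>2) \<longlonglongrightarrow> 0"
    by (rule square_integrable_complete[OF finite_measure_torus _ square_integrable_trig_sum cauchy])
  define g where "g x = lim (\<lambda>n. trig_sum c (r n) x)" for x
  have "periodic g" using periodic_trig_sum[of c] by (simp add: periodic_def g_def)
  have g: "square_integrable torus g" using r(3) by (simp add: g_def[abs_def])
  have "L2 g" using g \<open>periodic g\<close> by (simp add: L2_def square_integrable_def)
  moreover have "AE x in torus. (\<lambda>n. trig_sum c (r n) x) \<longlonglongrightarrow> g x"
    using r(2) unfolding g_def by eventually_elim (rule convergent_LIMSEQ_iff[THEN iffD1])
  moreover have "(\<lambda>n. LINT x|torus. (trig_sum c n x - g x)\<^sup>2) \<longlonglongrightarrow> 0" using r(4) by (simp add: g_def[abs_def])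
  moreover have "coef g k = c k" for k
  proof -
    have "eventually (\<lambda>n. coef (trig_sum c n) k = c k) sequentially"
    proof -
      obtain N where "k \<in> freq_box N" using freq_box_exhaust by blast
      then have "coef (trig_sum c n) k = c k" if "N \<le> n" for n
        using subsetD[OF freq_box_mono[OF that]] by (simp add: coef_trig_sum)
      then show ?thesis by (rule eventually_sequentiallyI)
    qed
    then have 1: "(\<lambda>n. coef (trig_sum c n) k) \<longlonglongrightarrow> c k" by (rule tendsto_eventually)
    have sd: "square_integrable torus (\<lambda>x. trig_sum c n x - g x)" for n
      by (rule square_integrable_diff[OF square_integrable_trig_sum g])
    \<comment> \<open>A Fourier coefficient is continuous in L2 by Cauchy-Schwarz, and that of the
      partial sums is eventually constant.\<close>
    have "(coef (trig_sum c n) k - coef g k)\<^sup>2 \<le> (LINT x|torus. (trig_sum c n x - g x)\<^sup>2)" for n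
    proof -
      have "coef (trig_sum c n) k - coef g k = (LINT x|torus. (trig_sum c n x - g x) * trig2 k x)"
        by (subst coef_diff[symmetric])
           (auto simp: coef_def intro!: square_integrable_imp_integrable[OF finite_measure_torus] g square_integrable_trig_sum)
      then show ?thesis
        using Cauchy_Schwarz_integral[OF sd square_integrable_trig2[of k], of n] integral_trig2_mult[of k k]
        by (simp add: power2_eq_square)
    qed
    then have "(\<lambda>n. (coef (trig_sum c n) k - coef g k)\<^sup>2) \<longlonglongrightarrow> 0"
      by (intro tendsto_sandwich[OF _ _ tendsto_const calculation(3)]) auto
    then have "(\<lambda>n. coef (trig_sum c n) k - coef g k) \<longlonglongrightarrow> 0"
      by (simp add: power_tendsto_0_iff)
    then have "(\<lambda>n. coef (trig_sum c n) k) \<longlonglongrightarrow> coef g k" by (rule LIM_zero_cancel)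
    then show ?thesis using 1 LIMSEQ_unique by blast
  qed
  ultimately show ?thesis using that r(1) by blast
qed

section \<open>Sobolev spaces and elliptic regularity\<close>

lemma L2_iff: "L2 u \<longleftrightarrow> periodic u \<and> square_integrable torus u"
  by (simp add: L2_def square_integrable_def)

lemma L2_imp_square_integrable: "L2 u \<Longrightarrow> square_integrable torus u"
  by (simp add: L2_iff)

lemma square_integrable_imp_integrable_torus: "square_integrable torus u \<Longrightarrow> integrable torus u"
  by (rule square_integrable_imp_integrable[OF finite_measure_torus])

lemma L2_imp_L1: "L2 u \<Longrightarrow> L1 u"
  by (simp add: L2_iff L1_def square_integrable_imp_integrable_torus)

lemma L1_imp_integrable: "L1 u \<Longrightarrow> integrable torus u"
  by (simp add: L1_def)

lemma L1_add: "L1 u \<Longrightarrow> L1 v \<Longrightarrow> L1 (\<lambda>x. u x + v x)"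
  by (auto simp: L1_def periodic_def)

lemma L2_add: "L2 u \<Longrightarrow> L2 v \<Longrightarrow> L2 (\<lambda>x. u x + v x)"
  by (auto simp: L2_iff periodic_def square_integrable_add)

lemma L2_cmult: "L2 u \<Longrightarrow> L2 (\<lambda>x. c * u x)"
  by (auto simp: L2_iff periodic_def square_integrable_cmult)

lemma L2_trig2: "L2 (trig2 k)"
  by (simp add: L2_iff periodic_trig2 square_integrable_trig2)

lemma Bessel_torus:
  assumes u: "square_integrable torus u"
  shows "(\<Sum>k\<in>freq_box N. (coef u k)\<^sup>2) \<le> (LINT x|torus. (u x)\<^sup>2)"
proof -
  define S where "S = trig_sum (coef u) N"
  have i: "integrable torus (\<lambda>x. (u x)\<^sup>2)" "integrable torus (\<lambda>x. u x * S x)" "integrable torus (\<lambda>x. S x * S x)"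
    unfolding S_def using u square_integrable_trig_sum
    by (auto intro: integrable_mult_square_integrable simp: square_integrable_power2)
  have uS: "(LINT x|torus. u x * S x) = (\<Sum>k\<in>freq_box N. (coef u k)\<^sup>2)"
    unfolding S_def by (simp add: integral_mult_trig_sum square_integrable_imp_integrable_torus u power2_eq_square)
  have SS: "(LINT x|torus. S x * S x) = (\<Sum>k\<in>freq_box N. (coef u k)\<^sup>2)"
    unfolding S_def by (simp add: integral_trig_sum_mult power2_eq_square)
  have "0 \<le> (LINT x|torus. (u x - S x)\<^sup>2)" by simp
  also have "\<dots> = (LINT x|torus. (u x)\<^sup>2 - 2 * (u x * S x) + S x * S x)"
    by (intro Bochner_Integration.integral_cong) (auto simp: power2_eq_square algebra_simps)
  also have "\<dots> = (LINT x|torus. (u x)\<^sup>2) - (\<Sum>k\<in>freq_box N. (coef u k)\<^sup>2)"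
    using i by (simp add: uS SS)
  finally show ?thesis by simp
qed

text \<open>Riesz-Fischer yields some function with the coefficients of u, and completeness
  identifies it with u almost everywhere.\<close>

lemma trig_sum_coef_tendsto:
  assumes u: "square_integrable torus u"
  shows "(\<lambda>n. LINT x|torus. (trig_sum (coef u) n x - u x)\<^sup>2) \<longlonglongrightarrow> 0"
    and "\<exists>r. strict_mono r \<and> (AE x in torus. (\<lambda>n. trig_sum (coef u) (r n) x) \<longlonglongrightarrow> u x)"
proof -
  obtain g r where g: "L2 g" and r: "strict_mono r"
    and ae: "AE x in torus. (\<lambda>n. trig_sum (coef u) (r n) x) \<longlonglongrightarrow> g x"
    and lim: "(\<lambda>n. LINT x|torus. (trig_sum (coef u) n x - g x)\<^sup>2) \<longlonglongrightarrow> 0" and c: "\<And>k. coef g k = coef u k"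
    using Riesz_Fischer_torus[of "coef u", OF Bessel_torus[OF u]] by blast
  have [measurable]: "u \<in> borel_measurable torus" "g \<in> borel_measurable torus"
    "trig_sum (coef u) n \<in> borel_measurable torus" for n
    using u g square_integrable_trig_sum by (auto simp: L2_iff square_integrable_def)
  have gu: "AE x in torus. g x = u x"
    using coef_eqI_AE[OF _ _ c] g u by (simp add: L2_iff square_integrable_imp_integrable_torus)
  have "(LINT x|torus. (trig_sum (coef u) n x - g x)\<^sup>2) = (LINT x|torus. (trig_sum (coef u) n x - u x)\<^sup>2)" for n
  proof (rule integral_cong_AE)
    show "AE x in torus. (trig_sum (coef u) n x - g x)\<^sup>2 = (trig_sum (coef u) n x - u x)\<^sup>2"
      using gu by eventually_elim simp
  qed measurable
  then show "(\<lambda>n. LINT x|torus. (trig_sum (coef u) n x - u x)\<^sup>2) \<longlonglongrightarrow> 0" using lim by simp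
  have "AE x in torus. (\<lambda>n. trig_sum (coef u) (r n) x) \<longlonglongrightarrow> u x"
    using ae gu by eventually_elim simp
  then show "\<exists>r. strict_mono r \<and> (AE x in torus. (\<lambda>n. trig_sum (coef u) (r n) x) \<longlonglongrightarrow> u x)"
    using r by blast
qed

text \<open>The partial sum differs from the integral by the pairing of v with the L2 error of the
  partial sums of u, so Cauchy-Schwarz suffices.\<close>

theorem Parseval_torus:
  assumes u: "square_integrable torus u" and v: "square_integrable torus v"
  shows "(\<lambda>N. \<Sum>k\<in>freq_box N. coef u k * coef v k) \<longlonglongrightarrow> (LINT x|torus. u x * v x)"
proof -
  have sd: "square_integrable torus (\<lambda>x. trig_sum (coef u) n x - u x)" for n
    by (rule square_integrable_diff[OF square_integrable_trig_sum u])
  have eq: "(\<Sum>k\<in>freq_box N. coef u k * coef v k) - (LINT x|torus. u x * v x)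
      = (LINT x|torus. (trig_sum (coef u) N x - u x) * v x)" for N
  proof -
    have "(LINT x|torus. (trig_sum (coef u) N x - u x) * v x) = (LINT x|torus. v x * trig_sum (coef u) N x) - (LINT x|torus. u x * v x)"
      using integrable_mult_square_integrable[OF square_integrable_trig_sum v] integrable_mult_square_integrable[OF u v]
      by (subst Bochner_Integration.integral_diff[symmetric]) (auto simp: mult.commute algebra_simps)
    then show ?thesis by (simp add: integral_mult_trig_sum square_integrable_imp_integrable_torus v)
  qed
  have "(\<lambda>N. ((\<Sum>k\<in>freq_box N. coef u k * coef v k) - (LINT x|torus. u x * v x))\<^sup>2) \<longlonglongrightarrow> 0"
  proof (rule tendsto_sandwich[OF _ _ tendsto_const])
    show "(\<lambda>n. (LINT x|torus. (trig_sum (coef u) n x - u x)\<^sup>2) * (LINT x|torus. (v x)\<^sup>2)) \<longlonglongrightarrow> 0"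
      using trig_sum_coef_tendsto(1)[OF u] by (rule tendsto_mult_left_zero)
  qed (use Cauchy_Schwarz_integral[OF sd v] eq in auto)
  then show ?thesis by (simp add: power_tendsto_0_iff LIM_zero_iff)
qed

section \<open>Weak derivatives through Fourier coefficients\<close>

definition partial_coef :: "2 \<Rightarrow> (real^2 \<Rightarrow> real) \<Rightarrow> (real^2 \<Rightarrow> real) \<Rightarrow> bool" where
  "partial_coef i u g \<longleftrightarrow> (\<forall>k. coef g k = - 2 * pi * (k$i) * coef u (flip i k))"

text \<open>Both sides are Parseval limits, and applying \<open>flip i\<close> to the summation
  index exchanges them, the sign arising from k_i becoming -k_i. Since the hypotheses concern
  coefficients, the identity covers test functions and H1 functions alike.\<close>

lemma partial_coef_integration_by_parts:
  assumes "square_integrable torus u" "square_integrable torus g" "partial_coef i u g"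
    and "square_integrable torus v" "square_integrable torus h" "partial_coef i v h"
  shows "(LINT x|torus. u x * h x) = - (LINT x|torus. g x * v x)"
proof -
  have "(\<Sum>k\<in>freq_box N. coef u k * coef h k) = - (\<Sum>k\<in>freq_box N. coef g k * coef v k)" for N
  proof -
    have "(\<Sum>k\<in>freq_box N. coef u k * coef h k) = (\<Sum>k\<in>freq_box N. coef u (flip i k) * coef h (flip i k))"
      by (rule sum_freq_box_flip[symmetric])
    also have "\<dots> = (\<Sum>k\<in>freq_box N. - (coef g k * coef v k))"
      using assms(3,6) by (intro sum.cong) (auto simp: partial_coef_def)
    finally show ?thesis by (simp add: sum_negf)
  qed
  then have "(\<lambda>N. - (\<Sum>k\<in>freq_box N. coef g k * coef v k)) \<longlonglongrightarrow> (LINT x|torus. u x * h x)"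
    using Parseval_torus[OF assms(1,5)] by simp
  moreover have "(\<lambda>N. - (\<Sum>k\<in>freq_box N. coef g k * coef v k)) \<longlonglongrightarrow> - (LINT x|torus. g x * v x)"
    by (intro tendsto_minus Parseval_torus assms)
  ultimately show ?thesis by (rule LIMSEQ_unique)
qed

lemma has_weak_partial_imp_partial_coef:
  assumes "has_weak_partial i u g"
  shows "partial_coef i u g"
  unfolding partial_coef_def
proof
  fix k
  have "(LINT x|torus. u x * partial_deriv i (trig2 k) x) = - coef g k"
    using assms test_function_trig2[of k] by (simp add: has_weak_partial_def coef_def)
  moreover have "(LINT x|torus. u x * partial_deriv i (trig2 k) x) = (LINT x|torus. (2 * pi * (k$i)) * (u x * trig2 (flip i k) x))"
    by (simp add: partial_deriv_trig2 mult_ac)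
  ultimately show "coef g k = - 2 * pi * (k$i) * coef u (flip i k)"
    by (simp add: coef_def)
qed

lemma test_function_partial_coef:
  assumes "test_function \<phi>"
  shows "partial_coef i \<phi> (partial_deriv i \<phi>)"
  unfolding partial_coef_def
proof
  fix k
  have "(LINT x|torus. \<phi> x * partial_deriv i (trig2 k) x) = - coef (partial_deriv i \<phi>) k"
    unfolding coef_def
    by (rule integration_by_parts_torus[OF test_function_C_k(1) test_function_has_partial test_function_continuous
        test_function_partial_continuous test_function_C_k(1) test_function_has_partial test_function_continuous
        test_function_partial_continuous]) (rule assms test_function_trig2)+
  moreover have "(LINT x|torus. \<phi> x * partial_deriv i (trig2 k) x) = (LINT x|torus. (2 * pi * (k$i)) * (\<phi> x * trig2 (flip i k) x))"
    by (simp add: partial_deriv_trig2 mult_ac)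
  ultimately show "coef (partial_deriv i \<phi>) k = - 2 * pi * (k$i) * coef \<phi> (flip i k)"
    by (simp add: coef_def)
qed

text \<open>The classical derivative of a test function has the matching coefficients, so Parseval
  extends the identity from single modes to all test functions.\<close>

lemma has_weak_partialI_coef:
  assumes "L2 u" "L2 g" "partial_coef i u g"
  shows "has_weak_partial i u g"
  unfolding has_weak_partial_def
proof (intro conjI allI impI L2_imp_L1 assms)
  fix \<phi> assume \<phi>: "test_function \<phi>"
  show "(LINT x|torus. u x * partial_deriv i \<phi> x) = - (LINT x|torus. g x * \<phi> x)"
    by (intro partial_coef_integration_by_parts[of u g i] L2_imp_square_integrable assms test_function_partial_coef \<phi>
        square_integrable_torus_continuous test_function_continuous test_function_partial_continuous)
qed

lemma has_weak_partial_unique: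
  assumes "has_weak_partial i u g" "has_weak_partial i u h"
  shows "AE x in torus. g x = h x"
proof (rule coef_eqI_AE)
  show "integrable torus g" "integrable torus h" using assms by (auto simp: has_weak_partial_def L1_def)
  show "coef g k = coef h k" for k
    using assms[THEN has_weak_partial_imp_partial_coef] by (simp add: partial_coef_def)
qed

lemma has_weak_partial_weak_partial: "has_weak_partial i u g \<Longrightarrow> has_weak_partial i u (weak_partial i u)"
  unfolding weak_partial_def by (rule someI[of "has_weak_partial i u" g])

lemma weak_partial_AE_eq: "has_weak_partial i u g \<Longrightarrow> AE x in torus. weak_partial i u x = g x"
  by (rule has_weak_partial_unique[OF has_weak_partial_weak_partial])

lemma L2_cong_AE:
  assumes "L2 g" "L1 h" "AE x in torus. h x = g x"
  shows "L2 h"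
proof -
  have "square_integrable torus h"
    by (rule square_integrable_cong_AE[OF L2_imp_square_integrable[OF assms(1)]]) (use assms in \<open>auto simp: L1_def\<close>)
  then show ?thesis using assms(2) by (simp add: L2_iff L1_def)
qed

text \<open>\<open>weak_partial\<close> picks an arbitrary weak derivative in L1; square
  integrability is transferred to it, by uniqueness almost everywhere, from the derivative that H1
  provides.\<close>

lemma H1_weak_partial:
  assumes "H1 u"
  shows "has_weak_partial i u (weak_partial i u)" "L2 (weak_partial i u)"
proof -
  obtain g where g: "L2 g" "has_weak_partial i u g" using assms by (auto simp: H1_def)
  show 1: "has_weak_partial i u (weak_partial i u)" by (rule has_weak_partial_weak_partial[OF g(2)])
  show "L2 (weak_partial i u)"
    by (rule L2_cong_AE[OF g(1) _ weak_partial_AE_eq[OF g(2)]]) (use 1 in \<open>simp add: has_weak_partial_def\<close>)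
qed

lemma H1_imp_L2: "H1 u \<Longrightarrow> L2 u"
  by (simp add: H1_def)

lemma H2_imp_H1: "H2 u \<Longrightarrow> H1 u"
  by (simp add: H2_def)

lemma H1_partial_coef: "H1 u \<Longrightarrow> partial_coef i u (weak_partial i u)"
  by (intro has_weak_partial_imp_partial_coef H1_weak_partial)

lemma H1I:
  assumes "L2 u" "\<And>i. L2 (g i)" "\<And>i. partial_coef i u (g i)"
  shows "H1 u"
  unfolding H1_def using assms has_weak_partialI_coef by blast

lemma H1_integration_by_parts:
  assumes "H1 u" "H1 v"
  shows "(LINT x|torus. weak_partial i u x * v x) = - (LINT x|torus. u x * weak_partial i v x)"
  using partial_coef_integration_by_parts[OF L2_imp_square_integrable[OF H1_imp_L2[OF assms(1)]]
      L2_imp_square_integrable[OF H1_weak_partial(2)[OF assms(1)]] H1_partial_coef[OF assms(1)]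
      L2_imp_square_integrable[OF H1_imp_L2[OF assms(2)]]
      L2_imp_square_integrable[OF H1_weak_partial(2)[OF assms(2)]] H1_partial_coef[OF assms(2)], of i]
  by simp

lemma H1_cong_AE:
  assumes u: "H1 u" and v: "L1 v" and eq: "AE x in torus. v x = u x"
  shows "H1 v"
proof (rule H1I)
  show "L2 v" by (rule L2_cong_AE[OF H1_imp_L2[OF u] v eq])
  then have "coef v k = coef u k" for k
    by (intro coef_cong_AE) (use u eq in \<open>auto simp: H1_def L2_def\<close>)
  then show "partial_coef i v (weak_partial i u)" for i
    using H1_partial_coef[OF u, of i] by (simp add: partial_coef_def)
qed (rule H1_weak_partial(2)[OF u])

text \<open>This is stated in L1 because it is applied to the logarithmic potential, whose gradient
  is not square integrable. Integrability of the products rests on boundedness of test functions on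
  the cube.\<close>

lemma has_weak_partial_add:
  assumes "has_weak_partial i u g" "has_weak_partial i v h"
  shows "has_weak_partial i (\<lambda>x. u x + v x) (\<lambda>x. g x + h x)"
  unfolding has_weak_partial_def
proof (intro conjI allI impI)
  show "L1 (\<lambda>x. u x + v x)" "L1 (\<lambda>x. g x + h x)" using assms by (auto simp: has_weak_partial_def intro: L1_add)
  fix \<phi> assume \<phi>: "test_function \<phi>"
  have int: "integrable torus (\<lambda>x. w x * \<psi> x)" if w: "L1 w" and \<psi>: "continuous_on UNIV \<psi>" for w \<psi> :: "real^2 \<Rightarrow> real"
  proof -
    have "bounded (\<psi> ` cbox 0 1)" by (intro compact_imp_bounded compact_continuous_image continuous_on_subset[OF \<psi>]) auto
    then obtain B where B: "\<And>x. x \<in> cbox 0 1 \<Longrightarrow> \<bar>\<psi> x\<bar> \<le> B" by (auto simp: bounded_iff)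
    have [measurable]: "w \<in> borel_measurable torus" "\<psi> \<in> borel_measurable torus"
      using w \<psi> by (auto simp: L1_def intro: measurable_torus_borel borel_measurable_continuous_onI)
    show ?thesis
    proof (rule Bochner_Integration.integrable_bound)
      show "integrable torus (\<lambda>x. B * w x)" using w by (simp add: L1_def)
      show "AE x in torus. norm (w x * \<psi> x) \<le> norm (B * w x)"
      proof (rule AE_I2)
        fix x :: "real^2" assume "x \<in> space torus"
        then have "\<bar>\<psi> x\<bar> \<le> \<bar>B\<bar>" using B[of x] by simp
        then show "norm (w x * \<psi> x) \<le> norm (B * w x)" by (simp add: abs_mult mult.commute mult_right_mono)
      qed
    qed measurable
  qed
  have i: "integrable torus (\<lambda>x. u x * partial_deriv i \<phi> x)" "integrable torus (\<lambda>x. v x * partial_deriv i \<phi> x)"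
    "integrable torus (\<lambda>x. g x * \<phi> x)" "integrable torus (\<lambda>x. h x * \<phi> x)"
    using assms \<phi> by (auto simp: has_weak_partial_def intro!: int test_function_continuous test_function_partial_continuous)
  show "(LINT x|torus. (u x + v x) * partial_deriv i \<phi> x) = - (LINT x|torus. (g x + h x) * \<phi> x)"
    using assms \<phi> i by (simp add: has_weak_partial_def distrib_right)
qed

section \<open>The Laplacian on the Fourier side and elliptic regularity\<close>

lemma H2_weak_laplacian:
  assumes u: "H2 u"
  shows "L2 (weak_laplacian u)" "coef (weak_laplacian u) k = - 4 * pi\<^sup>2 * ((k$1)\<^sup>2 + (k$2)\<^sup>2) * coef u k"
proof -
  have H1: "H1 u" "H1 (weak_partial i u)" for i using u by (auto simp: H2_def)
  have L2: "L2 (weak_partial i (weak_partial i u))" for i by (rule H1_weak_partial(2)[OF H1(2)])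
  have eq: "weak_laplacian u = (\<lambda>x. weak_partial 1 (weak_partial 1 u) x + weak_partial 2 (weak_partial 2 u) x)"
    by (simp add: weak_laplacian_def fun_eq_iff sum_2)
  show "L2 (weak_laplacian u)" unfolding eq by (intro L2_add L2)
  have c: "coef (weak_partial i (weak_partial i u)) k = - 4 * pi\<^sup>2 * (k$i)\<^sup>2 * coef u k" for i
    using H1_partial_coef[OF H1(2)[of i], of i] H1_partial_coef[OF H1(1), of i]
    by (simp add: partial_coef_def power2_eq_square)
  show "coef (weak_laplacian u) k = - 4 * pi\<^sup>2 * ((k$1)\<^sup>2 + (k$2)\<^sup>2) * coef u k"
    unfolding eq by (subst coef_add) (auto intro!: L1_imp_integrable L2_imp_L1 L2 simp: c algebra_simps)
qed

text \<open>A flip permutes the coefficients within each box and preserves square sums. It is needed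
  because derivatives of u at frequency k are controlled by the Laplacian at the flipped
  frequency.\<close>

lemma L2_flip_coef:
  assumes "L2 g"
  shows "\<exists>w. L2 w \<and> (\<forall>k. coef w k = coef g (flip i k))"
proof -
  have "(\<Sum>k\<in>freq_box N. (coef g (flip i k))\<^sup>2) \<le> (LINT x|torus. (g x)\<^sup>2)" for N
    using Bessel_torus[OF L2_imp_square_integrable[OF assms], of N] sum_freq_box_flip[of "\<lambda>k. (coef g k)\<^sup>2" i N] by simp
  then show ?thesis by (rule Riesz_Fischer_torus) blast
qed

lemma L2_bounded_coef:
  assumes "L2 g" "\<And>k. \<bar>c k\<bar> \<le> \<bar>coef g k\<bar>"
  shows "\<exists>w. L2 w \<and> (\<forall>k. coef w k = c k)"
proof -
  have "(\<Sum>k\<in>freq_box N. (c k)\<^sup>2) \<le> (LINT x|torus. (g x)\<^sup>2)" for N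
  proof -
    have "(\<Sum>k\<in>freq_box N. (c k)\<^sup>2) \<le> (\<Sum>k\<in>freq_box N. (coef g k)\<^sup>2)"
      using assms(2) by (intro sum_mono) (simp add: abs_le_square_iff)
    then show ?thesis using Bessel_torus[OF L2_imp_square_integrable[OF assms(1)], of N] by linarith
  qed
  then show ?thesis by (rule Riesz_Fischer_torus) blast
qed

lemma four_pi_square_ge: "4 * pi\<^sup>2 \<ge> 1" "4 * pi\<^sup>2 \<ge> 2 * pi"
proof -
  have p: "pi \<ge> 1" using pi_gt3 by simp
  then have "pi * 1 \<le> pi * pi" by (intro mult_left_mono) auto
  then have "pi \<le> pi\<^sup>2" by (simp add: power2_eq_square)
  then show "4 * pi\<^sup>2 \<ge> 1" "4 * pi\<^sup>2 \<ge> 2 * pi" using p by auto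
qed

text \<open>Derivatives of order one and two act on coefficients by multipliers dominated by that of
  the Laplacian, since |k_i| and |k_i k_j| are at most |k|^2 for integer frequencies. The mean of u
  is the one coefficient that g does not control.\<close>

theorem elliptic_regularity_torus:
  assumes u: "L1 u" and g: "L2 g"
    and eq: "\<And>k. coef g k = - 4 * pi\<^sup>2 * ((k$1)\<^sup>2 + (k$2)\<^sup>2) * coef u k"
  shows "H2 u" and "AE x in torus. weak_laplacian u x = g x"
proof -
  have int_le: "\<bar>a\<bar> \<le> a\<^sup>2" for a :: int
  proof (cases "a = 0")
    case False
    then have "\<bar>a\<bar> * 1 \<le> \<bar>a\<bar> * \<bar>a\<bar>" by (intro mult_left_mono) auto
    then show ?thesis by (simp add: power2_eq_square)
  qed simp
  have nn: "(k$i)\<^sup>2 \<le> (k$1)\<^sup>2 + (k$2)\<^sup>2" "\<bar>k$i\<bar> * \<bar>k$j\<bar> \<le> (k$1)\<^sup>2 + (k$2)\<^sup>2" for k :: "int^2" and i j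
  proof -
    have ij: "i = 1 \<or> i = 2" "j = 1 \<or> j = 2" using exhaust_2 by blast+
    then show 1: "(k$i)\<^sup>2 \<le> (k$1)\<^sup>2 + (k$2)\<^sup>2" by auto
    have "2 * (\<bar>k$1\<bar> * \<bar>k$2\<bar>) \<le> (k$1)\<^sup>2 + (k$2)\<^sup>2" using zero_le_power2[of "\<bar>k$1\<bar> - \<bar>k$2\<bar>"] by (simp add: power2_diff)
    moreover have "0 \<le> \<bar>k$1\<bar> * \<bar>k$2\<bar>" by simp
    ultimately have "\<bar>k$1\<bar> * \<bar>k$2\<bar> \<le> (k$1)\<^sup>2 + (k$2)\<^sup>2" by linarith
    then show "\<bar>k$i\<bar> * \<bar>k$j\<bar> \<le> (k$1)\<^sup>2 + (k$2)\<^sup>2" using ij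
      by (auto simp: power2_eq_square[symmetric] mult.commute)
  qed
  have ge1: "(k$1)\<^sup>2 + (k$2)\<^sup>2 \<ge> 1" if "k \<noteq> 0" for k :: "int^2"
  proof -
    have "(k$1)\<^sup>2 + (k$2)\<^sup>2 \<noteq> 0" using that by (auto simp: vec_eq_iff forall_2 sum_power2_eq_zero_iff)
    moreover have "(k$1)\<^sup>2 + (k$2)\<^sup>2 \<ge> 0" by simp
    ultimately show ?thesis by linarith
  qed
  have absg: "\<bar>coef g k\<bar> = 4 * pi\<^sup>2 * real_of_int ((k$1)\<^sup>2 + (k$2)\<^sup>2) * \<bar>coef u k\<bar>" for k
    unfolding eq by (simp add: abs_mult)
  have "\<exists>w. L2 w \<and> (\<forall>k. coef w k = coef u k)"
  proof -
    \<comment> \<open>The zero mode, on which the equation gives no information, is added by hand.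
      The resulting L2 function has the coefficients of the L1 function u, which is therefore square
      integrable.\<close>
    have "(\<Sum>k\<in>freq_box N. (coef u k)\<^sup>2) \<le> (LINT x|torus. (g x)\<^sup>2) + (coef u 0)\<^sup>2" for N
    proof -
      have "(coef u k)\<^sup>2 \<le> (coef g k)\<^sup>2 + (if k = 0 then (coef u 0)\<^sup>2 else 0)" for k
      proof (cases "k = 0")
        case False
        have "1 * 1 \<le> 4 * pi\<^sup>2 * real_of_int ((k$1)\<^sup>2 + (k$2)\<^sup>2)"
          using four_pi_square_ge(1) ge1[OF False] by (intro mult_mono) (auto simp del: of_int_add of_int_power)
        then have "1 * \<bar>coef u k\<bar> \<le> \<bar>coef g k\<bar>" unfolding absg by (intro mult_right_mono) auto
        then show ?thesis using False by (simp add: abs_le_square_iff)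
      qed simp
      then have "(\<Sum>k\<in>freq_box N. (coef u k)\<^sup>2) \<le> (\<Sum>k\<in>freq_box N. (coef g k)\<^sup>2 + (if k = 0 then (coef u 0)\<^sup>2 else 0))"
        by (intro sum_mono)
      also have "\<dots> = (\<Sum>k\<in>freq_box N. (coef g k)\<^sup>2) + (coef u 0)\<^sup>2"
      proof -
        have "0 \<in> freq_box N" by (simp add: freq_box_def)
        then show ?thesis by (simp add: sum.distrib)
      qed
      finally show ?thesis using Bessel_torus[OF L2_imp_square_integrable[OF g], of N] by linarith
    qed
    then show ?thesis by (rule Riesz_Fischer_torus) blast
  qed
  then obtain w where w: "L2 w" "\<And>k. coef w k = coef u k" by blast
  have "AE x in torus. u x = w x"
    using u w by (intro coef_eqI_AE) (auto intro: L1_imp_integrable L2_imp_L1)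
  from L2_cong_AE[OF w(1) u this] have uL2: "L2 u" .
  have "\<exists>d. L2 d \<and> partial_coef i u d" for i
  proof -
    obtain h where h: "L2 h" "\<And>k. coef h k = coef g (flip i k)" using L2_flip_coef[OF g] by blast
    have "\<bar>- 2 * pi * (k$i) * coef u (flip i k)\<bar> \<le> \<bar>coef h k\<bar>" for k
    proof -
      have "real_of_int \<bar>k$i\<bar> \<le> real_of_int ((k$1)\<^sup>2 + (k$2)\<^sup>2)"
        unfolding of_int_le_iff by (rule order_trans[OF int_le nn(1)])
      then have "2 * pi * real_of_int \<bar>k$i\<bar> \<le> 4 * pi\<^sup>2 * real_of_int ((k$1)\<^sup>2 + (k$2)\<^sup>2)"
        by (intro mult_mono[OF four_pi_square_ge(2)]) auto
      then have "2 * pi * real_of_int \<bar>k$i\<bar> * \<bar>coef u (flip i k)\<bar> \<le> 4 * pi\<^sup>2 * real_of_int ((k$1)\<^sup>2 + (k$2)\<^sup>2) * \<bar>coef u (flip i k)\<bar>"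
        by (rule mult_right_mono) simp
      then show ?thesis unfolding h(2) absg by (simp add: abs_mult)
    qed
    from L2_bounded_coef[OF h(1) this] show ?thesis by (auto simp: partial_coef_def)
  qed
  then obtain d where d: "\<And>i. L2 (d i)" "\<And>i. partial_coef i u (d i)" by metis
  have H1u: "H1 u" by (rule H1I[OF uL2 d])
  have d2: "\<exists>e. L2 e \<and> partial_coef j (d i) e" for i j
  proof -
    \<comment> \<open>Two flips in succession: the second derivative at k is compared with g at
      \<open>flip i (flip j k)\<close>.\<close>
    obtain h where h: "L2 h" "\<And>k. coef h k = coef g (flip i k)" using L2_flip_coef[OF g] by blast
    obtain h2 where h2: "L2 h2" "\<And>k. coef h2 k = coef h (flip j k)" using L2_flip_coef[OF h(1)] by blast
    have "\<bar>- 2 * pi * (k$j) * coef (d i) (flip j k)\<bar> \<le> \<bar>coef h2 k\<bar>" for k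
    proof -
      define l where "l = flip i (flip j k)"
      have a: "\<bar>real_of_int (flip j k $ i)\<bar> = \<bar>real_of_int (k$i)\<bar>" by (simp add: flip_def)
      have "\<bar>- 2 * pi * (k$j) * coef (d i) (flip j k)\<bar> = (4 * pi\<^sup>2) * real_of_int (\<bar>k$i\<bar> * \<bar>k$j\<bar>) * \<bar>coef u l\<bar>"
        using d(2)[of i] a unfolding partial_coef_def l_def
        by (simp add: abs_mult power2_eq_square)
      also have "\<dots> \<le> (4 * pi\<^sup>2) * real_of_int ((k$1)\<^sup>2 + (k$2)\<^sup>2) * \<bar>coef u l\<bar>"
        using nn(2)[of k i j] by (intro mult_right_mono mult_left_mono) (simp_all only: of_int_le_iff abs_ge_zero, simp)
      also have "\<dots> = \<bar>coef h2 k\<bar>" unfolding h2(2) h(2) l_def[symmetric] absg by (simp add: l_def)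
      finally show ?thesis .
    qed
    from L2_bounded_coef[OF h2(1) this] show ?thesis by (auto simp: partial_coef_def)
  qed
  have "H1 (d i)" for i
  proof -
    obtain e where "\<And>j. L2 (e j)" "\<And>j. partial_coef j (d i) (e j)" using d2[of _ i] by metis
    then show ?thesis by (rule H1I[OF d(1)])
  qed
  \<comment> \<open>The functions \<open>d i\<close> agree only almost everywhere with the chosen
    representatives \<open>weak_partial i u\<close>, to which the definition of \<open>H2\<close>
    refers.\<close>
  moreover have "AE x in torus. weak_partial i u x = d i x" for i
    by (rule weak_partial_AE_eq[OF has_weak_partialI_coef[OF uL2 d]])
  ultimately have "H1 (weak_partial i u)" for i
    by (rule H1_cong_AE[OF _ L2_imp_L1[OF H1_weak_partial(2)[OF H1u]]])
  then show "H2 u" using H1u by (simp add: H2_def)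
  then show "AE x in torus. weak_laplacian u x = g x"
    using g by (intro coef_eqI_AE) (auto simp: H2_weak_laplacian eq intro!: L1_imp_integrable L2_imp_L1)
qed

lemma H2_trig2: "H2 (trig2 k)" "AE x in torus. weak_laplacian (trig2 k) x = - 4 * pi\<^sup>2 * ((k$1)\<^sup>2 + (k$2)\<^sup>2) * trig2 k x"
proof -
  have L: "L1 (trig2 k)" "L2 (\<lambda>x. - 4 * pi\<^sup>2 * ((k$1)\<^sup>2 + (k$2)\<^sup>2) * trig2 k x)"
    by (intro L2_imp_L1 L2_cmult L2_trig2)+
  have c: "coef (\<lambda>x. - 4 * pi\<^sup>2 * ((k$1)\<^sup>2 + (k$2)\<^sup>2) * trig2 k x) l = - 4 * pi\<^sup>2 * ((l$1)\<^sup>2 + (l$2)\<^sup>2) * coef (trig2 k) l" for l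
    unfolding coef_cmult by (cases "k = l") (auto simp: coef_def integral_trig2_mult)
  show "H2 (trig2 k)" "AE x in torus. weak_laplacian (trig2 k) x = - 4 * pi\<^sup>2 * ((k$1)\<^sup>2 + (k$2)\<^sup>2) * trig2 k x"
    using elliptic_regularity_torus[OF L c] by simp_all
qed

text \<open>\<open>weak_partial\<close> is a choice and hence not literally additive; additivity
  almost everywhere is recovered from the additivity of coefficients by elliptic regularity.\<close>

lemma H2_add: "H2 u \<Longrightarrow> H2 v \<Longrightarrow> H2 (\<lambda>x. u x + v x)"
  and weak_laplacian_add: "H2 u \<Longrightarrow> H2 v \<Longrightarrow> AE x in torus. weak_laplacian (\<lambda>x. u x + v x) x = weak_laplacian u x + weak_laplacian v x"
proof -
  assume uv: "H2 u" "H2 v"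
  have L: "L1 (\<lambda>x. u x + v x)" "L2 (\<lambda>x. weak_laplacian u x + weak_laplacian v x)"
    using L1_add[OF uv[THEN H2_imp_H1, THEN H1_imp_L2, THEN L2_imp_L1]] L2_add[OF uv[THEN H2_weak_laplacian(1)]] by auto
  have c: "coef (\<lambda>x. weak_laplacian u x + weak_laplacian v x) k = - 4 * pi\<^sup>2 * ((k$1)\<^sup>2 + (k$2)\<^sup>2) * coef (\<lambda>x. u x + v x) k" for k
    unfolding coef_add[OF uv[THEN H2_imp_H1, THEN H1_imp_L2, THEN L2_imp_L1, THEN L1_imp_integrable]]
      coef_add[OF uv[THEN H2_weak_laplacian(1), THEN L2_imp_L1, THEN L1_imp_integrable]] uv[THEN H2_weak_laplacian(2)]
    by (simp add: distrib_left)
  show "H2 (\<lambda>x. u x + v x)" "AE x in torus. weak_laplacian (\<lambda>x. u x + v x) x = weak_laplacian u x + weak_laplacian v x"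
    using elliptic_regularity_torus[OF L c] by simp_all
qed

section \<open>Smooth approximation and Green's formula\<close>

text \<open>The bound is attained at N = 0, and its increments 4/((N+1)(N+2)) dominate those of the
  sum, 2/(1 + (N+1)^2).\<close>

lemma sum_inverse_square_le: "(\<Sum>j\<in>{- int N..int N}. 1 / (1 + (real_of_int j)\<^sup>2)) \<le> 5 - 4 / (real N + 1)"
proof (induction N)
  case (Suc N)
  have "{- int (Suc N)..int (Suc N)} = insert (int (Suc N)) (insert (- int (Suc N)) {- int N..int N})"
    by auto
  moreover have "(- 1 - real N)\<^sup>2 = (real N + 1)\<^sup>2" "(1 + real N)\<^sup>2 = (real N + 1)\<^sup>2"
    by (simp_all add: power2_eq_square algebra_simps)
  ultimately have "(\<Sum>j\<in>{- int (Suc N)..int (Suc N)}. 1 / (1 + (real_of_int j)\<^sup>2)) =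
      2 / (1 + (real N + 1)\<^sup>2) + (\<Sum>j\<in>{- int N..int N}. 1 / (1 + (real_of_int j)\<^sup>2))"
    by (simp add: add.commute[of 1 "real N"])
  also have "\<dots> \<le> 2 / (1 + (real N + 1)\<^sup>2) + (5 - 4 / (real N + 1))" using Suc by simp
  also have "2 / (1 + (real N + 1)\<^sup>2) \<le> 4 / (real N + 1) - 4 / (real N + 2)"
  proof -
    have "4 / (real N + 1) - 4 / (real N + 2) = 4 / ((real N + 1) * (real N + 2))"
      by (simp add: field_simps)
    also have "\<dots> \<ge> 2 / (1 + (real N + 1)\<^sup>2)"
      by (simp add: divide_simps) (simp add: power2_eq_square algebra_simps)
    finally show ?thesis .
  qed
  finally show ?case by (simp add: add_ac)
qed simp

text \<open>H2 embeds into bounded functions in dimension two because 1/(1 + |k|^2) is square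
  summable over the lattice. With Q = 1 + |k|^2 one writes |coef u| = (Q |coef u|)/Q and uses 2xy
  \<le> x^2 + y^2. The bound holds for all partial sums at once, as dominated convergence will
  require.\<close>

lemma H2_trig_sum_bounded:
  assumes u: "H2 u"
  obtains B where "\<And>N x. \<bar>trig_sum (coef u) N x\<bar> \<le> B"
proof -
  define g where "g = weak_laplacian u"
  have g: "square_integrable torus g" unfolding g_def by (intro L2_imp_square_integrable H2_weak_laplacian u)
  have su: "square_integrable torus u" by (intro L2_imp_square_integrable H1_imp_L2 H2_imp_H1 u)
  define Q where "Q k = 1 + (real_of_int (k$1))\<^sup>2 + (real_of_int (k$2))\<^sup>2" for k :: "int^2"
  \<comment> \<open>The factor 2 comes from (a + b)^2 \<le> 2(a^2 + b^2); 25 is the square of the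
    bound 5 for the one-dimensional sum, since Q^2 is at least the product of the two factors 1 +
    k_i^2.\<close>
  define B where "B = 2 * ((LINT x|torus. (u x)\<^sup>2) + (LINT x|torus. (g x)\<^sup>2)) + 25"
  have "\<bar>trig_sum (coef u) N x\<bar> \<le> B" for N x
  proof -
    have Q1: "Q k \<ge> 1" for k by (simp add: Q_def)
    have step: "\<bar>coef u k * trig2 k x\<bar> \<le> 2 * ((coef u k)\<^sup>2 + (coef g k)\<^sup>2)
        + 1 / (1 + (real_of_int (k$1))\<^sup>2) * (1 / (1 + (real_of_int (k$2))\<^sup>2))" for k
    proof -
      define a where "a = \<bar>coef u k\<bar>"
      define b where "b = \<bar>coef g k\<bar>"
      have "(Q k - 1) * a \<le> b"
      proof -
        have "1 * ((Q k - 1) * a) \<le> 4 * pi\<^sup>2 * ((Q k - 1) * a)"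
          using Q1[of k] four_pi_square_ge(1) by (intro mult_right_mono mult_nonneg_nonneg) (auto simp: a_def)
        also have "\<dots> = b" unfolding b_def g_def H2_weak_laplacian(2)[OF u] a_def Q_def by (simp add: abs_mult)
        finally show ?thesis by simp
      qed
      then have Qa: "Q k * a \<le> a + b" by (simp add: algebra_simps)
      have Qp: "(Q k)\<^sup>2 \<ge> (1 + (real_of_int (k$1))\<^sup>2) * (1 + (real_of_int (k$2))\<^sup>2)"
      proof -
        have "(1 + (real_of_int (k$1))\<^sup>2) * (1 + (real_of_int (k$2))\<^sup>2) \<le> Q k * Q k"
          by (intro mult_mono) (auto simp: Q_def)
        then show ?thesis by (simp add: power2_eq_square)
      qed
      have "\<bar>coef u k * trig2 k x\<bar> \<le> a * 2" unfolding abs_mult a_def by (intro mult_left_mono abs_trig2_le) auto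
      also have "\<dots> = 2 * ((Q k * a) * (1 / Q k))" using Q1[of k] by simp
      also have "\<dots> \<le> (Q k * a)\<^sup>2 + (1 / Q k)\<^sup>2" using sum_squares_bound[of "Q k * a" "1 / Q k"] by (simp only: mult.assoc)
      also have "(Q k * a)\<^sup>2 \<le> (a + b)\<^sup>2" using Qa Q1[of k] by (intro power_mono) (auto simp: a_def)
      also have "(a + b)\<^sup>2 \<le> 2 * (a\<^sup>2 + b\<^sup>2)" using sum_squares_bound[of a b] by (simp add: power2_sum)
      also have "(1 / Q k)\<^sup>2 \<le> 1 / ((1 + (real_of_int (k$1))\<^sup>2) * (1 + (real_of_int (k$2))\<^sup>2))"
        unfolding power_divide using Qp
        by (simp add: frac_le add_pos_nonneg)
      finally show ?thesis by (simp add: a_def b_def)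
    qed
    have "(\<Sum>k\<in>freq_box N. 1 / (1 + (real_of_int (k$1))\<^sup>2) * (1 / (1 + (real_of_int (k$2))\<^sup>2)))
        = (\<Sum>(a, b)\<in>{-int N..int N} \<times> {-int N..int N}. 1 / (1 + (real_of_int a)\<^sup>2) * (1 / (1 + (real_of_int b)\<^sup>2)))"
      unfolding freq_box_image
      by (subst sum.reindex) (auto simp: inj_on_def vec_eq_iff case_prod_unfold forall_2 intro!: sum.cong)
    also have "\<dots> = (\<Sum>a\<in>{-int N..int N}. 1 / (1 + (real_of_int a)\<^sup>2)) * (\<Sum>a\<in>{-int N..int N}. 1 / (1 + (real_of_int a)\<^sup>2))"
      by (simp add: sum_product sum.cartesian_product)
    also have "\<dots> \<le> 5 * 5"
    proof -
      have "(\<Sum>j\<in>{- int N..int N}. 1 / (1 + (real_of_int j)\<^sup>2)) \<le> 5 - 4 / (real N + 1)" by (rule sum_inverse_square_le)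
      also have "\<dots> \<le> 5" by simp
      finally show ?thesis by (intro mult_mono) (auto intro!: sum_nonneg)
    qed
    finally have 25: "(\<Sum>k\<in>freq_box N. 1 / (1 + (real_of_int (k$1))\<^sup>2) * (1 / (1 + (real_of_int (k$2))\<^sup>2))) \<le> 25" by simp
    have "\<bar>trig_sum (coef u) N x\<bar> \<le> (\<Sum>k\<in>freq_box N. \<bar>coef u k * trig2 k x\<bar>)"
      unfolding trig_sum_def by (rule sum_abs)
    also have "\<dots> \<le> (\<Sum>k\<in>freq_box N. 2 * ((coef u k)\<^sup>2 + (coef g k)\<^sup>2)
        + 1 / (1 + (real_of_int (k$1))\<^sup>2) * (1 / (1 + (real_of_int (k$2))\<^sup>2)))"
      by (intro sum_mono step)
    also have "\<dots> = 2 * ((\<Sum>k\<in>freq_box N. (coef u k)\<^sup>2) + (\<Sum>k\<in>freq_box N. (coef g k)\<^sup>2))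
        + (\<Sum>k\<in>freq_box N. 1 / (1 + (real_of_int (k$1))\<^sup>2) * (1 / (1 + (real_of_int (k$2))\<^sup>2)))"
      by (simp only: sum.distrib sum_distrib_left distrib_left)
    also have "\<dots> \<le> B" unfolding B_def by (intro add_mono mult_left_mono 25 Bessel_torus su g) simp
    finally show ?thesis .
  qed
  then show ?thesis by (rule that)
qed

text \<open>The asymmetry is deliberate: functions are uniformly bounded and converge almost
  everywhere, derivatives converge in L1. Under exactly these conditions products of a function with
  a derivative converge, see \<open>tendsto_integral_bounded_mult\<close>.\<close>

definition smooth_approx ::
  "(real^2 \<Rightarrow> real) \<Rightarrow> (nat \<Rightarrow> real^2 \<Rightarrow> real) \<Rightarrow> (2 \<Rightarrow> nat \<Rightarrow> real^2 \<Rightarrow> real) \<Rightarrow> real \<Rightarrow> bool" where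
  "smooth_approx u U D B \<longleftrightarrow>
     (\<forall>n. periodic (U n) \<and> continuous_on UNIV (U n) \<and>
        (\<forall>i. has_partial i (U n) (D i n) \<and> continuous_on UNIV (D i n)) \<and> (\<forall>x. \<bar>U n x\<bar> \<le> B)) \<and>
     (AE x in torus. (\<lambda>n. U n x) \<longlonglongrightarrow> u x) \<and>
     (\<forall>i. (\<lambda>n. LINT x|torus. \<bar>D i n x - weak_partial i u x\<bar>) \<longlonglongrightarrow> 0)"

lemma smooth_approxD:
  assumes "smooth_approx u U D B"
  shows "periodic (U n)" "continuous_on UNIV (U n)" "has_partial i (U n) (D i n)"
    "continuous_on UNIV (D i n)" "\<bar>U n x\<bar> \<le> B" "AE x in torus. (\<lambda>n. U n x) \<longlonglongrightarrow> u x"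
    "(\<lambda>n. LINT x|torus. \<bar>D i n x - weak_partial i u x\<bar>) \<longlonglongrightarrow> 0"
  using assms by (auto simp: smooth_approx_def)

lemma H2_approx:
  assumes u: "H2 u"
  shows "\<exists>U D B. smooth_approx u U D B"
proof -
  have H1: "H1 u" by (rule H2_imp_H1[OF u])
  have su: "square_integrable torus u" by (intro L2_imp_square_integrable H1_imp_L2 H1)
  obtain r where r: "strict_mono r" "AE x in torus. (\<lambda>n. trig_sum (coef u) (r n) x) \<longlonglongrightarrow> u x"
    using trig_sum_coef_tendsto(2)[OF su] by blast
  obtain B where B: "\<And>N x. \<bar>trig_sum (coef u) N x\<bar> \<le> B" using H2_trig_sum_bounded[OF u] by blast
  define U where "U n = trig_sum (coef u) (r n)" for n
  define D where "D i n = trig_sum (coef (weak_partial i u)) (r n)" for i n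
  have "(\<lambda>k. - 2 * pi * (k$i) * coef u (flip i k)) = coef (weak_partial i u)" for i
    using H1_partial_coef[OF H1, of i] by (simp add: partial_coef_def fun_eq_iff)
  then have "has_partial i (U n) (D i n)" for i n
    unfolding U_def D_def using has_partial_trig_sum[of i "coef u" "r n"] by simp
  moreover have "(\<lambda>n. LINT x|torus. \<bar>D i n x - weak_partial i u x\<bar>) \<longlonglongrightarrow> 0" for i
  proof -
    have sp: "square_integrable torus (weak_partial i u)" by (intro L2_imp_square_integrable H1_weak_partial H1)
    have "(\<lambda>n. LINT x|torus. (D i n x - weak_partial i u x)\<^sup>2) \<longlonglongrightarrow> 0"
      using LIMSEQ_subseq_LIMSEQ[OF trig_sum_coef_tendsto(1)[OF sp] r(1)] by (simp add: D_def o_def)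
    then have "(\<lambda>n. sqrt (LINT x|torus. (D i n x - weak_partial i u x)\<^sup>2)) \<longlonglongrightarrow> sqrt 0"
      by (rule tendsto_real_sqrt)
    then have lim0: "(\<lambda>n. sqrt (LINT x|torus. (D i n x - weak_partial i u x)\<^sup>2)) \<longlonglongrightarrow> 0" by simp
    show ?thesis
    proof (rule tendsto_sandwich[OF _ _ tendsto_const lim0])
      show "eventually (\<lambda>n. (LINT x|torus. \<bar>D i n x - weak_partial i u x\<bar>)
          \<le> sqrt (LINT x|torus. (D i n x - weak_partial i u x)\<^sup>2)) sequentially"
        by (intro always_eventually allI integral_abs_le_sqrt finite_measure_torus square_integrable_diff sp)
           (auto simp: D_def square_integrable_trig_sum measure_torus)
    qed simp
  qed
  ultimately have "smooth_approx u U D B"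
    using r(2) B by (auto simp: smooth_approx_def U_def D_def periodic_trig_sum continuous_on_trig_sum)
  then show ?thesis by blast
qed

lemma H2_AE_bounded:
  assumes "H2 u"
  obtains B where "AE x in torus. \<bar>u x\<bar> \<le> B"
proof -
  obtain U D B where "smooth_approx u U D B" using H2_approx[OF assms] by blast
  then have B: "\<And>n x. \<bar>U n x\<bar> \<le> B" and lim: "AE x in torus. (\<lambda>n. U n x) \<longlonglongrightarrow> u x"
    by (auto dest: smooth_approxD)
  have "AE x in torus. \<bar>u x\<bar> \<le> B"
    using lim
  proof eventually_elim
    case (elim x)
    then have "(\<lambda>n. \<bar>U n x\<bar>) \<longlonglongrightarrow> \<bar>u x\<bar>" by (rule tendsto_rabs)
    then show ?case by (rule LIMSEQ_le_const2) (use B in auto)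
  qed
  then show ?thesis by (rule that)
qed

text \<open>In a_n b_n - A B = a_n (b_n - B) + (a_n B - A B) the first part is at most C times the
  L1 error of b_n, and the second tends to 0 by dominated convergence with majorant C |B|.\<close>

lemma tendsto_integral_bounded_mult:
  fixes a :: "nat \<Rightarrow> 'a \<Rightarrow> real"
  assumes a: "\<And>n. a n \<in> borel_measurable M" "\<And>n x. x \<in> space M \<Longrightarrow> \<bar>a n x\<bar> \<le> C" "AE x in M. (\<lambda>n. a n x) \<longlonglongrightarrow> A x"
      "A \<in> borel_measurable M"
    and b: "\<And>n. integrable M (b n)" "integrable M B" "(\<lambda>n. \<integral>x. \<bar>b n x - B x\<bar> \<partial>M) \<longlonglongrightarrow> 0"
  shows "integrable M (\<lambda>x. A x * B x)" "(\<lambda>n. \<integral>x. a n x * b n x \<partial>M) \<longlonglongrightarrow> (\<integral>x. A x * B x \<partial>M)"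
proof -
  note a(1)[measurable] a(4)[measurable]
  have [measurable]: "B \<in> borel_measurable M" "b n \<in> borel_measurable M" for n
    using b by auto
  have bound: "integrable M (\<lambda>x. c x * w x)" if "c \<in> borel_measurable M" "\<And>x. x \<in> space M \<Longrightarrow> \<bar>c x\<bar> \<le> C" "integrable M w" for c w
  proof (rule Bochner_Integration.integrable_bound)
    show "integrable M (\<lambda>x. C * w x)" using that by simp
    show "(\<lambda>x. c x * w x) \<in> borel_measurable M" using that by auto
    show "AE x in M. norm (c x * w x) \<le> norm (C * w x)"
    proof (rule AE_I2)
      fix x assume "x \<in> space M"
      then have "\<bar>c x\<bar> \<le> \<bar>C\<bar>" using that(2)[of x] by linarith
      then show "norm (c x * w x) \<le> norm (C * w x)" by (simp add: abs_mult mult_right_mono)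
    qed
  qed
  have lim: "AE x in M. (\<lambda>n. a n x * B x) \<longlonglongrightarrow> A x * B x"
    using a(3) by eventually_elim (intro tendsto_intros)
  have le: "AE x in M. norm (a n x * B x) \<le> C * \<bar>B x\<bar>" for n
    by (rule AE_I2) (use a(2) in \<open>auto simp: abs_mult mult_right_mono\<close>)
  have w: "integrable M (\<lambda>x. C * \<bar>B x\<bar>)" using b(2) by simp
  show "integrable M (\<lambda>x. A x * B x)"
    by (rule integrable_dominated_convergence[OF _ _ w lim le]) measurable
  have 1: "(\<lambda>n. \<integral>x. a n x * B x \<partial>M) \<longlonglongrightarrow> (\<integral>x. A x * B x \<partial>M)"
    by (rule integral_dominated_convergence[OF _ _ w lim le]) measurable
  have "(\<lambda>n. (\<integral>x. a n x * b n x \<partial>M) - (\<integral>x. a n x * B x \<partial>M)) \<longlonglongrightarrow> 0"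
  proof (rule tendsto_0_le[OF b(3), where K = C], rule always_eventually, rule allI)
    fix n
    have i: "integrable M (\<lambda>x. a n x * (b n x - B x))" by (rule bound) (use a b in auto)
    have "(\<integral>x. a n x * b n x \<partial>M) - (\<integral>x. a n x * B x \<partial>M) = (\<integral>x. a n x * (b n x - B x) \<partial>M)"
    proof -
      have "integrable M (\<lambda>x. a n x * b n x)" "integrable M (\<lambda>x. a n x * B x)"
        by (rule bound; use a b in auto)+
      then show ?thesis by (simp add: right_diff_distrib)
    qed
    also have "\<bar>\<dots>\<bar> \<le> (\<integral>x. \<bar>b n x - B x\<bar> * C \<partial>M)"
    proof (rule order_trans[OF integral_abs_bound], rule integral_mono)
      show "integrable M (\<lambda>x. \<bar>b n x - B x\<bar> * C)" using b by simp
      fix x assume "x \<in> space M"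
      then show "\<bar>a n x * (b n x - B x)\<bar> \<le> \<bar>b n x - B x\<bar> * C"
        using a(2)[of x n] by (simp add: abs_mult mult.commute mult_right_mono)
    qed (use i in simp)
    finally show "norm ((\<integral>x. a n x * b n x \<partial>M) - (\<integral>x. a n x * B x \<partial>M)) \<le> norm (\<integral>x. \<bar>b n x - B x\<bar> \<partial>M) * C"
      by simp
  qed
  from tendsto_add[OF this 1] show "(\<lambda>n. \<integral>x. a n x * b n x \<partial>M) \<longlonglongrightarrow> (\<integral>x. A x * B x \<partial>M)" by simp
qed

section \<open>Green's formula and very weak solutions\<close>

lemma integrable_weak_grad_inner:
  assumes "H1 u" "H1 v"
  shows "integrable torus (\<lambda>x. weak_partial i u x * weak_partial j v x)"
  by (intro integrable_mult_square_integrable L2_imp_square_integrable H1_weak_partial assms)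

lemma weak_grad_inner: "weak_grad u x \<bullet> weak_grad v x = weak_partial 1 u x * weak_partial 1 v x + weak_partial 2 u x * weak_partial 2 v x"
  by (simp add: inner_vec_def sum_2 weak_grad_def)

lemma Green_torus:
  assumes u: "H2 u" and v: "H1 v"
  shows "(LINT x|torus. weak_grad u x \<bullet> weak_grad v x) = - (LINT x|torus. weak_laplacian u x * v x)"
proof -
  have H1: "H1 u" "H1 (weak_partial i u)" for i using u by (auto simp: H2_def)
  have i: "integrable torus (\<lambda>x. weak_partial i (weak_partial i u) x * v x)" for i
    by (intro integrable_mult_square_integrable L2_imp_square_integrable H1_weak_partial H1 H1_imp_L2 v)
  have "(LINT x|torus. weak_grad u x \<bullet> weak_grad v x) =
      (LINT x|torus. weak_partial 1 u x * weak_partial 1 v x) + (LINT x|torus. weak_partial 2 u x * weak_partial 2 v x)"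
    unfolding weak_grad_inner
    by (intro Bochner_Integration.integral_add integrable_weak_grad_inner H1 v)
  also have "\<dots> = - ((LINT x|torus. weak_partial 1 (weak_partial 1 u) x * v x) + (LINT x|torus. weak_partial 2 (weak_partial 2 u) x * v x))"
    using H1_integration_by_parts[OF H1(2) v] by simp
  also have "\<dots> = - (LINT x|torus. weak_laplacian u x * v x)"
    using i by (simp add: weak_laplacian_def sum_2 distrib_right)
  finally show ?thesis .
qed

lemma integral_mult_weak_laplacian:
  assumes u: "square_integrable torus u"
  shows "(LINT x|torus. u x * weak_laplacian (trig2 k) x) = - 4 * pi\<^sup>2 * ((k$1)\<^sup>2 + (k$2)\<^sup>2) * coef u k"
proof -
  have [measurable]: "u \<in> borel_measurable torus" "trig2 k \<in> borel_measurable torus" "weak_laplacian (trig2 k) \<in> borel_measurable torus"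
    using u H2_weak_laplacian(1)[OF H2_trig2(1)[of k]] square_integrable_trig2[of k] by (auto simp: square_integrable_def L2_def)
  have "(LINT x|torus. u x * weak_laplacian (trig2 k) x) = (LINT x|torus. (- 4 * pi\<^sup>2 * ((k$1)\<^sup>2 + (k$2)\<^sup>2)) * (u x * trig2 k x))"
  proof (rule integral_cong_AE)
    show "AE x in torus. u x * weak_laplacian (trig2 k) x = (- 4 * pi\<^sup>2 * ((k$1)\<^sup>2 + (k$2)\<^sup>2)) * (u x * trig2 k x)"
      using H2_trig2(2)[of k] by eventually_elim simp
  qed measurable
  then show ?thesis by (simp add: coef_def)
qed

text \<open>Weyl's lemma on the torus: testing with single modes already gives the Fourier form of
  the equation, and elliptic regularity moves u from L2 to H2. It serves for v, known at first as an
  L2 expression in \<Delta>u.\<close>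

lemma very_weak_solution_iff:
  assumes u: "L2 u" and g: "L2 g"
  shows "(\<forall>\<phi>. H2 \<phi> \<longrightarrow> (LINT x|torus. u x * weak_laplacian \<phi> x) = (LINT x|torus. g x * \<phi> x)) \<longleftrightarrow>
    H2 u \<and> (AE x in torus. weak_laplacian u x = g x)"
proof (intro iffI conjI allI impI)
  assume *: "\<forall>\<phi>. H2 \<phi> \<longrightarrow> (LINT x|torus. u x * weak_laplacian \<phi> x) = (LINT x|torus. g x * \<phi> x)"
  have "coef g k = - 4 * pi\<^sup>2 * ((k$1)\<^sup>2 + (k$2)\<^sup>2) * coef u k" for k
    using *[rule_format, OF H2_trig2(1), of k] integral_mult_weak_laplacian[OF L2_imp_square_integrable[OF u], of k]
    by (simp add: coef_def)
  from elliptic_regularity_torus[OF L2_imp_L1[OF u] g this]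
  show "H2 u" "AE x in torus. weak_laplacian u x = g x" .
next
  fix \<phi> assume *: "H2 u \<and> (AE x in torus. weak_laplacian u x = g x)" and \<phi>: "H2 \<phi>"
  then have H2: "H2 u" and ae: "AE x in torus. weak_laplacian u x = g x" by auto
  have [measurable]: "g \<in> borel_measurable torus" "weak_laplacian u \<in> borel_measurable torus" "\<phi> \<in> borel_measurable torus"
    using g H2_weak_laplacian(1)[OF H2] H1_imp_L2[OF H2_imp_H1[OF \<phi>]] by (auto simp: L2_def)
  have "(LINT x|torus. u x * weak_laplacian \<phi> x) = - (LINT x|torus. weak_grad \<phi> x \<bullet> weak_grad u x)"
    using Green_torus[OF \<phi> H2_imp_H1[OF H2]] by (simp add: mult.commute)
  also have "\<dots> = (LINT x|torus. weak_laplacian u x * \<phi> x)"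
    using Green_torus[OF H2 H2_imp_H1[OF \<phi>]] by (simp add: inner_commute)
  also have "\<dots> = (LINT x|torus. g x * \<phi> x)"
  proof (rule integral_cong_AE)
    show "AE x in torus. weak_laplacian u x * \<phi> x = g x * \<phi> x" using ae by eventually_elim simp
  qed measurable
  finally show "(LINT x|torus. u x * weak_laplacian \<phi> x) = (LINT x|torus. g x * \<phi> x)" .
qed

text \<open>Restricted to H2 test functions the weak equation is the very weak one, which yields
  regularity and the equation almost everywhere; Green's formula leads back to all H1 test
  functions.\<close>

lemma weak_solution_iff:
  assumes u: "H1 u" and g: "L2 g"
  shows "(\<forall>\<phi>. H1 \<phi> \<longrightarrow> (LINT x|torus. weak_grad u x \<bullet> weak_grad \<phi> x) = (LINT x|torus. g x * \<phi> x)) \<longleftrightarrow>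
    H2 u \<and> (AE x in torus. weak_laplacian u x = - g x)"
proof (intro iffI)
  assume *: "\<forall>\<phi>. H1 \<phi> \<longrightarrow> (LINT x|torus. weak_grad u x \<bullet> weak_grad \<phi> x) = (LINT x|torus. g x * \<phi> x)"
  have mg: "L2 (\<lambda>x. - g x)" using L2_cmult[OF g, of "-1"] by simp
  have "\<forall>\<phi>. H2 \<phi> \<longrightarrow> (LINT x|torus. u x * weak_laplacian \<phi> x) = (LINT x|torus. (- g x) * \<phi> x)"
    using * Green_torus[OF _ u] H2_imp_H1 by (simp add: mult.commute inner_commute)
  then show "H2 u \<and> (AE x in torus. weak_laplacian u x = - g x)"
    unfolding very_weak_solution_iff[OF H1_imp_L2[OF u] mg] .
next
  assume *: "H2 u \<and> (AE x in torus. weak_laplacian u x = - g x)"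
  show "\<forall>\<phi>. H1 \<phi> \<longrightarrow> (LINT x|torus. weak_grad u x \<bullet> weak_grad \<phi> x) = (LINT x|torus. g x * \<phi> x)"
  proof (intro allI impI)
    fix \<phi> assume \<phi>: "H1 \<phi>"
    have H2: "H2 u" and ae: "AE x in torus. weak_laplacian u x = - g x" using * by auto
    have [measurable]: "g \<in> borel_measurable torus" "weak_laplacian u \<in> borel_measurable torus" "\<phi> \<in> borel_measurable torus"
      using g H2_weak_laplacian(1)[OF H2] H1_imp_L2[OF \<phi>] by (auto simp: L2_def)
    have "(LINT x|torus. weak_laplacian u x * \<phi> x) = (LINT x|torus. - (g x * \<phi> x))"
    proof (rule integral_cong_AE)
      show "AE x in torus. weak_laplacian u x * \<phi> x = - (g x * \<phi> x)" using ae by eventually_elim simp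
    qed measurable
    then show "(LINT x|torus. weak_grad u x \<bullet> weak_grad \<phi> x) = (LINT x|torus. g x * \<phi> x)"
      using Green_torus[OF H2 \<phi>] by simp
  qed
qed

section \<open>The logarithmic kernel\<close>

text \<open>The substitution by the tangent leads to an arctangent. Over one period the smooth
  antiderivative grows by \<pi>, the contribution of its linear part.\<close>

lemma integral_inverse_add_sin_square:
  assumes b: "b > (0::real)"
  shows "((\<lambda>y. 1 / (b + (sin (pi * y))\<^sup>2)) has_integral 1 / sqrt (b * (b + 1))) {0..1}"
proof -
  \<comment> \<open>This value makes c^2 + \<kappa>^2 s^2 proportional to b + s^2 when s^2 + c^2 =
    1.\<close>
  define \<kappa> where "\<kappa> = sqrt ((b + 1) / b)"
  have \<kappa>: "\<kappa> > 0" "\<kappa>\<^sup>2 = (b + 1) / b" using b by (simp_all add: \<kappa>_def)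
  have cancel: "inverse y * (y * z) = z" if "y \<noteq> 0" for y z :: real
    using that by simp
  \<comment> \<open>a smooth branch of \<open>arctan (\<kappa> * tan (pi * y))\<close>\<close>
  define G where "G y = pi * y + arctan ((\<kappa> - 1) * (sin (pi * y) * cos (pi * y)) / ((cos (pi * y))\<^sup>2 + \<kappa> * (sin (pi * y))\<^sup>2))" for y
  have "(G has_real_derivative (pi * \<kappa> * b) * (1 / (b + (sin (pi * y))\<^sup>2))) (at y)" for y
  proof -
    define s c where "s = sin (pi * y)" and "c = cos (pi * y)"
    have sc: "s\<^sup>2 + c\<^sup>2 = 1" by (simp add: s_def c_def)
    define q where "q = c\<^sup>2 + \<kappa> * s\<^sup>2"
    have q: "q > 0"
    proof (cases "s = 0")
      case True then show ?thesis using sc by (simp add: q_def)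
    next
      case False then show ?thesis using \<kappa> by (simp add: q_def add_nonneg_pos)
    qed
    define g where "g = (\<kappa> - 1) * (s * c) / q"
    have D: "(G has_real_derivative pi + inverse (1 + g\<^sup>2) *
      (((\<kappa> - 1) * (pi * (c\<^sup>2 - s\<^sup>2)) * q - (\<kappa> - 1) * (s * c) * (2 * pi * (\<kappa> - 1) * (s * c))) / q\<^sup>2)) (at y)"
      unfolding G_def[abs_def] using q
      by (auto intro!: derivative_eq_intros simp: s_def c_def q_def g_def power2_eq_square)
         (simp add: algebra_simps)
    \<comment> \<open>Keeping the factor s^2 + c^2 makes these polynomial identities, free of the
      trigonometric relation.\<close>
    have n1: "(c\<^sup>2 - s\<^sup>2) * q - 2 * (\<kappa> - 1) * (s * c)\<^sup>2 = (s\<^sup>2 + c\<^sup>2) * (c\<^sup>2 - \<kappa> * s\<^sup>2)"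
      unfolding q_def by algebra
    have n2: "q\<^sup>2 + (\<kappa> - 1)\<^sup>2 * (s * c)\<^sup>2 = (s\<^sup>2 + c\<^sup>2) * (c\<^sup>2 + \<kappa>\<^sup>2 * s\<^sup>2)"
      unfolding q_def by algebra
    define r where "r = c\<^sup>2 + \<kappa>\<^sup>2 * s\<^sup>2"
    have r: "r > 0"
    proof (cases "s = 0")
      case True then show ?thesis using sc by (simp add: r_def)
    next
      case False then show ?thesis using \<kappa>(1) by (simp add: r_def add_nonneg_pos)
    qed
    have "1 + g\<^sup>2 = r / q\<^sup>2"
    proof -
      have "1 + g\<^sup>2 = (q\<^sup>2 + (\<kappa> - 1)\<^sup>2 * (s * c)\<^sup>2) / q\<^sup>2"
        using q by (simp add: g_def power_divide power_mult_distrib add_divide_distrib)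
      then show ?thesis unfolding n2 sc r_def by simp
    qed
    then have i: "inverse (1 + g\<^sup>2) = q\<^sup>2 / r" by simp
    have "pi + inverse (1 + g\<^sup>2) * (((\<kappa> - 1) * (pi * (c\<^sup>2 - s\<^sup>2)) * q - (\<kappa> - 1) * (s * c) * (2 * pi * (\<kappa> - 1) * (s * c))) / q\<^sup>2)
       = pi + (\<kappa> - 1) * pi * ((c\<^sup>2 - s\<^sup>2) * q - 2 * (\<kappa> - 1) * (s * c)\<^sup>2) / r"
      unfolding i using q r by (simp add: field_simps power2_eq_square)
    also have "\<dots> = (pi * r + (\<kappa> - 1) * pi * (c\<^sup>2 - \<kappa> * s\<^sup>2)) / r"
      unfolding n1 sc using r by (simp add: field_simps)
    also have "pi * r + (\<kappa> - 1) * pi * (c\<^sup>2 - \<kappa> * s\<^sup>2) = pi * \<kappa> * (s\<^sup>2 + c\<^sup>2)"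
      unfolding r_def by algebra
    also have "r = (b + s\<^sup>2) / b"
    proof -
      have c2: "c\<^sup>2 = 1 - s\<^sup>2" using sc by simp
      show ?thesis unfolding r_def \<kappa>(2) c2 using b by (simp add: field_simps)
    qed
    finally have e: "pi + inverse (1 + g\<^sup>2) * (((\<kappa> - 1) * (pi * (c\<^sup>2 - s\<^sup>2)) * q - (\<kappa> - 1) * (s * c) * (2 * pi * (\<kappa> - 1) * (s * c))) / q\<^sup>2)
       = (pi * \<kappa> * b) * (1 / (b + s\<^sup>2))" using b sc by simp
    show ?thesis using D[unfolded e] by (simp only: s_def)
  qed
  then have "((\<lambda>y. (pi * \<kappa> * b) * (1 / (b + (sin (pi * y))\<^sup>2))) has_integral G 1 - G 0) {0..1}"
    by (intro fundamental_theorem_of_calculus)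
       (auto simp: has_real_derivative_iff_has_vector_derivative[symmetric] intro: has_field_derivative_at_within)
  then have "((\<lambda>y. inverse (pi * \<kappa> * b) * ((pi * \<kappa> * b) * (1 / (b + (sin (pi * y))\<^sup>2)))) has_integral inverse (pi * \<kappa> * b) * pi) {0..1}"
    by (intro has_integral_mult_right) (simp add: G_def)
  moreover have "inverse (pi * \<kappa> * b) * pi = 1 / sqrt (b * (b + 1))"
  proof -
    have "\<kappa> * b = sqrt (b * (b + 1))"
    proof (rule real_sqrt_unique[symmetric])
      have "(\<kappa> * b)\<^sup>2 = (b + 1) / b * b\<^sup>2" by (simp add: power_mult_distrib \<kappa>(2))
      then show "(\<kappa> * b)\<^sup>2 = b * (b + 1)" using b by (simp add: power2_eq_square)
    qed (use b \<kappa> in simp)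
    then show ?thesis by (simp add: field_simps)
  qed
  moreover have "inverse (pi * \<kappa> * b) * ((pi * \<kappa> * b) * z) = z" for z
    by (rule cancel) (use b \<kappa>(1) in simp)
  ultimately show ?thesis by (simp only:)
qed

text \<open>With t = sin^2 the integrand combines 1/(b + t) with the derivative of the periodic
  function sin cos/(b + t), by (b + t) - (b - (1 + 2b) t) = 2(b + 1) t; the derivative integrates to
  zero.\<close>

lemma integral_sin_square_quotient:
  assumes b: "b > (0::real)"
  shows "((\<lambda>y. (sin (pi * y))\<^sup>2 / (b + (sin (pi * y))\<^sup>2)\<^sup>2) has_integral 1 / (2 * (b + 1) * sqrt (b * (b + 1)))) {0..1}"
proof -
  define T where "T y = sin (pi * y) * cos (pi * y) / (b + (sin (pi * y))\<^sup>2)" for y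
  have pos: "b + (sin y)\<^sup>2 > 0" for y using b by (simp add: add_pos_nonneg)
  define T' where "T' y = pi * ((b - (1 + 2 * b) * (sin (pi * y))\<^sup>2) / (b + (sin (pi * y))\<^sup>2)\<^sup>2)" for y
  have "(T has_real_derivative T' y) (at y)" for y
  proof -
    define s c where "s = sin (pi * y)" and "c = cos (pi * y)"
    have c2: "c\<^sup>2 = 1 - s\<^sup>2" by (simp add: s_def c_def cos_squared_eq)
    have "(T has_real_derivative (pi * (c\<^sup>2 - s\<^sup>2) * (b + s\<^sup>2) - s * c * (2 * pi * (s * c))) / (b + s\<^sup>2)\<^sup>2) (at y)"
      unfolding T_def[abs_def] using pos[of "pi * y"]
      by (auto intro!: derivative_eq_intros simp: s_def c_def power2_eq_square) (simp add: algebra_simps)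
    moreover have "pi * (c\<^sup>2 - s\<^sup>2) * (b + s\<^sup>2) - s * c * (2 * pi * (s * c)) = pi * (b - (1 + 2 * b) * s\<^sup>2)"
    proof -
      have "pi * (c\<^sup>2 - s\<^sup>2) * (b + s\<^sup>2) - s * c * (2 * pi * (s * c)) = pi * (c\<^sup>2 - s\<^sup>2) * (b + s\<^sup>2) - 2 * pi * s\<^sup>2 * c\<^sup>2"
        by (simp add: power2_eq_square)
      also have "\<dots> = pi * (b - (1 + 2 * b) * s\<^sup>2)" unfolding c2 by (simp add: algebra_simps power2_eq_square)
      finally show ?thesis .
    qed
    ultimately show ?thesis by (simp add: T'_def s_def)
  qed
  then have "(T' has_integral T 1 - T 0) {0..1}"
    by (intro fundamental_theorem_of_calculus)
       (auto simp: has_real_derivative_iff_has_vector_derivative[symmetric] intro: has_field_derivative_at_within)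
  then have T0: "(T' has_integral 0) {0..1}" by (simp add: T_def)
  have "((\<lambda>y. (1 / (2 * (b + 1))) * (1 / (b + (sin (pi * y))\<^sup>2) - (1 / pi) * T' y)) has_integral
     (1 / (2 * (b + 1))) * (1 / sqrt (b * (b + 1)) - (1 / pi) * 0)) {0..1}"
    by (intro has_integral_mult_right has_integral_diff integral_inverse_add_sin_square b T0)
  moreover have "(1 / (2 * (b + 1))) * (1 / (b + t) - (1 / pi) * (pi * ((b - (1 + 2 * b) * t) / (b + t)\<^sup>2))) = t / (b + t)\<^sup>2"
    if "b + t > 0" for t
  proof -
    have "1 / (b + t) - (1 / pi) * (pi * ((b - (1 + 2 * b) * t) / (b + t)\<^sup>2)) = ((b + t) - (b - (1 + 2 * b) * t)) / (b + t)\<^sup>2"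
    proof -
      have "1 / (b + t) = (b + t) / (b + t)\<^sup>2" using that by (simp add: power2_eq_square)
      moreover have "(1 / pi) * (pi * z) = z" for z :: real by simp
      ultimately show ?thesis by (simp only: diff_divide_distrib)
    qed
    also have "(b + t) - (b - (1 + 2 * b) * t) = (2 * (b + 1)) * t" by algebra
    finally show ?thesis using b by simp
  qed
  ultimately show ?thesis using pos by (simp add: T'_def)
qed

text \<open>This is what remains of the mass integral at d = 0 after one integration; its value
  1/(2\<pi>) is the source of the mass 4\<pi>.\<close>

lemma integral_sin_quotient: "((\<lambda>x. sin (pi * x) / (2 * (1 + (sin (pi * x))\<^sup>2) * sqrt (1 + (sin (pi * x))\<^sup>2))) has_integral 1 / (2 * pi)) {0..1}"
proof -
  define W where "W x = - (1 / (4 * pi)) * (cos (pi * x) / sqrt (1 + (sin (pi * x))\<^sup>2))" for x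
  have "(W has_real_derivative sin (pi * x) / (2 * (1 + (sin (pi * x))\<^sup>2) * sqrt (1 + (sin (pi * x))\<^sup>2))) (at x)" for x
  proof -
    define s c where "s = sin (pi * x)" and "c = cos (pi * x)"
    have c2: "c\<^sup>2 = 1 - s\<^sup>2" by (simp add: s_def c_def cos_squared_eq)
    define q where "q = sqrt (1 + s\<^sup>2)"
    have q: "q > 0" "q\<^sup>2 = 1 + s\<^sup>2" by (auto simp: q_def add_pos_nonneg)
    have pos: "1 + s\<^sup>2 > 0" by (simp add: add_pos_nonneg)
    have "(W has_real_derivative - (1 / (4 * pi)) * ((- (pi * s) * q - c * (inverse q / 2 * (2 * s * (pi * c)))) / q\<^sup>2)) (at x)"
    proof -
      have D1: "((\<lambda>x. cos (pi * x)) has_real_derivative - (pi * s)) (at x)"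
        by (auto intro!: derivative_eq_intros simp: s_def)
      have "((\<lambda>x. 1 + (sin (pi * x))\<^sup>2) has_real_derivative 2 * s * (pi * c)) (at x)"
        by (auto intro!: derivative_eq_intros simp: s_def c_def)
      then have D2: "((\<lambda>x. sqrt (1 + (sin (pi * x))\<^sup>2)) has_real_derivative inverse q / 2 * (2 * s * (pi * c))) (at x)"
        unfolding q_def s_def by (intro DERIV_chain2[OF DERIV_real_sqrt]) (use pos in \<open>simp_all add: s_def\<close>)
      show ?thesis unfolding W_def[abs_def]
        by (rule DERIV_cong[OF DERIV_cmult[OF DERIV_divide[OF D1 D2]]])
           (use q(1) in \<open>simp_all add: q_def s_def c_def power2_eq_square\<close>)
    qed
    moreover have "- (1 / (4 * pi)) * ((- (pi * s) * q - c * (inverse q / 2 * (2 * s * (pi * c)))) / q\<^sup>2) = s / (2 * (1 + s\<^sup>2) * q)"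
    proof -
      have "- (pi * s) * q - c * (inverse q / 2 * (2 * s * (pi * c))) = - (pi * s) * (q\<^sup>2 + c\<^sup>2) / q"
      proof -
        have e1: "- (pi * s) * q = - (pi * s) * q\<^sup>2 / q" using q(1) by (simp add: power2_eq_square)
        have e2: "c * (inverse q / 2 * (2 * s * (pi * c))) = pi * s * c\<^sup>2 / q"
          using q(1) by (simp add: field_simps power2_eq_square)
        have "- (pi * s) * q - c * (inverse q / 2 * (2 * s * (pi * c))) = - (pi * s) * q\<^sup>2 / q - pi * s * c\<^sup>2 / q"
          by (rule arg_cong2[OF e1 e2])
        also have "\<dots> = (- (pi * s) * q\<^sup>2 - pi * s * c\<^sup>2) / q" by (rule diff_divide_distrib[symmetric])
        also have "- (pi * s) * q\<^sup>2 - pi * s * c\<^sup>2 = - (pi * s) * (q\<^sup>2 + c\<^sup>2)" by algebra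
        finally show ?thesis .
      qed
      also have "q\<^sup>2 + c\<^sup>2 = 2" unfolding q(2) c2 by simp
      finally have N: "- (pi * s) * q - c * (inverse q / 2 * (2 * s * (pi * c))) = - (pi * s) * 2 / q" .
      have "- (1 / (4 * pi)) * ((- (pi * s) * 2 / q) / q\<^sup>2) = s / (2 * q\<^sup>2 * q)"
        using q(1) by (simp add: field_simps)
      then show ?thesis unfolding N q(2) .
    qed
    ultimately show ?thesis unfolding q_def s_def by simp
  qed
  then have "((\<lambda>x. sin (pi * x) / (2 * (1 + (sin (pi * x))\<^sup>2) * sqrt (1 + (sin (pi * x))\<^sup>2))) has_integral W 1 - W 0) {0..1}"
    by (intro fundamental_theorem_of_calculus)
       (auto simp: has_real_derivative_iff_has_vector_derivative[symmetric] intro: has_field_derivative_at_within)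
  then show ?thesis by (simp add: W_def)
qed

section \<open>A periodic substitute for the squared distance and the integrability of its inverse
  root\<close>

definition sinsq :: "real^2 \<Rightarrow> real" where
  "sinsq x = (sin (pi * x$1))\<^sup>2 + (sin (pi * x$2))\<^sup>2"

definition sinsq' :: "2 \<Rightarrow> real^2 \<Rightarrow> real" where
  "sinsq' i x = 2 * pi * (sin (pi * x$i) * cos (pi * x$i))"

definition sinsq'' :: "2 \<Rightarrow> real^2 \<Rightarrow> real" where
  "sinsq'' i x = 2 * pi\<^sup>2 * (1 - 2 * (sin (pi * x$i))\<^sup>2)"

lemma sinsq_nonneg [simp]: "sinsq x \<ge> 0" by (simp add: sinsq_def)

lemma sinsq_le_2: "sinsq x \<le> 2"
  unfolding sinsq_def using abs_square_le_1[of "sin (pi * x$1)"] abs_square_le_1[of "sin (pi * x$2)"] by simp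

lemma sin_shift_period: "sin (pi * (t + 1)) = - sin (pi * t)" "cos (pi * (t + 1)) = - cos (pi * t)"
  by (simp_all add: distrib_left sin_add cos_add)

lemma sin_le_sinsq: "(sin (pi * x$i))\<^sup>2 \<le> sinsq x"
proof -
  have "i = 1 \<or> i = 2" using exhaust_2 by blast
  then show ?thesis by (auto simp: sinsq_def)
qed

lemma periodic_sinsq: "periodic sinsq"
  unfolding periodic_def sinsq_def by (auto simp: axis_def sin_shift_period)

lemma periodic_sinsq': "periodic (sinsq' i)"
  unfolding periodic_def sinsq'_def by (auto simp: axis_def sin_shift_period)

lemma continuous_on_sinsq [continuous_intros]:
  "continuous_on S f \<Longrightarrow> continuous_on S (\<lambda>x. sinsq (f x))"
  "continuous_on S f \<Longrightarrow> continuous_on S (\<lambda>x. sinsq' i (f x))"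
  "continuous_on S f \<Longrightarrow> continuous_on S (\<lambda>x. sinsq'' i (f x))"
proof -
  assume f: "continuous_on S f"
  have "continuous_on UNIV sinsq" "continuous_on UNIV (sinsq' i)" "continuous_on UNIV (sinsq'' i)"
    unfolding sinsq_def[abs_def] sinsq'_def[abs_def] sinsq''_def[abs_def] by (intro continuous_intros)+
  from this[THEN continuous_on_compose2, OF f]
  show "continuous_on S (\<lambda>x. sinsq (f x))" "continuous_on S (\<lambda>x. sinsq' i (f x))" "continuous_on S (\<lambda>x. sinsq'' i (f x))"
    by simp_all
qed

lemma has_partial_component:
  assumes "\<And>t. (f has_real_derivative f' t) (at t)"
  shows "has_partial i (\<lambda>x. f (x$j)) (\<lambda>x. if j = i then f' (x$i) else 0)"
  unfolding has_partial_def
proof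
  fix x :: "real^2"
  show "((\<lambda>t. f ((x + axis i t) $ j)) has_real_derivative (if j = i then f' (x$i) else 0)) (at 0)"
  proof (cases "j = i")
    case True
    have "((\<lambda>t. f (x$i + t)) has_real_derivative f' (x$i) * (0 + 1)) (at 0)"
      by (rule DERIV_chain2[where g = "\<lambda>t. x$i + t"]) (use assms[of "x$i"] in \<open>auto intro!: derivative_eq_intros\<close>)
    then show ?thesis using True by simp
  qed (simp add: axis_def)
qed

lemma has_partial_sinsq: "has_partial i sinsq (sinsq' i)"
proof -
  have D: "((\<lambda>t. (sin (pi * t))\<^sup>2) has_real_derivative 2 * pi * (sin (pi * t) * cos (pi * t))) (at t)" for t
    by (auto intro!: derivative_eq_intros)
  have "i = 1 \<or> i = 2" using exhaust_2 by blast
  then show ?thesis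
    using has_partial_add[OF has_partial_component[OF D, of i 1] has_partial_component[OF D, of i 2]]
    by (auto simp: sinsq_def[abs_def] sinsq'_def[abs_def])
qed

lemma has_partial_sinsq': "has_partial i (sinsq' i) (sinsq'' i)"
proof -
  have D: "((\<lambda>t. 2 * pi * (sin (pi * t) * cos (pi * t))) has_real_derivative 2 * pi\<^sup>2 * (1 - 2 * (sin (pi * t))\<^sup>2)) (at t)" for t
  proof -
    have "((\<lambda>t. 2 * pi * (sin (pi * t) * cos (pi * t))) has_real_derivative 2 * pi\<^sup>2 * ((cos (pi * t))\<^sup>2 - (sin (pi * t))\<^sup>2)) (at t)"
      by (auto intro!: derivative_eq_intros simp: power2_eq_square algebra_simps)
    then show ?thesis by (simp add: cos_squared_eq)
  qed
  then show ?thesis using has_partial_component[OF D, of i i]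
    by (simp add: sinsq'_def[abs_def] sinsq''_def[abs_def])
qed

lemma sinsq'_square: "(sinsq' i x)\<^sup>2 = 4 * pi\<^sup>2 * ((sin (pi * x$i))\<^sup>2 - (sin (pi * x$i))^4)"
proof -
  have "(sinsq' i x)\<^sup>2 = 4 * pi\<^sup>2 * ((sin (pi * x$i))\<^sup>2 * (cos (pi * x$i))\<^sup>2)"
    by (simp add: sinsq'_def power_mult_distrib)
  then show ?thesis unfolding cos_squared_eq by (simp add: algebra_simps power2_eq_square power4_eq_xxxx)
qed

lemma sinsq'_square_le: "(sinsq' i x)\<^sup>2 \<le> 4 * pi\<^sup>2 * sinsq x"
proof -
  have "(sin (pi * x$i))\<^sup>2 - (sin (pi * x$i))^4 \<le> sinsq x"
  proof -
    have "0 \<le> (sin (pi * x$i))^4" by simp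
    then show ?thesis using sin_le_sinsq[of x i] by linarith
  qed
  then show ?thesis unfolding sinsq'_square by simp
qed

lemma sinsq_minus: "sinsq (a - b) = sinsq (b - a)"
proof -
  have "(sin (pi * (a$i - b$i)))\<^sup>2 = (sin (pi * (b$i - a$i)))\<^sup>2" for i
    using sin_minus[of "pi * (b$i - a$i)"] by (simp add: algebra_simps)
  then show ?thesis by (simp add: sinsq_def)
qed

text \<open>The quasi-triangle inequality of a squared distance; it separates the poles in
  \<open>exp_minus_abs_Lam_le\<close>.\<close>

lemma sinsq_add_le: "sinsq (x + y) \<le> 2 * sinsq x + 2 * sinsq y"
proof -
  have "(sin (s + t))\<^sup>2 \<le> 2 * (sin s)\<^sup>2 + 2 * (sin t)\<^sup>2" for s t :: real
  proof -
    have "\<bar>sin (s + t)\<bar> \<le> \<bar>sin s\<bar> * 1 + 1 * \<bar>sin t\<bar>"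
      unfolding sin_add by (rule order_trans[OF abs_triangle_ineq]) (unfold abs_mult, intro add_mono mult_mono; simp)
    then have "(sin (s + t))\<^sup>2 \<le> (\<bar>sin s\<bar> + \<bar>sin t\<bar>)\<^sup>2"
      using power_mono[of "\<bar>sin (s + t)\<bar>" "\<bar>sin s\<bar> + \<bar>sin t\<bar>" 2] by simp
    also have "\<dots> \<le> 2 * (sin s)\<^sup>2 + 2 * (sin t)\<^sup>2"
      using sum_squares_bound[of "\<bar>sin s\<bar>" "\<bar>sin t\<bar>"] by (simp add: power2_sum)
    finally show ?thesis .
  qed
  from this[of "pi * x$1" "pi * y$1"] this[of "pi * x$2" "pi * y$2"] show ?thesis
    by (simp add: sinsq_def distrib_left)
qed

text \<open>The zeros form the translate of the integer lattice by a, a countable set.\<close>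

lemma AE_sinsq_pos: "AE x in torus. sinsq (x - a) > 0"
proof -
  define Z where "Z = (\<lambda>(m, n). (\<chi> i. a$i + (if i = 1 then of_int m else of_int n)) :: real^2) ` (UNIV :: (int \<times> int) set)"
  have "countable Z" unfolding Z_def by simp
  then have "negligible Z" by (simp add: negligible_iff_null_sets countable_imp_null_set_lborel null_sets_completionI)
  then have "AE x in torus. x \<notin> Z" by (rule AE_torus_notin_negligible)
  then show ?thesis
  proof eventually_elim
    case (elim x)
    show ?case
    proof (rule ccontr)
      assume "\<not> sinsq (x - a) > 0"
      then have "sinsq (x - a) = 0" using sinsq_nonneg[of "x - a"] by linarith
      then have "sin (pi * (x$1 - a$1)) = 0" "sin (pi * (x$2 - a$2)) = 0"
        by (auto simp: sinsq_def sum_power2_eq_zero_iff)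
      then obtain m n where "pi * (x$1 - a$1) = of_int m * pi" "pi * (x$2 - a$2) = of_int n * pi"
        by (auto simp: sin_zero_iff_int2)
      then have "x$1 = a$1 + of_int m" "x$2 = a$2 + of_int n" by auto
      then have "x \<in> Z" unfolding Z_def by (intro image_eqI[of _ _ "(m, n)"]) (auto simp: vec_eq_iff forall_2)
      then show False using elim by simp
    qed
  qed
qed

text \<open>Integrating the Laplacian of \<open>sqrt (d + sinsq x)\<close>, which vanishes, bounds the integral of
  \<open>1 / sqrt (d + sinsq x)\<close> uniformly in \<open>d\<close>.\<close>

lemma integral_inverse_sqrt_sinsq_le:
  assumes d: "0 < d" "d \<le> 1"
  shows "(LINT x|torus. 1 / sqrt (d + sinsq x)) \<le> 8"
proof -
  define q where "q x = sqrt (d + sinsq x)" for x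
  have pos: "d + sinsq x > 0" for x using d by (simp add: add_pos_nonneg)
  have q: "q x > 0" "(q x)\<^sup>2 = d + sinsq x" for x using pos[of x] by (simp_all add: q_def less_imp_le)
  have qc: "continuous_on UNIV q" unfolding q_def by (intro continuous_intros)
  define g where "g i x = sinsq'' i x * (1 / (2 * q x)) + sinsq' i x * ((- 1 / (4 * q x ^ 3)) * sinsq' i x)" for i x
  have gc: "continuous_on UNIV (g i)" for i
    unfolding g_def using q(1) by (intro continuous_intros qc) (auto simp: less_imp_neq[symmetric])
  have "has_partial i (\<lambda>x. sinsq' i x * (1 / (2 * q x))) (g i)" for i
  proof -
    have "((\<lambda>s. 1 / (2 * sqrt (d + s))) has_real_derivative - 1 / (4 * sqrt (d + s) ^ 3)) (at s)" if "s \<ge> 0" for s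
    proof -
      have p: "d + s > 0" using d that by simp
      then have e: "sqrt (d + s) * sqrt (d + s) = d + s" by simp
      have "((\<lambda>s. 1 / (2 * sqrt (d + s))) has_real_derivative (0 * (2 * sqrt (d + s)) - 1 * (2 * (inverse (sqrt (d + s)) / 2))) / ((2 * sqrt (d + s)) * (2 * sqrt (d + s)))) (at s)"
        using p by (auto intro!: derivative_eq_intros)
      moreover have "(0 * (2 * sqrt (d + s)) - 1 * (2 * (inverse (sqrt (d + s)) / 2))) / ((2 * sqrt (d + s)) * (2 * sqrt (d + s))) = - 1 / (4 * sqrt (d + s) ^ 3)"
        using p by (simp add: field_simps power3_eq_cube)
      ultimately show ?thesis by simp
    qed
    then have "has_partial i (\<lambda>x. 1 / (2 * q x)) (\<lambda>x. (- 1 / (4 * q x ^ 3)) * sinsq' i x)"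
      unfolding q_def by (intro has_partial_chain[OF has_partial_sinsq]) simp
    from has_partial_mult[OF has_partial_sinsq' this] show ?thesis by (simp add: g_def[abs_def])
  qed
  moreover have "periodic (\<lambda>x. sinsq' i x * (1 / (2 * q x)))" for i
    using periodic_sinsq periodic_sinsq'[of i] by (simp add: periodic_def q_def)
  ultimately have g0: "(LINT x|torus. g i x) = 0" for i
    using torus_integral_partial gc by blast
  \<comment> \<open>The right side is the Laplacian of q. Its second-order term is at least 2\<pi>^2
    (1/q - q), and its gradient term costs at most \<pi>^2/q because |\<nabla> sinsq|^2 \<le>
    4\<pi>^2 q^2; half of the 1/q survives.\<close>
  have le: "pi\<^sup>2 * (1 / q x) - 2 * pi\<^sup>2 * q x \<le> g 1 x + g 2 x" for x
  proof -
    have "g 1 x + g 2 x = (sinsq'' 1 x + sinsq'' 2 x) / (2 * q x) - ((sinsq' 1 x)\<^sup>2 + (sinsq' 2 x)\<^sup>2) / (4 * q x ^ 3)"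
      using q(1)[of x] by (simp add: g_def power2_eq_square add_divide_distrib)
    moreover have "sinsq'' 1 x + sinsq'' 2 x = 4 * pi\<^sup>2 * (1 - sinsq x)"
      by (simp add: sinsq''_def sinsq_def algebra_simps)
    moreover have "((sinsq' 1 x)\<^sup>2 + (sinsq' 2 x)\<^sup>2) / (4 * q x ^ 3) \<le> (4 * pi\<^sup>2 * (q x)\<^sup>2) / (4 * q x ^ 3)"
    proof (rule divide_right_mono)
      have "(sinsq' 1 x)\<^sup>2 + (sinsq' 2 x)\<^sup>2 \<le> 4 * pi\<^sup>2 * sinsq x"
      proof -
        have "0 \<le> (sin (pi * x$1))^4" "0 \<le> (sin (pi * x$2))^4" by simp_all
        then show ?thesis unfolding sinsq'_square sinsq_def distrib_left[symmetric]
          by (intro mult_left_mono; linarith?) auto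
      qed
      also have "\<dots> \<le> 4 * pi\<^sup>2 * (q x)\<^sup>2" unfolding q(2) using d by simp
      finally show "(sinsq' 1 x)\<^sup>2 + (sinsq' 2 x)\<^sup>2 \<le> 4 * pi\<^sup>2 * (q x)\<^sup>2" .
    qed (use q(1)[of x] in simp)
    moreover have "(4 * pi\<^sup>2 * (q x)\<^sup>2) / (4 * q x ^ 3) = pi\<^sup>2 * (1 / q x)"
      using q(1)[of x] by (simp add: power2_eq_square power3_eq_cube)
    moreover have "4 * pi\<^sup>2 * (1 - sinsq x) / (2 * q x) \<ge> 2 * pi\<^sup>2 * (1 / q x) - 2 * pi\<^sup>2 * q x"
    proof -
      have "2 * pi\<^sup>2 * (1 / q x) - 2 * pi\<^sup>2 * q x = 2 * pi\<^sup>2 * (1 - (q x)\<^sup>2) / q x"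
        using q(1)[of x] by (simp add: field_simps power2_eq_square)
      also have "\<dots> \<le> 2 * pi\<^sup>2 * (1 - sinsq x) / q x"
        unfolding q(2) using q(1)[of x] d by (intro divide_right_mono mult_left_mono) auto
      also have "\<dots> = 4 * pi\<^sup>2 * (1 - sinsq x) / (2 * q x)" by simp
      finally show ?thesis .
    qed
    ultimately show ?thesis by simp
  qed
  have q2: "q x \<le> 2" for x
    unfolding q_def using sinsq_le_2[of x] d by (intro real_le_lsqrt) auto
  have i: "integrable torus (\<lambda>x. 1 / q x)" "integrable torus q" "integrable torus (g i)" for i
    using q(1) by (intro integrable_torus_continuous continuous_intros qc gc; simp add: less_imp_neq[symmetric])+
  have "(LINT x|torus. pi\<^sup>2 * (1 / q x) - 2 * pi\<^sup>2 * q x) \<le> (LINT x|torus. g 1 x + g 2 x)"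
    by (intro integral_mono le Bochner_Integration.integrable_diff integrable_mult_right Bochner_Integration.integrable_add i)
  also have "\<dots> = 0" using i g0 by simp
  also have "(LINT x|torus. pi\<^sup>2 * (1 / q x) - 2 * pi\<^sup>2 * q x) = pi\<^sup>2 * (LINT x|torus. 1 / q x) - 2 * pi\<^sup>2 * (LINT x|torus. q x)"
    by (subst Bochner_Integration.integral_diff; (intro integrable_mult_right i)?) (simp only: integral_mult_right_zero)
  finally have "pi\<^sup>2 * (LINT x|torus. 1 / q x) \<le> pi\<^sup>2 * (2 * (LINT x|torus. q x))"
    by simp
  then have "(LINT x|torus. 1 / q x) \<le> 2 * (LINT x|torus. q x)" by simp
  also have "(LINT x|torus. q x) \<le> (LINT x|torus. 2)"
    by (intro integral_mono i q2 finite_measure.integrable_const finite_measure_torus)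
  also have "\<dots> = 2" by (simp add: measure_torus)
  finally show ?thesis by (simp add: q_def)
qed

text \<open>Fatou's lemma along d -> 0 with the uniform bound. This is the integrability of 1/r in
  the plane; it dominates the logarithm, its gradient and the error in the Dirac limit.\<close>

lemma integrable_inverse_sqrt_sinsq: "integrable torus (\<lambda>x. 1 / sqrt (sinsq (x - a)))"
proof (rule integrableI_bounded)
  define d where "d n = 1 / (real n + 1)" for n
  have d: "0 < d n" "d n \<le> 1" for n by (auto simp: d_def)
  have dlim: "d \<longlonglongrightarrow> 0" unfolding d_def by real_asymp
  have c: "continuous_on UNIV (\<lambda>x. 1 / sqrt (d n + sinsq (x - a)))" "continuous_on UNIV (\<lambda>x. 1 / sqrt (d n + sinsq x))" for n
    using d(1)[of n] by (intro continuous_intros; simp add: add_pos_nonneg less_imp_neq[symmetric])+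
  have [measurable]: "(\<lambda>x. 1 / sqrt (d n + sinsq (x - a))) \<in> borel_measurable torus" for n
    by (rule borel_measurable_integrable[OF integrable_torus_continuous[OF c(1)]])
  have [measurable]: "(\<lambda>x. sinsq (x - a)) \<in> borel_measurable borel"
    by (intro borel_measurable_continuous_onI continuous_intros)
  show meas: "(\<lambda>x. 1 / sqrt (sinsq (x - a))) \<in> borel_measurable torus"
    by (intro measurable_torus_borel) measurable
  have "(\<integral>\<^sup>+x. ennreal (norm (1 / sqrt (sinsq (x - a)))) \<partial>torus) =
      (\<integral>\<^sup>+x. liminf (\<lambda>n. ennreal (1 / sqrt (d n + sinsq (x - a)))) \<partial>torus)"
  proof (rule nn_integral_cong_AE)
    show "AE x in torus. ennreal (norm (1 / sqrt (sinsq (x - a)))) = liminf (\<lambda>n. ennreal (1 / sqrt (d n + sinsq (x - a))))"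
      using AE_sinsq_pos[of a]
    proof eventually_elim
      case (elim x)
      have "(\<lambda>n. 1 / sqrt (d n + sinsq (x - a))) \<longlonglongrightarrow> 1 / sqrt (0 + sinsq (x - a))"
        using elim by (intro tendsto_intros dlim) auto
      then have "(\<lambda>n. ennreal (1 / sqrt (d n + sinsq (x - a)))) \<longlonglongrightarrow> ennreal (1 / sqrt (sinsq (x - a)))"
        by (intro tendsto_ennrealI) simp
      then show ?case using lim_imp_Liminf[OF trivial_limit_sequentially] elim by fastforce
    qed
  qed
  also have "\<dots> \<le> liminf (\<lambda>n. \<integral>\<^sup>+x. ennreal (1 / sqrt (d n + sinsq (x - a))) \<partial>torus)"
    by (intro nn_integral_liminf) measurable
  also have "\<dots> \<le> liminf (\<lambda>n. ennreal 8)"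
  proof (rule Liminf_mono, rule always_eventually, rule allI)
    fix n
    have "(\<integral>\<^sup>+x. ennreal (1 / sqrt (d n + sinsq (x - a))) \<partial>torus) = ennreal (LINT x|torus. 1 / sqrt (d n + sinsq (x - a)))"
      using d(1)[of n] by (intro nn_integral_eq_integral integrable_torus_continuous c) (auto simp: add_nonneg_nonneg less_imp_le)
    also have "(LINT x|torus. 1 / sqrt (d n + sinsq (x - a))) = (LINT x|torus. 1 / sqrt (d n + sinsq x))"
      using torus_integral_shift[OF c(2), of n "- a"] periodic_sinsq by (simp add: periodic_def)
    also have "ennreal \<dots> \<le> ennreal 8" using integral_inverse_sqrt_sinsq_le[OF d] by (rule ennreal_leI)
    finally show "(\<integral>\<^sup>+x. ennreal (1 / sqrt (d n + sinsq (x - a))) \<partial>torus) \<le> ennreal 8" .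
  qed
  also have "\<dots> < \<infinity>" by (simp add: Liminf_const)
  finally show "(\<integral>\<^sup>+x. ennreal (norm (1 / sqrt (sinsq (x - a)))) \<partial>torus) < \<infinity>" .
qed

text \<open>The inner integral is \<open>integral_sin_square_quotient\<close> with b = d + sin^2
  (\<pi>x); the outer integrand stays below 1 uniformly in d and converges to that of
  \<open>integral_sin_quotient\<close>.\<close>

lemma sinsq_mass_limit:
  assumes d: "\<And>n. 0 < d n" "d \<longlonglongrightarrow> 0"
  shows "(\<lambda>n. LINT x|torus. (sin (pi * x$1))\<^sup>2 * (sin (pi * x$2))\<^sup>2 / (d n + sinsq x)\<^sup>2) \<longlonglongrightarrow> 1 / (2 * pi)"
proof -
  define F where "F d x = (sin (pi * x))\<^sup>2 * (1 / (2 * (d + (sin (pi * x))\<^sup>2 + 1) * sqrt ((d + (sin (pi * x))\<^sup>2) * (d + (sin (pi * x))\<^sup>2 + 1))))" for d x :: real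
  have pos: "d n + (sin y)\<^sup>2 > 0" for n y using d(1)[of n] by (simp add: add_pos_nonneg)
  have eq: "(LINT x|torus. (sin (pi * x$1))\<^sup>2 * (sin (pi * x$2))\<^sup>2 / (d n + sinsq x)\<^sup>2) = integral {0..1} (F (d n))" for n
  proof -
    have c: "continuous_on UNIV (\<lambda>x::real^2. (sin (pi * x$1))\<^sup>2 * (sin (pi * x$2))\<^sup>2 / (d n + sinsq x)\<^sup>2)"
      using d(1)[of n] by (intro continuous_intros) (auto simp: add_pos_nonneg less_imp_neq[symmetric])
    have "integral {0..1} (\<lambda>y. (sin (pi * x))\<^sup>2 * (sin (pi * y))\<^sup>2 / (d n + sinsq (pair_vec (x, y)))\<^sup>2) = F (d n) x" for x
    proof -
      have "((\<lambda>y. (sin (pi * x))\<^sup>2 * ((sin (pi * y))\<^sup>2 / ((d n + (sin (pi * x))\<^sup>2) + (sin (pi * y))\<^sup>2)\<^sup>2)) has_integral F (d n) x) {0..1}"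
        unfolding F_def by (intro has_integral_mult_right integral_sin_square_quotient pos)
      then show ?thesis by (simp add: integral_unique sinsq_def add.assoc)
    qed
    then show ?thesis unfolding torus_Fubini(1)[OF c] by simp
  qed
  define G where "G x = sin (pi * x) / (2 * (1 + (sin (pi * x))\<^sup>2) * sqrt (1 + (sin (pi * x))\<^sup>2))" for x
  have "(\<lambda>n. integral {0..1} (F (d n))) \<longlonglongrightarrow> integral {0..1} G"
  proof (rule dominated_convergence(2)[where h = "\<lambda>x. 1"])
    show "F (d n) integrable_on {0..1}" for n
    proof (rule integrable_continuous_real)
      have "2 * (d n + (sin (pi * x))\<^sup>2 + 1) * sqrt ((d n + (sin (pi * x))\<^sup>2) * (d n + (sin (pi * x))\<^sup>2 + 1)) \<noteq> 0" for x
      proof -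
        have "d n + (sin (pi * x))\<^sup>2 \<noteq> 0" "d n + (sin (pi * x))\<^sup>2 + 1 \<noteq> 0"
          using pos[of n "pi * x"] by linarith+
        then show ?thesis by (simp del: distrib_left_numeral)
      qed
      then show "continuous_on {0..1} (F (d n))"
        unfolding F_def by (intro continuous_intros) blast
    qed
    show "norm (F (d n) x) \<le> 1" for n x
    proof (cases "sin (pi * x) = 0")
      case False
      define s where "s = (sin (pi * x))\<^sup>2"
      have s: "s > 0" using False by (simp add: s_def)
      have "s \<le> sqrt ((d n + s) * (d n + s + 1))"
      proof (rule real_le_rsqrt)
        have "s * s \<le> (d n + s) * (d n + s + 1)" using s d(1)[of n] by (intro mult_mono) auto
        then show "s\<^sup>2 \<le> (d n + s) * (d n + s + 1)" by (simp add: power2_eq_square)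
      qed
      also have "\<dots> \<le> 2 * (d n + s + 1) * \<dots>"
      proof -
        have "1 \<le> 2 * (d n + s + 1)" "0 \<le> sqrt ((d n + s) * (d n + s + 1))" using s d(1)[of n] by auto
        from mult_right_mono[OF this] show ?thesis by simp
      qed
      finally have "s * (1 / (2 * (d n + s + 1) * sqrt ((d n + s) * (d n + s + 1)))) \<le> 1"
        using s d(1)[of n] by (simp add: divide_le_eq_1)
      moreover have "0 \<le> s * (1 / (2 * (d n + s + 1) * sqrt ((d n + s) * (d n + s + 1))))"
        using s d(1)[of n] by (intro mult_nonneg_nonneg divide_nonneg_nonneg) auto
      ultimately show ?thesis unfolding F_def s_def[symmetric] real_norm_def by (simp only: abs_of_nonneg)
    qed (simp add: F_def)
    show "(\<lambda>n. F (d n) x) \<longlonglongrightarrow> G x" if x: "x \<in> {0..1}" for x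
    proof -
      define s where "s = sin (pi * x)"
      have "s \<ge> 0" unfolding s_def using x by (intro sin_ge_zero) (auto simp: mult_left_le)
      show "(\<lambda>n. F (d n) x) \<longlonglongrightarrow> G x"
      proof (cases "s = 0")
        case True then show ?thesis by (simp add: F_def G_def s_def)
      next
        case False
        then have s: "s > 0" using \<open>s \<ge> 0\<close> by simp
        then have q: "1 + s\<^sup>2 > 0" by (simp add: add_pos_nonneg)
        have "(\<lambda>n. s\<^sup>2 * (1 / (2 * (d n + s\<^sup>2 + 1) * sqrt ((d n + s\<^sup>2) * (d n + s\<^sup>2 + 1)))))
           \<longlonglongrightarrow> s\<^sup>2 * (1 / (2 * (0 + s\<^sup>2 + 1) * sqrt ((0 + s\<^sup>2) * (0 + s\<^sup>2 + 1))))"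
          using s q by (intro tendsto_intros d) (auto simp: add.commute)
        also have "s\<^sup>2 * (1 / (2 * (0 + s\<^sup>2 + 1) * sqrt ((0 + s\<^sup>2) * (0 + s\<^sup>2 + 1)))) = s / (2 * (1 + s\<^sup>2) * sqrt (1 + s\<^sup>2))"
          using s by (simp add: real_sqrt_mult add.commute power2_eq_square)
        finally show ?thesis by (simp add: F_def G_def s_def)
      qed
    qed
  qed (rule integrable_const_ivl)
  moreover have "integral {0..1} G = 1 / (2 * pi)"
    unfolding G_def by (rule integral_unique[OF integral_sin_quotient])
  ultimately show ?thesis by (simp add: eq)
qed

section \<open>The regularised logarithm and its Laplacian\<close>

lemma sqrt_divide_self_pos: "x > 0 \<Longrightarrow> sqrt x / x = 1 / sqrt x" for x :: real
  using real_sqrt_mult_self[of x] by (simp add: divide_simps)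

definition dlog_sinsq :: "real \<Rightarrow> 2 \<Rightarrow> real^2 \<Rightarrow> real" where
  "dlog_sinsq d i x = sinsq' i x / (d + sinsq x)"

definition ddlog_sinsq :: "real \<Rightarrow> 2 \<Rightarrow> real^2 \<Rightarrow> real" where
  "ddlog_sinsq d i x = sinsq'' i x / (d + sinsq x) - (sinsq' i x)\<^sup>2 / (d + sinsq x)\<^sup>2"

text \<open>The Laplacian of \<open>ln (d + sinsq x)\<close> splits into this part, bounded
  uniformly in d, and \<open>lap_sing\<close>, which carries a factor d and concentrates at the
  lattice points as d -> 0.\<close>

definition lap_reg :: "real \<Rightarrow> real^2 \<Rightarrow> real" where
  "lap_reg d x = - 8 * pi\<^sup>2 * ((sin (pi * x$1))\<^sup>2 * (sin (pi * x$2))\<^sup>2 / (d + sinsq x)\<^sup>2)"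

definition lap_sing :: "real \<Rightarrow> real^2 \<Rightarrow> real" where
  "lap_sing d x = 4 * pi\<^sup>2 * (d * (1 - sinsq x) / (d + sinsq x)\<^sup>2)"

lemma ddlog_sinsq_sum:
  assumes "d + sinsq x > 0"
  shows "ddlog_sinsq d 1 x + ddlog_sinsq d 2 x = lap_reg d x + lap_sing d x"
proof -
  define s t where "s = (sin (pi * x$1))\<^sup>2" and "t = (sin (pi * x$2))\<^sup>2"
  have S: "sinsq x = s + t" by (simp add: sinsq_def s_def t_def)
  have p4: "(sin (pi * x$1))^4 = s\<^sup>2" "(sin (pi * x$2))^4 = t\<^sup>2" by (simp_all add: s_def t_def)
  have q: "d + (s + t) > 0" using assms S by simp
  have "ddlog_sinsq d 1 x + ddlog_sinsq d 2 x =
     (2 * pi\<^sup>2 * (1 - 2 * s) + 2 * pi\<^sup>2 * (1 - 2 * t)) / (d + (s + t)) - (4 * pi\<^sup>2 * (s - s\<^sup>2) + 4 * pi\<^sup>2 * (t - t\<^sup>2)) / (d + (s + t))\<^sup>2"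
    unfolding ddlog_sinsq_def sinsq'_square p4 sinsq''_def s_def[symmetric] t_def[symmetric] S
    by (simp add: add_divide_distrib)
  also have "\<dots> = ((2 * pi\<^sup>2 * (1 - 2 * s) + 2 * pi\<^sup>2 * (1 - 2 * t)) * (d + (s + t)) - (4 * pi\<^sup>2 * (s - s\<^sup>2) + 4 * pi\<^sup>2 * (t - t\<^sup>2))) / (d + (s + t))\<^sup>2"
    using q by (simp add: diff_divide_distrib power2_eq_square)
  also have "(2 * pi\<^sup>2 * (1 - 2 * s) + 2 * pi\<^sup>2 * (1 - 2 * t)) * (d + (s + t)) - (4 * pi\<^sup>2 * (s - s\<^sup>2) + 4 * pi\<^sup>2 * (t - t\<^sup>2))
    = - 8 * pi\<^sup>2 * (s * t) + 4 * pi\<^sup>2 * (d * (1 - (s + t)))"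
    by algebra
  finally show ?thesis
    unfolding lap_reg_def lap_sing_def s_def[symmetric] t_def[symmetric] S
    by (simp add: add_divide_distrib diff_divide_distrib)
qed

text \<open>By 4st \<le> (s + t)^2 the quotient stays bounded where its denominator
  degenerates.\<close>

lemma abs_lap_reg_le: "\<bar>lap_reg d x\<bar> \<le> 2 * pi\<^sup>2" if "d \<ge> 0"
proof -
  define s t where "s = (sin (pi * x$1))\<^sup>2" and "t = (sin (pi * x$2))\<^sup>2"
  have st: "s \<ge> 0" "t \<ge> 0" by (auto simp: s_def t_def)
  have S: "sinsq x = s + t" by (simp add: sinsq_def s_def t_def)
  have "4 * (s * t) \<le> (s + t)\<^sup>2" using sum_squares_bound[of s t] by (simp add: power2_sum)
  also have "\<dots> \<le> (d + (s + t))\<^sup>2" using st that by (intro power_mono) auto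
  finally have "4 * (s * t) / (d + (s + t))\<^sup>2 \<le> 1" by (auto simp: divide_le_eq_1)
  moreover have "0 \<le> 4 * (s * t) / (d + (s + t))\<^sup>2" using st by simp
  ultimately have "\<bar>(2 * pi\<^sup>2) * (4 * (s * t) / (d + (s + t))\<^sup>2)\<bar> \<le> (2 * pi\<^sup>2) * 1"
    unfolding abs_mult by (intro mult_mono) auto
  moreover have "lap_reg d x = - ((2 * pi\<^sup>2) * (4 * (s * t) / (d + (s + t))\<^sup>2))"
    unfolding lap_reg_def s_def[symmetric] t_def[symmetric] S by simp
  ultimately show ?thesis by simp
qed

lemma abs_lap_sing_le:
  assumes "d \<ge> 0"
  shows "\<bar>lap_sing d x\<bar> \<le> 4 * pi\<^sup>2 * (d / (d + sinsq x)\<^sup>2)"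
proof -
  have "\<bar>1 - sinsq x\<bar> \<le> 1" using sinsq_le_2[of x] sinsq_nonneg[of x] by linarith
  then have "\<bar>d * (1 - sinsq x)\<bar> \<le> d * 1" unfolding abs_mult using assms by (intro mult_mono) auto
  then have "\<bar>d * (1 - sinsq x)\<bar> / (d + sinsq x)\<^sup>2 \<le> d / (d + sinsq x)\<^sup>2" by (intro divide_right_mono) auto
  then have "4 * pi\<^sup>2 * (\<bar>d * (1 - sinsq x)\<bar> / (d + sinsq x)\<^sup>2) \<le> 4 * pi\<^sup>2 * (d / (d + sinsq x)\<^sup>2)"
    by (intro mult_left_mono) auto
  then show ?thesis unfolding lap_sing_def by (simp add: abs_mult)
qed

lemma abs_dlog_sinsq_le:
  assumes "d \<ge> 0"
  shows "\<bar>dlog_sinsq d i x\<bar> \<le> 2 * pi / sqrt (d + sinsq x)"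
proof (cases "d + sinsq x = 0")
  case False
  then have pos: "d + sinsq x > 0" using assms sinsq_nonneg[of x] by linarith
  have "\<bar>sinsq' i x\<bar> \<le> 2 * pi * sqrt (d + sinsq x)"
  proof -
    have "(sinsq' i x)\<^sup>2 \<le> (2 * pi * sqrt (d + sinsq x))\<^sup>2"
    proof -
      have "4 * pi\<^sup>2 * sinsq x \<le> 4 * pi\<^sup>2 * (d + sinsq x)" using assms by (intro mult_left_mono) auto
      also have "\<dots> = (2 * pi * sqrt (d + sinsq x))\<^sup>2" using pos by (simp add: power_mult_distrib)
      finally show ?thesis using sinsq'_square_le[of i x] by linarith
    qed
    then show ?thesis by (simp add: abs_le_square_iff[symmetric] pos less_imp_le)
  qed
  then have "\<bar>dlog_sinsq d i x\<bar> \<le> 2 * pi * sqrt (d + sinsq x) / (d + sinsq x)"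
    using pos by (simp add: dlog_sinsq_def divide_right_mono)
  also have "\<dots> = 2 * pi / sqrt (d + sinsq x)"
    using sqrt_divide_self_pos[OF pos] by (metis times_divide_eq_right mult.right_neutral)
  finally show ?thesis .
qed (simp add: dlog_sinsq_def)

text \<open>The estimate -ln (q^2) = 2 ln (1/q) \<le> 2/q trades the logarithm for the integrable
  1/q, so the same kind of majorant serves for the potential and for its gradient.\<close>

lemma abs_ln_sinsq_le:
  assumes "0 \<le> d" "d \<le> 1" "sinsq x > 0"
  shows "\<bar>ln (d + sinsq x)\<bar> \<le> 2 + 2 * (1 / sqrt (sinsq x))"
proof -
  define q where "q = sqrt (sinsq x)"
  have q: "q > 0" "q\<^sup>2 = sinsq x" using assms by (auto simp: q_def)
  have "ln (d + sinsq x) \<le> (d + sinsq x) - 1" using assms by (intro ln_le_minus_one) auto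
  also have "\<dots> \<le> 2" using assms sinsq_le_2[of x] by simp
  finally have 1: "ln (d + sinsq x) \<le> 2" .
  have "- ln (d + sinsq x) \<le> - ln (q\<^sup>2)" using assms q by simp
  also have "\<dots> = 2 * ln (1 / q)" using q(1) by (simp only: ln_realpow ln_div) (simp add: ln_realpow)
  also have "\<dots> \<le> 2 * (1 / q)" using ln_le_minus_one[of "1 / q"] q by simp
  finally have "- ln (d + sinsq x) \<le> 2 * (1 / q)" .
  moreover have "0 \<le> 2 * (1 / q)" using q by simp
  ultimately show ?thesis using 1 unfolding q_def by linarith
qed

lemma has_partial_log_sinsq:
  assumes "d > 0"
  shows "has_partial i (\<lambda>x. ln (d + sinsq x)) (dlog_sinsq d i)"
    and "has_partial i (dlog_sinsq d i) (ddlog_sinsq d i)"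
proof -
  have pos: "d + sinsq x > 0" for x using assms by (simp add: add_pos_nonneg)
  have "has_partial i (\<lambda>x. ln (d + sinsq x)) (\<lambda>x. 1 / (d + sinsq x) * sinsq' i x)"
  proof (rule has_partial_chain[OF has_partial_sinsq])
    fix x
    show "((\<lambda>s. ln (d + s)) has_real_derivative 1 / (d + sinsq x)) (at (sinsq x))"
      using pos[of x] by (auto intro!: derivative_eq_intros simp: divide_inverse)
  qed
  then show "has_partial i (\<lambda>x. ln (d + sinsq x)) (dlog_sinsq d i)"
    by (simp add: dlog_sinsq_def[abs_def])
  have "has_partial i (\<lambda>x. 1 / (d + sinsq x)) (\<lambda>x. (- 1 / (d + sinsq x)\<^sup>2) * sinsq' i x)"
  proof (rule has_partial_chain[OF has_partial_sinsq])
    fix x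
    show "((\<lambda>s. 1 / (d + s)) has_real_derivative - 1 / (d + sinsq x)\<^sup>2) (at (sinsq x))"
      using pos[of x] by (auto intro!: derivative_eq_intros simp: power2_eq_square)
  qed
  from has_partial_mult[OF has_partial_sinsq' this]
  show "has_partial i (dlog_sinsq d i) (ddlog_sinsq d i)"
    by (simp add: dlog_sinsq_def[abs_def] ddlog_sinsq_def[abs_def] power2_eq_square)
qed

lemma continuous_on_log_sinsq:
  assumes "d > 0"
  shows "continuous_on S (\<lambda>x. ln (d + sinsq x))" "continuous_on S (dlog_sinsq d i)" "continuous_on S (ddlog_sinsq d i)"
    "continuous_on S (lap_reg d)" "continuous_on S (lap_sing d)"
proof -
  have "d + sinsq x \<noteq> 0" "d + sinsq x > 0" for x using assms by (auto simp: add_pos_nonneg less_imp_neq[symmetric])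
  then show "continuous_on S (\<lambda>x. ln (d + sinsq x))" "continuous_on S (dlog_sinsq d i)" "continuous_on S (ddlog_sinsq d i)"
    "continuous_on S (lap_reg d)" "continuous_on S (lap_sing d)"
    unfolding dlog_sinsq_def[abs_def] ddlog_sinsq_def[abs_def] lap_reg_def[abs_def] lap_sing_def[abs_def]
    by (auto intro!: continuous_intros)
qed

lemma periodic_log_sinsq:
  "periodic (\<lambda>x. ln (d + sinsq x))" "periodic (dlog_sinsq d i)" "periodic (lap_reg d)" "periodic (lap_sing d)"
  using periodic_sinsq periodic_sinsq'[of i]
  by (auto simp: periodic_def dlog_sinsq_def lap_reg_def lap_sing_def axis_def sin_shift_period)

text \<open>The Laplacian of a periodic function has integral zero, so the singular mass is minus
  the integral of the bounded part, that is 8\<pi>^2 times the explicit integral with limit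
  1/(2\<pi>).\<close>

lemma lap_sing_mass_limit:
  assumes d: "\<And>n. 0 < d n" "d \<longlonglongrightarrow> 0"
  shows "(\<lambda>n. LINT x|torus. lap_sing (d n) x) \<longlonglongrightarrow> 4 * pi"
proof -
  have eq: "(LINT x|torus. lap_sing (d n) x) =
      8 * pi\<^sup>2 * (LINT x|torus. (sin (pi * x$1))\<^sup>2 * (sin (pi * x$2))\<^sup>2 / (d n + sinsq x)\<^sup>2)" for n
  proof -
    have pos: "d n + sinsq x > 0" for x using d(1)[of n] by (simp add: add_pos_nonneg)
    have i: "integrable torus (ddlog_sinsq (d n) i)" "integrable torus (lap_reg (d n))" "integrable torus (lap_sing (d n))" for i
      by (intro integrable_torus_continuous continuous_on_log_sinsq d)+
    have "(LINT x|torus. lap_reg (d n) x + lap_sing (d n) x) = (LINT x|torus. ddlog_sinsq (d n) 1 x + ddlog_sinsq (d n) 2 x)"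
      by (simp add: ddlog_sinsq_sum pos)
    also have "\<dots> = 0"
      using i torus_integral_partial[OF periodic_log_sinsq(2) has_partial_log_sinsq(2)[OF d(1)] continuous_on_log_sinsq(3)[OF d(1)]]
      by simp
    finally have "(LINT x|torus. lap_sing (d n) x) = - (LINT x|torus. lap_reg (d n) x)" using i by simp
    also have "\<dots> = (LINT x|torus. (8 * pi\<^sup>2) * ((sin (pi * x$1))\<^sup>2 * (sin (pi * x$2))\<^sup>2 / (d n + sinsq x)\<^sup>2))"
      by (simp add: lap_reg_def)
    finally show ?thesis by (simp only: integral_mult_right_zero)
  qed
  have "(\<lambda>n. LINT x|torus. lap_sing (d n) x) \<longlonglongrightarrow> 8 * pi\<^sup>2 * (1 / (2 * pi))"
    unfolding eq by (intro tendsto_mult tendsto_const sinsq_mass_limit d)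
  then show ?thesis by (simp add: power2_eq_square)
qed

section \<open>Convergence of the singular part to a Dirac mass\<close>

lemma abs_sin_mult_le: "\<bar>sin (of_int j * t)\<bar> \<le> \<bar>of_int j\<bar> * \<bar>sin t\<bar>" for t :: real
proof -
  have n: "\<bar>sin (real m * t)\<bar> \<le> real m * \<bar>sin t\<bar>" for m :: nat
  proof (induction m)
    case (Suc m)
    have "\<bar>sin (real (Suc m) * t)\<bar> = \<bar>sin (real m * t) * cos t + cos (real m * t) * sin t\<bar>"
    proof -
      have "real (Suc m) * t = real m * t + t" by (simp add: distrib_right)
      then show ?thesis by (simp only: sin_add)
    qed
    also have "\<dots> \<le> \<bar>sin (real m * t)\<bar> * 1 + 1 * \<bar>sin t\<bar>"
      by (rule order_trans[OF abs_triangle_ineq]) (unfold abs_mult, intro add_mono mult_mono; simp)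
    finally show ?case using Suc by (simp add: distrib_right)
  qed simp
  show ?thesis
  proof (cases "j \<ge> 0")
    case True then show ?thesis using n[of "nat j"] by simp
  next
    case False then show ?thesis using n[of "nat (- j)"] by simp
  qed
qed

text \<open>Differences are measured by |sin (\<pi>t)|, a periodic distance comparable with
  \<open>sinsq\<close>; the factor |j| comes from |sin (jt)| \<le> |j| |sin t|.\<close>

lemma trig_diff_le: "\<bar>trig j (t + a) - trig j a\<bar> \<le> 2 * sqrt 2 * \<bar>of_int j\<bar> * \<bar>sin (pi * t)\<bar>"
proof -
  have "\<bar>cos (2 * pi * j * (t + a)) - cos (2 * pi * j * a)\<bar> \<le> 2 * (\<bar>of_int j\<bar> * \<bar>sin (pi * t)\<bar>)"
    and "\<bar>sin (2 * pi * j * (t + a)) - sin (2 * pi * j * a)\<bar> \<le> 2 * (\<bar>of_int j\<bar> * \<bar>sin (pi * t)\<bar>)"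
  proof -
    have e: "(2 * pi * j * (t + a) - 2 * pi * j * a) / 2 = of_int j * (pi * t)" 
      "(2 * pi * j * a - 2 * pi * j * (t + a)) / 2 = - (of_int j * (pi * t))" by (simp_all add: algebra_simps)
    note s = abs_sin_mult_le[of j "pi * t"]
    have "\<bar>cos (2 * pi * j * (t + a)) - cos (2 * pi * j * a)\<bar> = 2 * (\<bar>sin ((2 * pi * j * (t + a) + 2 * pi * j * a) / 2)\<bar> * \<bar>sin (of_int j * (pi * t))\<bar>)"
      unfolding cos_diff_cos e by (simp add: abs_mult)
    also have "\<dots> \<le> 2 * (1 * (\<bar>of_int j\<bar> * \<bar>sin (pi * t)\<bar>))"
      by (intro mult_left_mono mult_mono s) auto
    finally show "\<bar>cos (2 * pi * j * (t + a)) - cos (2 * pi * j * a)\<bar> \<le> 2 * (\<bar>of_int j\<bar> * \<bar>sin (pi * t)\<bar>)" by simp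
    have "\<bar>sin (2 * pi * j * (t + a)) - sin (2 * pi * j * a)\<bar> = 2 * (\<bar>sin (of_int j * (pi * t))\<bar> * \<bar>cos ((2 * pi * j * (t + a) + 2 * pi * j * a) / 2)\<bar>)"
      unfolding sin_diff_sin e by (simp add: abs_mult)
    also have "\<dots> \<le> 2 * ((\<bar>of_int j\<bar> * \<bar>sin (pi * t)\<bar>) * 1)"
      by (intro mult_left_mono mult_mono s) auto
    finally show "\<bar>sin (2 * pi * j * (t + a)) - sin (2 * pi * j * a)\<bar> \<le> 2 * (\<bar>of_int j\<bar> * \<bar>sin (pi * t)\<bar>)" by simp
  qed
  then have "sqrt 2 * \<bar>cos (2 * pi * j * (t + a)) - cos (2 * pi * j * a)\<bar> \<le> sqrt 2 * (2 * (\<bar>of_int j\<bar> * \<bar>sin (pi * t)\<bar>))"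
    "sqrt 2 * \<bar>sin (2 * pi * j * (t + a)) - sin (2 * pi * j * a)\<bar> \<le> sqrt 2 * (2 * (\<bar>of_int j\<bar> * \<bar>sin (pi * t)\<bar>))"
    by (intro mult_left_mono; simp)+
  then have "\<bar>sqrt 2 * cos (2 * pi * j * (t + a)) - sqrt 2 * cos (2 * pi * j * a)\<bar> \<le> 2 * sqrt 2 * \<bar>of_int j\<bar> * \<bar>sin (pi * t)\<bar>"
    "\<bar>sqrt 2 * sin (2 * pi * j * (t + a)) - sqrt 2 * sin (2 * pi * j * a)\<bar> \<le> 2 * sqrt 2 * \<bar>of_int j\<bar> * \<bar>sin (pi * t)\<bar>"
    unfolding right_diff_distrib[symmetric] abs_mult by (simp_all only: abs_of_nonneg[OF real_sqrt_ge_zero[OF zero_le_numeral]] mult_ac)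
  then show ?thesis unfolding trig_def by (cases "j = 0"; cases "j > 0"; simp)
qed

lemma trig2_diff_le: "\<bar>trig2 k (y + a) - trig2 k a\<bar> \<le> 4 * (\<bar>of_int (k$1)\<bar> + \<bar>of_int (k$2)\<bar>) * sqrt (sinsq y)"
proof -
  have s: "\<bar>sin (pi * y$i)\<bar> \<le> sqrt (sinsq y)" for i
    by (rule real_le_rsqrt) (simp add: sin_le_sinsq)
  define A B a1 b1 where "A = trig (k$1) (y$1 + a$1)" and "B = trig (k$2) (y$2 + a$2)" and "a1 = trig (k$1) (a$1)" and "b1 = trig (k$2) (a$2)"
  have dA: "\<bar>A - a1\<bar> \<le> 2 * sqrt 2 * \<bar>of_int (k$1)\<bar> * sqrt (sinsq y)" and dB: "\<bar>B - b1\<bar> \<le> 2 * sqrt 2 * \<bar>of_int (k$2)\<bar> * sqrt (sinsq y)"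
    unfolding A_def B_def a1_def b1_def
    by (rule order_trans[OF trig_diff_le mult_left_mono[OF s]]; simp)+
  have "trig2 k (y + a) - trig2 k a = (A - a1) * B + a1 * (B - b1)"
    by (simp add: trig2_def A_def B_def a1_def b1_def algebra_simps)
  also have "\<bar>\<dots>\<bar> \<le> \<bar>A - a1\<bar> * \<bar>B\<bar> + \<bar>a1\<bar> * \<bar>B - b1\<bar>"
    by (rule order_trans[OF abs_triangle_ineq]) (simp add: abs_mult)
  also have "\<dots> \<le> (2 * sqrt 2 * \<bar>of_int (k$1)\<bar> * sqrt (sinsq y)) * sqrt 2 + sqrt 2 * (2 * sqrt 2 * \<bar>of_int (k$2)\<bar> * sqrt (sinsq y))"
    using dA dB unfolding A_def B_def a1_def b1_def by (intro add_mono mult_mono abs_trig_le) auto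
  also have "\<dots> = (sqrt 2 * sqrt 2) * (2 * (\<bar>of_int (k$1)\<bar> + \<bar>of_int (k$2)\<bar>) * sqrt (sinsq y))"
    by (simp only: distrib_left distrib_right mult_ac)
  also have "\<dots> = 4 * (\<bar>of_int (k$1)\<bar> + \<bar>of_int (k$2)\<bar>) * sqrt (sinsq y)" by simp
  finally show ?thesis .
qed

text \<open>The value of the mode at the pole is split off and carries the mass 4\<pi>; the rest
  vanishes because the mode is Lipschitz in the periodic distance. Modes suffice as tests, since the
  Laplacian is later identified through its Fourier coefficients.\<close>

lemma lap_sing_tendsto_delta:
  assumes d: "\<And>n. 0 < d n" "d \<longlonglongrightarrow> 0"
  shows "(\<lambda>n. LINT x|torus. lap_sing (d n) (x - a) * trig2 k x) \<longlonglongrightarrow> 4 * pi * trig2 k a"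
proof -
  define C where "C = 4 * (\<bar>real_of_int (k$1)\<bar> + \<bar>real_of_int (k$2)\<bar>)"
  have C: "C \<ge> 0" by (simp add: C_def)
  have tc: "continuous_on S (\<lambda>y. trig2 k (y + a))" for S
    by (rule continuous_on_compose2[OF continuous_on_trig2]) (auto intro!: continuous_intros)
  have lc: "continuous_on S (lap_sing (d n))" for S n by (rule continuous_on_log_sinsq(5)[OF d(1)])
  have i1: "integrable torus (\<lambda>y. lap_sing (d n) y * (trig2 k (y + a) - trig2 k a))" for n
    by (intro integrable_torus_continuous continuous_intros lc tc)
  have i2: "integrable torus (\<lambda>y. lap_sing (d n) y * trig2 k a)" for n
    by (intro integrable_torus_continuous continuous_intros lc)
  have eq: "(LINT x|torus. lap_sing (d n) (x - a) * trig2 k x) =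
      (LINT y|torus. lap_sing (d n) y * (trig2 k (y + a) - trig2 k a)) + (LINT y|torus. lap_sing (d n) y) * trig2 k a" for n
  proof -
    have c: "continuous_on UNIV (\<lambda>y. lap_sing (d n) y * trig2 k (y + a))" by (intro continuous_intros lc tc)
    have p: "periodic (\<lambda>y. lap_sing (d n) y * trig2 k (y + a))"
      using periodic_log_sinsq(4)[of "d n"] periodic_shift[OF periodic_trig2[of k], of "- a"] by (simp add: periodic_def)
    have "(LINT x|torus. lap_sing (d n) (x - a) * trig2 k x) = (LINT y|torus. lap_sing (d n) y * trig2 k (y + a))"
      using torus_integral_shift[OF c p, of "- a"] by simp
    also have "\<dots> = (LINT y|torus. lap_sing (d n) y * (trig2 k (y + a) - trig2 k a) + lap_sing (d n) y * trig2 k a)"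
      by (simp add: algebra_simps)
    also have "\<dots> = (LINT y|torus. lap_sing (d n) y * (trig2 k (y + a) - trig2 k a)) + (LINT y|torus. lap_sing (d n) y * trig2 k a)"
      by (rule Bochner_Integration.integral_add[OF i1 i2])
    finally show ?thesis by simp
  qed
  \<comment> \<open>The last two factors have separate roles: 1/sqrt (sinsq y) is an integrable
    majorant, while e/(e + sinsq y) is at most 1 and tends to 0 away from the pole.\<close>
  have bound: "\<bar>lap_sing e y * (trig2 k (y + a) - trig2 k a)\<bar> \<le> 4 * pi\<^sup>2 * C * (1 / sqrt (sinsq y)) * (e / (e + sinsq y))"
    if "e > 0" "sinsq y > 0" for e y
  proof -
    have q: "e + sinsq y > 0" using that by simp
    have "\<bar>lap_sing e y * (trig2 k (y + a) - trig2 k a)\<bar> \<le> (4 * pi\<^sup>2 * (e / (e + sinsq y)\<^sup>2)) * (C * sqrt (sinsq y))"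
      unfolding abs_mult C_def using that
      by (intro mult_mono trig2_diff_le abs_lap_sing_le) auto
    also have "\<dots> = 4 * pi\<^sup>2 * C * (e / (e + sinsq y)) * (sqrt (sinsq y) / (e + sinsq y))"
      by (simp add: power2_eq_square)
    also have "\<dots> \<le> 4 * pi\<^sup>2 * C * (e / (e + sinsq y)) * (sqrt (sinsq y) / sinsq y)"
      using that C q by (intro mult_left_mono divide_left_mono) auto
    also have "sqrt (sinsq y) / sinsq y = 1 / sqrt (sinsq y)"
      by (rule sqrt_divide_self_pos[OF that(2)])
    finally show ?thesis by (simp add: mult_ac)
  qed
  have w: "integrable torus (\<lambda>y. 4 * pi\<^sup>2 * C * (1 / sqrt (sinsq y)))"
    using integrable_inverse_sqrt_sinsq[of 0] by (intro integrable_mult_right) simp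
  have pos: "AE y in torus. sinsq y > 0" using AE_sinsq_pos[of 0] by simp
  have "(\<lambda>n. LINT y|torus. lap_sing (d n) y * (trig2 k (y + a) - trig2 k a)) \<longlonglongrightarrow> (LINT y|torus. 0)"
  proof (rule integral_dominated_convergence[OF _ _ w])
    show "AE y in torus. (\<lambda>n. lap_sing (d n) y * (trig2 k (y + a) - trig2 k a)) \<longlonglongrightarrow> 0"
      using pos
    proof eventually_elim
      case (elim y)
      have "(\<lambda>n. 4 * pi\<^sup>2 * C * (1 / sqrt (sinsq y)) * (d n / (d n + sinsq y))) \<longlonglongrightarrow> 4 * pi\<^sup>2 * C * (1 / sqrt (sinsq y)) * (0 / (0 + sinsq y))"
        using elim by (intro tendsto_intros d) auto
      then have l: "(\<lambda>n. 4 * pi\<^sup>2 * C * (1 / sqrt (sinsq y)) * (d n / (d n + sinsq y))) \<longlonglongrightarrow> 0" by simp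
      show ?case
        by (rule Lim_null_comparison[OF always_eventually l]) (use bound[OF d(1) elim] in auto)
    qed
    show "AE y in torus. norm (lap_sing (d n) y * (trig2 k (y + a) - trig2 k a)) \<le> 4 * pi\<^sup>2 * C * (1 / sqrt (sinsq y))" for n
      using pos
    proof eventually_elim
      case (elim y)
      have "d n / (d n + sinsq y) \<le> 1" using d(1)[of n] elim by simp
      then have "4 * pi\<^sup>2 * C * (1 / sqrt (sinsq y)) * (d n / (d n + sinsq y)) \<le> 4 * pi\<^sup>2 * C * (1 / sqrt (sinsq y)) * 1"
        using C elim by (intro mult_left_mono) auto
      then show ?case using bound[OF d(1)[of n] elim] by simp
    qed
  qed (use i1 in auto)
  then have "(\<lambda>n. LINT x|torus. lap_sing (d n) (x - a) * trig2 k x) \<longlonglongrightarrow> 0 + 4 * pi * trig2 k a"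
    unfolding eq by (intro tendsto_add tendsto_mult tendsto_const lap_sing_mass_limit d) simp
  then show ?thesis by simp
qed

section \<open>Logarithmic potentials\<close>

text \<open>Classical integration by parts holds for each \<open>F n\<close>, and both sides pass to
  the limit because test functions and their derivatives are bounded.\<close>

lemma has_weak_partial_limit:
  assumes F: "\<And>n. periodic (F n)" "\<And>n. has_partial i (F n) (G n)" "\<And>n. continuous_on UNIV (F n)" "\<And>n. continuous_on UNIV (G n)"
    and L1: "L1 f" "L1 g"
    and lim: "(\<lambda>n. LINT x|torus. \<bar>F n x - f x\<bar>) \<longlonglongrightarrow> 0" "(\<lambda>n. LINT x|torus. \<bar>G n x - g x\<bar>) \<longlonglongrightarrow> 0"
  shows "has_weak_partial i f g"
  unfolding has_weak_partial_def
proof (intro conjI allI impI L1)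
  fix \<phi> assume \<phi>: "test_function \<phi>"
  have T: "(\<lambda>n. LINT x|torus. \<psi> x * H n x) \<longlonglongrightarrow> (LINT x|torus. \<psi> x * h x)"
    if \<psi>: "continuous_on UNIV \<psi>" and H: "\<And>n. continuous_on UNIV (H n)" "L1 h" "(\<lambda>n. LINT x|torus. \<bar>H n x - h x\<bar>) \<longlonglongrightarrow> 0"
    for \<psi> h :: "real^2 \<Rightarrow> real" and H
  proof -
    have "bounded (\<psi> ` cbox 0 1)" by (intro compact_imp_bounded compact_continuous_image continuous_on_subset[OF \<psi>]) auto
    then obtain B where B: "\<And>x. x \<in> cbox 0 1 \<Longrightarrow> \<bar>\<psi> x\<bar> \<le> B" by (auto simp: bounded_iff)
    have m: "\<psi> \<in> borel_measurable torus"
      by (intro measurable_torus_borel borel_measurable_continuous_onI \<psi>)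
    show ?thesis
      by (rule tendsto_integral_bounded_mult(2)[where a = "\<lambda>n. \<psi>" and C = B])
         (use B m H in \<open>auto simp: L1_def intro: integrable_torus_continuous\<close>)
  qed
  have "(LINT x|torus. partial_deriv i \<phi> x * F n x) = - (LINT x|torus. \<phi> x * G n x)" for n
    using integration_by_parts_torus[OF F(1-4) test_function_C_k(1) test_function_has_partial test_function_continuous
        test_function_partial_continuous, OF \<phi> \<phi> \<phi> \<phi>, of n]
    by (simp add: mult.commute)
  then have "(\<lambda>n. - (LINT x|torus. \<phi> x * G n x)) \<longlonglongrightarrow> (LINT x|torus. partial_deriv i \<phi> x * f x)"
    using T[OF test_function_partial_continuous[OF \<phi>, of i] F(3) L1(1) lim(1)] by simp
  moreover have "(\<lambda>n. - (LINT x|torus. \<phi> x * G n x)) \<longlonglongrightarrow> - (LINT x|torus. \<phi> x * g x)"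
    by (intro tendsto_minus T test_function_continuous \<phi> F L1 lim)
  ultimately show "(LINT x|torus. f x * partial_deriv i \<phi> x) = - (LINT x|torus. g x * \<phi> x)"
    using LIMSEQ_unique by (fastforce simp: mult.commute)
qed

lemma dominated_imp_L1_convergence:
  fixes F :: "nat \<Rightarrow> 'a \<Rightarrow> real"
  assumes F: "\<And>n. F n \<in> borel_measurable M" and f: "f \<in> borel_measurable M" and w: "integrable M w"
    and b: "\<And>n. AE x in M. \<bar>F n x\<bar> \<le> w x" and lim: "AE x in M. (\<lambda>n. F n x) \<longlonglongrightarrow> f x"
  shows "integrable M f" "(\<lambda>n. \<integral>x. \<bar>F n x - f x\<bar> \<partial>M) \<longlonglongrightarrow> 0"
proof -
  have b': "AE x in M. norm (F n x) \<le> w x" for n using b by simp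
  show i: "integrable M f" by (rule integrable_dominated_convergence[OF f F w lim b'])
  have "(\<lambda>n. \<integral>x. \<bar>F n x - f x\<bar> \<partial>M) \<longlonglongrightarrow> (\<integral>x. 0 \<partial>M)"
  proof (rule integral_dominated_convergence)
    show "integrable M (\<lambda>x. w x + \<bar>f x\<bar>)" using w i by simp
    show "AE x in M. (\<lambda>n. \<bar>F n x - f x\<bar>) \<longlonglongrightarrow> 0"
      using lim
    proof eventually_elim
      case (elim x)
      then have "(\<lambda>n. \<bar>F n x - f x\<bar>) \<longlonglongrightarrow> \<bar>f x - f x\<bar>" by (intro tendsto_intros)
      then show ?case by simp
    qed
    show "AE x in M. norm \<bar>F n x - f x\<bar> \<le> w x + \<bar>f x\<bar>" for n
      using b[of n] by eventually_elim simp
  qed (use F f in auto)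
  then show "(\<lambda>n. \<integral>x. \<bar>F n x - f x\<bar> \<partial>M) \<longlonglongrightarrow> 0" by simp
qed

text \<open>Lebesgue measure is complete. This gives measurability to functions known only off a
  null set, such as a potential away from its poles.\<close>

lemma borel_measurable_AE_torus:
  fixes f g :: "real^2 \<Rightarrow> real"
  assumes f: "f \<in> borel_measurable torus" and eq: "AE x in torus. f x = g x"
  shows "g \<in> borel_measurable torus"
proof -
  have iff: "h \<in> borel_measurable torus \<longleftrightarrow> (\<lambda>x. indicator (cbox 0 1) x *\<^sub>R h x) \<in> borel_measurable lebesgue" for h :: "real^2 \<Rightarrow> real"
    by (rule borel_measurable_restrict_space_iff) simp
  have "AE x in lebesgue. indicator (cbox 0 1) x *\<^sub>R f x = indicator (cbox 0 1) x *\<^sub>R g x"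
    using eq unfolding AE_torus_iff by eventually_elim (auto simp: indicator_def)
  then show ?thesis using f unfolding iff by (rule borel_measurable_AE[rotated])
qed

text \<open>\<open>separated\<close> says that poles are distinct modulo the lattice; |N a| \<ge> 1
  makes exp (- |Lam|) vanish at least quadratically at each pole.\<close>

locale log_potential =
  fixes P :: "(real^2) set" and N :: "real^2 \<Rightarrow> real"
  assumes finite_P: "finite P" and N: "\<And>a. a \<in> P \<Longrightarrow> \<bar>N a\<bar> \<ge> 1"
    and separated: "\<And>a b. a \<in> P \<Longrightarrow> b \<in> P \<Longrightarrow> a \<noteq> b \<Longrightarrow> sinsq (a - b) > 0"
begin

definition Lam :: "real \<Rightarrow> real^2 \<Rightarrow> real" where
  "Lam d x = (\<Sum>a\<in>P. N a * ln (d + sinsq (x - a)))"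

definition dLam :: "real \<Rightarrow> 2 \<Rightarrow> real^2 \<Rightarrow> real" where
  "dLam d i x = (\<Sum>a\<in>P. N a * dlog_sinsq d i (x - a))"

definition ddLam :: "real \<Rightarrow> 2 \<Rightarrow> real^2 \<Rightarrow> real" where
  "ddLam d i x = (\<Sum>a\<in>P. N a * ddlog_sinsq d i (x - a))"

definition Reg :: "real \<Rightarrow> real^2 \<Rightarrow> real" where
  "Reg d x = (\<Sum>a\<in>P. N a * lap_reg d (x - a))"

definition Sing :: "real \<Rightarrow> real^2 \<Rightarrow> real" where
  "Sing d x = (\<Sum>a\<in>P. N a * lap_sing d (x - a))"

text \<open>At a pole the functions with d = 0 take conventional values of ln and of division at 0,
  so limits and pole bounds at d = 0 are stated off the poles.\<close>

definition off_poles :: "real^2 \<Rightarrow> bool" where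
  "off_poles x \<longleftrightarrow> (\<forall>a\<in>P. sinsq (x - a) > 0)"

lemma AE_off_poles: "AE x in torus. off_poles x"
  unfolding off_poles_def using finite_P AE_sinsq_pos by (simp add: AE_finite_all)

lemma continuous_on_shift: "continuous_on UNIV f \<Longrightarrow> continuous_on S (\<lambda>x. f (x - a))" for f :: "real^2 \<Rightarrow> real"
  by (erule continuous_on_compose2) (auto intro!: continuous_intros)

lemma continuous_on_Lam:
  assumes "d > 0"
  shows "continuous_on S (Lam d)" "continuous_on S (dLam d i)" "continuous_on S (ddLam d i)"
    "continuous_on S (Reg d)" "continuous_on S (Sing d)"
  unfolding Lam_def[abs_def] dLam_def[abs_def] ddLam_def[abs_def] Reg_def[abs_def] Sing_def[abs_def]
  using continuous_on_log_sinsq[OF assms, of UNIV, THEN continuous_on_shift]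
  by (auto intro!: continuous_on_sum continuous_on_mult_left)

lemma periodic_Lam: "periodic (Lam d)" "periodic (dLam d i)" "periodic (Reg d)" "periodic (Sing d)"
  using periodic_log_sinsq[of d, THEN periodic_shift]
  by (auto simp: periodic_def Lam_def dLam_def Reg_def Sing_def)

lemma has_partial_Lam:
  assumes "d > 0"
  shows "has_partial i (Lam d) (dLam d i)" "has_partial i (dLam d i) (ddLam d i)"
  unfolding Lam_def[abs_def] dLam_def[abs_def] ddLam_def[abs_def]
  by (intro has_partial_sum has_partial_cmult has_partial_shift has_partial_log_sinsq assms)+

lemma ddLam_sum:
  assumes "d > 0"
  shows "ddLam d 1 x + ddLam d 2 x = Reg d x + Sing d x"
proof -
  have "N a * ddlog_sinsq d 1 (x - a) + N a * ddlog_sinsq d 2 (x - a) = N a * lap_reg d (x - a) + N a * lap_sing d (x - a)" for a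
    using ddlog_sinsq_sum[of d "x - a"] assms by (simp add: distrib_left[symmetric] add_pos_nonneg)
  then show ?thesis by (simp add: ddLam_def Reg_def Sing_def sum.distrib[symmetric])
qed

text \<open>Close to a the other logarithms are bounded, so |Lam| exceeds |ln (d + sinsq (x - a))|
  up to a constant; elsewhere d + sinsq (x - a) is bounded below and exp \<le> 1 suffices. The
  constant is uniform in d, including d = 0.\<close>

lemma exp_minus_abs_Lam_le:
  obtains C where "C > 0" "\<And>d x a. 0 \<le> d \<Longrightarrow> d \<le> 1 \<Longrightarrow> (\<And>b. b \<in> P \<Longrightarrow> d + sinsq (x - b) > 0) \<Longrightarrow> a \<in> P \<Longrightarrow>
     exp (- \<bar>Lam d x\<bar>) \<le> C * (d + sinsq (x - a))"
proof -
  \<comment> \<open>The element 1 keeps the set nonempty when there are fewer than two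
    poles.\<close>
  define D where "D = insert 1 ((\<lambda>(a, b). sinsq (a - b)) ` {(a, b) \<in> P \<times> P. a \<noteq> b})"
  have "{(a, b) \<in> P \<times> P. a \<noteq> b} \<subseteq> P \<times> P" by auto
  then have D: "finite D" "D \<noteq> {}" unfolding D_def using finite_subset[OF _ finite_cartesian_product[OF finite_P finite_P]] by auto
  define m where "m = Min D"
  have "m \<in> D" unfolding m_def using D by (rule Min_in)
  then have m: "m > 0" unfolding D_def using separated by auto
  have mle: "m \<le> sinsq (a - b)" if "a \<in> P" "b \<in> P" "a \<noteq> b" for a b
    unfolding m_def using D(1) by (rule Min_le) (use that in \<open>auto simp: D_def\<close>)
  define K where "K = \<bar>ln (m / 4)\<bar> + 2"
  define C1 where "C1 = exp (\<Sum>b\<in>P. \<bar>N b\<bar> * K)"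
  define C where "C = C1 + 4 / m"
  have "C > 0" using m by (simp add: C_def C1_def add_pos_pos)
  have "exp (- \<bar>Lam d x\<bar>) \<le> C * (d + sinsq (x - a))"
    if d: "0 \<le> d" "d \<le> 1" and pos: "\<And>b. b \<in> P \<Longrightarrow> d + sinsq (x - b) > 0" and a: "a \<in> P" for d x a
  proof (cases "sinsq (x - a) < m / 4")
    case True
    \<comment> \<open>By the quasi-triangle inequality a point with \<open>sinsq\<close> below m/4
      from a keeps at least m/4 from every other pole.\<close>
    have far: "\<bar>ln (d + sinsq (x - b))\<bar> \<le> K" if "b \<in> P - {a}" for b
    proof -
      have "m \<le> sinsq (a - b)" using mle a that by auto
      also have "sinsq (a - b) \<le> 2 * sinsq (a - x) + 2 * sinsq (x - b)"
        using sinsq_add_le[of "a - x" "x - b"] by simp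
      finally have "sinsq (x - b) \<ge> m / 4" using True by (simp add: sinsq_minus[of a x])
      then have "m / 4 \<le> d + sinsq (x - b)" using d by simp
      then have 1: "ln (m / 4) \<le> ln (d + sinsq (x - b))" using m by simp
      have "ln (d + sinsq (x - b)) \<le> d + sinsq (x - b) - 1"
        using pos that by (intro ln_le_minus_one) auto
      also have "\<dots> \<le> 2" using d sinsq_le_2[of "x - b"] by simp
      finally show ?thesis using 1 unfolding K_def by linarith
    qed
    define l where "l = ln (d + sinsq (x - a))"
    define r where "r = (\<Sum>b\<in>P - {a}. N b * ln (d + sinsq (x - b)))"
    have "\<bar>r\<bar> \<le> (\<Sum>b\<in>P - {a}. \<bar>N b * ln (d + sinsq (x - b))\<bar>)" unfolding r_def by (rule sum_abs)
    also have "\<dots> \<le> (\<Sum>b\<in>P - {a}. \<bar>N b\<bar> * K)"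
      unfolding abs_mult by (intro sum_mono mult_left_mono far) auto
    also have "\<dots> \<le> (\<Sum>b\<in>P. \<bar>N b\<bar> * K)"
      using finite_P by (intro sum_mono2) (auto simp: K_def)
    finally have r: "\<bar>r\<bar> \<le> (\<Sum>b\<in>P. \<bar>N b\<bar> * K)" .
    have "Lam d x = N a * l + r" unfolding Lam_def l_def r_def using finite_P a by (rule sum.remove)
    moreover have "\<bar>N a * l\<bar> \<ge> 1 * \<bar>l\<bar>" unfolding abs_mult using N[OF a] by (intro mult_right_mono) auto
    \<comment> \<open>Here |N a| \<ge> 1 enters through -|N a * l| \<le> -|l| \<le> l, for either
      sign of N a.\<close>
    ultimately have "- \<bar>Lam d x\<bar> \<le> l + (\<Sum>b\<in>P. \<bar>N b\<bar> * K)" using r by linarith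
    then have "exp (- \<bar>Lam d x\<bar>) \<le> exp (l + (\<Sum>b\<in>P. \<bar>N b\<bar> * K))" by simp
    also have "\<dots> = C1 * (d + sinsq (x - a))" using pos[OF a] by (simp add: exp_add l_def C1_def)
    also have "\<dots> \<le> C * (d + sinsq (x - a))" using pos[OF a] m by (intro mult_right_mono) (auto simp: C_def)
    finally show ?thesis .
  next
    case False
    then have "1 \<le> 4 / m * (d + sinsq (x - a))" using m d by (simp add: field_simps)
    also have "\<dots> \<le> C * (d + sinsq (x - a))" using pos[OF a] by (intro mult_right_mono) (auto simp: C_def C1_def)
    finally have "1 \<le> C * (d + sinsq (x - a))" .
    moreover have "exp (- \<bar>Lam d x\<bar>) \<le> 1" by simp
    ultimately show ?thesis by linarith
  qed
  with \<open>C > 0\<close> show ?thesis by (rule that)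
qed

text \<open>A factor of order d + sinsq compensates the squared gradient, of order its inverse, and
  the singular Laplacian, of order d/(d + sinsq)^2. The bound linear in the gradient follows from
  the quadratic one by |y| \<le> y^2 + 1.\<close>

lemma pole_bounds:
  obtains C where "C > 0"
    "\<And>d x i. 0 \<le> d \<Longrightarrow> d \<le> 1 \<Longrightarrow> d > 0 \<or> off_poles x \<Longrightarrow> exp (- \<bar>Lam d x\<bar>) * (dLam d i x)\<^sup>2 \<le> C"
    "\<And>d x i. 0 \<le> d \<Longrightarrow> d \<le> 1 \<Longrightarrow> d > 0 \<or> off_poles x \<Longrightarrow> exp (- \<bar>Lam d x\<bar>) * \<bar>dLam d i x\<bar> \<le> C"
    "\<And>d x. 0 \<le> d \<Longrightarrow> d \<le> 1 \<Longrightarrow> d > 0 \<or> off_poles x \<Longrightarrow> exp (- \<bar>Lam d x\<bar>) * \<bar>Sing d x\<bar> \<le> C"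
proof -
  obtain C0 where C0: "C0 > 0" and le: "\<And>d x a. 0 \<le> d \<Longrightarrow> d \<le> 1 \<Longrightarrow> (\<And>b. b \<in> P \<Longrightarrow> d + sinsq (x - b) > 0) \<Longrightarrow> a \<in> P \<Longrightarrow>
     exp (- \<bar>Lam d x\<bar>) \<le> C0 * (d + sinsq (x - a))"
    using exp_minus_abs_Lam_le by blast
  define C1 where "C1 = real (card P) * (\<Sum>a\<in>P. (N a)\<^sup>2 * (4 * pi\<^sup>2 * C0))"
  define C2 where "C2 = (\<Sum>a\<in>P. \<bar>N a\<bar> * (4 * pi\<^sup>2 * C0))"
  define C where "C = C1 + C2 + 1"
  have C12: "C1 \<ge> 0" "C2 \<ge> 0" unfolding C1_def C2_def using C0
    by (auto intro!: mult_nonneg_nonneg sum_nonneg)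
  have pos: "d + sinsq (x - b) > 0" if "0 \<le> d" "d > 0 \<or> off_poles x" "b \<in> P" for d x b
    using that by (auto simp: off_poles_def add_pos_nonneg add_nonneg_pos)
  have 1: "exp (- \<bar>Lam d x\<bar>) * (dLam d i x)\<^sup>2 \<le> C1" if d: "0 \<le> d" "d \<le> 1" "d > 0 \<or> off_poles x" for d x i
  proof -
    define e where "e = exp (- \<bar>Lam d x\<bar>)"
    have e: "e \<ge> 0" by (simp add: e_def)
    have "(dLam d i x)\<^sup>2 \<le> real (card P) * (\<Sum>a\<in>P. (N a * dlog_sinsq d i (x - a))\<^sup>2)"
      unfolding dLam_def using sum_squared_le_sum_of_squares[of "\<lambda>a. N a * dlog_sinsq d i (x - a)" P] by (simp add: mult.commute)
    then have "e * (dLam d i x)\<^sup>2 \<le> e * (real (card P) * (\<Sum>a\<in>P. (N a * dlog_sinsq d i (x - a))\<^sup>2))"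
      using e by (rule mult_left_mono)
    also have "\<dots> = real (card P) * (\<Sum>a\<in>P. (N a)\<^sup>2 * (e * (dlog_sinsq d i (x - a))\<^sup>2))"
      by (simp add: sum_distrib_left mult_ac power_mult_distrib)
    also have "\<dots> \<le> C1"
      unfolding C1_def
    proof (intro mult_left_mono sum_mono)
      fix a assume a: "a \<in> P"
      define q where "q = d + sinsq (x - a)"
      have q: "q > 0" unfolding q_def by (rule pos[OF d(1,3) a])
      have "(dlog_sinsq d i (x - a))\<^sup>2 \<le> (2 * pi / sqrt q)\<^sup>2"
        unfolding q_def by (rule power2_le_iff_abs_le[THEN iffD2, OF _ abs_dlog_sinsq_le[OF d(1)]])
          (use q in \<open>simp add: q_def less_imp_le\<close>)
      also have "\<dots> = 4 * pi\<^sup>2 / q" using q by (simp add: power_divide power_mult_distrib)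
      finally have "e * (dlog_sinsq d i (x - a))\<^sup>2 \<le> (C0 * q) * (4 * pi\<^sup>2 / q)"
        unfolding e_def using le[OF d(1,2) pos[OF d(1,3)] a] C0 q by (intro mult_mono) (auto simp: q_def)
      also have "\<dots> = 4 * pi\<^sup>2 * C0" using q by simp
      finally show "e * (dlog_sinsq d i (x - a))\<^sup>2 \<le> 4 * pi\<^sup>2 * C0" .
    qed auto
    finally show ?thesis by (simp add: e_def)
  qed
  have 2: "exp (- \<bar>Lam d x\<bar>) * \<bar>dLam d i x\<bar> \<le> C1 + 1" if d: "0 \<le> d" "d \<le> 1" "d > 0 \<or> off_poles x" for d x i
  proof -
    have "\<bar>dLam d i x\<bar> \<le> (dLam d i x)\<^sup>2 + 1"
      using sum_squares_bound[of "\<bar>dLam d i x\<bar>" 1] by simp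
    then have "exp (- \<bar>Lam d x\<bar>) * \<bar>dLam d i x\<bar> \<le> exp (- \<bar>Lam d x\<bar>) * ((dLam d i x)\<^sup>2 + 1)"
      by (intro mult_left_mono) auto
    also have "\<dots> \<le> C1 + 1" using 1[OF d] by (simp add: distrib_left add_mono)
    finally show ?thesis .
  qed
  have 3: "exp (- \<bar>Lam d x\<bar>) * \<bar>Sing d x\<bar> \<le> C2" if d: "0 \<le> d" "d \<le> 1" "d > 0 \<or> off_poles x" for d x
  proof -
    define e where "e = exp (- \<bar>Lam d x\<bar>)"
    have e: "e \<ge> 0" by (simp add: e_def)
    have "\<bar>Sing d x\<bar> \<le> (\<Sum>a\<in>P. \<bar>N a\<bar> * \<bar>lap_sing d (x - a)\<bar>)"
      unfolding Sing_def by (rule order_trans[OF sum_abs]) (simp add: abs_mult)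
    then have "e * \<bar>Sing d x\<bar> \<le> e * (\<Sum>a\<in>P. \<bar>N a\<bar> * \<bar>lap_sing d (x - a)\<bar>)" using e by (rule mult_left_mono)
    also have "\<dots> = (\<Sum>a\<in>P. \<bar>N a\<bar> * (e * \<bar>lap_sing d (x - a)\<bar>))" by (simp add: sum_distrib_left mult_ac)
    also have "\<dots> \<le> C2" unfolding C2_def
    proof (intro sum_mono mult_left_mono)
      fix a assume a: "a \<in> P"
      define q where "q = d + sinsq (x - a)"
      have q: "q > 0" "d \<le> q" unfolding q_def using pos[OF d(1,3) a] by auto
      have "e * \<bar>lap_sing d (x - a)\<bar> \<le> (C0 * q) * (4 * pi\<^sup>2 * (d / q\<^sup>2))"
        unfolding e_def q_def using le[OF d(1,2) pos[OF d(1,3)] a] abs_lap_sing_le[OF d(1)] C0 q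
        by (intro mult_mono) (auto simp: q_def)
      also have "\<dots> = 4 * pi\<^sup>2 * C0 * (d / q)" using q by (simp add: power2_eq_square)
      also have "\<dots> \<le> 4 * pi\<^sup>2 * C0 * 1" using q d C0 by (intro mult_left_mono) auto
      finally show "e * \<bar>lap_sing d (x - a)\<bar> \<le> 4 * pi\<^sup>2 * C0" by simp
    qed auto
    finally show ?thesis by (simp add: e_def)
  qed
  show ?thesis
  proof (rule that[of C])
    show "C > 0" using C12 by (simp add: C_def)
    fix d :: real and x i assume d: "0 \<le> d" "d \<le> 1" "d > 0 \<or> off_poles x"
    show "exp (- \<bar>Lam d x\<bar>) * (dLam d i x)\<^sup>2 \<le> C" using 1[OF d, of i] C12 unfolding C_def by linarith
    show "exp (- \<bar>Lam d x\<bar>) * \<bar>dLam d i x\<bar> \<le> C" using 2[OF d, of i] C12 unfolding C_def by linarith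
    show "exp (- \<bar>Lam d x\<bar>) * \<bar>Sing d x\<bar> \<le> C" using 3[OF d] C12 unfolding C_def by linarith
  qed
qed

lemma Lam_tendsto:
  assumes d: "d \<longlonglongrightarrow> 0" and x: "off_poles x"
  shows "(\<lambda>n. Lam (d n) x) \<longlonglongrightarrow> Lam 0 x" "(\<lambda>n. dLam (d n) i x) \<longlonglongrightarrow> dLam 0 i x"
    "(\<lambda>n. Reg (d n) x) \<longlonglongrightarrow> Reg 0 x" "(\<lambda>n. Sing (d n) x) \<longlonglongrightarrow> 0"
proof -
  have p: "0 + sinsq (x - a) \<noteq> 0" if "a \<in> P" for a using x that by (auto simp: off_poles_def)
  show "(\<lambda>n. Lam (d n) x) \<longlonglongrightarrow> Lam 0 x" unfolding Lam_def using p by (intro tendsto_intros d) auto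
  show "(\<lambda>n. dLam (d n) i x) \<longlonglongrightarrow> dLam 0 i x" unfolding dLam_def dlog_sinsq_def using p by (intro tendsto_intros d) auto
  show "(\<lambda>n. Reg (d n) x) \<longlonglongrightarrow> Reg 0 x" unfolding Reg_def lap_reg_def using p by (intro tendsto_intros d) auto
  have "(\<lambda>n. Sing (d n) x) \<longlonglongrightarrow> Sing 0 x" unfolding Sing_def lap_sing_def using p by (intro tendsto_intros d) auto
  then show "(\<lambda>n. Sing (d n) x) \<longlonglongrightarrow> 0" by (simp add: Sing_def lap_sing_def)
qed

definition step :: "nat \<Rightarrow> real" where "step n = 1 / (real n + 1)"

lemma step: "0 < step n" "step n \<le> 1" "step \<longlonglongrightarrow> 0"
proof -
  show "step \<longlonglongrightarrow> 0" unfolding step_def by real_asymp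
qed (auto simp: step_def)

lemma borel_measurable_limit_off_poles:
  fixes g :: "real^2 \<Rightarrow> real"
  assumes "\<And>n. continuous_on UNIV (G n)" "\<And>x. off_poles x \<Longrightarrow> (\<lambda>n. G n x) \<longlonglongrightarrow> g x"
  shows "g \<in> borel_measurable torus"
proof -
  have [measurable]: "G n \<in> borel_measurable torus" for n
    by (intro measurable_torus_borel borel_measurable_continuous_onI assms)
  have "(\<lambda>x. lim (\<lambda>n. G n x)) \<in> borel_measurable torus" by measurable
  moreover have "AE x in torus. lim (\<lambda>n. G n x) = g x"
    using AE_off_poles by eventually_elim (rule limI[OF assms(2)])
  ultimately show ?thesis
    by (rule borel_measurable_AE_torus)
qed

lemma measurable_Lam0: "Lam 0 \<in> borel_measurable torus" "dLam 0 i \<in> borel_measurable torus" "Reg 0 \<in> borel_measurable torus"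
proof -
  show "Lam 0 \<in> borel_measurable torus"
    by (rule borel_measurable_limit_off_poles[of "\<lambda>n. Lam (step n)"]) (intro continuous_on_Lam Lam_tendsto step; assumption)+
  show "dLam 0 i \<in> borel_measurable torus"
    by (rule borel_measurable_limit_off_poles[of "\<lambda>n. dLam (step n) i"]) (intro continuous_on_Lam Lam_tendsto step; assumption)+
  show "Reg 0 \<in> borel_measurable torus"
    by (rule borel_measurable_limit_off_poles[of "\<lambda>n. Reg (step n)"]) (intro continuous_on_Lam Lam_tendsto step; assumption)+
qed

lemma abs_Reg_le: "0 \<le> d \<Longrightarrow> \<bar>Reg d x\<bar> \<le> (\<Sum>a\<in>P. \<bar>N a\<bar> * (2 * pi\<^sup>2))"
  unfolding Reg_def
  by (rule order_trans[OF sum_abs]) (auto simp: abs_mult intro!: sum_mono mult_left_mono abs_lap_reg_le)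

lemma L2_Reg: "L2 (Reg 0)"
  using square_integrable_bounded[OF finite_measure_torus measurable_Lam0(3) AE_I2[OF abs_Reg_le[OF order_refl]]]
  by (simp add: L2_iff periodic_Lam)

text \<open>Uniformly in n, the regularised potentials and their gradients are dominated by
  constants plus multiples of \<open>1 / sqrt (sinsq (x - a))\<close>.\<close>

lemma L1_Lam:
  "L1 (Lam 0)" "(\<lambda>n. LINT x|torus. \<bar>Lam (step n) x - Lam 0 x\<bar>) \<longlonglongrightarrow> 0"
  "L1 (dLam 0 i)" "(\<lambda>n. LINT x|torus. \<bar>dLam (step n) i x - dLam 0 i x\<bar>) \<longlonglongrightarrow> 0"
proof -
  define w where "w x = (\<Sum>a\<in>P. \<bar>N a\<bar> * (2 + 2 * (1 / sqrt (sinsq (x - a)))))" for x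
  define w' where "w' x = (\<Sum>a\<in>P. \<bar>N a\<bar> * (2 * pi * (1 / sqrt (sinsq (x - a)))))" for x
  note i = integrable_inverse_sqrt_sinsq finite_measure.integrable_const[OF finite_measure_torus]
  have w: "integrable torus w"
    unfolding w_def by (intro Bochner_Integration.integrable_sum integrable_mult_right Bochner_Integration.integrable_add i)
  have w': "integrable torus w'"
    unfolding w'_def by (intro Bochner_Integration.integrable_sum integrable_mult_right i)
  have m: "Lam (step n) \<in> borel_measurable torus" "dLam (step n) i \<in> borel_measurable torus" for n
    by (intro measurable_torus_borel borel_measurable_continuous_onI continuous_on_Lam step)+
  have b: "AE x in torus. \<bar>Lam (step n) x\<bar> \<le> w x" for n
    using AE_off_poles
  proof eventually_elim
    case (elim x)
    show ?case unfolding Lam_def w_def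
      by (rule order_trans[OF sum_abs], unfold abs_mult, intro sum_mono mult_left_mono abs_ln_sinsq_le)
         (use elim step(1,2)[of n] in \<open>auto simp: off_poles_def less_imp_le\<close>)
  qed
  have b': "AE x in torus. \<bar>dLam (step n) i x\<bar> \<le> w' x" for n
    using AE_off_poles
  proof eventually_elim
    case (elim x)
    show ?case unfolding dLam_def w'_def
    proof (rule order_trans[OF sum_abs], unfold abs_mult, intro sum_mono mult_left_mono)
      fix a assume "a \<in> P"
      then have q: "sinsq (x - a) > 0" using elim by (auto simp: off_poles_def)
      have "\<bar>dlog_sinsq (step n) i (x - a)\<bar> \<le> 2 * pi / sqrt (step n + sinsq (x - a))"
        by (rule abs_dlog_sinsq_le) (simp add: step less_imp_le)
      also have "\<dots> \<le> 2 * pi / sqrt (sinsq (x - a))"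
        using q step(1)[of n] by (intro divide_left_mono) auto
      finally show "\<bar>dlog_sinsq (step n) i (x - a)\<bar> \<le> 2 * pi * (1 / sqrt (sinsq (x - a)))" by simp
    qed simp
  qed
  have l: "AE x in torus. (\<lambda>n. Lam (step n) x) \<longlonglongrightarrow> Lam 0 x"
    using AE_off_poles by eventually_elim (intro Lam_tendsto step)
  have l': "AE x in torus. (\<lambda>n. dLam (step n) i x) \<longlonglongrightarrow> dLam 0 i x"
    using AE_off_poles by eventually_elim (intro Lam_tendsto step)
  show "L1 (Lam 0)" "L1 (dLam 0 i)"
    using dominated_imp_L1_convergence(1)[OF m(1) measurable_Lam0(1) w b l]
      dominated_imp_L1_convergence(1)[OF m(2) measurable_Lam0(2) w' b' l']
    by (simp_all add: L1_def periodic_Lam)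
  show "(\<lambda>n. LINT x|torus. \<bar>Lam (step n) x - Lam 0 x\<bar>) \<longlonglongrightarrow> 0"
    by (rule dominated_imp_L1_convergence(2)[OF m(1) measurable_Lam0(1) w b l])
  show "(\<lambda>n. LINT x|torus. \<bar>dLam (step n) i x - dLam 0 i x\<bar>) \<longlonglongrightarrow> 0"
    by (rule dominated_imp_L1_convergence(2)[OF m(2) measurable_Lam0(2) w' b' l'])
qed

lemma has_weak_partial_Lam: "has_weak_partial i (Lam 0) (dLam 0 i)"
  by (rule has_weak_partial_limit[of "\<lambda>n. Lam (step n)" _ "\<lambda>n. dLam (step n) i"])
     (intro periodic_Lam has_partial_Lam continuous_on_Lam step L1_Lam)+

text \<open>A Dirac mass at a has k-th coefficient \<open>trig2 k a\<close>, so this states that the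
  Laplacian of \<open>Lam 0\<close> is 4\<pi> times the weighted masses plus \<open>Reg 0\<close>.
  It is computed classically for \<open>Lam (step n)\<close>, and the two parts converge
  separately.\<close>

lemma Lam_distributional_laplacian:
  "- 4 * pi\<^sup>2 * ((k$1)\<^sup>2 + (k$2)\<^sup>2) * coef (Lam 0) k = 4 * pi * (\<Sum>a\<in>P. N a * trig2 k a) + coef (Reg 0) k"
proof -
  have m: "- 4 * pi\<^sup>2 * ((k$1)\<^sup>2 + (k$2)\<^sup>2) * coef (Lam (step n)) k =
      coef (Reg (step n)) k + (\<Sum>a\<in>P. N a * (LINT x|torus. lap_sing (step n) (x - a) * trig2 k x))" for n
  proof -
    have c: "continuous_on UNIV (Lam (step n))" "continuous_on UNIV (dLam (step n) i)" "continuous_on UNIV (ddLam (step n) i)"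
      "continuous_on UNIV (Reg (step n))" "continuous_on UNIV (Sing (step n))" for i
      by (intro continuous_on_Lam step)+
    have int: "integrable torus (\<lambda>x. H x * trig2 k x)" if "continuous_on UNIV H" for H
      by (intro integrable_torus_continuous continuous_intros that continuous_on_trig2)
    have 1: "coef (ddLam (step n) i) k = - 4 * pi\<^sup>2 * (k$i)\<^sup>2 * coef (Lam (step n)) k" for i
    proof -
      have p: "coef G' l = - 2 * pi * (l$i) * coef G (flip i l)"
        if "periodic G" "has_partial i G G'" "continuous_on UNIV G" "continuous_on UNIV G'" for G G' l
      proof -
        have "(LINT x|torus. G x * partial_deriv i (trig2 l) x) = - coef G' l"
          unfolding coef_def
          by (rule integration_by_parts_torus[OF that test_function_C_k(1) test_function_has_partial test_function_continuous
              test_function_partial_continuous]) (rule test_function_trig2)+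
        moreover have "(LINT x|torus. G x * partial_deriv i (trig2 l) x) = (LINT x|torus. (2 * pi * (l$i)) * (G x * trig2 (flip i l) x))"
          by (simp add: partial_deriv_trig2 mult_ac)
        ultimately show ?thesis by (simp add: coef_def)
      qed
      show ?thesis
        using p[OF periodic_Lam(2) has_partial_Lam(2)[OF step(1)] c(2) c(3), of k]
          p[OF periodic_Lam(1) has_partial_Lam(1)[OF step(1)] c(1) c(2), of "flip i k"]
        by (simp add: power2_eq_square)
    qed
    have "coef (ddLam (step n) 1) k + coef (ddLam (step n) 2) k = (LINT x|torus. (ddLam (step n) 1 x + ddLam (step n) 2 x) * trig2 k x)"
      unfolding coef_def distrib_right by (intro Bochner_Integration.integral_add[symmetric] int c)
    also have "\<dots> = (LINT x|torus. Reg (step n) x * trig2 k x + Sing (step n) x * trig2 k x)"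
      by (simp add: ddLam_sum step distrib_right)
    also have "\<dots> = coef (Reg (step n)) k + (LINT x|torus. Sing (step n) x * trig2 k x)"
      unfolding coef_def by (intro Bochner_Integration.integral_add int c)
    also have "(LINT x|torus. Sing (step n) x * trig2 k x) = (LINT x|torus. (\<Sum>a\<in>P. N a * (lap_sing (step n) (x - a) * trig2 k x)))"
      by (simp add: Sing_def sum_distrib_right mult.assoc)
    also have "\<dots> = (\<Sum>a\<in>P. N a * (LINT x|torus. lap_sing (step n) (x - a) * trig2 k x))"
      using int[OF continuous_on_shift[OF continuous_on_log_sinsq(5)[OF step(1)]]]
      by (subst Bochner_Integration.integral_sum) (auto intro: integrable_mult_right)
    finally show ?thesis unfolding 1 by (simp add: algebra_simps)
  qed
  have tm: "trig2 k \<in> borel_measurable torus" using square_integrable_trig2[of k] by (simp add: square_integrable_def)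
  have "(\<lambda>n. LINT x|torus. trig2 k x * Lam (step n) x) \<longlonglongrightarrow> (LINT x|torus. trig2 k x * Lam 0 x)"
    by (rule tendsto_integral_bounded_mult(2)[where a = "\<lambda>n. trig2 k" and C = 2])
       (use abs_trig2_le tm L1_Lam in \<open>auto simp: L1_def intro!: integrable_torus_continuous continuous_on_Lam step\<close>)
  then have "(\<lambda>n. coef (Lam (step n)) k) \<longlonglongrightarrow> coef (Lam 0) k" by (simp add: coef_def mult.commute)
  then have lhs: "(\<lambda>n. - 4 * pi\<^sup>2 * ((k$1)\<^sup>2 + (k$2)\<^sup>2) * coef (Lam (step n)) k) \<longlonglongrightarrow> - 4 * pi\<^sup>2 * ((k$1)\<^sup>2 + (k$2)\<^sup>2) * coef (Lam 0) k"
    by (intro tendsto_mult tendsto_const)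
  have "(\<lambda>n. LINT x|torus. Reg (step n) x * trig2 k x) \<longlonglongrightarrow> (LINT x|torus. Reg 0 x * trig2 k x)"
  proof (rule tendsto_integral_bounded_mult(2)[where C = "\<Sum>a\<in>P. \<bar>N a\<bar> * (2 * pi\<^sup>2)"])
    show "AE x in torus. (\<lambda>n. Reg (step n) x) \<longlonglongrightarrow> Reg 0 x"
      using AE_off_poles by (eventually_elim, intro Lam_tendsto step)
    show "Reg (step n) \<in> borel_measurable torus" for n
      by (intro measurable_torus_borel borel_measurable_continuous_onI continuous_on_Lam step)
  qed (use abs_Reg_le step(1) measurable_Lam0(3) in \<open>auto simp: less_imp_le intro: integrable_torus_continuous continuous_on_trig2\<close>)
  then have "(\<lambda>n. coef (Reg (step n)) k) \<longlonglongrightarrow> coef (Reg 0) k" by (simp add: coef_def)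
  moreover have "(\<lambda>n. \<Sum>a\<in>P. N a * (LINT x|torus. lap_sing (step n) (x - a) * trig2 k x)) \<longlonglongrightarrow> (\<Sum>a\<in>P. N a * (4 * pi * trig2 k a))"
    by (intro tendsto_sum tendsto_mult tendsto_const lap_sing_tendsto_delta step)
  ultimately have "(\<lambda>n. coef (Reg (step n)) k + (\<Sum>a\<in>P. N a * (LINT x|torus. lap_sing (step n) (x - a) * trig2 k x)))
     \<longlonglongrightarrow> coef (Reg 0) k + (\<Sum>a\<in>P. N a * (4 * pi * trig2 k a))"
    by (rule tendsto_add)
  then have "- 4 * pi\<^sup>2 * ((k$1)\<^sup>2 + (k$2)\<^sup>2) * coef (Lam 0) k = coef (Reg 0) k + (\<Sum>a\<in>P. N a * (4 * pi * trig2 k a))"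
    using lhs unfolding m by (rule LIMSEQ_unique[rotated])
  then show ?thesis by (simp add: sum_distrib_left mult_ac)
qed

end

section \<open>Compositions with a singular potential\<close>

lemma real_tendsto_sandwich_0:
  fixes f g :: "nat \<Rightarrow> real"
  assumes "\<And>n. 0 \<le> f n" "\<And>n. f n \<le> g n" "g \<longlonglongrightarrow> 0"
  shows "f \<longlonglongrightarrow> 0"
  by (rule tendsto_sandwich[OF always_eventually always_eventually tendsto_const assms(3)]) (use assms in auto)

text \<open>The splitting used for the convergence of integrals, now in the L1 norm, as
  \<open>has_weak_partial_limit\<close> asks for L1 convergence of derivatives.\<close>

lemma L1_tendsto_bounded_mult:
  fixes a :: "nat \<Rightarrow> 'a \<Rightarrow> real"
  assumes a: "\<And>n. a n \<in> borel_measurable M" "\<And>n x. x \<in> space M \<Longrightarrow> \<bar>a n x\<bar> \<le> C" "AE x in M. (\<lambda>n. a n x) \<longlonglongrightarrow> A x"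
      "A \<in> borel_measurable M"
    and b: "\<And>n. integrable M (b n)" "integrable M B" "(\<lambda>n. \<integral>x. \<bar>b n x - B x\<bar> \<partial>M) \<longlonglongrightarrow> 0"
  shows "(\<lambda>n. \<integral>x. \<bar>a n x * b n x - A x * B x\<bar> \<partial>M) \<longlonglongrightarrow> 0"
proof -
  note a(1)[measurable] a(4)[measurable]
  have [measurable]: "B \<in> borel_measurable M" "b n \<in> borel_measurable M" for n
    using b by auto
  have A: "AE x in M. \<bar>A x\<bar> \<le> C"
    using a(3) AE_space
  proof eventually_elim
    case (elim x)
    then have "(\<lambda>n. \<bar>a n x\<bar>) \<longlonglongrightarrow> \<bar>A x\<bar>" by (intro tendsto_rabs)
    then show ?case by (rule LIMSEQ_le_const2) (use a(2) elim in auto)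
  qed
  have lim2: "(\<lambda>n. \<integral>x. \<bar>a n x * B x - A x * B x\<bar> \<partial>M) \<longlonglongrightarrow> 0"
  proof (rule dominated_imp_L1_convergence(2))
    show "integrable M (\<lambda>x. C * \<bar>B x\<bar>)" using b(2) by simp
    show "AE x in M. (\<lambda>n. a n x * B x) \<longlonglongrightarrow> A x * B x"
      using a(3) by eventually_elim (intro tendsto_intros)
    show "AE x in M. \<bar>a n x * B x\<bar> \<le> C * \<bar>B x\<bar>" for n
      by (rule AE_I2) (use a(2) in \<open>auto simp: abs_mult mult_right_mono\<close>)
  qed measurable
  have AB: "integrable M (\<lambda>x. A x * B x)"
    by (rule tendsto_integral_bounded_mult(1)[OF a b])
  have ib: "integrable M (\<lambda>x. a n x * w x)" if "integrable M w" for w n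
  proof (rule Bochner_Integration.integrable_bound)
    show "integrable M (\<lambda>x. C * w x)" using that by simp
    show "(\<lambda>x. a n x * w x) \<in> borel_measurable M" using that by auto
    show "AE x in M. norm (a n x * w x) \<le> norm (C * w x)"
    proof (rule AE_I2)
      fix x assume "x \<in> space M"
      then have "\<bar>a n x\<bar> \<le> \<bar>C\<bar>" using a(2)[of x n] by linarith
      then show "norm (a n x * w x) \<le> norm (C * w x)" by (simp add: abs_mult mult_right_mono)
    qed
  qed
  have "(\<integral>x. \<bar>a n x * b n x - A x * B x\<bar> \<partial>M) \<le> C * (\<integral>x. \<bar>b n x - B x\<bar> \<partial>M) + (\<integral>x. \<bar>a n x * B x - A x * B x\<bar> \<partial>M)" for n
  proof -
    have i: "integrable M (\<lambda>x. C * \<bar>b n x - B x\<bar>)" "integrable M (\<lambda>x. \<bar>a n x * B x - A x * B x\<bar>)"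
      "integrable M (\<lambda>x. \<bar>a n x * b n x - A x * B x\<bar>)"
      using b AB ib by auto
    have "(\<integral>x. \<bar>a n x * b n x - A x * B x\<bar> \<partial>M) \<le> (\<integral>x. C * \<bar>b n x - B x\<bar> + \<bar>a n x * B x - A x * B x\<bar> \<partial>M)"
    proof (rule integral_mono)
      fix x assume x: "x \<in> space M"
      have "a n x * b n x - A x * B x = a n x * (b n x - B x) + (a n x * B x - A x * B x)" by (simp add: algebra_simps)
      also have "\<bar>\<dots>\<bar> \<le> \<bar>a n x\<bar> * \<bar>b n x - B x\<bar> + \<bar>a n x * B x - A x * B x\<bar>"
        by (rule order_trans[OF abs_triangle_ineq]) (simp add: abs_mult)
      also have "\<dots> \<le> C * \<bar>b n x - B x\<bar> + \<bar>a n x * B x - A x * B x\<bar>"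
        using a(2)[OF x] by (intro add_right_mono mult_right_mono) auto
      finally show "\<bar>a n x * b n x - A x * B x\<bar> \<le> C * \<bar>b n x - B x\<bar> + \<bar>a n x * B x - A x * B x\<bar>" .
    qed (use i in auto)
    also have "\<dots> = C * (\<integral>x. \<bar>b n x - B x\<bar> \<partial>M) + (\<integral>x. \<bar>a n x * B x - A x * B x\<bar> \<partial>M)"
      using i by simp
    finally show ?thesis .
  qed
  note le = this
  have "(\<lambda>n. C * (\<integral>x. \<bar>b n x - B x\<bar> \<partial>M) + (\<integral>x. \<bar>a n x * B x - A x * B x\<bar> \<partial>M)) \<longlonglongrightarrow> C * 0 + 0"
    by (intro tendsto_intros b lim2)
  then show ?thesis
    by (intro real_tendsto_sandwich_0[OF _ le]) simp_all
qed

lemma L1_tendsto_add: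
  fixes f :: "nat \<Rightarrow> 'a \<Rightarrow> real"
  assumes i: "\<And>n. integrable M (f n)" "integrable M F" "\<And>n. integrable M (g n)" "integrable M G"
    and l: "(\<lambda>n. \<integral>x. \<bar>f n x - F x\<bar> \<partial>M) \<longlonglongrightarrow> 0" "(\<lambda>n. \<integral>x. \<bar>g n x - G x\<bar> \<partial>M) \<longlonglongrightarrow> 0"
  shows "(\<lambda>n. \<integral>x. \<bar>(f n x + g n x) - (F x + G x)\<bar> \<partial>M) \<longlonglongrightarrow> 0"
proof -
  have "(\<integral>x. \<bar>(f n x + g n x) - (F x + G x)\<bar> \<partial>M) \<le> (\<integral>x. \<bar>f n x - F x\<bar> \<partial>M) + (\<integral>x. \<bar>g n x - G x\<bar> \<partial>M)" for n
  proof -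
    have "(\<integral>x. \<bar>(f n x + g n x) - (F x + G x)\<bar> \<partial>M) \<le> (\<integral>x. \<bar>f n x - F x\<bar> + \<bar>g n x - G x\<bar> \<partial>M)"
      using i by (intro integral_mono) auto
    also have "\<dots> = (\<integral>x. \<bar>f n x - F x\<bar> \<partial>M) + (\<integral>x. \<bar>g n x - G x\<bar> \<partial>M)"
      using i by simp
    finally show ?thesis .
  qed
  note le = this
  have "(\<lambda>n. (\<integral>x. \<bar>f n x - F x\<bar> \<partial>M) + (\<integral>x. \<bar>g n x - G x\<bar> \<partial>M)) \<longlonglongrightarrow> 0 + 0"
    by (intro tendsto_add l)
  then show ?thesis
    by (intro real_tendsto_sandwich_0[OF _ le]) simp_all
qed

lemma integrable_const_torus: "integrable torus (\<lambda>x. c :: real)"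
  by (rule finite_measure.integrable_const[OF finite_measure_torus])

text \<open>Here \<open>u\<close> is any H2 perturbation. It is later instantiated with \<tau> plus
  the unknown function, which makes \<open>w\<close> equal to the exponent \<sigma> + u.\<close>

locale perturbed_potential = log_potential +
  fixes u :: "real^2 \<Rightarrow> real"
  assumes H2_u: "H2 u"
begin

definition w :: "real^2 \<Rightarrow> real" where "w x = Lam 0 x + u x"

text \<open>An explicit representative of the weak gradient, split into a part singular at the poles
  and a part in L2, which call for different estimates.\<close>

definition dw :: "2 \<Rightarrow> real^2 \<Rightarrow> real" where "dw i x = dLam 0 i x + weak_partial i u x"

lemma H1_u: "H1 u" by (rule H2_imp_H1[OF H2_u])

lemma has_weak_partial_w: "has_weak_partial i w (dw i)"
  unfolding w_def[abs_def] dw_def[abs_def]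
  by (intro has_weak_partial_add has_weak_partial_Lam H1_weak_partial H1_u)

lemma measurable_u: "u \<in> borel_measurable torus"
  using H1_imp_L2[OF H1_u] by (simp add: L2_def)

lemma measurable_w: "w \<in> borel_measurable torus"
  unfolding w_def[abs_def] by (intro borel_measurable_add measurable_Lam0 measurable_u)

lemma periodic_w: "periodic w"
  using periodic_Lam(1)[of 0] H1_imp_L2[OF H1_u] by (simp add: periodic_def w_def L2_def)

lemma measurable_weak_partial: "H1 \<phi> \<Longrightarrow> weak_partial i \<phi> \<in> borel_measurable torus"
  using H1_weak_partial(2) by (simp add: L2_def)

lemma measurable_comp_w: "continuous_on UNIV G \<Longrightarrow> (\<lambda>x. G (w x)) \<in> borel_measurable torus" for G :: "real \<Rightarrow> real"
  using measurable_compose[OF measurable_w borel_measurable_continuous_onI] by simp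

text \<open>A perturbation bounded by B changes exp (- |Lam|) by at most the factor exp B, so the
  pole bounds survive for \<open>Lam (step n) + U n\<close> uniformly in n. They are bundled because
  the chain rule and the pairing with the potential draw on the same approximants.\<close>

lemma approximation:
  obtains U D B C where "smooth_approx u U D B" "C > 0" "AE x in torus. \<bar>u x\<bar> \<le> B"
    "\<And>n x i. exp (- \<bar>Lam (step n) x + U n x\<bar>) * \<bar>dLam (step n) i x\<bar> \<le> C"
    "\<And>n x i. exp (- \<bar>Lam (step n) x + U n x\<bar>) * (dLam (step n) i x)\<^sup>2 \<le> C"
    "\<And>n x. exp (- \<bar>Lam (step n) x + U n x\<bar>) * \<bar>Sing (step n) x\<bar> \<le> C"
    "\<And>i. AE x in torus. exp (- \<bar>w x\<bar>) * \<bar>dLam 0 i x\<bar> \<le> C"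
    "\<And>i. AE x in torus. exp (- \<bar>w x\<bar>) * (dLam 0 i x)\<^sup>2 \<le> C"
    "AE x in torus. (\<lambda>n. Lam (step n) x + U n x) \<longlonglongrightarrow> w x"
proof -
  obtain U D B where A: "smooth_approx u U D B" using H2_approx[OF H2_u] by blast
  note UB = smooth_approxD[OF A]
  obtain C0 where C0: "C0 > 0"
    "\<And>d x i. 0 \<le> d \<Longrightarrow> d \<le> 1 \<Longrightarrow> d > 0 \<or> off_poles x \<Longrightarrow> exp (- \<bar>Lam d x\<bar>) * (dLam d i x)\<^sup>2 \<le> C0"
    "\<And>d x i. 0 \<le> d \<Longrightarrow> d \<le> 1 \<Longrightarrow> d > 0 \<or> off_poles x \<Longrightarrow> exp (- \<bar>Lam d x\<bar>) * \<bar>dLam d i x\<bar> \<le> C0"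
    "\<And>d x. 0 \<le> d \<Longrightarrow> d \<le> 1 \<Longrightarrow> d > 0 \<or> off_poles x \<Longrightarrow> exp (- \<bar>Lam d x\<bar>) * \<bar>Sing d x\<bar> \<le> C0"
    using pole_bounds by blast
  define C where "C = exp B * C0"
  have C: "C > 0" using C0 by (simp add: C_def)
  have uB: "AE x in torus. \<bar>u x\<bar> \<le> B"
    using UB(6)
  proof eventually_elim
    case (elim x)
    then have "(\<lambda>n. \<bar>U n x\<bar>) \<longlonglongrightarrow> \<bar>u x\<bar>" by (rule tendsto_rabs)
    then show ?case by (rule LIMSEQ_le_const2) (use UB(5) in auto)
  qed
  have key: "exp (- \<bar>l + t\<bar>) * z \<le> C" if "\<bar>t\<bar> \<le> B" "exp (- \<bar>l\<bar>) * z \<le> C0" "z \<ge> 0" for l t z :: real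
  proof -
    have "- \<bar>l + t\<bar> \<le> B + - \<bar>l\<bar>" using that(1) by linarith
    then have "exp (- \<bar>l + t\<bar>) \<le> exp (B + - \<bar>l\<bar>)" by simp
    then have "exp (- \<bar>l + t\<bar>) * z \<le> exp (B + - \<bar>l\<bar>) * z" using that(3) by (rule mult_right_mono)
    also have "\<dots> = exp B * (exp (- \<bar>l\<bar>) * z)" by (simp only: exp_add mult.assoc)
    also have "\<dots> \<le> C" unfolding C_def using that(2) by (intro mult_left_mono) auto
    finally show ?thesis .
  qed
  have st: "0 \<le> step n" for n using step(1)[of n] by simp
  have ae: "AE x in torus. off_poles x \<and> \<bar>u x\<bar> \<le> B" using AE_off_poles uB by eventually_elim simp
  show ?thesis
  proof (rule that[OF A C uB])
    show "exp (- \<bar>Lam (step n) x + U n x\<bar>) * \<bar>dLam (step n) i x\<bar> \<le> C" for n x i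
      by (intro key UB(5) C0(3)) (simp_all add: st step)
    show "exp (- \<bar>Lam (step n) x + U n x\<bar>) * (dLam (step n) i x)\<^sup>2 \<le> C" for n x i
      by (intro key UB(5) C0(2)) (simp_all add: st step)
    show "exp (- \<bar>Lam (step n) x + U n x\<bar>) * \<bar>Sing (step n) x\<bar> \<le> C" for n x
      by (intro key UB(5) C0(4)) (simp_all add: st step)
    show "AE x in torus. exp (- \<bar>w x\<bar>) * \<bar>dLam 0 i x\<bar> \<le> C" for i
      using ae unfolding w_def by eventually_elim (intro key C0(3), auto)
    show "AE x in torus. exp (- \<bar>w x\<bar>) * (dLam 0 i x)\<^sup>2 \<le> C" for i
      using ae unfolding w_def by eventually_elim (intro key C0(2), auto)
    show "AE x in torus. (\<lambda>n. Lam (step n) x + U n x) \<longlonglongrightarrow> w x"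
      using AE_off_poles UB(6) unfolding w_def by eventually_elim (intro tendsto_add Lam_tendsto step)
  qed
qed

text \<open>The decay e of the first factor is spent on the singular factor b, while c is merely
  bounded.\<close>

lemma abs_mult3_le: "\<bar>a * (b * c)\<bar> \<le> K * (C * B)"
  if "\<bar>a\<bar> \<le> K * e" "e * \<bar>b\<bar> \<le> C" "\<bar>c\<bar> \<le> B" "K \<ge> 0" "C \<ge> 0" for a b c K e C B :: real
proof -
  have "\<bar>a * b\<bar> \<le> K * (e * \<bar>b\<bar>)" unfolding abs_mult using that(1) by (simp add: mult.assoc[symmetric] mult_right_mono)
  also have "\<dots> \<le> K * C" using that by (intro mult_left_mono)
  finally have "\<bar>a * b\<bar> * \<bar>c\<bar> \<le> (K * C) * B" using that by (intro mult_mono mult_nonneg_nonneg) auto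
  then show ?thesis by (simp add: abs_mult mult.assoc)
qed

text \<open>The classical product and chain rules for the approximants pass to the limit in L1: the
  decay of g bounds g(w) dLam, and the gradients of u and \<phi> appear with bounded coefficients.
  The factor \<phi> lets one statement provide both h(w) \<phi> and, with \<phi> = 1, F(w).\<close>

lemma chain_rule:
  fixes G g :: "real \<Rightarrow> real"
  assumes DG: "\<And>t. (G has_real_derivative g t) (at t)" and gc: "continuous_on UNIV g"
    and GK: "\<And>t. \<bar>G t\<bar> \<le> K" and gK: "\<And>t. \<bar>g t\<bar> \<le> K * exp (- \<bar>t\<bar>)" and \<phi>: "H2 \<phi>"
  defines "g' \<equiv> \<lambda>i x. g (w x) * (dLam 0 i x * \<phi> x) + (g (w x) * \<phi> x) * weak_partial i u x + G (w x) * weak_partial i \<phi> x"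
  shows "has_weak_partial i (\<lambda>x. G (w x) * \<phi> x) (g' i)" "L2 (g' i)" "L2 (\<lambda>x. G (w x) * \<phi> x)"
proof -
  have K: "K \<ge> 0" using GK[of 0] by linarith
  have Gc: "continuous_on UNIV G" by (rule DERIV_continuous_on[OF DG])
  have H1\<phi>: "H1 \<phi>" by (rule H2_imp_H1[OF \<phi>])
  obtain U D B C where A: "smooth_approx u U D B" and C: "C > 0" and uB: "AE x in torus. \<bar>u x\<bar> \<le> B"
    and e2: "\<And>n x i. exp (- \<bar>Lam (step n) x + U n x\<bar>) * \<bar>dLam (step n) i x\<bar> \<le> C"
    and "\<And>n x i. exp (- \<bar>Lam (step n) x + U n x\<bar>) * (dLam (step n) i x)\<^sup>2 \<le> C"
    "\<And>n x. exp (- \<bar>Lam (step n) x + U n x\<bar>) * \<bar>Sing (step n) x\<bar> \<le> C"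
    and e3: "\<And>i. AE x in torus. exp (- \<bar>w x\<bar>) * \<bar>dLam 0 i x\<bar> \<le> C"
    and "\<And>i. AE x in torus. exp (- \<bar>w x\<bar>) * (dLam 0 i x)\<^sup>2 \<le> C"
    and W: "AE x in torus. (\<lambda>n. Lam (step n) x + U n x) \<longlonglongrightarrow> w x"
    using approximation by blast
  note UB = smooth_approxD[OF A]
  obtain V E B' where A': "smooth_approx \<phi> V E B'" using H2_approx[OF \<phi>] by blast
  note VB = smooth_approxD[OF A']
  have B': "B' \<ge> 0" using VB(5)[of 0 0] by linarith
  have \<phi>B: "AE x in torus. \<bar>\<phi> x\<bar> \<le> B'"
    using VB(6)
  proof eventually_elim
    case (elim x)
    then have "(\<lambda>n. \<bar>V n x\<bar>) \<longlonglongrightarrow> \<bar>\<phi> x\<bar>" by (rule tendsto_rabs)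
    then show ?case by (rule LIMSEQ_le_const2) (use VB(5) in auto)
  qed
  define Wn where "Wn n x = Lam (step n) x + U n x" for n x
  have gK1: "\<bar>g t\<bar> \<le> K" for t
    by (rule order_trans[OF gK]) (use K in \<open>simp add: mult_left_le\<close>)
  have Wc: "continuous_on UNIV (Wn n)" for n unfolding Wn_def by (intro continuous_intros continuous_on_Lam step UB)
  have cc: "continuous_on UNIV (\<lambda>x. G (Wn n x))" "continuous_on UNIV (\<lambda>x. g (Wn n x))" for n
    by (auto intro!: continuous_on_compose2[OF Gc Wc] continuous_on_compose2[OF gc Wc])
  have Wp: "periodic (Wn n)" for n
    using periodic_Lam(1)[of "step n"] UB(1)[of n] by (simp add: periodic_def Wn_def)
  have dc: "continuous_on UNIV (dLam (step n) i)" for n i by (rule continuous_on_Lam(2)[OF step(1)])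
  have mV: "\<phi> \<in> borel_measurable torus" using H1_imp_L2[OF H1\<phi>] by (simp add: L2_def)
  note meas[measurable] = mV measurable_w measurable_Lam0 measurable_weak_partial[OF H1_u] measurable_weak_partial[OF H1\<phi>]
    measurable_comp_w[OF Gc] measurable_comp_w[OF gc]
  have mc: "f \<in> borel_measurable torus" if "continuous_on UNIV f" for f :: "real^2 \<Rightarrow> real"
    by (intro measurable_torus_borel borel_measurable_continuous_onI that)
  note [measurable] = mc[OF cc(1)] mc[OF cc(2)] mc[OF VB(2)] mc[OF dc]
  have Gl: "AE x in torus. (\<lambda>n. G (Wn n x)) \<longlonglongrightarrow> G (w x)" "AE x in torus. (\<lambda>n. g (Wn n x)) \<longlonglongrightarrow> g (w x)"
    using W unfolding Wn_def
    by (eventually_elim, intro continuous_on_tendsto_compose[OF Gc] continuous_on_tendsto_compose[OF gc]; simp)+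
  have i\<phi>: "integrable torus (weak_partial i \<phi>)" "integrable torus (weak_partial i u)" for i
    by (intro L1_imp_integrable L2_imp_L1 H1_weak_partial H1\<phi> H1_u)+
  have iD: "integrable torus (D i n)" "integrable torus (E i n)" for i n
    by (intro integrable_torus_continuous UB VB)+
  have one: "(\<lambda>n. LINT x|torus. \<bar>a n x - A x\<bar>) \<longlonglongrightarrow> 0"
    if "\<And>n. a n \<in> borel_measurable torus" "\<And>n x. \<bar>a n x\<bar> \<le> Z" "AE x in torus. (\<lambda>n. a n x) \<longlonglongrightarrow> A x" "A \<in> borel_measurable torus"
    for a A and Z :: real
    using that dominated_imp_L1_convergence(2)[OF that(1,4) integrable_const_torus[of Z], OF AE_I2 that(3)] by blast
  have b0: "\<bar>G (Wn n x) * V n x\<bar> \<le> K * B'" for n x unfolding abs_mult using GK VB(5) K by (intro mult_mono) auto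
  have l0: "(\<lambda>n. LINT x|torus. \<bar>G (Wn n x) * V n x - G (w x) * \<phi> x\<bar>) \<longlonglongrightarrow> 0"
  proof (rule one[OF _ b0])
    show "AE x in torus. (\<lambda>n. G (Wn n x) * V n x) \<longlonglongrightarrow> G (w x) * \<phi> x"
      using Gl(1) VB(6) by eventually_elim (rule tendsto_mult)
  qed measurable
  have b1: "\<bar>g (Wn n x) * (dLam (step n) i x * V n x)\<bar> \<le> K * (C * B')" for n x i
    using gK[of "Wn n x"] e2[of n x i] VB(5)[of n x] K C unfolding Wn_def by (intro abs_mult3_le) auto
  have t1: "(\<lambda>n. LINT x|torus. \<bar>g (Wn n x) * (dLam (step n) i x * V n x) - g (w x) * (dLam 0 i x * \<phi> x)\<bar>) \<longlonglongrightarrow> 0"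
  proof (rule one[OF _ b1])
    show "AE x in torus. (\<lambda>n. g (Wn n x) * (dLam (step n) i x * V n x)) \<longlonglongrightarrow> g (w x) * (dLam 0 i x * \<phi> x)"
      using Gl(2) VB(6) AE_off_poles by eventually_elim (intro tendsto_mult Lam_tendsto step)
  qed measurable
  have b2: "\<bar>g (Wn n x) * V n x\<bar> \<le> K * B'" for n x unfolding abs_mult using gK1 VB(5) K by (intro mult_mono) auto
  have t2: "(\<lambda>n. LINT x|torus. \<bar>(g (Wn n x) * V n x) * D i n x - (g (w x) * \<phi> x) * weak_partial i u x\<bar>) \<longlonglongrightarrow> 0"
  proof (rule L1_tendsto_bounded_mult[OF _ b2])
    show "AE x in torus. (\<lambda>n. g (Wn n x) * V n x) \<longlonglongrightarrow> g (w x) * \<phi> x"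
      using Gl(2) VB(6) by eventually_elim (rule tendsto_mult)
  qed (use iD i\<phi> UB(7) in \<open>simp_all\<close>)
  have t3: "(\<lambda>n. LINT x|torus. \<bar>G (Wn n x) * E i n x - G (w x) * weak_partial i \<phi> x\<bar>) \<longlonglongrightarrow> 0"
    by (rule L1_tendsto_bounded_mult[OF _ GK Gl(1)]) (use iD i\<phi> VB(7) in \<open>simp_all\<close>)
  have sq: "square_integrable torus (weak_partial i \<phi>)" "square_integrable torus (weak_partial i u)" for i
    by (intro L2_imp_square_integrable H1_weak_partial H1\<phi> H1_u)+
  have s1: "square_integrable torus (\<lambda>x. g (w x) * (dLam 0 i x * \<phi> x))"
  proof (rule square_integrable_bounded[OF finite_measure_torus, where B = "K * (C * B')"])
    show "AE x in torus. \<bar>g (w x) * (dLam 0 i x * \<phi> x)\<bar> \<le> K * (C * B')"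
      using e3[of i] \<phi>B by eventually_elim (rule abs_mult3_le[OF gK]; use K C in simp)
  qed measurable
  have s2: "square_integrable torus (\<lambda>x. (g (w x) * \<phi> x) * weak_partial i u x)"
  proof (rule square_integrable_bounded_mult[OF sq(2), where B = "K * B'"])
    show "AE x in torus. \<bar>g (w x) * \<phi> x\<bar> \<le> K * B'"
      using \<phi>B by eventually_elim (unfold abs_mult, intro mult_mono gK1, use K in auto)
  qed measurable
  have s3: "square_integrable torus (\<lambda>x. G (w x) * weak_partial i \<phi> x)"
    by (rule square_integrable_bounded_mult[OF sq(1), where B = K]) (use GK in \<open>auto intro: measurable_comp_w Gc\<close>)
  have s0: "square_integrable torus (\<lambda>x. G (w x) * \<phi> x)"
    by (rule square_integrable_bounded_mult[where B = K])
       (use GK in \<open>auto intro: measurable_comp_w Gc L2_imp_square_integrable H1_imp_L2 H1\<phi>\<close>)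
  have per: "periodic (dLam 0 i)" "periodic \<phi>" "periodic (weak_partial i u)" "periodic (weak_partial i \<phi>)"
    using H1_weak_partial(2)[OF H1_u, of i] H1_weak_partial(2)[OF H1\<phi>, of i] H1_imp_L2[OF H1\<phi>] periodic_Lam(2)
    by (auto simp: L2_def)
  show L2: "L2 (g' i)" "L2 (\<lambda>x. G (w x) * \<phi> x)"
    unfolding g'_def L2_iff using square_integrable_add[OF square_integrable_add[OF s1 s2] s3] s0 per periodic_w
    by (auto simp: periodic_def)
  note si = square_integrable_imp_integrable_torus
  show "has_weak_partial i (\<lambda>x. G (w x) * \<phi> x) (g' i)"
  proof (rule has_weak_partial_limit)
    show "has_partial i (\<lambda>x. G (Wn n x) * V n x)
        (\<lambda>x. g (Wn n x) * (dLam (step n) i x * V n x) + (g (Wn n x) * V n x) * D i n x + G (Wn n x) * E i n x)" for n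
    proof -
      have "has_partial i (Wn n) (\<lambda>x. dLam (step n) i x + D i n x)"
        unfolding Wn_def by (intro has_partial_add has_partial_Lam step UB)
      from has_partial_mult[OF has_partial_chain[OF this DG] VB(3)]
      show ?thesis by (simp add: algebra_simps)
    qed
    show "(\<lambda>n. LINT x|torus. \<bar>G (Wn n x) * V n x - G (w x) * \<phi> x\<bar>) \<longlonglongrightarrow> 0" by (rule l0)
    show "(\<lambda>n. LINT x|torus. \<bar>g (Wn n x) * (dLam (step n) i x * V n x) + (g (Wn n x) * V n x) * D i n x + G (Wn n x) * E i n x - g' i x\<bar>) \<longlonglongrightarrow> 0"
      unfolding g'_def
      by (rule L1_tendsto_add[OF _ _ _ _ L1_tendsto_add[OF _ _ _ _ t1 t2] t3])
         (intro Bochner_Integration.integrable_add si s1 s2 s3 integrable_torus_continuous continuous_intros cc VB UB dc)+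
    show "periodic (\<lambda>x. G (Wn n x) * V n x)" for n
      using Wp[of n] VB(1)[of n] by (simp add: periodic_def)
  qed (intro L2_imp_L1 L2 continuous_intros cc VB UB dc)+
qed

lemma H1_chain_rule:
  fixes G g :: "real \<Rightarrow> real"
  assumes "\<And>t. (G has_real_derivative g t) (at t)" "continuous_on UNIV g"
    and "\<And>t. \<bar>G t\<bar> \<le> K" "\<And>t. \<bar>g t\<bar> \<le> K * exp (- \<bar>t\<bar>)" "H2 \<phi>"
  shows "H1 (\<lambda>x. G (w x) * \<phi> x)"
  unfolding H1_def using chain_rule[OF assms] by blast

end

section \<open>Integrated identities for the singular potential\<close>

context perturbed_potential
begin

text \<open>This is the pairing of h(w) \<phi> with the Laplacian of \<open>Lam 0\<close>, one
  derivative being moved onto h(w) \<phi>. As dLam is not in L2, the identity is taken to the limit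
  from the approximants. The grouping reflects the estimates: a1 is bounded, a2 and a3 are a bounded
  factor times a derivative converging in L1.\<close>

lemma Lam_pairing:
  fixes h h' :: "real \<Rightarrow> real"
  assumes Dh: "\<And>t. (h has_real_derivative h' t) (at t)" and h'c: "continuous_on UNIV h'"
    and hK: "\<And>t. \<bar>h t\<bar> \<le> K * exp (- \<bar>t\<bar>)" and h'K: "\<And>t. \<bar>h' t\<bar> \<le> K * exp (- \<bar>t\<bar>)" and \<phi>: "H2 \<phi>"
  defines "a1 \<equiv> \<lambda>i x. h' (w x) * ((dLam 0 i x)\<^sup>2 * \<phi> x)"
    and "a2 \<equiv> \<lambda>i x. (h' (w x) * (dLam 0 i x * \<phi> x)) * weak_partial i u x"
    and "a3 \<equiv> \<lambda>i x. (h (w x) * dLam 0 i x) * weak_partial i \<phi> x"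
  shows "integrable torus (a1 i)" "integrable torus (a2 i)" "integrable torus (a3 i)"
    "integrable torus (\<lambda>x. (h (w x) * \<phi> x) * Reg 0 x)"
    "(\<Sum>i\<in>UNIV. (LINT x|torus. a1 i x) + (LINT x|torus. a2 i x) + (LINT x|torus. a3 i x)) =
      - (LINT x|torus. (h (w x) * \<phi> x) * Reg 0 x)"
proof -
  have K: "K \<ge> 0" using hK[of 0] by simp
  have hc: "continuous_on UNIV h" by (rule DERIV_continuous_on[OF Dh])
  have H1\<phi>: "H1 \<phi>" by (rule H2_imp_H1[OF \<phi>])
  obtain U D B C where A: "smooth_approx u U D B" and C: "C > 0" and uB: "AE x in torus. \<bar>u x\<bar> \<le> B"
    and e2: "\<And>n x i. exp (- \<bar>Lam (step n) x + U n x\<bar>) * \<bar>dLam (step n) i x\<bar> \<le> C"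
    and e22: "\<And>n x i. exp (- \<bar>Lam (step n) x + U n x\<bar>) * (dLam (step n) i x)\<^sup>2 \<le> C"
    and eS: "\<And>n x. exp (- \<bar>Lam (step n) x + U n x\<bar>) * \<bar>Sing (step n) x\<bar> \<le> C"
    and "\<And>i. AE x in torus. exp (- \<bar>w x\<bar>) * \<bar>dLam 0 i x\<bar> \<le> C"
    and "\<And>i. AE x in torus. exp (- \<bar>w x\<bar>) * (dLam 0 i x)\<^sup>2 \<le> C"
    and W: "AE x in torus. (\<lambda>n. Lam (step n) x + U n x) \<longlonglongrightarrow> w x"
    using approximation by blast
  note UB = smooth_approxD[OF A]
  obtain V E B' where A': "smooth_approx \<phi> V E B'" using H2_approx[OF \<phi>] by blast
  note VB = smooth_approxD[OF A']
  have B': "B' \<ge> 0" using VB(5)[of 0 0] by linarith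
  define Wn where "Wn n x = Lam (step n) x + U n x" for n x
  have hK1: "\<bar>h t\<bar> \<le> K" for t
    by (rule order_trans[OF hK]) (use K in \<open>simp add: mult_left_le\<close>)
  have Wc: "continuous_on UNIV (Wn n)" for n unfolding Wn_def by (intro continuous_intros continuous_on_Lam step UB)
  have cc: "continuous_on UNIV (\<lambda>x. h (Wn n x))" "continuous_on UNIV (\<lambda>x. h' (Wn n x))" for n
    by (auto intro!: continuous_on_compose2[OF hc Wc] continuous_on_compose2[OF h'c Wc])
  have Wp: "periodic (Wn n)" for n
    using periodic_Lam(1)[of "step n"] UB(1)[of n] by (simp add: periodic_def Wn_def)
  have dc: "continuous_on UNIV (dLam (step n) i)" "continuous_on UNIV (ddLam (step n) i)"
    "continuous_on UNIV (Reg (step n))" "continuous_on UNIV (Sing (step n))" for n i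
    by (intro continuous_on_Lam step)+
  have mV: "\<phi> \<in> borel_measurable torus" using H1_imp_L2[OF H1\<phi>] by (simp add: L2_def)
  have mc: "f \<in> borel_measurable torus" if "continuous_on UNIV f" for f :: "real^2 \<Rightarrow> real"
    by (intro measurable_torus_borel borel_measurable_continuous_onI that)
  note meas[measurable] = mV measurable_w measurable_Lam0 measurable_weak_partial[OF H1_u] measurable_weak_partial[OF H1\<phi>]
    measurable_comp_w[OF hc] measurable_comp_w[OF h'c] mc[OF cc(1)] mc[OF cc(2)] mc[OF VB(2)] mc[OF dc(1)] mc[OF dc(3)] mc[OF dc(4)]
  have Gl: "AE x in torus. (\<lambda>n. h (Wn n x)) \<longlonglongrightarrow> h (w x)" "AE x in torus. (\<lambda>n. h' (Wn n x)) \<longlonglongrightarrow> h' (w x)"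
    using W unfolding Wn_def
    by (eventually_elim, intro continuous_on_tendsto_compose[OF hc] continuous_on_tendsto_compose[OF h'c]; simp)+
  have i\<phi>: "integrable torus (weak_partial i \<phi>)" "integrable torus (weak_partial i u)" for i
    by (intro L1_imp_integrable L2_imp_L1 H1_weak_partial H1\<phi> H1_u)+
  have iD: "integrable torus (D i n)" "integrable torus (E i n)" for i n
    by (intro integrable_torus_continuous UB VB)+
  have one: "integrable torus A" "(\<lambda>n. LINT x|torus. a n x) \<longlonglongrightarrow> (LINT x|torus. A x)"
    if "\<And>n. a n \<in> borel_measurable torus" "\<And>n x. \<bar>a n x\<bar> \<le> Z" "AE x in torus. (\<lambda>n. a n x) \<longlonglongrightarrow> A x" "A \<in> borel_measurable torus"
    for a A and Z :: real
    using tendsto_integral_bounded_mult[OF that(1,2,3,4), where b = "\<lambda>n x. 1" and B = "\<lambda>x. 1"] integrable_const_torus by simp_all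
  have b1: "\<bar>h' (Wn n x) * ((dLam (step n) i x)\<^sup>2 * V n x)\<bar> \<le> K * (C * B')" for n x i
    using h'K[of "Wn n x"] e22[of n x i] VB(5)[of n x] K C unfolding Wn_def by (intro abs_mult3_le) auto
  have l1: "AE x in torus. (\<lambda>n. h' (Wn n x) * ((dLam (step n) i x)\<^sup>2 * V n x)) \<longlonglongrightarrow> a1 i x" for i
    unfolding a1_def using Gl(2) VB(6) AE_off_poles by eventually_elim (intro tendsto_mult tendsto_power Lam_tendsto step)
  have m1: "a1 i \<in> borel_measurable torus" for i unfolding a1_def by measurable
  have t1: "integrable torus (a1 i)" "(\<lambda>n. LINT x|torus. h' (Wn n x) * ((dLam (step n) i x)\<^sup>2 * V n x)) \<longlonglongrightarrow> (LINT x|torus. a1 i x)" for i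
    by (rule one[OF _ b1 l1 m1], measurable)+
  have b2: "\<bar>h' (Wn n x) * (dLam (step n) i x * V n x)\<bar> \<le> K * (C * B')" for n x i
    using h'K[of "Wn n x"] e2[of n x i] VB(5)[of n x] K C unfolding Wn_def by (intro abs_mult3_le) auto
  have l2: "AE x in torus. (\<lambda>n. h' (Wn n x) * (dLam (step n) i x * V n x)) \<longlonglongrightarrow> h' (w x) * (dLam 0 i x * \<phi> x)" for i
    using Gl(2) VB(6) AE_off_poles by eventually_elim (intro tendsto_mult Lam_tendsto step)
  have t2: "integrable torus (a2 i)" "(\<lambda>n. LINT x|torus. (h' (Wn n x) * (dLam (step n) i x * V n x)) * D i n x) \<longlonglongrightarrow> (LINT x|torus. a2 i x)" for i
    using tendsto_integral_bounded_mult[OF _ b2 l2 _ iD(1) i\<phi>(2) UB(7)] unfolding a2_def by simp_all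
  have b3: "\<bar>h (Wn n x) * dLam (step n) i x\<bar> \<le> K * (C * 1)" for n x i
    using abs_mult3_le[OF hK e2[folded Wn_def], of 1 1 n x i] K C by simp
  have l3: "AE x in torus. (\<lambda>n. h (Wn n x) * dLam (step n) i x) \<longlonglongrightarrow> h (w x) * dLam 0 i x" for i
    using Gl(1) AE_off_poles by eventually_elim (intro tendsto_mult Lam_tendsto step)
  have t3: "integrable torus (a3 i)" "(\<lambda>n. LINT x|torus. (h (Wn n x) * dLam (step n) i x) * E i n x) \<longlonglongrightarrow> (LINT x|torus. a3 i x)" for i
    using tendsto_integral_bounded_mult[OF _ b3 l3 _ iD(2) i\<phi>(1) VB(7)] unfolding a3_def by simp_all
  define R where "R = (\<Sum>a\<in>P. \<bar>N a\<bar> * (2 * pi\<^sup>2))"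
  have R: "R \<ge> 0" unfolding R_def by (intro sum_nonneg) auto
  have b4: "\<bar>(h (Wn n x) * V n x) * Reg (step n) x\<bar> \<le> (K * B') * R" for n x
    unfolding abs_mult R_def using hK1 VB(5) K B' step(1)[of n] by (intro mult_mono abs_Reg_le) auto
  have l4: "AE x in torus. (\<lambda>n. (h (Wn n x) * V n x) * Reg (step n) x) \<longlonglongrightarrow> (h (w x) * \<phi> x) * Reg 0 x"
    using Gl(1) VB(6) AE_off_poles by eventually_elim (intro tendsto_mult Lam_tendsto step)
  have m4: "(\<lambda>x. (h (w x) * \<phi> x) * Reg 0 x) \<in> borel_measurable torus" by measurable
  have t4: "integrable torus (\<lambda>x. (h (w x) * \<phi> x) * Reg 0 x)"
    "(\<lambda>n. LINT x|torus. (h (Wn n x) * V n x) * Reg (step n) x) \<longlonglongrightarrow> (LINT x|torus. (h (w x) * \<phi> x) * Reg 0 x)"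
    by (rule one[OF _ b4 l4 m4], measurable)+
  have b5: "\<bar>h (Wn n x) * (Sing (step n) x * V n x)\<bar> \<le> K * (C * B')" for n x
    using hK[of "Wn n x"] eS[of n x] VB(5)[of n x] K C unfolding Wn_def by (intro abs_mult3_le) auto
  have l5: "AE x in torus. (\<lambda>n. h (Wn n x) * (Sing (step n) x * V n x)) \<longlonglongrightarrow> h (w x) * (0 * \<phi> x)"
    using Gl(1) VB(6) AE_off_poles by eventually_elim (intro tendsto_mult Lam_tendsto step)
  \<comment> \<open>The Dirac masses disappear here: \<open>Sing\<close> concentrates at the poles
    without losing mass, but the decay of h keeps its product with h(Wn) bounded, and off the poles
    this product tends to 0.\<close>
  have t5: "(\<lambda>n. LINT x|torus. h (Wn n x) * (Sing (step n) x * V n x)) \<longlonglongrightarrow> 0"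
    using one(2)[OF _ b5 l5] by simp
  have classical: "(\<Sum>i\<in>UNIV. (LINT x|torus. h' (Wn n x) * ((dLam (step n) i x)\<^sup>2 * V n x))
      + (LINT x|torus. (h' (Wn n x) * (dLam (step n) i x * V n x)) * D i n x)
      + (LINT x|torus. (h (Wn n x) * dLam (step n) i x) * E i n x)) =
      - ((LINT x|torus. (h (Wn n x) * V n x) * Reg (step n) x) + (LINT x|torus. h (Wn n x) * (Sing (step n) x * V n x)))" for n
  proof -
    define F where "F x = h (Wn n x) * V n x" for x
    define f where "f i x = h' (Wn n x) * (dLam (step n) i x + D i n x) * V n x + h (Wn n x) * E i n x" for i x
    have Fc: "continuous_on UNIV F" unfolding F_def by (intro continuous_intros cc VB)
    have fc: "continuous_on UNIV (f i)" for i unfolding f_def by (intro continuous_intros cc VB UB dc)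
    have Fp: "periodic F" using Wp[of n] VB(1)[of n] by (simp add: periodic_def F_def)
    have Fd: "has_partial i F (f i)" for i
    proof -
      have "has_partial i (Wn n) (\<lambda>x. dLam (step n) i x + D i n x)"
        unfolding Wn_def by (intro has_partial_add has_partial_Lam step UB)
      from has_partial_mult[OF has_partial_chain[OF this Dh] VB(3)]
      show ?thesis by (simp add: F_def[abs_def] f_def[abs_def])
    qed
    have ibp: "(LINT x|torus. f i x * dLam (step n) i x) = - (LINT x|torus. F x * ddLam (step n) i x)" for i
      using integration_by_parts_torus[OF Fp Fd[of i] Fc fc[of i] periodic_Lam(2) has_partial_Lam(2)[OF step(1)] dc(1) dc(2)]
      by simp
    have ct: "integrable torus G" if "continuous_on UNIV G" for G :: "real^2 \<Rightarrow> real"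
      by (rule integrable_torus_continuous[OF that])
    have split: "(LINT x|torus. h' (Wn n x) * ((dLam (step n) i x)\<^sup>2 * V n x))
      + (LINT x|torus. (h' (Wn n x) * (dLam (step n) i x * V n x)) * D i n x)
      + (LINT x|torus. (h (Wn n x) * dLam (step n) i x) * E i n x) = (LINT x|torus. f i x * dLam (step n) i x)" for i
    proof -
      have "(LINT x|torus. h' (Wn n x) * ((dLam (step n) i x)\<^sup>2 * V n x) + (h' (Wn n x) * (dLam (step n) i x * V n x)) * D i n x
          + (h (Wn n x) * dLam (step n) i x) * E i n x) = (LINT x|torus. f i x * dLam (step n) i x)"
        by (intro Bochner_Integration.integral_cong) (auto simp: f_def algebra_simps power2_eq_square)
      moreover have "integrable torus (\<lambda>x. h' (Wn n x) * ((dLam (step n) i x)\<^sup>2 * V n x))"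
        "integrable torus (\<lambda>x. (h' (Wn n x) * (dLam (step n) i x * V n x)) * D i n x)"
        "integrable torus (\<lambda>x. (h (Wn n x) * dLam (step n) i x) * E i n x)"
        by (intro ct continuous_intros cc VB UB dc)+
      ultimately show ?thesis by simp
    qed
    have "(\<Sum>i\<in>UNIV. LINT x|torus. f i x * dLam (step n) i x) = - ((LINT x|torus. F x * ddLam (step n) 1 x) + (LINT x|torus. F x * ddLam (step n) 2 x))"
      by (simp add: sum_2 ibp)
    also have "(LINT x|torus. F x * ddLam (step n) 1 x) + (LINT x|torus. F x * ddLam (step n) 2 x) = (LINT x|torus. F x * ddLam (step n) 1 x + F x * ddLam (step n) 2 x)"
      by (intro Bochner_Integration.integral_add[symmetric] ct continuous_intros Fc dc)
    also have "\<dots> = (LINT x|torus. F x * Reg (step n) x + h (Wn n x) * (Sing (step n) x * V n x))"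
      unfolding distrib_left[symmetric] ddLam_sum[OF step(1)]
      by (intro Bochner_Integration.integral_cong) (auto simp: F_def algebra_simps)
    also have "\<dots> = (LINT x|torus. F x * Reg (step n) x) + (LINT x|torus. h (Wn n x) * (Sing (step n) x * V n x))"
      by (intro Bochner_Integration.integral_add ct continuous_intros Fc dc cc VB)
    finally show ?thesis unfolding split by (simp add: F_def)
  qed
  have lim1: "(\<lambda>n. (\<Sum>i\<in>UNIV. (LINT x|torus. h' (Wn n x) * ((dLam (step n) i x)\<^sup>2 * V n x))
      + (LINT x|torus. (h' (Wn n x) * (dLam (step n) i x * V n x)) * D i n x)
      + (LINT x|torus. (h (Wn n x) * dLam (step n) i x) * E i n x))) \<longlonglongrightarrow>
      (\<Sum>i\<in>UNIV. (LINT x|torus. a1 i x) + (LINT x|torus. a2 i x) + (LINT x|torus. a3 i x))"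
    by (intro tendsto_sum tendsto_add t1 t2 t3)
  have lim2: "(\<lambda>n. - ((LINT x|torus. (h (Wn n x) * V n x) * Reg (step n) x) + (LINT x|torus. h (Wn n x) * (Sing (step n) x * V n x))))
      \<longlonglongrightarrow> - ((LINT x|torus. (h (w x) * \<phi> x) * Reg 0 x) + 0)"
    by (intro tendsto_minus tendsto_add t4 t5)
  show "(\<Sum>i\<in>UNIV. (LINT x|torus. a1 i x) + (LINT x|torus. a2 i x) + (LINT x|torus. a3 i x)) =
      - (LINT x|torus. (h (w x) * \<phi> x) * Reg 0 x)"
    using LIMSEQ_unique[OF lim1 lim2[folded classical]] by simp
  show "integrable torus (a1 i)" "integrable torus (a2 i)" "integrable torus (a3 i)"
    "integrable torus (\<lambda>x. (h (w x) * \<phi> x) * Reg 0 x)"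
    by (rule t1 t2 t3 t4)+
qed

text \<open>Chosen weak derivatives are replaced by explicit ones under the integral.\<close>

lemma integral_weak_grad_inner_eq:
  assumes "H1 v" "H1 \<psi>" "\<And>i. has_weak_partial i v (g i)"
  shows "(LINT x|torus. weak_grad \<psi> x \<bullet> weak_grad v x) = (\<Sum>i\<in>UNIV. LINT x|torus. weak_partial i \<psi> x * g i x)"
proof -
  have "(LINT x|torus. weak_grad \<psi> x \<bullet> weak_grad v x) = (\<Sum>i\<in>UNIV. LINT x|torus. weak_partial i \<psi> x * weak_partial i v x)"
    unfolding weak_grad_inner sum_2
    by (intro Bochner_Integration.integral_add integrable_weak_grad_inner assms)
  also have "\<dots> = (\<Sum>i\<in>UNIV. LINT x|torus. weak_partial i \<psi> x * g i x)"
  proof (intro sum.cong refl integral_cong_AE)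
    fix i
    have [measurable]: "weak_partial i \<psi> \<in> borel_measurable torus" "weak_partial i v \<in> borel_measurable torus" "g i \<in> borel_measurable torus"
      using assms(3)[of i] by (auto simp: has_weak_partial_def L1_def intro!: measurable_weak_partial assms)
    show "(\<lambda>x. weak_partial i \<psi> x * weak_partial i v x) \<in> borel_measurable torus" "(\<lambda>x. weak_partial i \<psi> x * g i x) \<in> borel_measurable torus"
      by measurable
    show "AE x in torus. weak_partial i \<psi> x * weak_partial i v x = weak_partial i \<psi> x * g i x"
      using weak_partial_AE_eq[OF assms(3)[of i]] by eventually_elim simp
  qed
  finally show ?thesis .
qed

text \<open>Green's formula for \<phi> against F(w), which the chain rule places in H1.\<close>

lemma first_order_identity:
  fixes F h :: "real \<Rightarrow> real"
  assumes DF: "\<And>t. (F has_real_derivative h t) (at t)" and hc: "continuous_on UNIV h"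
    and FK: "\<And>t. \<bar>F t\<bar> \<le> K" and hK: "\<And>t. \<bar>h t\<bar> \<le> K * exp (- \<bar>t\<bar>)" and \<phi>: "H2 \<phi>"
  shows "(LINT x|torus. F (w x) * weak_laplacian \<phi> x) = - (LINT x|torus. h (w x) * (\<Sum>i\<in>UNIV. dw i x * weak_partial i \<phi> x))"
    and "L2 (\<lambda>x. F (w x))"
proof -
  \<comment> \<open>The mode \<open>trig2 0\<close> is the constant 1, so the chain rule specialises
    to F(w).\<close>
  note cr = chain_rule[OF DF hc FK hK H2_trig2(1)[of 0], simplified]
  define g where "g i x = h (w x) * dLam 0 i x + h (w x) * weak_partial i u x + F (w x) * weak_partial i (trig2 0) x" for i x
  have H1\<phi>: "H1 \<phi>" by (rule H2_imp_H1[OF \<phi>])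
  have H1F: "H1 (\<lambda>x. F (w x))" using H1_chain_rule[OF DF hc FK hK H2_trig2(1)[of 0]] by simp
  have wp: "has_weak_partial i (\<lambda>x. F (w x)) (g i)" for i using cr(1) by (simp add: g_def[abs_def])
  show "L2 (\<lambda>x. F (w x))" by (rule H1_imp_L2[OF H1F])
  have z: "AE x in torus. weak_partial i (trig2 0) x = 0" for i
  proof (rule weak_partial_AE_eq, rule has_weak_partialI_coef)
    show "L2 (trig2 0)" by (rule L2_trig2)
    show "L2 (\<lambda>x. 0)" using L2_cmult[OF L2_trig2[of 0], of 0] by simp
    show "partial_coef i (trig2 0) (\<lambda>x. 0)"
      unfolding partial_coef_def
    proof
      fix k
      \<comment> \<open>Either k_i = 0, or \<open>flip i k\<close> is nonzero and its mode is
        orthogonal to the constant.\<close>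
      have "k $ i = 0 \<or> coef (trig2 0) (flip i k) = 0"
        using integral_trig2_mult[of 0 "flip i k"] by (auto simp: coef_def flip_def vec_eq_iff)
      then show "coef (\<lambda>x. 0) k = - 2 * pi * (k$i) * coef (trig2 0) (flip i k)" by (auto simp: coef_def)
    qed
  qed
  have H1w: "integrable torus (\<lambda>x. weak_partial i \<phi> x * g i x)" for i
  proof -
    have "L2 (g i)" using cr(2)[of i] by (simp add: g_def[abs_def])
    then show ?thesis by (intro integrable_mult_square_integrable L2_imp_square_integrable H1_weak_partial H1\<phi>)
  qed
  have "(LINT x|torus. F (w x) * weak_laplacian \<phi> x) = - (LINT x|torus. weak_grad \<phi> x \<bullet> weak_grad (\<lambda>x. F (w x)) x)"
    using Green_torus[OF \<phi> H1F] by (simp add: mult.commute)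
  also have "\<dots> = - (\<Sum>i\<in>UNIV. LINT x|torus. weak_partial i \<phi> x * g i x)"
    unfolding integral_weak_grad_inner_eq[OF H1F H1\<phi> wp] ..
  also have "(\<Sum>i\<in>UNIV. LINT x|torus. weak_partial i \<phi> x * g i x) = (LINT x|torus. (\<Sum>i\<in>UNIV. weak_partial i \<phi> x * g i x))"
    using H1w by (subst Bochner_Integration.integral_sum) auto
  also have "\<dots> = (LINT x|torus. h (w x) * (\<Sum>i\<in>UNIV. dw i x * weak_partial i \<phi> x))"
  proof (rule integral_cong_AE)
    have Fc: "continuous_on UNIV F" by (rule DERIV_continuous_on[OF DF])
    note [measurable] = measurable_comp_w[OF Fc] measurable_comp_w[OF hc] measurable_Lam0 measurable_weak_partial[OF H1_u]
      measurable_weak_partial[OF H1\<phi>] measurable_weak_partial[OF H2_imp_H1[OF H2_trig2(1)]]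
    show "(\<lambda>x. \<Sum>i\<in>UNIV. weak_partial i \<phi> x * g i x) \<in> borel_measurable torus"
      "(\<lambda>x. h (w x) * (\<Sum>i\<in>UNIV. dw i x * weak_partial i \<phi> x)) \<in> borel_measurable torus"
      unfolding g_def dw_def by measurable
    show "AE x in torus. (\<Sum>i\<in>UNIV. weak_partial i \<phi> x * g i x) = h (w x) * (\<Sum>i\<in>UNIV. dw i x * weak_partial i \<phi> x)"
      using z[of 1] z[of 2] by eventually_elim (simp add: g_def dw_def sum_2 algebra_simps)
  qed
  finally show "(LINT x|torus. F (w x) * weak_laplacian \<phi> x) = - (LINT x|torus. h (w x) * (\<Sum>i\<in>UNIV. dw i x * weak_partial i \<phi> x))" .
qed

text \<open>Two integrations by parts with the test function h(w) \<phi> are added: Green's formula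
  for the H2 part and \<open>Lam_pairing\<close> for the singular part. The mixed term a2 occurs
  once in each, which matches its double occurrence in the squared gradient.\<close>

lemma second_order_identity:
  fixes h h' :: "real \<Rightarrow> real"
  assumes Dh: "\<And>t. (h has_real_derivative h' t) (at t)" and h'c: "continuous_on UNIV h'"
    and hK: "\<And>t. \<bar>h t\<bar> \<le> K * exp (- \<bar>t\<bar>)" and h'K: "\<And>t. \<bar>h' t\<bar> \<le> K * exp (- \<bar>t\<bar>)" and \<phi>: "H2 \<phi>"
  shows "(LINT x|torus. h' (w x) * (\<Sum>i\<in>UNIV. (dw i x)\<^sup>2) * \<phi> x) + (LINT x|torus. h (w x) * (\<Sum>i\<in>UNIV. dw i x * weak_partial i \<phi> x))
    = - (LINT x|torus. h (w x) * (weak_laplacian u x + Reg 0 x) * \<phi> x)"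
proof -
  have K: "K \<ge> 0" using hK[of 0] by simp
  have hc: "continuous_on UNIV h" by (rule DERIV_continuous_on[OF Dh])
  have le1: "K * exp (- \<bar>t\<bar>) \<le> K" for t using K by (simp add: mult_left_le)
  have hK1: "\<bar>h t\<bar> \<le> K" for t by (rule order_trans[OF hK le1])
  have h'K1: "\<bar>h' t\<bar> \<le> K" for t by (rule order_trans[OF h'K le1])
  have H1\<phi>: "H1 \<phi>" by (rule H2_imp_H1[OF \<phi>])
  note [measurable] = measurable_comp_w[OF hc] measurable_comp_w[OF h'c] measurable_Lam0 measurable_weak_partial[OF H1_u]
    measurable_weak_partial[OF H1\<phi>]
  have m\<phi>[measurable]: "\<phi> \<in> borel_measurable torus" using H1_imp_L2[OF H1\<phi>] by (simp add: L2_def)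
  obtain B where \<phi>B: "AE x in torus. \<bar>\<phi> x\<bar> \<le> B" using H2_AE_bounded[OF \<phi>] by blast
  define a1 where "a1 i x = h' (w x) * ((dLam 0 i x)\<^sup>2 * \<phi> x)" for i x
  define a2 where "a2 i x = (h' (w x) * (dLam 0 i x * \<phi> x)) * weak_partial i u x" for i x
  define a3 where "a3 i x = (h (w x) * dLam 0 i x) * weak_partial i \<phi> x" for i x
  define b1 where "b1 i x = ((h' (w x) * \<phi> x) * weak_partial i u x) * weak_partial i u x" for i x
  define b3 where "b3 i x = (h (w x) * weak_partial i \<phi> x) * weak_partial i u x" for i x
  note Lp = Lam_pairing[OF Dh h'c hK h'K \<phi>, folded a1_def[abs_def] a2_def[abs_def] a3_def[abs_def]]
  have a: "integrable torus (a1 i)" "integrable torus (a2 i)" "integrable torus (a3 i)" for i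
    unfolding a1_def[abs_def] a2_def[abs_def] a3_def[abs_def] by (rule Lam_pairing[OF Dh h'c hK h'K \<phi>])+
  have sq: "square_integrable torus (weak_partial i \<phi>)" "square_integrable torus (weak_partial i u)" for i
    by (intro L2_imp_square_integrable H1_weak_partial H1\<phi> H1_u)+
  have b: "integrable torus (b1 i)" "integrable torus (b3 i)" for i
  proof -
    have "square_integrable torus (\<lambda>x. (h' (w x) * \<phi> x) * weak_partial i u x)"
    proof (rule square_integrable_bounded_mult[OF sq(2), where B = "K * B"])
      show "AE x in torus. \<bar>h' (w x) * \<phi> x\<bar> \<le> K * B"
        using \<phi>B by eventually_elim (unfold abs_mult, intro mult_mono h'K1, use K in auto)
    qed measurable
    then show "integrable torus (b1 i)" unfolding b1_def by (rule integrable_mult_square_integrable[OF _ sq(2)])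
    have "square_integrable torus (\<lambda>x. h (w x) * weak_partial i \<phi> x)"
      by (rule square_integrable_bounded_mult[OF sq(1), where B = K]) (use hK1 in auto)
    then show "integrable torus (b3 i)" unfolding b3_def by (rule integrable_mult_square_integrable[OF _ sq(2)])
  qed
  have Green: "(\<Sum>i\<in>UNIV. (LINT x|torus. a2 i x) + (LINT x|torus. b1 i x) + (LINT x|torus. b3 i x)) = - (LINT x|torus. weak_laplacian u x * (h (w x) * \<phi> x))"
  proof -
    have H1h: "H1 (\<lambda>x. h (w x) * \<phi> x)" by (rule H1_chain_rule[OF Dh h'c hK1 h'K \<phi>])
    have "- (LINT x|torus. weak_laplacian u x * (h (w x) * \<phi> x)) = (LINT x|torus. weak_grad u x \<bullet> weak_grad (\<lambda>x. h (w x) * \<phi> x) x)"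
      using Green_torus[OF H2_u H1h] by simp
    also have "\<dots> = (\<Sum>i\<in>UNIV. LINT x|torus. weak_partial i u x *
        (h' (w x) * (dLam 0 i x * \<phi> x) + (h' (w x) * \<phi> x) * weak_partial i u x + h (w x) * weak_partial i \<phi> x))"
      by (rule integral_weak_grad_inner_eq[OF H1h H1_u chain_rule(1)[OF Dh h'c hK1 h'K \<phi>]])
    also have "\<dots> = (\<Sum>i\<in>UNIV. LINT x|torus. a2 i x + b1 i x + b3 i x)"
      by (simp add: a2_def b1_def b3_def algebra_simps)
    also have "\<dots> = (\<Sum>i\<in>UNIV. (LINT x|torus. a2 i x) + (LINT x|torus. b1 i x) + (LINT x|torus. b3 i x))"
      using a b by simp
    finally show ?thesis by simp
  qed
  have 1: "(LINT x|torus. h' (w x) * (\<Sum>i\<in>UNIV. (dw i x)\<^sup>2) * \<phi> x) =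
      (\<Sum>i\<in>UNIV. (LINT x|torus. a1 i x) + 2 * (LINT x|torus. a2 i x) + (LINT x|torus. b1 i x))"
  proof -
    have "h' (w x) * (\<Sum>i\<in>UNIV. (dw i x)\<^sup>2) * \<phi> x = (\<Sum>i\<in>UNIV. a1 i x + 2 * a2 i x + b1 i x)" for x
      by (simp add: sum_2 dw_def a1_def a2_def b1_def power2_eq_square algebra_simps)
    then show ?thesis using a b by (simp add: Bochner_Integration.integral_sum)
  qed
  have 2: "(LINT x|torus. h (w x) * (\<Sum>i\<in>UNIV. dw i x * weak_partial i \<phi> x)) =
      (\<Sum>i\<in>UNIV. (LINT x|torus. a3 i x) + (LINT x|torus. b3 i x))"
  proof -
    have "h (w x) * (\<Sum>i\<in>UNIV. dw i x * weak_partial i \<phi> x) = (\<Sum>i\<in>UNIV. a3 i x + b3 i x)" for x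
      by (simp add: sum_2 dw_def a3_def b3_def algebra_simps)
    then show ?thesis using a b by (simp add: Bochner_Integration.integral_sum)
  qed
  have 3: "(LINT x|torus. h (w x) * (weak_laplacian u x + Reg 0 x) * \<phi> x) =
      (LINT x|torus. weak_laplacian u x * (h (w x) * \<phi> x)) + (LINT x|torus. (h (w x) * \<phi> x) * Reg 0 x)"
  proof -
    have i: "integrable torus (\<lambda>x. weak_laplacian u x * (h (w x) * \<phi> x))"
      by (intro integrable_mult_square_integrable L2_imp_square_integrable H2_weak_laplacian H2_u chain_rule(3)[OF Dh h'c hK1 h'K \<phi>])
    have "(LINT x|torus. h (w x) * (weak_laplacian u x + Reg 0 x) * \<phi> x) =
        (LINT x|torus. weak_laplacian u x * (h (w x) * \<phi> x) + (h (w x) * \<phi> x) * Reg 0 x)"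
      by (simp add: algebra_simps)
    also have "\<dots> = (LINT x|torus. weak_laplacian u x * (h (w x) * \<phi> x)) + (LINT x|torus. (h (w x) * \<phi> x) * Reg 0 x)"
      by (rule Bochner_Integration.integral_add[OF i Lam_pairing(4)[OF Dh h'c hK h'K \<phi>]])
    finally show ?thesis .
  qed
  have "(\<Sum>i\<in>UNIV. (LINT x|torus. a1 i x) + (LINT x|torus. a2 i x) + (LINT x|torus. a3 i x)) =
      - (LINT x|torus. (h (w x) * \<phi> x) * Reg 0 x)"
    unfolding a1_def a2_def a3_def by (rule Lam_pairing(5)[OF Dh h'c hK h'K \<phi>])
  then show ?thesis unfolding 1 2 3 using Green by (simp add: sum_2)
qed

end

section \<open>The nonlinearity\<close>

text \<open>A derivative bounded below by e > 0 forces linear growth beyond any M.\<close>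

lemma increasing_unbounded_contradiction:
  fixes G G' :: "real \<Rightarrow> real"
  assumes D: "\<And>t. t \<ge> t0 \<Longrightarrow> (G has_real_derivative G' t) (at t)"
    and e: "e > 0" "\<And>t. t \<ge> t0 \<Longrightarrow> G' t \<ge> e" and M: "\<And>t. t \<ge> t0 \<Longrightarrow> G t \<le> M"
  shows False
proof -
  have lower: "G t0 - e * t0 \<le> G t - e * t" if "t \<ge> t0" for t
  proof (rule DERIV_nonneg_imp_nondecreasing[OF that])
    fix x assume "t0 \<le> x" "x \<le> t"
    then have "((\<lambda>t. G t - e * t) has_real_derivative G' x - e * 1) (at x)"
      by (intro DERIV_diff D DERIV_cmult DERIV_ident)
    moreover have "G' x - e * 1 \<ge> 0" using e(2)[OF \<open>t0 \<le> x\<close>] by simp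
    ultimately show "\<exists>y. ((\<lambda>t. G t - e * t) has_real_derivative y) (at x) \<and> 0 \<le> y" by blast
  qed
  define t where "t = t0 + (\<bar>M - G t0\<bar> + 1) / e"
  have "t \<ge> t0" using e by (simp add: t_def)
  then have "G t \<ge> G t0 + e * (t - t0)" using lower[OF \<open>t \<ge> t0\<close>] by (simp add: algebra_simps)
  moreover have "e * (t - t0) = \<bar>M - G t0\<bar> + 1" using e by (simp add: t_def)
  ultimately show False using M[OF \<open>t \<ge> t0\<close>] by linarith
qed

text \<open>Subtracting C/((k+1) t^(k+1)) from G leaves a nondecreasing function, and the factor
  1/(k+1) is then dropped. In effect a lower bound of order t^-(k+2) is integrated from t0
  onwards.\<close>

lemma inverse_power_decay:
  fixes G G' :: "real \<Rightarrow> real"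
  assumes D: "\<And>t. t > 0 \<Longrightarrow> (G has_real_derivative G' t) (at t)"
    and C: "C \<ge> 0" "\<And>t. t > 0 \<Longrightarrow> G' t \<ge> - (C / t ^ Suc (Suc k))" and t: "0 < t0" "t0 \<le> t"
  shows "G t \<ge> G t0 - C / t0 ^ Suc k"
proof -
  define H where "H t = G t - C / real (Suc k) * (1 / t ^ Suc k)" for t
  have "H t0 \<le> H t"
  proof (rule DERIV_nonneg_imp_nondecreasing[OF t(2)])
    fix x assume x: "t0 \<le> x" "x \<le> t"
    then have x0: "x > 0" using t by simp
    have "((\<lambda>x. 1 / x ^ Suc k) has_real_derivative - (real (Suc k) / x ^ Suc (Suc k))) (at x)"
    proof -
      have "((\<lambda>x. inverse (x ^ Suc k)) has_real_derivative
          - (inverse (x ^ Suc k) * (real (Suc k) * x ^ (Suc k - Suc 0)) * inverse (x ^ Suc k))) (at x)"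
        using x0 by (intro DERIV_inverse' DERIV_pow) simp
      moreover have "- (inverse (x ^ Suc k) * (real (Suc k) * x ^ (Suc k - Suc 0)) * inverse (x ^ Suc k)) = - (real (Suc k) / x ^ Suc (Suc k))"
        using x0 by (simp add: field_simps)
      ultimately show ?thesis by (simp add: inverse_eq_divide)
    qed
    then have "(H has_real_derivative G' x - C / real (Suc k) * (- (real (Suc k) / x ^ Suc (Suc k)))) (at x)"
      unfolding H_def[abs_def] by (intro DERIV_diff D x0 DERIV_cmult)
    moreover have "G' x - C / real (Suc k) * (- (real (Suc k) / x ^ Suc (Suc k))) = G' x + C / x ^ Suc (Suc k)"
      by simp
    ultimately show "\<exists>y. (H has_real_derivative y) (at x) \<and> 0 \<le> y" using C(2)[OF x0] by auto
  qed
  moreover have "0 \<le> C / real (Suc k) * (1 / t ^ Suc k)" using C t by simp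
  moreover have "C / real (Suc k) * (1 / t0 ^ Suc k) \<le> C / 1 * (1 / t0 ^ Suc k)"
    using C t by (intro mult_right_mono divide_left_mono) auto
  ultimately show ?thesis unfolding H_def by simp
qed

text \<open>The bound f''' = O(t^-4) is integrated twice from infinity, where the boundedness and
  monotonicity of f exclude nonzero limits of f'' and f'. With r = e^t this gives r f'(r) = O(1/r)
  for r \<ge> 1, and smoothness at 0 gives O(r) for r \<le> 1; both are exp (- |t|).\<close>

lemma nonlinearity_bounds:
  fixes f :: "real \<Rightarrow> real"
  assumes f0: "smooth_on_nonneg f" "\<And>t. t > 0 \<Longrightarrow> deriv f t > 0"
    and f1: "bdd_above (f ` {0<..})" and f2: "bdd_above ((\<lambda>t. t ^ 4 * \<bar>(deriv ^^ 3) f t\<bar>) ` {0<..})"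
  defines "F \<equiv> \<lambda>t. f (exp t)" and "h \<equiv> \<lambda>t. deriv f (exp t) * exp t"
    and "h' \<equiv> \<lambda>t. (deriv (deriv f) (exp t) * exp t + deriv f (exp t)) * exp t"
  shows "\<exists>K. (\<forall>t. (F has_real_derivative h t) (at t) \<and> (h has_real_derivative h' t) (at t)) \<and>
    continuous_on UNIV h \<and> continuous_on UNIV h' \<and>
    (\<forall>t. \<bar>F t\<bar> \<le> K \<and> \<bar>h t\<bar> \<le> K * exp (- \<bar>t\<bar>) \<and> \<bar>h' t\<bar> \<le> K * exp (- \<bar>t\<bar>))"
proof -
  obtain D :: "nat \<Rightarrow> real \<Rightarrow> real" where D0: "\<And>t. t \<ge> 0 \<Longrightarrow> D 0 t = f t"
    and D: "\<And>k t. t \<ge> 0 \<Longrightarrow> (D k has_real_derivative D (Suc k) t) (at t within {0..})"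
    using f0(1) unfolding smooth_on_nonneg_def by blast
  have Dp: "(D k has_real_derivative D (Suc k) t) (at t)" if "t > 0" for k t
  proof -
    have "at t within {0..} = at t" using that by (intro at_within_interior) (simp add: interior_real_atLeast)
    then show ?thesis using D[of t k] that by simp
  qed
  have tr: "deriv g t = D (Suc k) t" "(g has_real_derivative D (Suc k) t) (at t)"
    if "t > 0" "\<And>x. x > 0 \<Longrightarrow> g x = D k x" for g k t
  proof -
    show 1: "(g has_real_derivative D (Suc k) t) (at t)"
      by (rule has_field_derivative_transform_within_open[OF Dp[OF that(1)], of "{0<..}"]) (use that in auto)
    then show "deriv g t = D (Suc k) t" by (rule DERIV_imp_deriv)
  qed
  have e0: "f x = D 0 x" if "x > 0" for x using D0 that by simp
  have e1: "deriv f x = D 1 x" if "x > 0" for x using tr(1)[OF that e0] by simp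
  have e2: "deriv (deriv f) x = D 2 x" if "x > 0" for x using tr(1)[OF that e1] by (simp add: numeral_2_eq_2)
  have e3: "(deriv ^^ 3) f x = D 3 x" if "x > 0" for x
    using tr(1)[OF that e2] by (simp add: numeral_3_eq_3)
  have d0: "(f has_real_derivative D 1 t) (at t)" if "t > 0" for t using tr(2)[OF that e0] by simp
  have d1: "(deriv f has_real_derivative D 2 t) (at t)" if "t > 0" for t using tr(2)[OF that e1] by (simp add: numeral_2_eq_2)
  have d2: "(D 1 has_real_derivative D 2 t) (at t)" "(D 2 has_real_derivative D 3 t) (at t)" if "t > 0" for t
    using Dp[OF that, of 1] Dp[OF that, of 2] by (simp_all add: numeral_2_eq_2 numeral_3_eq_3)
  have D1pos: "D 1 t > 0" if "t > 0" for t using f0(2)[OF that] e1[OF that] by simp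
  obtain M where M: "\<And>t. t > 0 \<Longrightarrow> f t \<le> M" using f1 by (auto simp: bdd_above_def)
  obtain C0 where C0: "\<And>t. t > 0 \<Longrightarrow> t ^ 4 * \<bar>(deriv ^^ 3) f t\<bar> \<le> C0" using f2 by (auto simp: bdd_above_def)
  define C where "C = \<bar>C0\<bar>"
  have C: "C \<ge> 0" by (simp add: C_def)
  have D3: "\<bar>D 3 t\<bar> \<le> C / t ^ Suc (Suc 2)" if "t > 0" for t
  proof -
    have "t ^ 4 * \<bar>D 3 t\<bar> \<le> C" using C0[OF that] e3[OF that] by (simp add: C_def)
    then have "\<bar>D 3 t\<bar> \<le> C / t ^ 4" using that by (simp add: pos_le_divide_eq mult.commute)
    then show ?thesis by (simp add: eval_nat_numeral)
  qed
  have D3': "- (C / t ^ Suc (Suc 2)) \<le> D 3 t" "- (C / t ^ Suc (Suc 2)) \<le> - D 3 t" if "t > 0" for t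
    using D3[OF that] by linarith+
  have D2: "\<bar>D 2 t\<bar> \<le> C / t ^ 3" if "t > 0" for t
  proof (rule ccontr)
    assume "\<not> \<bar>D 2 t\<bar> \<le> C / t ^ 3"
    then consider "D 2 t > C / t ^ 3" | "D 2 t < - (C / t ^ 3)" by linarith
    then show False
    proof cases
      \<comment> \<open>If f'' exceeded C/t^3 at t, it would be nonnegative from there on, f' would
        stay above f'(t) > 0 and f would be unbounded.\<close>
      case 1
      have lower: "D 2 r \<ge> 0" if "r \<ge> t" for r
      proof -
        have "D 2 r \<ge> D 2 t - C / t ^ Suc 2"
          by (rule inverse_power_decay[OF d2(2) C D3'(1) \<open>t > 0\<close> that])
        then show ?thesis using 1 by (simp add: eval_nat_numeral)
      qed
      have mono: "D 1 t \<le> D 1 r" if "r \<ge> t" for r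
        by (rule DERIV_nonneg_imp_nondecreasing[OF that]) (use d2(1) lower \<open>t > 0\<close> in \<open>meson less_le_trans\<close>)
      show False
        by (rule increasing_unbounded_contradiction[OF d0 D1pos[OF \<open>t > 0\<close>] mono M]) (use \<open>t > 0\<close> in auto)
    next
      \<comment> \<open>Here f'' would stay below a negative constant, which drives f' below
        zero.\<close>
      case 2
      define e where "e = - D 2 t - C / t ^ 3"
      have e: "e > 0" using 2 by (simp add: e_def)
      have upper: "- D 2 r \<ge> e" if "r \<ge> t" for r
      proof -
        have "- D 2 r \<ge> - D 2 t - C / t ^ Suc 2"
          by (rule inverse_power_decay[OF DERIV_minus[OF d2(2)] C D3'(2) \<open>t > 0\<close> that])
        then show ?thesis by (simp add: e_def eval_nat_numeral)
      qed
      show False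
      proof (rule increasing_unbounded_contradiction[OF _ e upper])
        show "((\<lambda>r. - D 1 r) has_real_derivative - D 2 r) (at r)" if "r \<ge> t" for r
          using that \<open>t > 0\<close> by (intro DERIV_minus d2) auto
        show "- D 1 r \<le> 0" if "r \<ge> t" for r using D1pos[of r] that \<open>t > 0\<close> by simp
      qed auto
    qed
  qed
  have D2': "- (C / t ^ Suc (Suc 1)) \<le> D 2 t" if "t > 0" for t
  proof -
    have "- (C / t ^ 3) \<le> D 2 t" using D2[OF that] by linarith
    then show ?thesis by (simp add: eval_nat_numeral)
  qed
  \<comment> \<open>If f' exceeded C/t^2 at t, it would stay above a positive constant, and f would
    be unbounded.\<close>
  have D1: "D 1 t \<le> C / t\<^sup>2" if "t > 0" for t
  proof (rule ccontr)
    assume "\<not> D 1 t \<le> C / t\<^sup>2"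
    then have e: "D 1 t - C / t\<^sup>2 > 0" by simp
    have lower: "D 1 r \<ge> D 1 t - C / t\<^sup>2" if "r \<ge> t" for r
    proof -
      have "D 1 r \<ge> D 1 t - C / t ^ Suc 1"
        by (rule inverse_power_decay[OF d2(1) C D2' \<open>t > 0\<close> that])
      then show ?thesis by (simp add: eval_nat_numeral)
    qed
    show False
      by (rule increasing_unbounded_contradiction[OF d0 e lower M]) (use \<open>t > 0\<close> in auto)
  qed
  have contD: "continuous_on {0..1} (D k)" for k
  proof (rule continuous_on_subset)
    show "continuous_on {0..} (D k)"
      unfolding continuous_on_eq_continuous_within using D DERIV_continuous by blast
  qed auto
  have bdd: "\<exists>B. \<forall>t\<in>{0..1}. \<bar>D k t\<bar> \<le> B" for k
    using compact_imp_bounded[OF compact_continuous_image[OF contD[of k] compact_Icc]] by (auto simp: bounded_iff)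
  obtain B0 where B0: "\<And>t. t \<in> {0..1} \<Longrightarrow> \<bar>D 0 t\<bar> \<le> B0" using bdd by blast
  obtain B1 where B1: "\<And>t. t \<in> {0..1} \<Longrightarrow> \<bar>D 1 t\<bar> \<le> B1" using bdd by blast
  obtain B2 where B2: "\<And>t. t \<in> {0..1} \<Longrightarrow> \<bar>D 2 t\<bar> \<le> B2" using bdd by blast
  have Bn: "B0 \<ge> 0" "B1 \<ge> 0" "B2 \<ge> 0" using B0[of 0] B1[of 0] B2[of 0] by auto
  define K where "K = \<bar>M\<bar> + B0 + B1 + B2 + 2 * C"
  have DF: "(F has_real_derivative h t) (at t)" for t
    unfolding F_def h_def using DERIV_chain2[OF d0[OF exp_gt_zero] DERIV_exp, of t] e1[OF exp_gt_zero, of t] by simp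
  have Dh: "(h has_real_derivative h' t) (at t)" for t
  proof -
    have "((\<lambda>t. deriv f (exp t)) has_real_derivative D 2 (exp t) * exp t) (at t)"
      by (rule DERIV_chain2[OF d1[OF exp_gt_zero] DERIV_exp])
    from DERIV_mult[OF this DERIV_exp] show ?thesis
      unfolding h_def h'_def using e2[OF exp_gt_zero, of t] by (simp add: algebra_simps)
  qed
  have hc: "continuous_on UNIV h" by (rule DERIV_continuous_on[OF Dh])
  have "continuous_on {0<..} (D k)" for k
    using Dp by (auto intro!: continuous_at_imp_continuous_on dest: DERIV_continuous)
  then have cD: "continuous_on UNIV (\<lambda>t. D k (exp t))" for k
    by (rule continuous_on_compose2) (auto intro!: continuous_intros)
  have h'_eq: "h' t = (D 2 (exp t) * exp t + D 1 (exp t)) * exp t" for t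
    by (simp add: h'_def e1 e2)
  have h_eq: "h t = D 1 (exp t) * exp t" for t by (simp add: h_def e1)
  have h'c: "continuous_on UNIV h'" unfolding h'_eq by (intro continuous_intros cD)
  have Fb: "\<bar>F t\<bar> \<le> K" for t
  proof (cases "t \<le> 0")
    case True
    then have "\<bar>D 0 (exp t)\<bar> \<le> B0" by (intro B0) auto
    then show ?thesis using D0[of "exp t"] Bn C by (simp add: F_def K_def)
  next
    case False
    have "f 1 \<le> f (exp t)"
    proof (rule DERIV_nonneg_imp_nondecreasing[of 1 "exp t" f])
      show "1 \<le> exp t" using False by simp
      fix x :: real assume "1 \<le> x" "x \<le> exp t"
      then show "\<exists>y. (f has_real_derivative y) (at x) \<and> 0 \<le> y" using d0[of x] D1pos[of x] by (intro exI[of _ "D 1 x"]) auto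
    qed
    moreover have "f (exp t) \<le> M" by (rule M) simp
    moreover have "\<bar>f 1\<bar> \<le> B0" using B0[of 1] D0[of 1] by simp
    ultimately show ?thesis using Bn C unfolding F_def K_def by linarith
  qed
  have hb: "\<bar>h t\<bar> \<le> K * exp (- \<bar>t\<bar>) \<and> \<bar>h' t\<bar> \<le> K * exp (- \<bar>t\<bar>)" for t
  proof (cases "t \<le> 0")
    case True
    define r where "r = exp t"
    have r: "0 < r" "r \<le> 1" using True by (auto simp: r_def)
    have b: "\<bar>D 1 r\<bar> \<le> B1" "\<bar>D 2 r\<bar> \<le> B2" using B1[of r] B2[of r] r by simp_all
    have "\<bar>D 1 r * r\<bar> \<le> B1 * r" unfolding abs_mult using b r by (intro mult_mono) auto
    also have "\<dots> \<le> K * r" using r Bn C by (intro mult_right_mono) (auto simp: K_def)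
    finally have 1: "\<bar>D 1 r * r\<bar> \<le> K * r" .
    have "\<bar>D 2 r * r\<bar> \<le> B2 * 1" unfolding abs_mult using b r Bn by (intro mult_mono) auto
    then have "\<bar>D 2 r * r + D 1 r\<bar> \<le> K" using b Bn C unfolding K_def by linarith
    then have "\<bar>(D 2 r * r + D 1 r) * r\<bar> \<le> K * r" unfolding abs_mult using r by (intro mult_mono) auto
    then show ?thesis using 1 True by (simp add: h_eq h'_eq r_def)
  next
    case False
    define r where "r = exp t"
    have r: "r \<ge> 1" using False by (auto simp: r_def)
    then have r0: "r > 0" by simp
    have b: "\<bar>D 1 r\<bar> \<le> C / r\<^sup>2" "\<bar>D 2 r\<bar> \<le> C / r ^ 3" using D1[OF r0] D1pos[OF r0] D2[OF r0] by auto
    have "\<bar>D 1 r * r\<bar> \<le> (C / r\<^sup>2) * r" unfolding abs_mult using b(1) r0 by (intro mult_mono) auto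
    also have "\<dots> = C / r" using r0 by (simp add: power2_eq_square)
    also have "\<dots> \<le> K / r" using r0 Bn C by (intro divide_right_mono) (auto simp: K_def)
    finally have 1: "\<bar>D 1 r * r\<bar> \<le> K / r" .
    have "\<bar>D 2 r * r\<bar> \<le> (C / r ^ 3) * r" unfolding abs_mult using b(2) r0 by (intro mult_mono) auto
    also have "\<dots> = C / r\<^sup>2" using r0 by (simp add: power2_eq_square power3_eq_cube)
    finally have "\<bar>D 2 r * r + D 1 r\<bar> \<le> C / r\<^sup>2 + C / r\<^sup>2" using b(1) by linarith
    then have "\<bar>(D 2 r * r + D 1 r) * r\<bar> \<le> (C / r\<^sup>2 + C / r\<^sup>2) * r" unfolding abs_mult using r0 by (intro mult_mono) auto
    also have "\<dots> = (2 * C) / r" using r0 by (simp add: power2_eq_square add_divide_distrib)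
    also have "\<dots> \<le> K / r" using r0 Bn by (intro divide_right_mono) (auto simp: K_def)
    finally show ?thesis using 1 False by (simp add: h_eq h'_eq r_def exp_minus divide_inverse)
  qed
  show ?thesis
    by (rule exI[of _ K]) (use DF Dh hc h'c Fb hb in auto)
qed

section \<open>Points of the torus and the splitting of \<open>\<sigma>\<close>\<close>

definition torus_rep :: "real^2 \<Rightarrow> real^2" where
  "torus_rep a = (\<chi> i. frac (a$i))"

lemma trig_frac: "trig j (frac t) = trig j t"
proof -
  define z where "z = j * \<lfloor>t\<rfloor>"
  have e: "2 * pi * j * frac t = 2 * pi * j * t - of_int z * (2 * pi)"
    by (simp add: frac_def z_def algebra_simps)
  have "cos (of_int z * (2 * pi)) = 1" "sin (of_int z * (2 * pi)) = 0"
    using cos_int_2pin[of z] sin_int_2pin[of z] by (simp_all add: mult_ac)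
  then show ?thesis unfolding trig_def e by (simp add: cos_diff sin_diff)
qed

lemma trig2_torus_rep: "trig2 k (torus_rep a) = trig2 k a"
  by (simp add: trig2_def torus_rep_def trig_frac)

lemma sinsq_torus_rep_pos:
  assumes "torus_rep a \<noteq> torus_rep b"
  shows "sinsq (torus_rep a - torus_rep b) > 0"
proof (rule ccontr)
  assume "\<not> sinsq (torus_rep a - torus_rep b) > 0"
  then have z: "sinsq (torus_rep a - torus_rep b) = 0" using sinsq_nonneg by (metis not_less order_antisym)
  have "torus_rep a $ i = torus_rep b $ i" for i
  proof -
    have "(sin (pi * (frac (a$i) - frac (b$i))))\<^sup>2 \<le> 0"
      using sin_le_sinsq[of "torus_rep a - torus_rep b" i] z by (simp add: torus_rep_def)
    then have "sin (pi * (frac (a$i) - frac (b$i))) = 0" by simp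
    then obtain n :: int where "pi * (frac (a$i) - frac (b$i)) = of_int n * pi" by (auto simp: sin_zero_iff_int2)
    then have n: "frac (a$i) - frac (b$i) = of_int n" by simp
    have "\<bar>frac (a$i) - frac (b$i)\<bar> < 1"
      using frac_lt_1[of "a$i"] frac_lt_1[of "b$i"] frac_ge_0[of "a$i"] frac_ge_0[of "b$i"] by linarith
    then have "\<bar>n\<bar> < 1" unfolding n by linarith
    then show ?thesis using n by (simp add: torus_rep_def)
  qed
  then show False using assms by (simp add: vec_eq_iff)
qed

text \<open>Points are counted modulo \<open>\<int>\<^sup>2\<close> with net multiplicities: coinciding \<open>p j\<close> and \<open>q k\<close> cancel, and
  the remaining multiplicities have modulus at least 1, which the pole bounds need.\<close>

lemma sigma_decomposition:
  assumes \<sigma>: "is_sigma m n p q A \<sigma>"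
  obtains P N \<tau> where "log_potential P N" "H2 \<tau>" "\<And>x. \<sigma> x = log_potential.Lam P N 0 x + \<tau> x"
    "AE x in torus. weak_laplacian \<tau> x = A - log_potential.Reg P N 0 x"
proof -
  define S where "S = torus_rep ` (p ` {1..m} \<union> q ` {1..n})"
  \<comment> \<open>The signs follow the Laplacian: that of \<sigma> has mass +4\<pi> at the points
    q and -4\<pi> at the points p, while each logarithm contributes +4\<pi>.\<close>
  define N where "N b = real (card {k \<in> {1..n}. torus_rep (q k) = b}) - real (card {j \<in> {1..m}. torus_rep (p j) = b})" for b
  define P where "P = {b \<in> S. N b \<noteq> 0}"
  have "finite S" by (simp add: S_def)
  interpret log_potential P N
  proof
    show "finite P" using \<open>finite S\<close> by (simp add: P_def)
    show "\<bar>N a\<bar> \<ge> 1" if "a \<in> P" for a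
    proof -
      define z where "z = int (card {k \<in> {1..n}. torus_rep (q k) = a}) - int (card {j \<in> {1..m}. torus_rep (p j) = a})"
      have N: "N a = of_int z" by (simp add: N_def z_def)
      then have "z \<noteq> 0" using that by (auto simp: P_def)
      then have "\<bar>z\<bar> \<ge> 1" by linarith
      then show ?thesis unfolding N by linarith
    qed
    show "sinsq (a - b) > 0" if "a \<in> P" "b \<in> P" "a \<noteq> b" for a b
    proof -
      have "\<exists>a'. a = torus_rep a'" "\<exists>b'. b = torus_rep b'" using that by (auto simp: P_def S_def)
      then show ?thesis using that(3) sinsq_torus_rep_pos by blast
    qed
  qed
  \<comment> \<open>Grouping the indices by the fibres of \<open>torus_rep\<close> turns
    multiplicities into a sum over indices, since modes take the same value at congruent
    points.\<close>
  have fib: "(\<Sum>b\<in>S. real (card {j \<in> {1..l}. torus_rep (r j) = b}) * trig2 k b) = (\<Sum>j=1..l. trig2 k (r j))"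
    if "(\<lambda>j. torus_rep (r j)) ` {1..l} \<subseteq> S" for r :: "nat \<Rightarrow> real^2" and l k
  proof -
    have "(\<Sum>b\<in>S. real (card {j \<in> {1..l}. torus_rep (r j) = b}) * trig2 k b) = (\<Sum>b\<in>S. \<Sum>j\<in>{j \<in> {1..l}. torus_rep (r j) = b}. trig2 k (r j))"
    proof (rule sum.cong[OF refl])
      fix b
      have "(\<Sum>j\<in>{j \<in> {1..l}. torus_rep (r j) = b}. trig2 k (r j)) = (\<Sum>j\<in>{j \<in> {1..l}. torus_rep (r j) = b}. trig2 k b)"
        by (rule sum.cong[OF refl]) (auto simp: trig2_torus_rep)
      then show "real (card {j \<in> {1..l}. torus_rep (r j) = b}) * trig2 k b = (\<Sum>j\<in>{j \<in> {1..l}. torus_rep (r j) = b}. trig2 k (r j))"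
        by simp
    qed
    also have "\<dots> = (\<Sum>j=1..l. trig2 k (r j))"
      by (rule sum.group[OF _ \<open>finite S\<close> that]) simp
    finally show ?thesis .
  qed
  have tot: "(\<Sum>a\<in>P. N a * trig2 k a) = (\<Sum>j=1..n. trig2 k (q j)) - (\<Sum>j=1..m. trig2 k (p j))" for k
  proof -
    have "(\<Sum>a\<in>P. N a * trig2 k a) = (\<Sum>a\<in>S. N a * trig2 k a)"
      by (rule sum.mono_neutral_left) (auto simp: P_def \<open>finite S\<close>)
    also have "\<dots> = (\<Sum>a\<in>S. real (card {j \<in> {1..n}. torus_rep (q j) = a}) * trig2 k a) - (\<Sum>a\<in>S. real (card {j \<in> {1..m}. torus_rep (p j) = a}) * trig2 k a)"
      by (simp add: N_def left_diff_distrib sum_subtractf)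
    also have "\<dots> = (\<Sum>j=1..n. trig2 k (q j)) - (\<Sum>j=1..m. trig2 k (p j))"
      by (subst (1 2) fib) (auto simp: S_def)
    finally show ?thesis .
  qed
  define \<tau> where "\<tau> x = \<sigma> x + (- 1) * Lam 0 x" for x
  have L1\<sigma>: "L1 \<sigma>" using \<sigma> by (simp add: is_sigma_def)
  have L1m: "L1 (\<lambda>x. (- 1) * Lam 0 x)" using L1_Lam(1) by (simp add: L1_def periodic_def)
  have L1\<tau>: "L1 \<tau>" unfolding \<tau>_def by (rule L1_add[OF L1\<sigma> L1m])
  \<comment> \<open>\<open>trig2 0\<close> is the constant 1, which lets the lemmas on modes treat
    the constant A.\<close>
  define g where "g x = A * trig2 0 x + (- 1) * Reg 0 x" for x
  have L2c: "L2 (\<lambda>x. A * trig2 0 x)" "L2 (\<lambda>x. (- 1) * Reg 0 x)" by (intro L2_cmult L2_trig2 L2_Reg)+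
  have L2g: "L2 g" unfolding g_def by (rule L2_add[OF L2c])
  have eq: "coef g k = - 4 * pi\<^sup>2 * ((k$1)\<^sup>2 + (k$2)\<^sup>2) * coef \<tau> k" for k
  proof -
    have "- (LINT x|torus. \<sigma> x * laplacian (trig2 k) x) = 4 * pi * (\<Sum>j=1..m. trig2 k (p j)) - 4 * pi * (\<Sum>k'=1..n. trig2 k (q k'))
            - A * (LINT x|torus. trig2 k x)"
      using \<sigma> test_function_trig2[of k] unfolding is_sigma_def by blast
    moreover have "(LINT x|torus. \<sigma> x * laplacian (trig2 k) x) = (LINT x|torus. (- 4 * pi\<^sup>2 * ((k$1)\<^sup>2 + (k$2)\<^sup>2)) * (\<sigma> x * trig2 k x))"
      by (simp add: laplacian_trig2 mult_ac)
    then have "(LINT x|torus. \<sigma> x * laplacian (trig2 k) x) = - 4 * pi\<^sup>2 * ((k$1)\<^sup>2 + (k$2)\<^sup>2) * coef \<sigma> k"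
      by (simp only: integral_mult_right_zero coef_def)
    moreover have "(LINT x|torus. trig2 k x) = coef (trig2 0) k" by (simp add: coef_def)
    ultimately have s: "- 4 * pi\<^sup>2 * ((k$1)\<^sup>2 + (k$2)\<^sup>2) * coef \<sigma> k = 4 * pi * (\<Sum>a\<in>P. N a * trig2 k a) + A * coef (trig2 0) k"
      unfolding tot by (simp add: algebra_simps)
    have "coef \<tau> k = coef \<sigma> k - coef (Lam 0) k"
      unfolding \<tau>_def coef_add[OF L1\<sigma>[THEN L1_imp_integrable] L1m[THEN L1_imp_integrable]] coef_cmult by simp
    then have "- 4 * pi\<^sup>2 * ((k$1)\<^sup>2 + (k$2)\<^sup>2) * coef \<tau> k = (- 4 * pi\<^sup>2 * ((k$1)\<^sup>2 + (k$2)\<^sup>2) * coef \<sigma> k) - (- 4 * pi\<^sup>2 * ((k$1)\<^sup>2 + (k$2)\<^sup>2) * coef (Lam 0) k)"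
      by (simp only: right_diff_distrib)
    also have "\<dots> = A * coef (trig2 0) k - coef (Reg 0) k"
      unfolding s Lam_distributional_laplacian by simp
    also have "\<dots> = coef g k"
      unfolding g_def coef_add[OF L2c[THEN L2_imp_L1, THEN L1_imp_integrable]] coef_cmult by simp
    finally show ?thesis by simp
  qed
  show ?thesis
  proof (rule that[of P N \<tau>])
    show "log_potential P N" by (rule log_potential_axioms)
    show "H2 \<tau>" by (rule elliptic_regularity_torus(1)[OF L1\<tau> L2g eq])
    show "\<sigma> x = Lam 0 x + \<tau> x" for x by (simp add: \<tau>_def)
    show "AE x in torus. weak_laplacian \<tau> x = A - Reg 0 x"
      using elliptic_regularity_torus(2)[OF L1\<tau> L2g eq] by (simp add: g_def)
  qed
qed

section \<open>The two weak formulations\<close>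

lemma integral_weak_laplacian_eq_0:
  assumes "H2 u"
  shows "(LINT x|torus. weak_laplacian u x) = 0"
  using H2_weak_laplacian(2)[OF assms, of 0] by (simp add: coef_def)

text \<open>The decomposition leaves no trace in the result: chosen weak gradients agree almost
  everywhere with \<open>dw\<close>, and \<Delta>(\<tau> + u) + Reg equals \<Delta>u + A almost
  everywhere.\<close>

lemma singular_potential_identities:
  assumes \<sigma>: "is_sigma m n p q A \<sigma>" and u: "H2 u" and \<phi>: "H2 \<phi>"
    and DF: "\<And>t. (F has_real_derivative h t) (at t)" and Dh: "\<And>t. (h has_real_derivative h' t) (at t)"
    and hc: "continuous_on UNIV h" and h'c: "continuous_on UNIV h'"
    and FK: "\<And>t. \<bar>F t\<bar> \<le> K" and hK: "\<And>t. \<bar>h t\<bar> \<le> K * exp (- \<bar>t\<bar>)" and h'K: "\<And>t. \<bar>h' t\<bar> \<le> K * exp (- \<bar>t\<bar>)"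
  shows "(LINT x|torus. F (\<sigma> x + u x) * weak_laplacian \<phi> x) =
      - (LINT x|torus. h (\<sigma> x + u x) * (weak_grad (\<lambda>y. \<sigma> y + u y) x \<bullet> weak_grad \<phi> x))"
    and "(LINT x|torus. h' (\<sigma> x + u x) * (norm (weak_grad (\<lambda>y. \<sigma> y + u y) x))\<^sup>2 * \<phi> x)
       + (LINT x|torus. h (\<sigma> x + u x) * (weak_grad (\<lambda>y. \<sigma> y + u y) x \<bullet> weak_grad \<phi> x)) =
      - (LINT x|torus. h (\<sigma> x + u x) * (weak_laplacian u x + A) * \<phi> x)"
proof -
  obtain P N \<tau> where P: "log_potential P N" and \<tau>: "H2 \<tau>" and \<sigma>\<tau>: "\<And>x. \<sigma> x = log_potential.Lam P N 0 x + \<tau> x"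
    and l\<tau>: "AE x in torus. weak_laplacian \<tau> x = A - log_potential.Reg P N 0 x"
    using sigma_decomposition[OF \<sigma>] by blast
  interpret log_potential P N by (rule P)
  interpret perturbed_potential P N "\<lambda>x. \<tau> x + u x"
    by unfold_locales (rule H2_add[OF \<tau> u])
  have H1\<phi>: "H1 \<phi>" by (rule H2_imp_H1[OF \<phi>])
  have W: "\<sigma> x + u x = w x" for x by (simp add: \<sigma>\<tau> w_def)
  have Fc: "continuous_on UNIV F" by (rule DERIV_continuous_on[OF DF])
  have wp: "AE x in torus. weak_partial i w x = dw i x" for i
    by (rule weak_partial_AE_eq[OF has_weak_partial_w])
  have mw: "weak_partial i w \<in> borel_measurable torus" "dw i \<in> borel_measurable torus" for i
    using has_weak_partial_weak_partial[OF has_weak_partial_w, of i] has_weak_partial_w[of i]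
    by (auto simp: has_weak_partial_def L1_def)
  have m\<phi>: "\<phi> \<in> borel_measurable torus" using H1_imp_L2[OF H1\<phi>] by (simp add: L2_def)
  have ml: "weak_laplacian u \<in> borel_measurable torus" "weak_laplacian (\<lambda>x. \<tau> x + u x) \<in> borel_measurable torus"
    using H2_weak_laplacian(1)[OF u] H2_weak_laplacian(1)[OF H2_u] by (auto simp: L2_def)
  note [measurable] = measurable_comp_w[OF Fc] measurable_comp_w[OF hc] measurable_comp_w[OF h'c] mw m\<phi> ml
    measurable_weak_partial[OF H1\<phi>] measurable_Lam0
  have Wf: "(\<lambda>y. \<sigma> y + u y) = w" using W by (simp add: fun_eq_iff)
  have inner: "weak_grad w x \<bullet> weak_grad \<phi> x = (\<Sum>i\<in>UNIV. weak_partial i w x * weak_partial i \<phi> x)" for x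
    by (simp add: weak_grad_inner sum_2)
  have nrm: "(norm (weak_grad w x))\<^sup>2 = (\<Sum>i\<in>UNIV. (weak_partial i w x)\<^sup>2)" for x
    unfolding power2_norm_eq_inner weak_grad_inner sum_2 by (simp add: power2_eq_square)
  have t2: "(LINT x|torus. h (w x) * (weak_grad w x \<bullet> weak_grad \<phi> x)) = (LINT x|torus. h (w x) * (\<Sum>i\<in>UNIV. dw i x * weak_partial i \<phi> x))"
    unfolding inner
  proof (rule integral_cong_AE)
    show "AE x in torus. h (w x) * (\<Sum>i\<in>UNIV. weak_partial i w x * weak_partial i \<phi> x) = h (w x) * (\<Sum>i\<in>UNIV. dw i x * weak_partial i \<phi> x)"
      using wp[of 1] wp[of 2] by eventually_elim (simp add: sum_2)
  qed measurable
  have t1: "(LINT x|torus. h' (w x) * (norm (weak_grad w x))\<^sup>2 * \<phi> x) = (LINT x|torus. h' (w x) * (\<Sum>i\<in>UNIV. (dw i x)\<^sup>2) * \<phi> x)"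
    unfolding nrm
  proof (rule integral_cong_AE)
    show "AE x in torus. h' (w x) * (\<Sum>i\<in>UNIV. (weak_partial i w x)\<^sup>2) * \<phi> x = h' (w x) * (\<Sum>i\<in>UNIV. (dw i x)\<^sup>2) * \<phi> x"
      using wp[of 1] wp[of 2] by eventually_elim (simp add: sum_2)
  qed measurable
  have q: "(LINT x|torus. h (w x) * (weak_laplacian (\<lambda>x. \<tau> x + u x) x + Reg 0 x) * \<phi> x) = (LINT x|torus. h (w x) * (weak_laplacian u x + A) * \<phi> x)"
  proof (rule integral_cong_AE)
    show "AE x in torus. h (w x) * (weak_laplacian (\<lambda>x. \<tau> x + u x) x + Reg 0 x) * \<phi> x = h (w x) * (weak_laplacian u x + A) * \<phi> x"
      using weak_laplacian_add[OF \<tau> u] l\<tau> by eventually_elim simp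
  qed measurable
  show "(LINT x|torus. F (\<sigma> x + u x) * weak_laplacian \<phi> x) =
      - (LINT x|torus. h (\<sigma> x + u x) * (weak_grad (\<lambda>y. \<sigma> y + u y) x \<bullet> weak_grad \<phi> x))"
    unfolding Wf W t2 by (rule first_order_identity[OF DF hc FK hK \<phi>])
  show "(LINT x|torus. h' (\<sigma> x + u x) * (norm (weak_grad (\<lambda>y. \<sigma> y + u y) x))\<^sup>2 * \<phi> x)
       + (LINT x|torus. h (\<sigma> x + u x) * (weak_grad (\<lambda>y. \<sigma> y + u y) x \<bullet> weak_grad \<phi> x)) =
      - (LINT x|torus. h (\<sigma> x + u x) * (weak_laplacian u x + A) * \<phi> x)"
    unfolding Wf W t1 t2 q[symmetric] by (rule second_order_identity[OF Dh h'c hK h'K \<phi>])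
qed

text \<open>For each single \<phi> the two equations are linear relations between the same integrals
  and differ by the factor \<open>- (\<epsilon> * lam)\<close>. The coefficient 2 of the gradient
  term has two sources: F(W) in v paired with \<Delta>\<phi>, and h(W)(\<Delta>u + A) coming from
  h(W)(s - v).\<close>

lemma very_weak_iff_fourth_order:
  assumes \<sigma>: "is_sigma m n p q A \<sigma>" and u: "H2 u" and \<phi>: "H2 \<phi>"
    and DF: "\<And>t. (F has_real_derivative h t) (at t)" and Dh: "\<And>t. (h has_real_derivative h' t) (at t)"
    and hc: "continuous_on UNIV h" and h'c: "continuous_on UNIV h'"
    and FK: "\<And>t. \<bar>F t\<bar> \<le> K" and hK: "\<And>t. \<bar>h t\<bar> \<le> K * exp (- \<bar>t\<bar>)" and h'K: "\<And>t. \<bar>h' t\<bar> \<le> K * exp (- \<bar>t\<bar>)"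
    and pos: "\<epsilon> > 0" "lam > 0" and v: "v \<in> borel_measurable torus"
    and veq: "AE x in torus. v x = - \<epsilon> * inverse lam * weak_laplacian u x - \<epsilon> * inverse lam * A + F (\<sigma> x + u x)"
  shows "(LINT x|torus. v x * weak_laplacian \<phi> x) = (LINT x|torus. - (inverse \<epsilon> *
      (lam * h (\<sigma> x + u x) * (s - v x) - inverse \<epsilon> * (v x - F (\<sigma> x + u x)))) * \<phi> x) \<longleftrightarrow>
    \<epsilon>\<^sup>2 * (LINT x|torus. weak_laplacian u x * weak_laplacian \<phi> x) + (LINT x|torus. weak_grad u x \<bullet> weak_grad \<phi> x) =
    - \<epsilon> * lam * (LINT x|torus. h' (\<sigma> x + u x) * (norm (weak_grad (\<lambda>y. \<sigma> y + u y) x))\<^sup>2 * \<phi> x)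
    + 2 * \<epsilon> * lam * (- (LINT x|torus. h (\<sigma> x + u x) * (weak_grad (\<lambda>y. \<sigma> y + u y) x \<bullet> weak_grad \<phi> x)))
    + lam\<^sup>2 * (LINT x|torus. h (\<sigma> x + u x) * (s - F (\<sigma> x + u x)) * \<phi> x) + A * (LINT x|torus. \<phi> x)"
proof -
  note ids = singular_potential_identities[OF \<sigma> u \<phi> DF Dh hc h'c FK hK h'K]
  define W where "W x = \<sigma> x + u x" for x
  define L where "L = weak_laplacian u"
  define M where "M = weak_laplacian \<phi>"
  have K: "K \<ge> 0" using FK[of 0] by linarith
  have hK1: "\<bar>h t\<bar> \<le> K" for t
    by (rule order_trans[OF hK]) (use K in \<open>simp add: mult_left_le\<close>)
  have Fc: "continuous_on UNIV F" by (rule DERIV_continuous_on[OF DF])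
  have H1: "H1 u" "H1 \<phi>" by (intro H2_imp_H1 u \<phi>)+
  have mW: "W \<in> borel_measurable torus"
    unfolding W_def[abs_def] using \<sigma> H1_imp_L2[OF H1(1)] by (auto simp: is_sigma_def L1_def L2_def)
  have mc: "(\<lambda>x. G (W x)) \<in> borel_measurable torus" if "continuous_on UNIV G" for G :: "real \<Rightarrow> real"
    using measurable_compose[OF mW borel_measurable_continuous_onI[OF that]] by simp
  have sq: "square_integrable torus L" "square_integrable torus M" "square_integrable torus \<phi>"
    unfolding L_def M_def by (intro L2_imp_square_integrable H2_weak_laplacian H1_imp_L2 u \<phi> H1)+
  have sF: "square_integrable torus (\<lambda>x. F (W x))" "square_integrable torus (\<lambda>x. h (W x))"
    by (rule square_integrable_bounded[OF finite_measure_torus mc, where B = K]; use Fc hc FK hK1 in auto)+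
  have s1: "square_integrable torus (\<lambda>x. 1)" by (intro square_integrable_torus_continuous continuous_intros)
  have sh: "square_integrable torus (\<lambda>x. h (W x) * \<phi> x)"
    by (rule square_integrable_bounded_mult[OF sq(3) mc, where B = K]; use hc hK1 in auto)
  note im = integrable_mult_square_integrable
  have i: "integrable torus (\<lambda>x. L x * M x)" "integrable torus M" "integrable torus (\<lambda>x. F (W x) * M x)"
    "integrable torus (\<lambda>x. L x * \<phi> x)" "integrable torus \<phi>" "integrable torus (\<lambda>x. (h (W x) * \<phi> x) * L x)"
    "integrable torus (\<lambda>x. h (W x) * \<phi> x)" "integrable torus (\<lambda>x. (h (W x) * \<phi> x) * F (W x))"
    by (intro im sq sF sh square_integrable_imp_integrable_torus)+
  note [measurable] = v mW mc[OF Fc] mc[OF hc] square_integrable_measurable[OF sq(1)] square_integrable_measurable[OF sq(2)]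
    square_integrable_measurable[OF sq(3)]
  define I1 where "I1 = (LINT x|torus. L x * M x)"
  define J where "J = (LINT x|torus. L x * \<phi> x)"
  define E where "E = (LINT x|torus. F (W x) * M x)"
  define T3 where "T3 = (LINT x|torus. h (W x) * (s - F (W x)) * \<phi> x)"
  define T4 where "T4 = (LINT x|torus. \<phi> x)"
  define Q where "Q = (LINT x|torus. h (W x) * (L x + A) * \<phi> x)"
  \<comment> \<open>The constant part of v drops out because a Laplacian has mean zero.\<close>
  have M0: "(LINT x|torus. M x) = 0" unfolding M_def by (rule integral_weak_laplacian_eq_0[OF \<phi>])
  have "(LINT x|torus. v x * M x) = (LINT x|torus. - \<epsilon> * inverse lam * (L x * M x) - \<epsilon> * inverse lam * A * M x + F (W x) * M x)"
  proof (rule integral_cong_AE)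
    show "AE x in torus. v x * M x = - \<epsilon> * inverse lam * (L x * M x) - \<epsilon> * inverse lam * A * M x + F (W x) * M x"
      using veq
    proof eventually_elim
      case (elim x)
      then have "v x = - \<epsilon> * inverse lam * L x - \<epsilon> * inverse lam * A + F (W x)" by (simp add: W_def L_def)
      then show ?case by (simp only:) (simp add: algebra_simps)
    qed
  qed measurable
  also have "\<dots> = - \<epsilon> * inverse lam * I1 + E"
    using i M0 by (simp add: I1_def E_def)
  finally have lhs: "(LINT x|torus. v x * M x) = - \<epsilon> * inverse lam * I1 + E" .
  have QT: "integrable torus (\<lambda>x. h (W x) * (s - F (W x)) * \<phi> x)" "integrable torus (\<lambda>x. h (W x) * (L x + A) * \<phi> x)"
  proof -
    have "integrable torus (\<lambda>x. s * (h (W x) * \<phi> x) - (h (W x) * \<phi> x) * F (W x))"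
      "integrable torus (\<lambda>x. (h (W x) * \<phi> x) * L x + A * (h (W x) * \<phi> x))"
      using i by auto
    then show "integrable torus (\<lambda>x. h (W x) * (s - F (W x)) * \<phi> x)" "integrable torus (\<lambda>x. h (W x) * (L x + A) * \<phi> x)"
      by (simp_all add: algebra_simps)
  qed
  have "(LINT x|torus. - (inverse \<epsilon> * (lam * h (W x) * (s - v x) - inverse \<epsilon> * (v x - F (W x)))) * \<phi> x) =
    (LINT x|torus. - (inverse \<epsilon> * lam) * (h (W x) * (s - F (W x)) * \<phi> x) - h (W x) * (L x + A) * \<phi> x
      - inverse \<epsilon> * inverse lam * (L x * \<phi> x + A * \<phi> x))"
  proof (rule integral_cong_AE)
    show "AE x in torus. - (inverse \<epsilon> * (lam * h (W x) * (s - v x) - inverse \<epsilon> * (v x - F (W x)))) * \<phi> x =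
      - (inverse \<epsilon> * lam) * (h (W x) * (s - F (W x)) * \<phi> x) - h (W x) * (L x + A) * \<phi> x
      - inverse \<epsilon> * inverse lam * (L x * \<phi> x + A * \<phi> x)"
      using veq
    proof eventually_elim
      case (elim x)
      then have "v x = - \<epsilon> * inverse lam * L x - \<epsilon> * inverse lam * A + F (W x)" by (simp add: W_def L_def)
      then have e: "s - v x = (s - F (W x)) + \<epsilon> * inverse lam * (L x + A)" "v x - F (W x) = - (\<epsilon> * inverse lam * (L x + A))"
        by (simp_all add: algebra_simps)
      show ?case unfolding e using pos by (simp add: field_simps power2_eq_square)
    qed
  qed measurable
  also have "\<dots> = - (inverse \<epsilon> * lam) * T3 - Q - inverse \<epsilon> * inverse lam * (J + A * T4)"
    using i QT by (simp add: T3_def Q_def J_def T4_def)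
  finally have rhs: "(LINT x|torus. - (inverse \<epsilon> * (lam * h (W x) * (s - v x) - inverse \<epsilon> * (v x - F (W x)))) * \<phi> x)
    = - (inverse \<epsilon> * lam) * T3 - Q - inverse \<epsilon> * inverse lam * (J + A * T4)" .
  define T1 where "T1 = (LINT x|torus. h' (W x) * (norm (weak_grad (\<lambda>y. \<sigma> y + u y) x))\<^sup>2 * \<phi> x)"
  define T2 where "T2 = (LINT x|torus. h (W x) * (weak_grad (\<lambda>y. \<sigma> y + u y) x \<bullet> weak_grad \<phi> x))"
  have E: "T2 = - E" and Q: "T1 = - Q - T2"
    using ids unfolding E_def T1_def T2_def Q_def W_def M_def L_def by simp_all
  have G: "(LINT x|torus. weak_grad u x \<bullet> weak_grad \<phi> x) = - J"
    unfolding J_def L_def by (rule Green_torus[OF u H1(2)])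
  \<comment> \<open>After T1 and T2 are expressed through Q and E, the difference of the two sides
    of one equation is \<open>- (\<epsilon> * lam)\<close> times that of the other.\<close>
  have alg: "- \<epsilon> * inverse lam * I1 + E = - (inverse \<epsilon> * lam) * T3 - Q - inverse \<epsilon> * inverse lam * (J + A * T4) \<longleftrightarrow>
     \<epsilon>\<^sup>2 * I1 + (- J) = - \<epsilon> * lam * T1 + 2 * \<epsilon> * lam * (- T2) + lam\<^sup>2 * T3 + A * T4"
    (is "?l = ?r \<longleftrightarrow> ?l' = ?r'")
  proof -
    have "?l' - ?r' = - (\<epsilon> * lam) * (?l - ?r)"
      unfolding Q E using pos by (simp add: field_simps power2_eq_square)
    moreover have "- (\<epsilon> * lam) \<noteq> 0" using pos by simp
    ultimately have "?l' - ?r' = 0 \<longleftrightarrow> ?l - ?r = 0" by (simp only: mult_eq_0_iff simp_thms)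
    then show ?thesis by (simp only: right_minus_eq)
  qed
  show ?thesis
    using alg unfolding lhs[symmetric] rhs[symmetric] G[symmetric] unfolding I1_def T1_def T2_def T3_def T4_def M_def L_def W_def .
qed

theorem lemma1p2:
  fixes m n :: nat and p q :: "nat \<Rightarrow> real^2" and A s \<epsilon> lam :: real
    and \<sigma> u v :: "real^2 \<Rightarrow> real" and f :: "real \<Rightarrow> real"
  assumes "m > n"
    and "A = 4 * pi * (real m - real n)"
    and "is_sigma m n p q A \<sigma>"
    and f0: "smooth_on_nonneg f" "\<And>t. t > 0 \<Longrightarrow> deriv f t > 0"
    and f1: "f 0 < s" "bdd_above (f ` {0<..})" "s < (SUP t\<in>{0<..}. f t)"
    and f2: "bdd_above ((\<lambda>t. t ^ 4 * \<bar>(deriv ^^ 3) f t\<bar>) ` {0<..})"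
    and "\<epsilon> > 0" and "lam > 0"
    and "periodic u" and "periodic v"
  shows "weak_solution_system f s \<sigma> A \<epsilon> lam u v \<longleftrightarrow>
    weak_solution_fourth_order f s \<sigma> A \<epsilon> lam u \<and>
    (AE x in torus. v x = - \<epsilon> * inverse lam * weak_laplacian u x - \<epsilon> * inverse lam * A
        + f (exp (\<sigma> x + u x)))"
proof -
  note \<sigma> = \<open>is_sigma m n p q A \<sigma>\<close>
  define F h h' where "F = (\<lambda>t. f (exp t))" and "h = (\<lambda>t. deriv f (exp t) * exp t)"
    and "h' = (\<lambda>t. (deriv (deriv f) (exp t) * exp t + deriv f (exp t)) * exp t)"
  have "\<exists>K. (\<forall>t. (F has_real_derivative h t) (at t) \<and> (h has_real_derivative h' t) (at t)) \<and>
    continuous_on UNIV h \<and> continuous_on UNIV h' \<and>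
    (\<forall>t. \<bar>F t\<bar> \<le> K \<and> \<bar>h t\<bar> \<le> K * exp (- \<bar>t\<bar>) \<and> \<bar>h' t\<bar> \<le> K * exp (- \<bar>t\<bar>))"
    unfolding F_def h_def h'_def by (rule nonlinearity_bounds[OF f0(1) _ f1(2) f2]) (rule f0(2))
  then obtain K where DF: "\<And>t. (F has_real_derivative h t) (at t)" and Dh: "\<And>t. (h has_real_derivative h' t) (at t)"
    and hc: "continuous_on UNIV h" and h'c: "continuous_on UNIV h'"
    and FK: "\<And>t. \<bar>F t\<bar> \<le> K" and hK: "\<And>t. \<bar>h t\<bar> \<le> K * exp (- \<bar>t\<bar>)" and h'K: "\<And>t. \<bar>h' t\<bar> \<le> K * exp (- \<bar>t\<bar>)"
    by blast
  have K: "K \<ge> 0" using FK[of 0] by linarith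
  have hK1: "\<bar>h t\<bar> \<le> K" for t
    by (rule order_trans[OF hK]) (use K in \<open>simp add: mult_left_le\<close>)
  have Fc: "continuous_on UNIV F" by (rule DERIV_continuous_on[OF DF])
  define g1 where "g1 = (\<lambda>x. inverse \<epsilon> * lam * (v x - F (\<sigma> x + u x)) + A)"
  define g2 where "g2 = (\<lambda>x. inverse \<epsilon> * (lam * h (\<sigma> x + u x) * (s - v x) - inverse \<epsilon> * (v x - F (\<sigma> x + u x))))"
  have p\<sigma>: "periodic \<sigma>" using \<sigma> by (simp add: is_sigma_def L1_def)
  \<comment> \<open>The boundedness of F and h makes both right hand sides square integrable, so
    linear regularity applies to the nonlinear system.\<close>
  have L2g: "L2 g1" "L2 g2" if "L2 u" "L2 v"
  proof -
    have mW: "(\<lambda>x. \<sigma> x + u x) \<in> borel_measurable torus"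
      using \<sigma> that by (auto simp: is_sigma_def L1_def L2_def)
    have mc: "(\<lambda>x. G (\<sigma> x + u x)) \<in> borel_measurable torus" if "continuous_on UNIV G" for G :: "real \<Rightarrow> real"
      using measurable_compose[OF mW borel_measurable_continuous_onI[OF that]] by simp
    have sF: "square_integrable torus (\<lambda>x. F (\<sigma> x + u x))"
      by (rule square_integrable_bounded[OF finite_measure_torus mc, where B = K]; use Fc FK in auto)
    have s1: "square_integrable torus (\<lambda>x. c)" for c :: real
      by (intro square_integrable_torus_continuous continuous_intros)
    have sv: "square_integrable torus v" using that by (simp add: L2_iff)
    have sh: "square_integrable torus (\<lambda>x. h (\<sigma> x + u x) * (s - v x))"
      by (rule square_integrable_bounded_mult[OF square_integrable_diff[OF s1 sv] mc, where B = K]; use hc hK1 in auto)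
    have d: "square_integrable torus (\<lambda>x. v x - F (\<sigma> x + u x))" by (rule square_integrable_diff[OF sv sF])
    show "L2 g1"
      unfolding L2_iff g1_def
      using square_integrable_add[OF square_integrable_cmult[OF d, of "inverse \<epsilon> * lam"] s1[of A]]
        \<open>periodic u\<close> \<open>periodic v\<close> p\<sigma> by (auto simp: periodic_def)
    show "L2 g2"
      unfolding L2_iff g2_def
      using square_integrable_cmult[OF square_integrable_diff[OF square_integrable_cmult[OF sh, of lam] square_integrable_cmult[OF d, of "inverse \<epsilon>"]], of "inverse \<epsilon>"]
        \<open>periodic u\<close> \<open>periodic v\<close> p\<sigma> by (auto simp: periodic_def mult.assoc)
  qed
  \<comment> \<open>Regularity turns the system into two equations valid almost everywhere with u
    and v in H2; the first of them is then the formula for v.\<close>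
  have system: "weak_solution_system f s \<sigma> A \<epsilon> lam u v \<longleftrightarrow>
      H2 u \<and> (AE x in torus. weak_laplacian u x = - g1 x) \<and> H2 v \<and> (AE x in torus. weak_laplacian v x = - g2 x)"
  proof -
    have "weak_solution_system f s \<sigma> A \<epsilon> lam u v \<longleftrightarrow> H1 u \<and> H1 v \<and>
      (\<forall>\<phi>. H1 \<phi> \<longrightarrow> (LINT x|torus. weak_grad u x \<bullet> weak_grad \<phi> x) = (LINT x|torus. g1 x * \<phi> x)) \<and>
      (\<forall>\<phi>. H1 \<phi> \<longrightarrow> (LINT x|torus. weak_grad v x \<bullet> weak_grad \<phi> x) = (LINT x|torus. g2 x * \<phi> x))"
      unfolding weak_solution_system_def g1_def g2_def F_def h_def by (simp only: mult.assoc)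
    also have "\<dots> \<longleftrightarrow> H1 u \<and> H1 v \<and> H2 u \<and> (AE x in torus. weak_laplacian u x = - g1 x) \<and> H2 v \<and> (AE x in torus. weak_laplacian v x = - g2 x)"
    proof (cases "H1 u \<and> H1 v")
      case True
      then have uv: "H1 u" "H1 v" by simp_all
      note L2 = L2g[OF uv[THEN H1_imp_L2]]
      show ?thesis unfolding weak_solution_iff[OF uv(1) L2(1)] weak_solution_iff[OF uv(2) L2(2)]
        by (simp only: conj_assoc)
    qed (simp only: simp_thms de_Morgan_conj, elim disjE; simp only: simp_thms)
    also have "\<dots> \<longleftrightarrow> H2 u \<and> (AE x in torus. weak_laplacian u x = - g1 x) \<and> H2 v \<and> (AE x in torus. weak_laplacian v x = - g2 x)"
      using H2_imp_H1 by blast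
    finally show ?thesis .
  qed
  have v_eq: "(AE x in torus. v x = - \<epsilon> * inverse lam * weak_laplacian u x - \<epsilon> * inverse lam * A + F (\<sigma> x + u x)) \<longleftrightarrow>
      (AE x in torus. weak_laplacian u x = - g1 x)"
  proof -
    have "v x = - \<epsilon> * inverse lam * weak_laplacian u x - \<epsilon> * inverse lam * A + F (\<sigma> x + u x) \<longleftrightarrow> weak_laplacian u x = - g1 x" for x
      unfolding g1_def using \<open>\<epsilon> > 0\<close> \<open>lam > 0\<close> by (auto simp: field_simps)
    then show ?thesis by simp
  qed
  \<comment> \<open>Given the first equation, the second is read in very weak form, whose test
    functions are those of the fourth order equation. That v belongs to H2 when u solves the latter
    comes from \<open>very_weak_solution_iff\<close>.\<close>
  have core: "(H2 v \<and> (AE x in torus. weak_laplacian v x = - g2 x)) \<longleftrightarrow> weak_solution_fourth_order f s \<sigma> A \<epsilon> lam u"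
    if u: "H2 u" and ae: "AE x in torus. weak_laplacian u x = - g1 x"
  proof -
    have veq: "AE x in torus. v x = - \<epsilon> * inverse lam * weak_laplacian u x - \<epsilon> * inverse lam * A + F (\<sigma> x + u x)"
      using ae v_eq by blast
    have L2u: "L2 u" by (intro H1_imp_L2 H2_imp_H1 u)
    \<comment> \<open>Of v only periodicity and the formula almost everywhere are known at this
      point; measurability and square integrability are taken from this explicit
      representative.\<close>
    define v' where "v' x = - \<epsilon> * inverse lam * weak_laplacian u x + (- \<epsilon> * inverse lam * A * trig2 0 x + F (\<sigma> x + u x))" for x
    have L2F: "L2 (\<lambda>x. F (\<sigma> x + u x))"
    proof -
      have "(\<lambda>x. \<sigma> x + u x) \<in> borel_measurable torus"
        using \<sigma> L2u by (auto simp: is_sigma_def L1_def L2_def)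
      from measurable_compose[OF this borel_measurable_continuous_onI[OF Fc]]
      have "square_integrable torus (\<lambda>x. F (\<sigma> x + u x))"
        using FK by (intro square_integrable_bounded[OF finite_measure_torus, where B = K]) auto
      then show ?thesis using p\<sigma> \<open>periodic u\<close> by (auto simp: L2_iff periodic_def)
    qed
    have L2v': "L2 v'" unfolding v'_def by (intro L2_add L2_cmult H2_weak_laplacian u L2_trig2 L2F)
    have vv': "AE x in torus. v x = v' x" using veq by eventually_elim (simp add: v'_def)
    have mv: "v \<in> borel_measurable torus"
      by (rule borel_measurable_AE_torus[of v']) (use L2v' vv' in \<open>auto simp: L2_def\<close>)
    have "square_integrable torus v"
      by (rule square_integrable_cong_AE[OF L2_imp_square_integrable[OF L2v'] mv vv'])
    then have L2v: "L2 v" using \<open>periodic v\<close> by (simp add: L2_iff)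
    have mg2: "L2 (\<lambda>x. - g2 x)" using L2_cmult[OF L2g(2)[OF L2u L2v], of "-1"] by simp
    have "(H2 v \<and> (AE x in torus. weak_laplacian v x = - g2 x)) \<longleftrightarrow>
       (\<forall>\<phi>. H2 \<phi> \<longrightarrow> (LINT x|torus. v x * weak_laplacian \<phi> x) = (LINT x|torus. - g2 x * \<phi> x))"
      by (rule very_weak_solution_iff[OF L2v mg2, symmetric])
    also have "\<dots> \<longleftrightarrow> weak_solution_fourth_order f s \<sigma> A \<epsilon> lam u"
    proof -
      note key = very_weak_iff_fourth_order[OF \<sigma> u _ DF Dh hc h'c FK hK h'K \<open>\<epsilon> > 0\<close> \<open>lam > 0\<close> mv veq, where s = s]
      show ?thesis
        unfolding weak_solution_fourth_order_def g2_def
        using u by (simp only: simp_thms key[unfolded F_def h_def h'_def] F_def h_def cong: imp_cong)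
    qed
    finally show ?thesis .
  qed
  have "H2 u" if "weak_solution_fourth_order f s \<sigma> A \<epsilon> lam u"
    using that by (simp add: weak_solution_fourth_order_def)
  then show ?thesis
    unfolding system v_eq[unfolded F_def] using core by blast
qed

end
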